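(* Let $\Omega$ be a doubly periodic domain with periodic cell $\varpi$, satisfying assumption $(\mathcal{A})$ (both as defined in the context). (i) The operator $\mathcal{P}$ defined by $\mathcal{P}f(z,\eta)=\big(P_\eta f(\cdot,\eta)\big)(z)$, $f\in L^2(\mathbf{Q};L^2(\varpi))$, $z\in\varpi$, $\eta\in\mathbf{Q}$, is the orthogonal projection from $L^2(\mathbf{Q};L^2(\varpi))$ onto $L^2(\mathbf{Q};A^2_\eta(\varpi))$. (ii) The Bergman projection $P_\Omega$ from $L^2(\Omega)$ onto $A^2(\Omega)$ can be written, for $f\in L^2(\Omega)$ and almost every $z\in\Omega$, as $$P_\Omega f(z)=\mathsf{F}^{-1}\mathcal{P}\mathsf{F}f(z)=\frac1{2\pi}\int_{\mathbf{Q}}e^{i[\mathrm{Re}\,z]\eta_1+i[\mathrm{Im}\,z]\eta_2}\big(P_\eta\widehat f(\cdot,\eta)\big)(z^{\mathsf{tr}})\,d\eta$$ $$=\frac1{4\pi^2}\int_\Omega\int_{\mathbf{Q}}e^{i\eta_1([\mathrm{Re}\,z]-[\mathrm{Re}\,w])+i\eta_2([\mathrm{Im}\,z]-[\mathrm{Im}\,w])}K_\eta(z^{\mathsf{tr}},w^{\mathsf{tr}})f(w)\,d\eta\,dA(w).$$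
   Context: Notation: $\Lambda=\{m\in\mathbb{C}: \mathrm{Re}\,m\in\mathbb{Z},\ \mathrm{Im}\,m\in\mathbb{Z}\}$; for $m\in\Lambda$ write $m_1=\mathrm{Re}\,m$, $m_2=\mathrm{Im}\,m$. $[x]$ is the largest integer not larger than $x\in\mathbb{R}$. $Q=(0,1)\times(0,1)\subset\mathbb{R}^2\cong\mathbb{C}$; $\mathbf{Q}=[-\pi,\pi]^2$, with elements $\eta=(\eta_1,\eta_2)$. $\mathrm{cl}$ denotes closure. $L^2(D)$ is with respect to area measure $dA$, and $A^2(D)$ is the closed subspace of $L^2(D)$ consisting of analytic functions. For $z\in\Omega$, $z^{\mathsf{tr}}=z-[\mathrm{Re}\,z]-i[\mathrm{Im}\,z]\in\mathrm{cl}(\varpi)$. Doubly periodic domain: the periodic cell $\varpi$ is a domain in $\mathbb{C}$ such that (i) $\varpi\subset Q$; (ii) $\partial\varpi\supset\partial Q$; (iii) $Q\setminus\mathrm{cl}(\varpi)$ contains a nonempty open set. Put $\varpi_m=\varpi+m$ for $m\in\Lambda$. The doubly periodic domain $\Omega$ is the interior of $\bigcup_{m\in\Lambda}\mathrm{cl}(\varpi_m)$. Assumption $(\mathcal{A})$: there is an elliptic function $\varphi$ (meromorphic in $\mathbb{C}$ with $\varphi(z)=\varphi(z+1)=\varphi(z+i)$) all of whose zeros lie in $\mathbb{C}\setminus\mathrm{cl}(\Omega)$, and which has a representation $\varphi(z)=\sum_{m\in\Lambda}\phi(z-m)$ for some function $\phi$ meromorphic in $\mathbb{C}$ with only finitely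 many poles, all situated in $Q$, and such that $\sup_{z\in\Omega\setminus\mathrm{cl}(Q)}(1+|z|)^b|\phi(z)|<\infty$ for some constant $b>2$. Floquet transform: for $f$ on $\Omega$, $$\mathsf{F}f(z,\eta)=\widehat f(z,\eta)=\frac1{2\pi}\sum_{m\in\Lambda}e^{-i\eta_1m_1-i\eta_2m_2}f(z+m),\quad z\in\varpi,\ \eta\in\mathbf{Q},$$ regarded as an isometric operator from $L^2(\Omega)$ onto the Bochner space $L^2(\mathbf{Q};L^2(\varpi))$; its inverse is $$\mathsf{F}^{-1}g(z)=\frac1{2\pi}\int_{\mathbf{Q}} e^{i[\mathrm{Re}\,z]\eta_1+i[\mathrm{Im}\,z]\eta_2} g(z-[\mathrm{Re}\,z]-i[\mathrm{Im}\,z],\eta)\,d\eta,\quad z\in\Omega.$$ For $\eta\in\mathbf{Q}$, $A^2_{\eta,\mathrm{ext}}(\varpi)$ is the subspace of $A^2(\varpi)$ consisting of functions $f$ which can be extended as analytic functions to a neighborhood of $\mathrm{cl}(\varpi)\cap\Omega$ in $\Omega$ and satisfy $f(1+iy)=e^{i\eta_1}f(iy)$ and $f(x+i)=e^{i\eta_2}f(x)$ for all $x,y\in(0,1)$. $A^2_\eta(\varpi)$ is the closure of $A^2_{\eta,\mathrm{ext}}(\varpi)$ in $A^2(\varpi)$. $L^2(\mathbf{Q};A^2_\eta(\varpi))$ is the subspace of $L^2(\mathbf{Q};A^2(\varpi))$ of functions $f$ such that $z\mapsto f(z,\eta)$ belongs to $A^2_\eta(\varpi)$ for a.e. $\eta\in\mathbf{Q}$.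 $P_\Omega$ is the orthogonal projection of $L^2(\Omega)$ onto $A^2(\Omega)$, and $P_\eta$ is the orthogonal projection of $L^2(\varpi)$ onto $A^2_\eta(\varpi)$. $K_\eta:\varpi\times\varpi\to\mathbb{C}$ is the integral kernel of $P_\eta$, i.e. $P_\eta f(z)=\int_\varpi K_\eta(z,w)f(w)\,dA(w)$ with $K_\eta(z,\cdot)\in L^2(\varpi)$ for all $z\in\varpi$.
   Formalization: Part (ii) is stated under the extra condition that Ω minus the union of the cells ϖ+m has area zero; without it the Floquet transform is not injective on L²(Ω), its inverse does not exist, and the formulas fail. Part (i) carries no extra condition. *)

theory Defs
  imports "HOL-Complex_Analysis.Complex_Analysis"
begin

section \<open>Spaces of square integrable functions\<close>

text \<open>
  Elements of the $L^2$-spaces are represented by functions, not by classes modulo null sets.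
  Values outside the underlying domain are irrelevant.  Inner products are linear in the first
  argument.
\<close>

abbreviation area :: "complex set \<Rightarrow> complex measure"
  where "area D \<equiv> lebesgue_on D"

definition L2 :: "'a measure \<Rightarrow> ('a \<Rightarrow> complex) set"
  where "L2 M = {f \<in> borel_measurable M. integrable M (\<lambda>x. (cmod (f x))\<^sup>2)}"

definition L2_inner :: "'a measure \<Rightarrow> ('a \<Rightarrow> complex) \<Rightarrow> ('a \<Rightarrow> complex) \<Rightarrow> complex"
  where "L2_inner M f g = (LINT x|M. f x * cnj (g x))"

definition L2_norm :: "'a measure \<Rightarrow> ('a \<Rightarrow> complex) \<Rightarrow> real"
  where "L2_norm M f = sqrt (LINT x|M. (cmod (f x))\<^sup>2)"

definition A2 :: "complex set \<Rightarrow> (complex \<Rightarrow> complex) set"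
  where "A2 D = {f \<in> L2 (area D). f holomorphic_on D}"

text \<open>
  The Bochner space $L^2(N; S)$ for a subspace \<open>S\<close> of \<open>L2 M\<close>.  A function $f(z,\eta)$ of two
  variables is represented as \<open>F\<close> with \<open>F \<eta> = f(\<cdot>, \<eta>)\<close>, that is, the parameter comes first.
  Strong measurability is approximability almost everywhere, in the norm of \<open>L2 M\<close>, by simple
  functions with values in \<open>S\<close>.
\<close>

definition strongly_measurable ::
    "'b measure \<Rightarrow> 'a measure \<Rightarrow> ('a \<Rightarrow> complex) set \<Rightarrow> ('b \<Rightarrow> 'a \<Rightarrow> complex) \<Rightarrow> bool"
  where "strongly_measurable N M S F \<longleftrightarrow>
    (\<exists>s. (\<forall>n. simple_function N (s n) \<and> (\<forall>\<eta>\<in>space N. s n \<eta> \<in> S)) \<and>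
         (AE \<eta> in N. (\<lambda>n::nat. L2_norm M (s n \<eta> - F \<eta>)) \<longlonglongrightarrow> 0))"

definition bochner_L2 ::
    "'b measure \<Rightarrow> 'a measure \<Rightarrow> ('a \<Rightarrow> complex) set \<Rightarrow> ('b \<Rightarrow> 'a \<Rightarrow> complex) set"
  where "bochner_L2 N M S =
    {F. (\<forall>\<eta>\<in>space N. F \<eta> \<in> S) \<and> strongly_measurable N M S F \<and>
        integrable N (\<lambda>\<eta>. (L2_norm M (F \<eta>))\<^sup>2)}"

definition bochner_inner ::
    "'b measure \<Rightarrow> 'a measure \<Rightarrow> ('b \<Rightarrow> 'a \<Rightarrow> complex) \<Rightarrow> ('b \<Rightarrow> 'a \<Rightarrow> complex) \<Rightarrow> complex"
  where "bochner_inner N M F G = (LINT \<eta>|N. L2_inner M (F \<eta>) (G \<eta>))"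

definition bochner_norm :: "'b measure \<Rightarrow> 'a measure \<Rightarrow> ('b \<Rightarrow> 'a \<Rightarrow> complex) \<Rightarrow> real"
  where "bochner_norm N M F = sqrt (LINT \<eta>|N. (L2_norm M (F \<eta>))\<^sup>2)"

text \<open>
  \<open>P\<close> is the orthogonal projection from \<open>V\<close> onto its subspace \<open>W\<close>: every \<open>f\<close> in \<open>V\<close> is split
  into a component \<open>P f\<close> in \<open>W\<close> and a component orthogonal to \<open>W\<close>.  This determines \<open>P f\<close> up to
  equality almost everywhere, and \<open>P\<close> fixes the elements of \<open>W\<close> in that sense.
\<close>

definition is_orth_proj :: "('v::minus \<Rightarrow> 'v \<Rightarrow> complex) \<Rightarrow> 'v set \<Rightarrow> 'v set \<Rightarrow> ('v \<Rightarrow> 'v) \<Rightarrow> bool"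
  where "is_orth_proj ip V W P \<longleftrightarrow>
    W \<subseteq> V \<and> (\<forall>f\<in>V. P f \<in> W \<and> (\<forall>g\<in>W. ip (f - P f) g = 0))"


section \<open>Doubly periodic domains\<close>

definition period_lattice :: "complex set"
  where "period_lattice = {m. Re m \<in> \<int> \<and> Im m \<in> \<int>}"

definition unit_cell :: "complex set"
  where "unit_cell = {z. 0 < Re z \<and> Re z < 1 \<and> 0 < Im z \<and> Im z < 1}"

definition dual_cell :: "(real \<times> real) set"
  where "dual_cell = {-pi..pi} \<times> {-pi..pi}"

definition periodic_cell :: "complex set \<Rightarrow> bool"
  where "periodic_cell \<omega> \<longleftrightarrow>
    open \<omega> \<and> connected \<omega> \<and> \<omega> \<noteq> {} \<and> \<omega> \<subseteq> unit_cell \<and>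
    frontier unit_cell \<subseteq> frontier \<omega> \<and>
    (\<exists>U. open U \<and> U \<noteq> {} \<and> U \<subseteq> unit_cell - closure \<omega>)"

definition translate :: "complex set \<Rightarrow> complex \<Rightarrow> complex set"
  where "translate \<omega> m = (\<lambda>z. z + m) ` \<omega>"

definition periodic_domain :: "complex set \<Rightarrow> complex set"
  where "periodic_domain \<omega> = interior (\<Union>m\<in>period_lattice. closure (translate \<omega> m))"

definition tr :: "complex \<Rightarrow> complex"
  where "tr z = z - of_int \<lfloor>Re z\<rfloor> - \<i> * of_int \<lfloor>Im z\<rfloor>"

text \<open>
  \<open>nicely_meromorphic_on\<close> excludes removable singularities, so the zeros of \<open>\<phi>\<close> are the points
  that are not poles (where the library assigns the value 0) and at which \<open>\<phi>\<close> vanishes.  The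
  lattice sum is unconditional and is required wherever none of its terms has a pole.
\<close>

definition assumption_A :: "complex set \<Rightarrow> bool"
  where "assumption_A \<omega> \<longleftrightarrow>
    (\<exists>\<phi> \<psi>. 
       \<phi> nicely_meromorphic_on UNIV \<and> (\<forall>z. \<phi> (z + 1) = \<phi> z \<and> \<phi> (z + \<i>) = \<phi> z) \<and>
       (\<forall>z. \<not> is_pole \<phi> z \<and> \<phi> z = 0 \<longrightarrow> z \<notin> closure (periodic_domain \<omega>)) \<and>
       \<psi> nicely_meromorphic_on UNIV \<and>
       finite {z. is_pole \<psi> z} \<and> {z. is_pole \<psi> z} \<subseteq> unit_cell \<and>
       (\<forall>z. (\<forall>m\<in>period_lattice. \<not> is_pole \<psi> (z - m)) \<longrightarrow> ((\<lambda>m. \<psi> (z - m)) has_sum \<phi> z) period_lattice) \<and>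
       (\<exists>b>2. bdd_above ((\<lambda>z. (1 + cmod z) powr b * cmod (\<psi> z)) `
                          (periodic_domain \<omega> - closure unit_cell))))"


section \<open>Floquet transform\<close>

abbreviation floquet_space :: "complex set \<Rightarrow> (real \<times> real \<Rightarrow> complex \<Rightarrow> complex) set"
  where "floquet_space \<omega> \<equiv> bochner_L2 (lebesgue_on dual_cell) (area \<omega>) (L2 (area \<omega>))"

text \<open>
  For a general square integrable \<open>f\<close> the defining series need not converge pointwise; as an
  operator on $L^2$, the transform is its (unconditional) sum in the norm of the Bochner space.
\<close>

definition floquet_partial_sum ::
    "(complex \<Rightarrow> complex) \<Rightarrow> complex set \<Rightarrow> real \<times> real \<Rightarrow> complex \<Rightarrow> complex"
  where "floquet_partial_sum f B = (\<lambda>\<eta> z.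
    of_real (1 / (2 * pi)) * (\<Sum>m\<in>B. cis (- fst \<eta> * Re m - snd \<eta> * Im m) * f (z + m)))"

definition floquet ::
    "complex set \<Rightarrow> (complex \<Rightarrow> complex) \<Rightarrow> real \<times> real \<Rightarrow> complex \<Rightarrow> complex"
  where "floquet \<omega> f = (SOME F. F \<in> floquet_space \<omega> \<and>
    ((\<lambda>B. bochner_norm (lebesgue_on dual_cell) (area \<omega>) (floquet_partial_sum f B - F)) \<longlongrightarrow> 0)
      (finite_subsets_at_top period_lattice))"

definition floquet_inv ::
    "complex set \<Rightarrow> (real \<times> real \<Rightarrow> complex \<Rightarrow> complex) \<Rightarrow> complex \<Rightarrow> complex"
  where "floquet_inv \<omega> G = (SOME f. f \<in> L2 (area (periodic_domain \<omega>)) \<and>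
    (AE \<eta> in lebesgue_on dual_cell. AE z in area \<omega>. floquet \<omega> f \<eta> z = G \<eta> z))"


section \<open>Quasiperiodic Bergman spaces, projections and kernels\<close>

text \<open>
  In the next definition \<open>g\<close> is the analytic extension of \<open>f\<close>.
\<close>

definition A2_ext :: "complex set \<Rightarrow> real \<times> real \<Rightarrow> (complex \<Rightarrow> complex) set"
  where "A2_ext \<omega> \<eta> = {f \<in> A2 \<omega>.
    \<exists>U g. open U \<and> closure \<omega> \<inter> periodic_domain \<omega> \<subseteq> U \<and> U \<subseteq> periodic_domain \<omega> \<and>
      g holomorphic_on U \<and> (\<forall>z\<in>\<omega>. g z = f z) \<and>
      (\<forall>y\<in>{0<..<1::real}. g (1 + \<i> * of_real y) = cis (fst \<eta>) * g (\<i> * of_real y)) \<and>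
      (\<forall>x\<in>{0<..<1::real}. g (of_real x + \<i>) = cis (snd \<eta>) * g (of_real x))}"

definition A2_eta :: "complex set \<Rightarrow> real \<times> real \<Rightarrow> (complex \<Rightarrow> complex) set"
  where "A2_eta \<omega> \<eta> =
    {f \<in> A2 \<omega>. \<forall>\<epsilon>>0. \<exists>g\<in>A2_ext \<omega> \<eta>. L2_norm (area \<omega>) (f - g) < \<epsilon>}"

definition floquet_A2_space :: "complex set \<Rightarrow> (real \<times> real \<Rightarrow> complex \<Rightarrow> complex) set"
  where "floquet_A2_space \<omega> =
    {F \<in> bochner_L2 (lebesgue_on dual_cell) (area \<omega>) (A2 \<omega>).
       AE \<eta> in lebesgue_on dual_cell. F \<eta> \<in> A2_eta \<omega> \<eta>}"

definition bergman_proj :: "complex set \<Rightarrow> (complex \<Rightarrow> complex) \<Rightarrow> complex \<Rightarrow> complex"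
  where "bergman_proj D = (SOME P. is_orth_proj (L2_inner (area D)) (L2 (area D)) (A2 D) P)"

definition P_eta ::
    "complex set \<Rightarrow> real \<times> real \<Rightarrow> (complex \<Rightarrow> complex) \<Rightarrow> complex \<Rightarrow> complex"
  where "P_eta \<omega> \<eta> =
    (SOME P. is_orth_proj (L2_inner (area \<omega>)) (L2 (area \<omega>)) (A2_eta \<omega> \<eta>) P)"

text \<open>
  The integral formula determines \<open>K z\<close> only up to a null set, which may vary with \<open>\<eta>\<close>.
  Continuity selects the usual pointwise defined kernel, as needed to integrate
  $K_\eta(z,w)$ with respect to $\eta$ for fixed $z$ and $w$.
\<close>

definition K_eta :: "complex set \<Rightarrow> real \<times> real \<Rightarrow> complex \<Rightarrow> complex \<Rightarrow> complex"
  where "K_eta \<omega> \<eta> = (SOME K. \<forall>z\<in>\<omega>.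
    K z \<in> L2 (area \<omega>) \<and> continuous_on \<omega> (K z) \<and>
    (\<forall>f\<in>L2 (area \<omega>). P_eta \<omega> \<eta> f z = (LINT w|area \<omega>. K z w * f w)))"

definition fiber_proj ::
    "complex set \<Rightarrow> (real \<times> real \<Rightarrow> complex \<Rightarrow> complex) \<Rightarrow> real \<times> real \<Rightarrow> complex \<Rightarrow> complex"
  where "fiber_proj \<omega> F = (\<lambda>\<eta>. P_eta \<omega> \<eta> (F \<eta>))"

text \<open>The integrands of the two integral representations of the Bergman projection.\<close>

definition single_integrand ::
    "complex set \<Rightarrow> (complex \<Rightarrow> complex) \<Rightarrow> complex \<Rightarrow> real \<times> real \<Rightarrow> complex"
  where "single_integrand \<omega> f z \<eta> =
    cis (of_int \<lfloor>Re z\<rfloor> * fst \<eta> + of_int \<lfloor>Im z\<rfloor> * snd \<eta>) * P_eta \<omega> \<eta> (floquet \<omega> f \<eta>) (tr z)"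

definition double_integrand ::
    "complex set \<Rightarrow> (complex \<Rightarrow> complex) \<Rightarrow> complex \<Rightarrow> complex \<Rightarrow> real \<times> real \<Rightarrow> complex"
  where "double_integrand \<omega> f z w \<eta> =
    cis (fst \<eta> * of_int (\<lfloor>Re z\<rfloor> - \<lfloor>Re w\<rfloor>) + snd \<eta> * of_int (\<lfloor>Im z\<rfloor> - \<lfloor>Im w\<rfloor>)) *
    K_eta \<omega> \<eta> (tr z) (tr w) * f w"

end

theory Submission imports Defs begin

text \<open>
  Dividing the summands of the elliptic function in assumption (A) by the function itself gives a
  holomorphic \<open>R\<close> on \<open>\<Omega>\<close> that decays faster than quadratically and whose lattice translates
  sum to 1.  The series \<open>T \<theta> z = (\<Sum>m. chi \<theta> m * R (z + m))\<close>, where \<open>chi \<theta>\<close> is the character with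
  parameter \<open>\<theta>\<close>, is quasiperiodic and close to 1 for small \<open>\<theta>\<close>, so multiplication by
  \<open>T (\<eta>0 - \<eta>)\<close> carries the space with parameter \<open>\<eta>0\<close> into the one with parameter \<open>\<eta>\<close> and
  moves functions only a little.  Hence the distance of a function to the quasiperiodic space is
  upper semicontinuous in \<open>\<eta>\<close>, and the projections depend measurably on \<open>\<eta>\<close>.

  For the second part it suffices that the Floquet transform maps the Bergman space of \<open>\<Omega>\<close> into the
  quasiperiodic spaces, and its orthogonal complement into their orthogonal complements.  If \<open>u\<close> is
  orthogonal to the Bergman space, testing it against translates of \<open>f * R\<close>, for the quasiperiodic
  extension of an \<open>f\<close> with parameter \<open>\<eta>0\<close>, shows that all Fourier coefficients of the pairing of
  its transform with \<open>f * T (\<eta>0 - \<eta>)\<close> vanish.  The exceptional null set depends on \<open>f\<close>; it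
  disappears at points \<open>\<eta>0\<close> of approximate continuity of the transform, since \<open>T (\<eta>0 - \<eta>)\<close>
  tends to 1.
\<close>

section \<open>Square integrable functions\<close>

text \<open>Fibers with different parameters must be compared through multiplication by an analytic
  function with prescribed unimodular multipliers. An exponential \<open>exp (c * z)\<close> cannot
  serve: its multipliers \<open>exp c\<close> and \<open>exp (\<i> * c)\<close> are both unimodular
  only for \<open>c = 0\<close>. The comparison has to exploit the holes of \<Omega>. The zeros of
  the elliptic function stay off the closure of \<Omega>, and periodicity then bounds its reciprocal
  on \<Omega>.

  Most of the analysis rests on one estimate: the value of an analytic function at a point is
  bounded by its L2 norm over a neighborhood. It makes Bergman spaces complete and separable,
  provides reproducing kernels, and turns norm convergence of Floquet sums into locally uniform
  convergence.

  Boundary points of the cells that belong to \<Omega> could fill positive area, and then the cells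
  alone would not determine a function on \<Omega>; the second part supposes that they are null.
  Elements are functions, not classes, and operators are picked by \<open>SOME\<close>. Values at
  single points are still meaningful because the projections have analytic values.\<close>

lemma L2D: "f \<in> L2 M \<Longrightarrow> f \<in> borel_measurable M" "f \<in> L2 M \<Longrightarrow> integrable M (\<lambda>x. (cmod (f x))\<^sup>2)"
  by (auto simp: L2_def)

lemma borel_measurable_cnj [measurable (raw)]:
  "f \<in> borel_measurable M \<Longrightarrow> (\<lambda>x. cnj (f x)) \<in> borel_measurable M"
  by (rule borel_measurable_continuous_on[of cnj]) (auto intro: continuous_intros)

lemma L2_cmult [intro]: "f \<in> L2 M \<Longrightarrow> (\<lambda>x. c * f x) \<in> L2 M"
  by (auto simp: L2_def norm_mult power_mult_distrib)

lemma cmod_add_sq_le: "(cmod (a + b))\<^sup>2 \<le> 2 * (cmod a)\<^sup>2 + 2 * (cmod b)\<^sup>2"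
proof -
  have "(cmod (a + b))\<^sup>2 \<le> (cmod a + cmod b)\<^sup>2"
    by (intro power_mono norm_triangle_ineq) auto
  also have "\<dots> \<le> 2 * (cmod a)\<^sup>2 + 2 * (cmod b)\<^sup>2"
    using sum_squares_bound[of "cmod a" "cmod b"] by (simp add: power2_sum)
  finally show ?thesis .
qed

lemma L2_add [intro]:
  assumes f: "f \<in> L2 M" and g: "g \<in> L2 M" shows "(\<lambda>x. f x + g x) \<in> L2 M"
proof -
  have [measurable]: "f \<in> borel_measurable M" "g \<in> borel_measurable M"
    using f g by (auto dest: L2D)
  have "integrable M (\<lambda>x. (cmod (f x + g x))\<^sup>2)"
  proof (rule Bochner_Integration.integrable_bound)
    show "integrable M (\<lambda>x. 2 * (cmod (f x))\<^sup>2 + 2 * (cmod (g x))\<^sup>2)"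
      using L2D(2)[OF f] L2D(2)[OF g] by auto
  qed (auto simp: cmod_add_sq_le)
  then show ?thesis by (simp add: L2_def)
qed

lemma L2_diff [intro]: "f \<in> L2 M \<Longrightarrow> g \<in> L2 M \<Longrightarrow> f - g \<in> L2 M"
  using L2_add[of f M "\<lambda>x. (-1) * g x"] L2_cmult[of g M "-1"] by (simp add: fun_diff_def)

lemma L2_zero [intro, simp]: "(\<lambda>x. 0) \<in> L2 M"
  by (simp add: L2_def)

lemma L2_sum [intro]: "(\<And>i. i \<in> I \<Longrightarrow> f i \<in> L2 M) \<Longrightarrow> (\<lambda>x. \<Sum>i\<in>I. f i x) \<in> L2 M"
  by (induction I rule: infinite_finite_induct) auto

lemma L2_inner_integrable:
  assumes f: "f \<in> L2 M" and g: "g \<in> L2 M" shows "integrable M (\<lambda>x. f x * cnj (g x))"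
proof (rule Bochner_Integration.integrable_bound)
  have [measurable]: "f \<in> borel_measurable M" "g \<in> borel_measurable M"
    using f g by (auto dest: L2D)
  show "(\<lambda>x. f x * cnj (g x)) \<in> borel_measurable M" by measurable
  show "integrable M (\<lambda>x. (cmod (f x))\<^sup>2 + (cmod (g x))\<^sup>2)"
    using L2D(2)[OF f] L2D(2)[OF g] by auto
  show "AE x in M. cmod (f x * cnj (g x)) \<le> norm ((cmod (f x))\<^sup>2 + (cmod (g x))\<^sup>2)"
  proof (rule AE_I2)
    fix x
    have "cmod (f x) * cmod (g x) \<le> (cmod (f x))\<^sup>2 + (cmod (g x))\<^sup>2"
      using sum_squares_bound[of "cmod (f x)" "cmod (g x)"] zero_le_power2[of "cmod (f x)"] zero_le_power2[of "cmod (g x)"]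
      by linarith
    then show "cmod (f x * cnj (g x)) \<le> norm ((cmod (f x))\<^sup>2 + (cmod (g x))\<^sup>2)"
      by (simp add: norm_mult)
  qed
qed

lemma L2_inner_integrable_norm:
  "f \<in> L2 M \<Longrightarrow> g \<in> L2 M \<Longrightarrow> integrable M (\<lambda>x. cmod (f x) * cmod (g x))"
  using integrable_norm[OF L2_inner_integrable[of f M g]] by (simp add: norm_mult)

lemma L2_inner_add_left:
  "f \<in> L2 M \<Longrightarrow> g \<in> L2 M \<Longrightarrow> h \<in> L2 M \<Longrightarrow> L2_inner M (\<lambda>x. f x + g x) h = L2_inner M f h + L2_inner M g h"
  using L2_inner_integrable[of f M h] L2_inner_integrable[of g M h]
  by (simp add: L2_inner_def distrib_right)

lemma L2_inner_diff_left:
  "f \<in> L2 M \<Longrightarrow> g \<in> L2 M \<Longrightarrow> h \<in> L2 M \<Longrightarrow> L2_inner M (f - g) h = L2_inner M f h - L2_inner M g h"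
  using L2_inner_integrable[of f M h] L2_inner_integrable[of g M h]
  by (simp add: L2_inner_def left_diff_distrib)

lemma L2_inner_cmult_left: "L2_inner M (\<lambda>x. c * f x) h = c * L2_inner M f h"
  by (simp add: L2_inner_def mult.assoc)

lemma L2_inner_commute: "L2_inner M g f = cnj (L2_inner M f g)"
proof -
  have "L2_inner M g f = (LINT x|M. cnj (f x * cnj (g x)))"
    by (simp add: L2_inner_def mult.commute)
  then show ?thesis by (simp add: L2_inner_def del: complex_cnj_mult)
qed

lemma L2_inner_add_right:
  "f \<in> L2 M \<Longrightarrow> g \<in> L2 M \<Longrightarrow> h \<in> L2 M \<Longrightarrow> L2_inner M h (\<lambda>x. f x + g x) = L2_inner M h f + L2_inner M h g"
  by (simp only: L2_inner_commute[of M h] L2_inner_add_left complex_cnj_add)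

lemma L2_inner_diff_right:
  "f \<in> L2 M \<Longrightarrow> g \<in> L2 M \<Longrightarrow> h \<in> L2 M \<Longrightarrow> L2_inner M h (f - g) = L2_inner M h f - L2_inner M h g"
  by (simp only: L2_inner_commute[of M h] L2_inner_diff_left complex_cnj_diff)

lemma L2_inner_cmult_right: "L2_inner M h (\<lambda>x. c * f x) = cnj c * L2_inner M h f"
  by (simp only: L2_inner_commute[of M h] L2_inner_cmult_left complex_cnj_mult)

lemma L2_inner_sum_left:
  assumes f: "\<And>i. i \<in> I \<Longrightarrow> f i \<in> L2 M" and h: "h \<in> L2 M"
  shows "L2_inner M (\<lambda>x. \<Sum>i\<in>I. f i x) h = (\<Sum>i\<in>I. L2_inner M (f i) h)"
  unfolding L2_inner_def sum_distrib_right
  by (rule Bochner_Integration.integral_sum) (rule L2_inner_integrable[OF f h])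

lemma L2_norm_nonneg [simp]: "0 \<le> L2_norm M f"
  by (simp add: L2_norm_def)

lemma L2_norm_sq: "(L2_norm M f)\<^sup>2 = (LINT x|M. (cmod (f x))\<^sup>2)"
  by (simp add: L2_norm_def)

lemma L2_inner_self: "L2_inner M f f = of_real ((L2_norm M f)\<^sup>2)"
  unfolding L2_norm_sq L2_inner_def integral_complex_of_real[symmetric]
  by (simp only: complex_norm_square)

lemma L2_norm_cmult: "L2_norm M (\<lambda>x. c * f x) = cmod c * L2_norm M f"
  by (simp add: L2_norm_def norm_mult power_mult_distrib real_sqrt_mult)

lemma L2_norm_zero [simp]: "L2_norm M (\<lambda>x. 0) = 0"
  by (simp add: L2_norm_def)

lemma L2_norm_diff_self [simp]: "L2_norm M (f - f) = 0"
  by (simp add: L2_norm_def)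

lemma L2_norm_minus_commute: "L2_norm M (f - g) = L2_norm M (g - f)"
  by (simp add: L2_norm_def norm_minus_commute)

lemma L2_norm_cong_AE:
  assumes "AE x in M. f x = g x" "f \<in> borel_measurable M" "g \<in> borel_measurable M"
  shows "L2_norm M f = L2_norm M g"
proof -
  have "(LINT x|M. (cmod (f x))\<^sup>2) = (LINT x|M. (cmod (g x))\<^sup>2)"
    using assms by (intro integral_cong_AE) auto
  then show ?thesis by (simp add: L2_norm_def)
qed

lemma L2_inner_cong_AE:
  assumes "AE x in M. f x = f' x" "f \<in> borel_measurable M" "f' \<in> borel_measurable M" "h \<in> borel_measurable M"
  shows "L2_inner M f h = L2_inner M f' h"
  unfolding L2_inner_def using assms by (intro integral_cong_AE) auto

lemma L2_norm_eq_0_AE: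
  assumes "f \<in> L2 M" "L2_norm M f = 0" shows "AE x in M. f x = 0"
proof -
  have "(LINT x|M. (cmod (f x))\<^sup>2) = 0" using assms by (simp add: L2_norm_def)
  then have "AE x in M. (cmod (f x))\<^sup>2 = 0"
    using integral_nonneg_eq_0_iff_AE[OF L2D(2)[OF assms(1)]] by simp
  then show ?thesis by simp
qed

lemma nn_integral_L2:
  "f \<in> L2 M \<Longrightarrow> (\<integral>\<^sup>+x. ennreal ((cmod (f x))\<^sup>2) \<partial>M) = ennreal ((L2_norm M f)\<^sup>2)"
  by (simp add: L2_norm_sq L2D nn_integral_eq_integral)

lemma L2_Cauchy_Schwarz_abs:
  assumes f: "f \<in> L2 M" and g: "g \<in> L2 M"
  shows "(LINT x|M. cmod (f x) * cmod (g x)) \<le> L2_norm M f * L2_norm M g"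
proof -
  have [measurable]: "f \<in> borel_measurable M" "g \<in> borel_measurable M"
    using f g by (auto dest: L2D)
  have "(\<integral>\<^sup>+x. ennreal (cmod (f x)) * ennreal (cmod (g x)) \<partial>M)\<^sup>2 \<le>
      (\<integral>\<^sup>+x. (ennreal (cmod (f x)))^2 \<partial>M) * (\<integral>\<^sup>+x. (ennreal (cmod (g x)))^2 \<partial>M)"
    by (rule Cauchy_Schwarz_nn_integral) measurable
  then have "(ennreal (LINT x|M. cmod (f x) * cmod (g x)))\<^sup>2 \<le> ennreal ((L2_norm M f)\<^sup>2) * ennreal ((L2_norm M g)\<^sup>2)"
    using nn_integral_eq_integral[OF L2_inner_integrable_norm[OF f g]] nn_integral_L2[OF f] nn_integral_L2[OF g]
    by (simp add: ennreal_mult' ennreal_power)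
  then have "(LINT x|M. cmod (f x) * cmod (g x))\<^sup>2 \<le> (L2_norm M f * L2_norm M g)\<^sup>2"
    by (simp add: ennreal_power ennreal_mult'[symmetric] power_mult_distrib)
  then show ?thesis
    by (rule power2_le_imp_le) simp
qed

lemma L2_Cauchy_Schwarz:
  assumes f: "f \<in> L2 M" and g: "g \<in> L2 M"
  shows "cmod (L2_inner M f g) \<le> L2_norm M f * L2_norm M g"
  using integral_norm_bound[of M "\<lambda>x. f x * cnj (g x)"] L2_Cauchy_Schwarz_abs[OF f g]
  by (simp add: L2_inner_def norm_mult)

lemma L2_norm_add_sq:
  assumes f: "f \<in> L2 M" and g: "g \<in> L2 M"
  shows "(L2_norm M (\<lambda>x. f x + g x))\<^sup>2 = (L2_norm M f)\<^sup>2 + (L2_norm M g)\<^sup>2 + 2 * Re (L2_inner M f g)"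
proof -
  have "complex_of_real ((L2_norm M (\<lambda>x. f x + g x))\<^sup>2) = L2_inner M (\<lambda>x. f x + g x) (\<lambda>x. f x + g x)"
    by (rule L2_inner_self[symmetric])
  also have "\<dots> = L2_inner M f f + L2_inner M g g + (L2_inner M f g + cnj (L2_inner M f g))"
    using f g by (simp add: L2_inner_add_left L2_inner_add_right L2_add algebra_simps L2_inner_commute[of M g f])
  also have "\<dots> = of_real ((L2_norm M f)\<^sup>2 + (L2_norm M g)\<^sup>2 + 2 * Re (L2_inner M f g))"
    by (simp only: L2_inner_self complex_add_cnj) simp
  finally show ?thesis by (simp only: of_real_eq_iff)
qed

lemma L2_norm_diff_sq:
  assumes f: "f \<in> L2 M" and g: "g \<in> L2 M"
  shows "(L2_norm M (f - g))\<^sup>2 = (L2_norm M f)\<^sup>2 + (L2_norm M g)\<^sup>2 - 2 * Re (L2_inner M f g)"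
proof -
  have "f - g = (\<lambda>x. f x + (-1) * g x)" by (simp add: fun_eq_iff)
  then have "(L2_norm M (f - g))\<^sup>2 = (L2_norm M f)\<^sup>2 + (cmod (-1) * L2_norm M g)\<^sup>2 + 2 * Re (cnj (-1) * L2_inner M f g)"
    by (simp only: L2_norm_add_sq[OF f L2_cmult[OF g]] L2_norm_cmult L2_inner_cmult_right)
  then show ?thesis by simp
qed

lemma L2_norm_triangle:
  assumes f: "f \<in> L2 M" and g: "g \<in> L2 M"
  shows "L2_norm M (\<lambda>x. f x + g x) \<le> L2_norm M f + L2_norm M g"
proof (rule power2_le_imp_le)
  have "Re (L2_inner M f g) \<le> L2_norm M f * L2_norm M g"
    using L2_Cauchy_Schwarz[OF f g] complex_Re_le_cmod order_trans by blast
  then show "(L2_norm M (\<lambda>x. f x + g x))\<^sup>2 \<le> (L2_norm M f + L2_norm M g)\<^sup>2"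
    by (simp add: L2_norm_add_sq[OF f g] power2_sum)
qed simp

lemma L2_norm_triangle_diff:
  assumes f: "f \<in> L2 M" and g: "g \<in> L2 M" and h: "h \<in> L2 M"
  shows "L2_norm M (f - h) \<le> L2_norm M (f - g) + L2_norm M (g - h)"
  using L2_norm_triangle[OF L2_diff[OF f g] L2_diff[OF g h]] by (simp add: fun_diff_def)

lemma L2_norm_le_diff:
  assumes f: "f \<in> L2 M" and g: "g \<in> L2 M"
  shows "L2_norm M f \<le> L2_norm M g + L2_norm M (f - g)"
  using L2_norm_triangle[OF g L2_diff[OF f g]] by (simp add: fun_diff_def)

lemma L2_norm_diff_abs:
  assumes "f \<in> L2 M" "g \<in> L2 M"
  shows "\<bar>L2_norm M f - L2_norm M g\<bar> \<le> L2_norm M (f - g)"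
  using L2_norm_le_diff[OF assms] L2_norm_le_diff[OF assms(2,1)] L2_norm_minus_commute[of M f g]
  by linarith

lemma L2_norm_sum:
  assumes "finite I" "\<And>i. i \<in> I \<Longrightarrow> f i \<in> L2 M"
  shows "L2_norm M (\<lambda>x. \<Sum>i\<in>I. f i x) \<le> (\<Sum>i\<in>I. L2_norm M (f i))"
  using assms
proof (induction I rule: finite_induct)
  case empty
  show ?case by (simp only: sum.empty L2_norm_zero order_refl)
next
  case (insert i I)
  have f: "f j \<in> L2 M" if "j \<in> insert i I" for j by (rule insert.prems[OF that])
  have "L2_norm M (\<lambda>x. \<Sum>i\<in>insert i I. f i x) = L2_norm M (\<lambda>x. f i x + (\<Sum>i\<in>I. f i x))"
    by (simp only: sum.insert[OF insert.hyps])
  also have "\<dots> \<le> L2_norm M (f i) + L2_norm M (\<lambda>x. \<Sum>i\<in>I. f i x)"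
    by (rule L2_norm_triangle[OF f L2_sum[OF f]]) auto
  also have "\<dots> \<le> L2_norm M (f i) + (\<Sum>i\<in>I. L2_norm M (f i))"
    by (rule add_left_mono, rule insert.IH, rule f) simp
  also have "\<dots> = (\<Sum>i\<in>insert i I. L2_norm M (f i))"
    by (simp only: sum.insert[OF insert.hyps])
  finally show ?case .
qed

lemma tendsto_L2_norm:
  assumes "\<And>n. f n \<in> L2 M" "g \<in> L2 M" "h \<in> L2 M" "(\<lambda>n. L2_norm M (f n - g)) \<longlonglongrightarrow> 0"
  shows "(\<lambda>n. L2_norm M (f n - h)) \<longlonglongrightarrow> L2_norm M (g - h)"
proof (rule LIM_zero_cancel, rule Lim_null_comparison[OF _ assms(4)], rule always_eventually, rule allI)
  fix n
  have "(f n - h) - (g - h) = f n - g" by (simp add: fun_eq_iff)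
  then show "norm (L2_norm M (f n - h) - L2_norm M (g - h)) \<le> L2_norm M (f n - g)"
    using L2_norm_diff_abs[of "f n - h" M "g - h"] assms by (simp add: L2_diff)
qed

lemma tendsto_L2_inner:
  assumes "\<And>n. f n \<in> L2 M" "g \<in> L2 M" "h \<in> L2 M" "(\<lambda>n. L2_norm M (f n - g)) \<longlonglongrightarrow> 0"
  shows "(\<lambda>n. L2_inner M (f n) h) \<longlonglongrightarrow> L2_inner M g h"
proof (rule LIM_zero_cancel, rule Lim_null_comparison[where g = "\<lambda>n. L2_norm M (f n - g) * L2_norm M h"], rule always_eventually, rule allI)
  fix n
  show "norm (L2_inner M (f n) h - L2_inner M g h) \<le> L2_norm M (f n - g) * L2_norm M h"
    using L2_Cauchy_Schwarz[of "f n - g" M h] assms by (simp add: L2_inner_diff_left L2_diff)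
  show "(\<lambda>n. L2_norm M (f n - g) * L2_norm M h) \<longlonglongrightarrow> 0"
    using tendsto_mult_right[OF assms(4), of "L2_norm M h"] by simp
qed

section \<open>Completeness and orthogonal projections in L2\<close>

definition L2_Cauchy :: "'a measure \<Rightarrow> (nat \<Rightarrow> 'a \<Rightarrow> complex) \<Rightarrow> bool" where
  "L2_Cauchy M f \<longleftrightarrow> (\<forall>e>0. \<exists>N. \<forall>m\<ge>N. \<forall>n\<ge>N. L2_norm M (f m - f n) < e)"

text \<open>Fatou's lemma in \<open>m\<close>, applied to the squared modulus of
  \<open>f n - f m\<close> for fixed \<open>n\<close>, bounds the norm of \<open>f n - g\<close> by
  the Cauchy tail. The same estimate shows that the limit is square integrable.\<close>

lemma L2_Fatou_limit:
  assumes f: "\<And>n. f n \<in> L2 M" and C: "L2_Cauchy M f" and g: "g \<in> borel_measurable M"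
    and lim: "AE x in M. (\<lambda>n. f n x) \<longlonglongrightarrow> g x"
  shows "g \<in> L2 M" "(\<lambda>n. L2_norm M (f n - g)) \<longlonglongrightarrow> 0"
proof -
  have [measurable]: "f n \<in> borel_measurable M" for n using f L2D by blast
  note [measurable] = g
  have key: "f n - g \<in> L2 M \<and> L2_norm M (f n - g) \<le> e" if e: "e > 0" and n: "\<forall>m\<ge>n. L2_norm M (f n - f m) < e" for n e
  proof -
    have "(\<integral>\<^sup>+x. ennreal ((cmod (f n x - g x))\<^sup>2) \<partial>M) \<le> (\<integral>\<^sup>+x. liminf (\<lambda>m. ennreal ((cmod (f n x - f m x))\<^sup>2)) \<partial>M)"
    proof (rule nn_integral_mono_AE)
      show "AE x in M. ennreal ((cmod (f n x - g x))\<^sup>2) \<le> liminf (\<lambda>m. ennreal ((cmod (f n x - f m x))\<^sup>2))"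
        using lim
      proof eventually_elim
        case (elim x)
        then have "(\<lambda>m. ennreal ((cmod (f n x - f m x))\<^sup>2)) \<longlonglongrightarrow> ennreal ((cmod (f n x - g x))\<^sup>2)"
          by (intro tendsto_intros)
        then have "liminf (\<lambda>m. ennreal ((cmod (f n x - f m x))\<^sup>2)) = ennreal ((cmod (f n x - g x))\<^sup>2)"
          by (intro lim_imp_Liminf) auto
        then show ?case by simp
      qed
    qed
    also have "\<dots> \<le> liminf (\<lambda>m. \<integral>\<^sup>+x. ennreal ((cmod (f n x - f m x))\<^sup>2) \<partial>M)"
      by (rule nn_integral_liminf) measurable
    also have "\<dots> \<le> ennreal (e\<^sup>2)"
    proof (rule Liminf_le)
      show "eventually (\<lambda>m. (\<integral>\<^sup>+x. ennreal ((cmod (f n x - f m x))\<^sup>2) \<partial>M) \<le> ennreal (e\<^sup>2)) sequentially"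
        using eventually_ge_at_top[of n]
      proof eventually_elim
        case (elim m)
        have "(L2_norm M (f n - f m))\<^sup>2 \<le> e\<^sup>2"
          by (rule power_mono) (use elim n in \<open>auto intro: less_imp_le\<close>)
        then show ?case using nn_integral_L2[OF L2_diff[OF f[of n] f[of m]]] by (simp add: ennreal_leI)
      qed
    qed simp
    finally have *: "(\<integral>\<^sup>+x. ennreal ((cmod (f n x - g x))\<^sup>2) \<partial>M) \<le> ennreal (e\<^sup>2)" .
    then have "integrable M (\<lambda>x. (cmod (f n x - g x))\<^sup>2)"
      by (intro integrableI_bounded) (auto simp: order_le_less_trans[OF _ ennreal_less_top])
    then have L: "f n - g \<in> L2 M" by (simp add: L2_def fun_diff_def)
    then have "ennreal ((L2_norm M (f n - g))\<^sup>2) \<le> ennreal (e\<^sup>2)"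
      using * nn_integral_L2[OF L] by simp
    then have "(L2_norm M (f n - g))\<^sup>2 \<le> e\<^sup>2" using e by (simp add: ennreal_le_iff)
    then have "L2_norm M (f n - g) \<le> e" using e by - (rule power2_le_imp_le, simp_all)
    with L show ?thesis by blast
  qed
  from C obtain N where N: "\<And>m n. m \<ge> N \<Longrightarrow> n \<ge> N \<Longrightarrow> L2_norm M (f m - f n) < 1"
    unfolding L2_Cauchy_def by (meson zero_less_one)
  have "f N - g \<in> L2 M" using key[of 1 N] N by auto
  then have "f N - (f N - g) \<in> L2 M" using f L2_diff by blast
  moreover have "f N - (f N - g) = g" by (simp add: fun_eq_iff)
  ultimately show g2: "g \<in> L2 M" by simp
  show "(\<lambda>n. L2_norm M (f n - g)) \<longlonglongrightarrow> 0"
  proof (rule LIMSEQ_I)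
    fix r :: real assume r: "r > 0"
    with C obtain N where N: "\<And>m n. m \<ge> N \<Longrightarrow> n \<ge> N \<Longrightarrow> L2_norm M (f m - f n) < r/2"
      unfolding L2_Cauchy_def by (meson half_gt_zero)
    then have "\<forall>n\<ge>N. L2_norm M (f n - g) \<le> r/2" using key[of "r/2"] r by auto
    then show "\<exists>no. \<forall>n\<ge>no. norm (L2_norm M (f n - g) - 0) < r" using r by (force)
  qed
qed

lemma L2_const: "finite_measure M \<Longrightarrow> (\<lambda>x. c) \<in> L2 M"
  by (simp add: L2_def finite_measure.integrable_const)

lemma L2_norm_one: "L2_norm M (\<lambda>x. 1) = sqrt (measure M (space M))"
  by (simp add: L2_norm_def)

lemma L2_finite_integrable:
  assumes "finite_measure M" "f \<in> L2 M" 
  shows "integrable M f" "(LINT x|M. cmod (f x)) \<le> sqrt (measure M (space M)) * L2_norm M f"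
  using L2_inner_integrable[OF assms(2) L2_const[OF assms(1), of 1]]
    L2_Cauchy_Schwarz_abs[OF assms(2) L2_const[OF assms(1), of 1]]
  by (simp_all add: L2_norm_one mult.commute)

text \<open>On a finite measure an L2 Cauchy sequence is L1 Cauchy and so has a subsequence
  converging almost everywhere. Fatou identifies its limit as an L2 limit, and the Cauchy property
  carries this over to the whole sequence.\<close>

lemma L2_Riesz_Fischer:
  assumes fin: "finite_measure M" and f: "\<And>n. f n \<in> L2 M" and C: "L2_Cauchy M f"
  shows "\<exists>g\<in>L2 M. (\<lambda>n. L2_norm M (f n - g)) \<longlonglongrightarrow> 0"
proof -
  have [measurable]: "f n \<in> borel_measurable M" for n using f L2D by blast
  \<comment> \<open>The summand 1 keeps \<open>K\<close> positive when the space has measure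
    zero.\<close>
  define K where "K = sqrt (measure M (space M)) + 1"
  have K: "K > 0" "sqrt (measure M (space M)) \<le> K" 
    using real_sqrt_ge_zero[of "measure M (space M)"] by (auto simp: K_def intro: add_nonneg_pos)
  obtain r where r: "strict_mono r" "AE x in M. Cauchy (\<lambda>i. f (r i) x)"
  proof (rule cauchy_L1_AE_cauchy_subseq[of M f])
    show "integrable M (f n)" for n using L2_finite_integrable[OF fin f] by blast
    fix e :: real assume "e > 0"
    then have "e / K > 0" using K by simp
    then obtain N where N: "\<And>m n. m \<ge> N \<Longrightarrow> n \<ge> N \<Longrightarrow> L2_norm M (f m - f n) < e / K"
      using C unfolding L2_Cauchy_def by meson
    show "\<exists>N. \<forall>i\<ge>N. \<forall>j\<ge>N. LINT x|M. norm (f i x - f j x) < e"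
    proof (intro exI allI impI)
      fix i j assume ij: "i \<ge> N" "j \<ge> N"
      have "(LINT x|M. norm (f i x - f j x)) \<le> sqrt (measure M (space M)) * L2_norm M (f i - f j)"
        using L2_finite_integrable(2)[OF fin L2_diff[OF f f]] by simp
      also have "\<dots> \<le> K * L2_norm M (f i - f j)" using K by (intro mult_right_mono) auto
      also have "\<dots> < e" using N[OF ij] K by (simp add: field_simps)
      finally show "(LINT x|M. norm (f i x - f j x)) < e" .
    qed
  qed
  have C': "L2_Cauchy M (\<lambda>i. f (r i))"
    unfolding L2_Cauchy_def
  proof (intro allI impI)
    fix e :: real assume "e > 0"
    with C obtain N where N: "\<And>m n. m \<ge> N \<Longrightarrow> n \<ge> N \<Longrightarrow> L2_norm M (f m - f n) < e" 
      unfolding L2_Cauchy_def by meson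
    show "\<exists>N. \<forall>m\<ge>N. \<forall>n\<ge>N. L2_norm M (f (r m) - f (r n)) < e"
      by (rule exI[of _ N]) (use N seq_suble[OF r(1)] order_trans in blast)
  qed
  define g where "g = (\<lambda>x. lim (\<lambda>i. f (r i) x))"
  have g: "g \<in> borel_measurable M" unfolding g_def by measurable
  have lim: "AE x in M. (\<lambda>i. f (r i) x) \<longlonglongrightarrow> g x"
    using r(2) by eventually_elim (simp add: g_def convergent_LIMSEQ_iff[symmetric] Cauchy_convergent_iff)
  note FL = L2_Fatou_limit[OF _ C' g lim]
  have gL: "g \<in> L2 M" using FL(1) f by blast
  have sub: "(\<lambda>n. L2_norm M (f (r n) - g)) \<longlonglongrightarrow> 0" using FL(2) f by blast
  have "(\<lambda>n. L2_norm M (f n - g)) \<longlonglongrightarrow> 0"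
  proof (rule LIMSEQ_I)
    fix e :: real assume e: "e > 0"
    with C obtain N where N: "\<And>m n. m \<ge> N \<Longrightarrow> n \<ge> N \<Longrightarrow> L2_norm M (f m - f n) < e/2" 
      unfolding L2_Cauchy_def by (meson half_gt_zero)
    obtain N' where N': "\<And>n. n \<ge> N' \<Longrightarrow> L2_norm M (f (r n) - g) < e/2"
      using LIMSEQ_D[OF sub, of "e/2"] e by auto
    have "L2_norm M (f n - g) < e" if "n \<ge> N" for n
    proof -
      define k where "k = max N N'"
      have "r k \<ge> N" using seq_suble[OF r(1), of k] by (simp add: k_def)
      then show ?thesis
        using L2_norm_triangle_diff[OF f[of n] f[of "r k"] gL] N[OF that \<open>r k \<ge> N\<close>] N'[of k] by (simp add: k_def)
    qed
    then show "\<exists>no. \<forall>n\<ge>no. norm (L2_norm M (f n - g) - 0) < e" by auto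
  qed
  with gL show ?thesis by blast
qed

text \<open>Elements are functions, so limits are unique only up to norm zero and completeness is
  phrased with sequences. Instances are the Bergman spaces, their subspaces of functions vanishing
  at a point, closures of subspaces, and through these the fibers \<open>A2_eta\<close>.\<close>

locale L2_closed_subspace =
  fixes M :: "'a measure" and W :: "('a \<Rightarrow> complex) set"
  assumes sub: "W \<subseteq> L2 M"
    and zero: "(\<lambda>x. 0) \<in> W"
    and add: "\<And>f g. f \<in> W \<Longrightarrow> g \<in> W \<Longrightarrow> (\<lambda>x. f x + g x) \<in> W"
    and scale: "\<And>c f. f \<in> W \<Longrightarrow> (\<lambda>x. c * f x) \<in> W"
    and complete: "\<And>f. (\<And>n. f n \<in> W) \<Longrightarrow> L2_Cauchy M f \<Longrightarrow> \<exists>g\<in>W. (\<lambda>n. L2_norm M (f n - g)) \<longlonglongrightarrow> 0"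
begin

lemma diff: "f \<in> W \<Longrightarrow> g \<in> W \<Longrightarrow> f - g \<in> W"
  using add[of f "\<lambda>x. (-1) * g x"] scale[of g "-1"] by (simp add: fun_diff_def)

text \<open>The distance is attained because the parallelogram law makes a minimizing sequence
  Cauchy. At a minimizer the first variation in every direction of \<open>W\<close> vanishes, which
  is the orthogonality.\<close>

lemma projection_exists:
  assumes f: "f \<in> L2 M"
  shows "\<exists>p\<in>W. \<forall>g\<in>W. L2_inner M (f - p) g = 0"
proof -
  define d where "d = (INF g\<in>W. (L2_norm M (f - g))\<^sup>2)"
  have bdd: "bdd_below ((\<lambda>g. (L2_norm M (f - g))\<^sup>2) ` W)" by (rule bdd_belowI[of _ 0]) auto
  have d_le: "d \<le> (L2_norm M (f - g))\<^sup>2" if "g \<in> W" for g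
    unfolding d_def by (rule cINF_lower[OF bdd that])
  have "\<exists>g\<in>W. (L2_norm M (f - g))\<^sup>2 < d + 1 / Suc n" for n
    using cInf_lessD[of "(\<lambda>g. (L2_norm M (f - g))\<^sup>2) ` W" "d + 1 / Suc n"] zero by (auto simp: d_def)
  then obtain g where g: "\<And>n. g n \<in> W" "\<And>n. (L2_norm M (f - g n))\<^sup>2 < d + 1 / Suc n"
    by metis
  have gL: "g n \<in> L2 M" for n using g sub by blast
  have para: "(L2_norm M (g m - g n))\<^sup>2 \<le> 2 / Suc m + 2 / Suc n" for m n
  proof -
    define u where "u = f - g m" define v where "v = f - g n"
    have uv: "u \<in> L2 M" "v \<in> L2 M" using f gL by (auto simp: u_def v_def)
    \<comment> \<open>The midpoint of two nearly optimal points lies in \<open>W\<close>, so its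
      squared distance to \<open>f\<close> is at least \<open>d\<close>; this is what bounds their
      mutual distance.\<close>
    have "(\<lambda>x. (1/2) * (g m x + g n x)) \<in> W" using add scale g by blast
    from d_le[OF this] have "d \<le> (L2_norm M (\<lambda>x. (1/2) * (u x + v x)))\<^sup>2"
      by (rule order_trans) (simp add: u_def v_def fun_diff_def field_simps)
    then have 1: "4 * d \<le> (L2_norm M (\<lambda>x. u x + v x))\<^sup>2"
      unfolding L2_norm_cmult by (simp add: power_divide)
    have eq: "g m - g n = v - u" by (simp add: u_def v_def fun_eq_iff)
    have "(L2_norm M (g m - g n))\<^sup>2 + (L2_norm M (\<lambda>x. u x + v x))\<^sup>2 = 2 * (L2_norm M u)\<^sup>2 + 2 * (L2_norm M v)\<^sup>2"
      unfolding eq using L2_norm_add_sq[OF uv] L2_norm_diff_sq[OF uv(2,1)] L2_inner_commute[of M u v] by simp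
    then show ?thesis using 1 g(2)[of m] g(2)[of n] by (simp add: u_def v_def)
  qed
  have "L2_Cauchy M g"
    unfolding L2_Cauchy_def
  proof (intro allI impI)
    fix e :: real assume e: "e > 0"
    obtain N where N: "inverse (real (Suc N)) < e\<^sup>2 / 4" using reals_Archimedean[of "e\<^sup>2/4"] e by auto
    show "\<exists>N. \<forall>m\<ge>N. \<forall>n\<ge>N. L2_norm M (g m - g n) < e"
    proof (intro exI allI impI)
      fix m n assume mn: "m \<ge> N" "n \<ge> N"
      have "1 / Suc m \<le> 1 / Suc N" "1 / Suc n \<le> 1 / Suc N" using mn by (auto intro!: divide_left_mono)
      then have "(L2_norm M (g m - g n))\<^sup>2 < e\<^sup>2"
        using para[of m n] N by (simp add: inverse_eq_divide)
      then show "L2_norm M (g m - g n) < e" using e by - (rule power2_less_imp_less, simp_all)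
    qed
  qed
  then obtain p where p: "p \<in> W" "(\<lambda>n. L2_norm M (g n - p)) \<longlonglongrightarrow> 0" using complete g by blast
  have pL: "p \<in> L2 M" using p sub by blast
  have "(\<lambda>n. (L2_norm M (g n - f))\<^sup>2) \<longlonglongrightarrow> (L2_norm M (p - f))\<^sup>2"
    by (intro tendsto_power tendsto_L2_norm gL pL f p)
  moreover have "(\<lambda>n. d + 1 / Suc n) \<longlonglongrightarrow> d + 0"
    by (intro tendsto_intros LIMSEQ_Suc lim_1_over_n)
  ultimately have "(L2_norm M (p - f))\<^sup>2 \<le> d + 0"
  proof (rule LIMSEQ_le)
    have "(L2_norm M (g n - f))\<^sup>2 \<le> d + 1 / Suc n" for n
      using g(2)[of n] L2_norm_minus_commute[of M "g n" f] by simp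
    then show "\<exists>N. \<forall>n\<ge>N. (L2_norm M (g n - f))\<^sup>2 \<le> d + 1 / Suc n" by blast
  qed
  then have min: "(L2_norm M (f - p))\<^sup>2 \<le> (L2_norm M (f - h))\<^sup>2" if "h \<in> W" for h
    using d_le[OF that] unfolding L2_norm_minus_commute[of M f p] by linarith
  show ?thesis
  proof (intro bexI[OF _ p(1)] ballI)
    fix h assume h: "h \<in> W"
    define u where "u = f - p"
    define c where "c = L2_inner M u h"
    have uL: "u \<in> L2 M" and hL: "h \<in> L2 M" using f pL h sub by (auto simp: u_def)
    \<comment> \<open>Moving \<open>p\<close> by \<open>t * c\<close> times \<open>h\<close>, with
      \<open>c\<close> the inner product in question, makes the linear term
      \<open>2 * t * (cmod c)\<^sup>2\<close> real, so a real parameter also covers complex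
      scalars.\<close>
    have ineq: "2 * t * (cmod c)\<^sup>2 \<le> t\<^sup>2 * ((cmod c)\<^sup>2 * (L2_norm M h)\<^sup>2)" for t :: real
    proof -
      have "(\<lambda>x. p x + (of_real t * c) * h x) \<in> W" using add scale p h by blast
      from min[OF this] have "(L2_norm M u)\<^sup>2 \<le> (L2_norm M (u - (\<lambda>x. (of_real t * c) * h x)))\<^sup>2"
        by (simp add: u_def fun_diff_def algebra_simps)
      also have "\<dots> = (L2_norm M u)\<^sup>2 + t\<^sup>2 * ((cmod c)\<^sup>2 * (L2_norm M h)\<^sup>2) - 2 * Re (of_real t * (cnj c * c))"
        unfolding L2_norm_diff_sq[OF uL L2_cmult[OF hL]] L2_norm_cmult L2_inner_cmult_right
        by (simp add: norm_mult power_mult_distrib c_def mult.assoc)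
      also have "Re (of_real t * (cnj c * c)) = t * (cmod c)\<^sup>2"
        by (simp only: mult.commute[of "cnj c"] complex_norm_square[symmetric] of_real_mult[symmetric] Re_complex_of_real)
      finally show ?thesis by simp
    qed
    \<comment> \<open>At \<open>t = 1 / A\<close> the quadratic term is at most half of the linear
      one; the summand 1 keeps \<open>A\<close> positive.\<close>
    define A where "A = (L2_norm M h)\<^sup>2 + 1"
    have A: "A > 0" by (simp add: A_def add_nonneg_pos)
    have "2 * (1/A) * (cmod c)\<^sup>2 \<le> (1/A)\<^sup>2 * ((cmod c)\<^sup>2 * (L2_norm M h)\<^sup>2)" by (rule ineq)
    also have "\<dots> \<le> (1/A)\<^sup>2 * ((cmod c)\<^sup>2 * A)" by (intro mult_left_mono) (auto simp: A_def)
    also have "\<dots> = (1/A) * (cmod c)\<^sup>2" using A by (simp add: field_simps power2_eq_square)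
    finally have "(1/A) * (cmod c)\<^sup>2 \<le> 0" by simp
    then have "c = 0" using A by (simp add: field_simps mult_le_0_iff)
    then show "L2_inner M (f - p) h = 0" by (simp add: c_def u_def)
  qed
qed

lemma orth_proj_exists: "\<exists>P. is_orth_proj (L2_inner M) (L2 M) W P"
  using projection_exists sub unfolding is_orth_proj_def by metis

text \<open>The difference of two candidates lies in \<open>W\<close> and is orthogonal to
  itself.\<close>

lemma orth_proj_unique:
  assumes P: "is_orth_proj (L2_inner M) (L2 M) W P" and f: "f \<in> L2 M"
    and p: "p \<in> W" "\<And>g. g \<in> W \<Longrightarrow> L2_inner M (f - p) g = 0"
  shows "AE x in M. P f x = p x"
proof -
  have Pf: "P f \<in> W" "\<And>g. g \<in> W \<Longrightarrow> L2_inner M (f - P f) g = 0"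
    using P f by (auto simp: is_orth_proj_def)
  have L: "P f \<in> L2 M" "p \<in> L2 M" using Pf p sub by auto
  have d: "P f - p \<in> W" using diff Pf p by blast
  have "L2_inner M (P f - p) (P f - p) = L2_inner M (f - p) (P f - p) - L2_inner M (f - P f) (P f - p)"
    using f L by (simp add: L2_inner_diff_left L2_diff)
  then have "L2_norm M (P f - p) = 0"
    using Pf(2)[OF d] p(2)[OF d] by (simp add: L2_inner_self)
  then show ?thesis
    using L2_norm_eq_0_AE[OF L2_diff[OF L]] by (simp)
qed

text \<open>Everything follows from the defining orthogonality: \<open>P\<close> is a choice among
  representatives and is linear only up to null sets.\<close>

lemma orth_proj_props:
  assumes P: "is_orth_proj (L2_inner M) (L2 M) W P" and f: "f \<in> L2 M"
  shows "P f \<in> W" "P f \<in> L2 M"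
    "\<And>g. g \<in> W \<Longrightarrow> L2_inner M f g = L2_inner M (P f) g"
    "\<And>g. g \<in> L2 M \<Longrightarrow> L2_inner M (P f) g = L2_inner M f (P g)"
    "(L2_norm M f)\<^sup>2 = (L2_norm M (P f))\<^sup>2 + (L2_norm M (f - P f))\<^sup>2"
    "\<And>g. g \<in> W \<Longrightarrow> L2_norm M (f - P f) \<le> L2_norm M (f - g)"
    "L2_norm M (P f) \<le> L2_norm M f"
proof -
  have W: "P f \<in> W" "\<And>f. f \<in> L2 M \<Longrightarrow> P f \<in> W" "\<And>f g. f \<in> L2 M \<Longrightarrow> g \<in> W \<Longrightarrow> L2_inner M (f - P f) g = 0"
    using P f by (auto simp: is_orth_proj_def)
  show "P f \<in> W" by (rule W)
  show L: "P f \<in> L2 M" using W sub by blast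
  have *: "L2_inner M f g = L2_inner M (P f) g" if "g \<in> W" "f \<in> L2 M" for f g
    using W(3)[OF that(2,1)] L2_inner_diff_left[OF that(2), of "P f" g] W(2)[OF that(2)] sub that by auto
  show "L2_inner M f g = L2_inner M (P f) g" if "g \<in> W" for g by (rule *[OF that f])
  show "L2_inner M (P f) g = L2_inner M f (P g)" if "g \<in> L2 M" for g
    using *[OF W(2)[OF that] f] *[OF W(1) that] by (metis L2_inner_commute)
  have pyth: "(L2_norm M (f - h))\<^sup>2 = (L2_norm M (P f - h))\<^sup>2 + (L2_norm M (f - P f))\<^sup>2" if h: "h \<in> W" for h
  proof -
    have "f - h = (\<lambda>x. (P f - h) x + (f - P f) x)" by (simp add: fun_eq_iff)
    moreover have "L2_inner M (P f - h) (f - P f) = 0"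
      using W(3)[OF f diff[OF W(1) h]] by (metis L2_inner_commute complex_cnj_zero)
    ultimately show ?thesis
      using L2_norm_add_sq[of "P f - h" M "f - P f"] f L h sub by (auto simp: L2_diff subset_eq)
  qed
  show 5: "(L2_norm M f)\<^sup>2 = (L2_norm M (P f))\<^sup>2 + (L2_norm M (f - P f))\<^sup>2"
    using pyth[OF zero] by (simp add: fun_diff_def)
  show "L2_norm M (f - P f) \<le> L2_norm M (f - g)" if "g \<in> W" for g
    using pyth[OF that] by - (rule power2_le_imp_le, simp_all)
  show "L2_norm M (P f) \<le> L2_norm M f"
    using 5 by - (rule power2_le_imp_le, simp_all)
qed

end

section \<open>Bergman spaces\<close>

lemma measurable_Complex_pair: "(\<lambda>(x, y). Complex x y) \<in> borel_measurable (lborel \<Otimes>\<^sub>M lborel)"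
proof -
  have "(\<lambda>(x, y). Complex x y) \<in> borel_measurable borel"
    unfolding case_prod_beta Complex_eq by (intro borel_measurable_continuous_onI continuous_intros)
  then show ?thesis by (simp add: lborel_prod)
qed

text \<open>Multiplication by \<open>\<i>\<close> turns the horizontal segment into a vertical one
  with real part \<open>- c\<close>, to which the formula for vertical segments applies.\<close>

lemma contour_integral_linepath_same_Im:
  assumes "Im z = c" "Im z' = c" "Re z = a" "Re z' = b" "a < b"
  shows "contour_integral (linepath z z') f = integral {a..b} (\<lambda>x. f (Complex x c))"
proof -
  have rot: "linepath (\<i> * z) (\<i> * z') x = \<i> * linepath z z' x" for x
    by (simp add: linepath_def algebra_simps)
  have "contour_integral (linepath z z') f = - \<i> * contour_integral (linepath (\<i> * z) (\<i> * z')) (\<lambda>w. f (- \<i> * w))"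
    by (simp add: contour_integral_integral) (simp add: rot algebra_simps)
  also have "contour_integral (linepath (\<i> * z) (\<i> * z')) (\<lambda>w. f (- \<i> * w)) =
      \<i> * integral {a..b} (\<lambda>x. f (- \<i> * Complex (- c) x))"
    using assms by (intro contour_integral_linepath_same_Re) auto
  also have "(\<lambda>x. - \<i> * Complex (- c) x) = (\<lambda>x. Complex x c)"
    by (auto simp: fun_eq_iff complex_eq_iff)
  finally show ?thesis by (simp flip: mult.assoc add: fun_eq_iff complex_eq_iff)
qed

text \<open>Lebesgue measure is determined by its values on boxes, and boxes in the plane are
  products of intervals. The identification gives Tonelli's theorem for area integrals.\<close>

lemma lborel_complex: "lborel = distr (lborel \<Otimes>\<^sub>M lborel) borel (\<lambda>(x, y). Complex x y)"
proof (rule lborel_eqI)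
  have m: "(\<lambda>(x, y). Complex x y) \<in> borel_measurable (lborel \<Otimes>\<^sub>M lborel)"
    by (rule measurable_Complex_pair)
  fix l u :: complex assume "\<And>b. b \<in> Basis \<Longrightarrow> l \<bullet> b \<le> u \<bullet> b"
  from this[of 1] this[of \<i>] have le: "Re l \<le> Re u" "Im l \<le> Im u" by (auto simp: Basis_complex_def)
  have "(\<lambda>(x, y). Complex x y) -` box l u \<inter> space (lborel \<Otimes>\<^sub>M lborel) = {Re l<..<Re u} \<times> {Im l<..<Im u}"
    by (auto simp: box_def Basis_complex_def space_pair_measure)
  then have "emeasure (distr (lborel \<Otimes>\<^sub>M lborel) borel (\<lambda>(x, y). Complex x y)) (box l u) =
      emeasure (lborel \<Otimes>\<^sub>M lborel) ({Re l<..<Re u} \<times> {Im l<..<Im u})"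
    by (subst emeasure_distr[OF m]) auto
  also have "\<dots> = ennreal (Re u - Re l) * ennreal (Im u - Im l)"
    using le by (subst lborel.emeasure_pair_measure_Times) auto
  also have "\<dots> = ennreal (\<Prod>b\<in>Basis. (u - l) \<bullet> b)"
    using le by (simp add: Basis_complex_def ennreal_mult)
  finally show "emeasure (distr (lborel \<Otimes>\<^sub>M lborel) borel (\<lambda>(x, y). Complex x y)) (box l u) = ennreal (\<Prod>b\<in>Basis. (u - l) \<bullet> b)" .
qed simp

lemma nn_integral_complex:
  assumes [measurable]: "f \<in> borel_measurable borel"
  shows "(\<integral>\<^sup>+z. f z \<partial>lborel) = (\<integral>\<^sup>+x. \<integral>\<^sup>+y. f (Complex x y) \<partial>lborel \<partial>lborel)"
    "(\<integral>\<^sup>+z. f z \<partial>lborel) = (\<integral>\<^sup>+y. \<integral>\<^sup>+x. f (Complex x y) \<partial>lborel \<partial>lborel)"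
proof -
  have m: "(\<lambda>(x, y). Complex x y) \<in> borel_measurable (lborel \<Otimes>\<^sub>M lborel)"
    by (rule measurable_Complex_pair)
  have m2: "(\<lambda>p. f (Complex (fst p) (snd p))) \<in> borel_measurable (lborel \<Otimes>\<^sub>M lborel)"
    using measurable_compose[OF m, of f borel] by (simp add: case_prod_beta)
  have "(\<integral>\<^sup>+z. f z \<partial>lborel) = (\<integral>\<^sup>+p. f (Complex (fst p) (snd p)) \<partial>(lborel \<Otimes>\<^sub>M lborel))"
    by (subst lborel_complex, subst nn_integral_distr[OF m]) (auto simp: case_prod_beta)
  then show "(\<integral>\<^sup>+z. f z \<partial>lborel) = (\<integral>\<^sup>+x. \<integral>\<^sup>+y. f (Complex x y) \<partial>lborel \<partial>lborel)"
    "(\<integral>\<^sup>+z. f z \<partial>lborel) = (\<integral>\<^sup>+y. \<integral>\<^sup>+x. f (Complex x y) \<partial>lborel \<partial>lborel)"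
    using lborel.nn_integral_fst[OF m2] lborel_pair.nn_integral_snd[of "\<lambda>p. f (Complex (fst p) (snd p))"] m2
    by (auto simp: case_prod_beta)
qed

text \<open>The range of integration is the full \<open>[-r, r]\<close> even for sides of smaller
  squares: with a fixed range, integrating over the position of the side yields an area integral
  over the large square.\<close>

definition side_V :: "(complex \<Rightarrow> complex) \<Rightarrow> real \<Rightarrow> real \<Rightarrow> real" where
  "side_V f r x = integral {-r..r} (\<lambda>y. cmod (f (Complex x y)))"
definition side_H :: "(complex \<Rightarrow> complex) \<Rightarrow> real \<Rightarrow> real \<Rightarrow> real" where
  "side_H f r y = integral {-r..r} (\<lambda>x. cmod (f (Complex x y)))"

definition sq :: "real \<Rightarrow> complex set" where "sq r = cbox (Complex (-r) (-r)) (Complex r r)"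

lemma sq_iff: "z \<in> sq r \<longleftrightarrow> \<bar>Re z\<bar> \<le> r \<and> \<bar>Im z\<bar> \<le> r"
  by (auto simp: sq_def in_cbox_complex_iff)

lemma continuous_on_side:
  assumes "continuous_on (sq r) f"
  shows "\<bar>x\<bar> \<le> r \<Longrightarrow> continuous_on {-r..r} (\<lambda>y. f (Complex x y))"
    "\<bar>y\<bar> \<le> r \<Longrightarrow> continuous_on {-r..r} (\<lambda>x. f (Complex x y))"
  by (auto intro!: continuous_on_compose2[OF assms] continuous_intros simp: sq_iff Complex_eq)

text \<open>Cauchy's integral formula over the boundary of the square with half-side
  \<open>s\<close>, where the denominator has modulus at least \<open>s\<close>.\<close>

lemma Cauchy_square_bound:
  assumes hol: "f holomorphic_on sq R" and s: "0 < s" "s \<le> R"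
  shows "2 * pi * cmod (f 0) \<le> (side_V f R s + side_V f R (-s) + side_H f R s + side_H f R (-s)) / s"
proof -
  have cont: "continuous_on (sq R) f" using hol holomorphic_on_imp_continuous_on by blast
  define h where "h = (\<lambda>w. f w / (w - 0))"
  define a b where "a = Complex (-s) (-s)" and "b = Complex s s"
  have bx: "0 \<in> box a b" using s by (auto simp: a_def b_def in_box_complex_iff)
  have pim: "path_image (rectpath a b) \<subseteq> sq R - {0}"
  proof -
    have "path_image (rectpath a b) = cbox a b - box a b"
      by (rule path_image_rectpath_cbox_minus_box) (use s in \<open>auto simp: a_def b_def\<close>)
    moreover have "cbox a b \<subseteq> sq R" using s by (auto simp: a_def b_def sq_iff in_cbox_complex_iff)
    ultimately show ?thesis using bx by auto
  qed
  have "(h has_contour_integral (2 * pi * \<i> * winding_number (rectpath a b) 0 * f 0)) (rectpath a b)"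
    unfolding h_def
  proof (rule Cauchy_integral_formula_convex_simple)
    show "convex (sq R)" by (simp add: sq_def)
    show "0 \<in> interior (sq R)" using s by (simp add: sq_def interior_cbox in_box_complex_iff)
  qed (use hol pim in auto)
  then have ci: "contour_integral (rectpath a b) h = 2 * pi * \<i> * f 0"
    using winding_number_rectpath[OF bx] contour_integral_unique by auto
  have conth: "continuous_on (sq R - {0}) h" unfolding h_def
    by (intro continuous_intros continuous_on_subset[OF cont]) auto
  define a2 a4 where "a2 = Complex s (-s)" and "a4 = Complex (-s) s"
  have rect: "rectpath a b = linepath a a2 +++ linepath a2 b +++ linepath b a4 +++ linepath a4 a"
    by (simp add: rectpath_def Let_def a_def b_def a2_def a4_def)
  have sub: "closed_segment a a2 \<subseteq> sq R - {0}" "closed_segment a2 b \<subseteq> sq R - {0}"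
      "closed_segment b a4 \<subseteq> sq R - {0}" "closed_segment a4 a \<subseteq> sq R - {0}"
    using pim unfolding rect by (simp_all add: path_image_join)
  have int: "h contour_integrable_on linepath x y" if "closed_segment x y \<subseteq> sq R - {0}" for x y
    by (rule contour_integrable_continuous_linepath[OF continuous_on_subset[OF conth that]])
  have "contour_integral (rectpath a b) h = contour_integral (linepath a a2) h + contour_integral (linepath a2 b) h
     + contour_integral (linepath b a4) h + contour_integral (linepath a4 a) h"
    unfolding rect using sub by (simp add: int)
  also have "contour_integral (linepath b a4) h = - contour_integral (linepath a4 b) h"
    using sub(3) by (intro contour_integral_reverse_linepath continuous_on_subset[OF conth]) (auto simp: closed_segment_commute)
  also have "contour_integral (linepath a4 a) h = - contour_integral (linepath a a4) h"
    using sub(4) by (intro contour_integral_reverse_linepath continuous_on_subset[OF conth]) (auto simp: closed_segment_commute)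
  also have "contour_integral (linepath a a2) h = integral {-s..s} (\<lambda>x. h (Complex x (-s)))"
    using s by (intro contour_integral_linepath_same_Im) (auto simp: a_def a2_def)
  also have "contour_integral (linepath a4 b) h = integral {-s..s} (\<lambda>x. h (Complex x s))"
    using s by (intro contour_integral_linepath_same_Im) (auto simp: b_def a4_def)
  also have "contour_integral (linepath a2 b) h = \<i> * integral {-s..s} (\<lambda>x. h (Complex s x))"
    using s by (intro contour_integral_linepath_same_Re) (auto simp: b_def a2_def)
  also have "contour_integral (linepath a a4) h = \<i> * integral {-s..s} (\<lambda>x. h (Complex (-s) x))"
    using s by (intro contour_integral_linepath_same_Re) (auto simp: a_def a4_def)
  finally have eq: "2 * pi * \<i> * f 0 = integral {-s..s} (\<lambda>x. h (Complex x (-s))) +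
     \<i> * integral {-s..s} (\<lambda>x. h (Complex s x)) - integral {-s..s} (\<lambda>x. h (Complex x s)) -
     \<i> * integral {-s..s} (\<lambda>x. h (Complex (-s) x))" unfolding ci by (simp add: algebra_simps)
  \<comment> \<open>One estimate for all four sides: \<open>p\<close> parametrizes the line carrying
    a side, and enlarging \<open>[-s, s]\<close> to \<open>[-R, R]\<close> only increases the
    integral of the modulus.\<close>
  have bnd: "cmod (integral {-s..s} (\<lambda>x. h (p x))) \<le> integral {-R..R} (\<lambda>x. cmod (f (p x))) / s"
    if c: "continuous_on {-R..R} (\<lambda>x. f (p x))" and p: "continuous_on {-R..R} p" "\<And>x. x \<in> {-R..R} \<Longrightarrow> p x \<in> sq R" 
      and ps: "\<And>x. cmod (p x) \<ge> s" for p
  proof -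
    have c': "continuous_on {-s..s} (\<lambda>x. f (p x))" by (rule continuous_on_subset[OF c]) (use s in auto)
    have "continuous_on {-s..s} (\<lambda>x. h (p x))"
    proof (rule continuous_on_compose2[OF conth])
      show "continuous_on {-s..s} p" by (rule continuous_on_subset[OF p(1)]) (use s in auto)
      have "p x \<noteq> 0" for x using ps[of x] s by auto
      then show "p ` {-s..s} \<subseteq> sq R - {0}" using p(2) s by auto
    qed
    then have "cmod (integral {-s..s} (\<lambda>x. h (p x))) \<le> integral {-s..s} (\<lambda>x. cmod (f (p x)) / s)"
    proof (intro integral_norm_bound_integral integrable_continuous_real)
      show "continuous_on {-s..s} (\<lambda>x. cmod (f (p x)) / s)" using s by (intro continuous_intros c') auto
      fix x
      show "cmod (h (p x)) \<le> cmod (f (p x)) / s"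
        unfolding h_def norm_divide using ps[of x] s by (intro frac_le) auto
    qed
    also have "\<dots> = integral {-s..s} (\<lambda>x. cmod (f (p x))) / s" by simp
    also have "\<dots> \<le> integral {-R..R} (\<lambda>x. cmod (f (p x))) / s"
      using s by (intro divide_right_mono integral_subset_le integrable_continuous_real continuous_intros c c') auto
    finally show ?thesis .
  qed
  have "2 * pi * cmod (f 0) = cmod (2 * pi * \<i> * f 0)" by (simp add: norm_mult)
  also have "\<dots> \<le> cmod (integral {-s..s} (\<lambda>x. h (Complex x (-s)))) + cmod (integral {-s..s} (\<lambda>x. h (Complex s x)))
     + cmod (integral {-s..s} (\<lambda>x. h (Complex x s))) + cmod (integral {-s..s} (\<lambda>x. h (Complex (-s) x)))"
    unfolding eq by (intro order_trans[OF norm_triangle_ineq4] order_trans[OF norm_triangle_ineq] add_mono) (auto simp: norm_mult)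
  also have "\<dots> \<le> side_H f R (-s) / s + side_V f R s / s + side_H f R s / s + side_V f R (-s) / s"
  proof (intro add_mono)
    have s': "\<bar>s\<bar> \<le> R" "\<bar>- s\<bar> \<le> R" using s by auto
    have H: "cmod (integral {-s..s} (\<lambda>x. h (Complex x y))) \<le> side_H f R y / s" if "y = s \<or> y = -s" for y
      unfolding side_H_def
    proof (rule bnd)
      show "continuous_on {-R..R} (\<lambda>x. f (Complex x y))" using that s' continuous_on_side(2)[OF cont] by auto
      show "s \<le> cmod (Complex x y)" for x using abs_Im_le_cmod[of "Complex x y"] that by auto
    qed (use that s in \<open>auto simp: sq_iff Complex_eq intro!: continuous_intros\<close>)
    have V: "cmod (integral {-s..s} (\<lambda>x. h (Complex y x))) \<le> side_V f R y / s" if "y = s \<or> y = -s" for y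
      unfolding side_V_def
    proof (rule bnd)
      show "continuous_on {-R..R} (\<lambda>x. f (Complex y x))" using that s' continuous_on_side(1)[OF cont] by auto
      show "s \<le> cmod (Complex y x)" for x using abs_Re_le_cmod[of "Complex y x"] that by auto
    qed (use that s in \<open>auto simp: sq_iff Complex_eq intro!: continuous_intros\<close>)
    show "cmod (integral {-s..s} (\<lambda>x. h (Complex x (-s)))) \<le> side_H f R (-s) / s"
      "cmod (integral {-s..s} (\<lambda>x. h (Complex s x))) \<le> side_V f R s / s"
      "cmod (integral {-s..s} (\<lambda>x. h (Complex x s))) \<le> side_H f R s / s"
      "cmod (integral {-s..s} (\<lambda>x. h (Complex (-s) x))) \<le> side_V f R (-s) / s"
      using H[of s] H[of "-s"] V[of s] V[of "-s"] by auto
  qed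
  finally show ?thesis using s by (simp add: add_divide_distrib)
qed

lemma nn_integral_side:
  fixes g :: "real \<Rightarrow> complex"
  assumes "continuous_on {-R..R} g"
  shows "ennreal (integral {-R..R} (\<lambda>x. cmod (g x))) = (\<integral>\<^sup>+x. ennreal (indicator {-R..R} x * cmod (g x)) \<partial>lborel)"
proof -
  have c: "continuous_on {-R..R} (\<lambda>x. cmod (g x))" by (intro continuous_intros assms)
  have "(\<lambda>x. indicator {-R..R} x *\<^sub>R cmod (g x)) = (\<lambda>x. if x \<in> {-R..R} then cmod (g x) else 0)"
    by (auto simp: fun_eq_iff indicator_def)
  then have "((\<lambda>x. indicator {-R..R} x *\<^sub>R cmod (g x)) has_integral integral {-R..R} (\<lambda>x. cmod (g x))) UNIV"
    using has_integral_restrict_UNIV[of "{-R..R}" "\<lambda>x. cmod (g x)"] integrable_integral[OF integrable_continuous_real[OF c]]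
    by (simp only:)
  then have "(\<integral>\<^sup>+x. ennreal (indicator {-R..R} x *\<^sub>R cmod (g x)) \<partial>lborel) = ennreal (integral {-R..R} (\<lambda>x. cmod (g x)))"
    by (intro nn_integral_has_integral_lborel borel_measurable_continuous_on_indicator c) auto
  then show ?thesis by simp
qed

text \<open>Averaging the Cauchy bound over half-sides \<open>s\<close> between \<open>r\<close> and
  \<open>2 * r\<close> turns boundary integrals into area integrals. Squares instead of discs keep
  the computation in Cartesian coordinates, where Tonelli applies directly.\<close>

lemma area_bound_zero:
  assumes hol: "f holomorphic_on sq (2 * r)" and r: "0 < r"
  shows "ennreal (r\<^sup>2 * cmod (f 0)) \<le> (\<integral>\<^sup>+z. ennreal (indicator (sq (2 * r)) z * cmod (f z)) \<partial>lborel)"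
proof -
  define R where "R = 2 * r"
  have R: "0 < R" using r by (simp add: R_def)
  have cont: "continuous_on (sq R) f" using hol holomorphic_on_imp_continuous_on unfolding R_def by blast
  define g where "g = (\<lambda>z. ennreal (indicator (sq R) z * cmod (f z)))"
  have "(\<lambda>z. indicator (sq R) z *\<^sub>R cmod (f z)) \<in> borel_measurable borel"
    by (intro borel_measurable_continuous_on_indicator continuous_intros cont) (simp add: sq_def)
  then have g [measurable]: "g \<in> borel_measurable borel" unfolding g_def by simp
  let ?I = "\<integral>\<^sup>+z. g z \<partial>lborel"
  have V: "ennreal (side_V f R x) = (\<integral>\<^sup>+y. g (Complex x y) \<partial>lborel)" if "\<bar>x\<bar> \<le> R" for x
    unfolding side_V_def nn_integral_side[OF continuous_on_side(1)[OF cont that]] g_def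
    by (intro nn_integral_cong) (use that in \<open>auto simp: indicator_def sq_iff\<close>)
  have H: "ennreal (side_H f R y) = (\<integral>\<^sup>+x. g (Complex x y) \<partial>lborel)" if "\<bar>y\<bar> \<le> R" for y
    unfolding side_H_def nn_integral_side[OF continuous_on_side(2)[OF cont that]] g_def
    by (intro nn_integral_cong) (use that in \<open>auto simp: indicator_def sq_iff\<close>)
  define u where "u = (\<lambda>x. \<integral>\<^sup>+y. g (Complex x y) \<partial>lborel)"
  define v where "v = (\<lambda>y. \<integral>\<^sup>+x. g (Complex x y) \<partial>lborel)"
  have gm: "(\<lambda>(x, y). g (Complex x y)) \<in> borel_measurable (lborel \<Otimes>\<^sub>M lborel)"
    using measurable_compose[OF measurable_Complex_pair, of g borel] by (simp add: case_prod_beta)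
  have gm2: "(\<lambda>(y, x). g (Complex x y)) \<in> borel_measurable (lborel \<Otimes>\<^sub>M lborel)"
    using measurable_pair_swap[OF gm] by (simp add: case_prod_beta)
  have um [measurable]: "u \<in> borel_measurable borel"
    using lborel.borel_measurable_nn_integral[OF gm] by (simp add: u_def)
  have vm [measurable]: "v \<in> borel_measurable borel"
    using lborel.borel_measurable_nn_integral[OF gm2] by (simp add: v_def)
  have ui: "(\<integral>\<^sup>+x. u x \<partial>lborel) = ?I" "(\<integral>\<^sup>+x. v x \<partial>lborel) = ?I"
    using nn_integral_complex[OF g] by (simp_all add: u_def v_def)
  have refl: "(\<integral>\<^sup>+x. w (- x) \<partial>lborel) = (\<integral>\<^sup>+x. w x \<partial>lborel)" if "w \<in> borel_measurable borel" for w :: "real \<Rightarrow> ennreal"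
    using nn_integral_real_affine[OF that, of "-1" 0] by simp
  have pw: "ennreal (2 * pi * r * cmod (f 0)) * indicator {r..R} s \<le> u s + u (-s) + v s + v (-s)" for s
  proof (cases "s \<in> {r..R}")
    case True
    then have s: "0 < s" "s \<le> R" "r \<le> s" using r by auto
    have "0 \<le> integral {-R..R} (\<lambda>x. cmod (p x))" for p :: "real \<Rightarrow> complex"
      by (cases "(\<lambda>x. cmod (p x)) integrable_on {-R..R}")
        (auto simp: not_integrable_integral intro!: Henstock_Kurzweil_Integration.integral_nonneg)
    then have nn: "0 \<le> side_V f R x" "0 \<le> side_H f R x" for x
      unfolding side_V_def side_H_def by auto
    have "2 * pi * r * cmod (f 0) \<le> 2 * pi * s * cmod (f 0)" using s by (intro mult_right_mono) auto
    also have "\<dots> \<le> side_V f R s + side_V f R (-s) + side_H f R s + side_H f R (-s)"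
      using Cauchy_square_bound[of f R s] hol s by (simp add: R_def field_simps)
    finally have "ennreal (2 * pi * r * cmod (f 0)) \<le> ennreal (side_V f R s) + ennreal (side_V f R (-s)) + ennreal (side_H f R s) + ennreal (side_H f R (-s))"
      using nn by (simp flip: ennreal_plus add: ennreal_leI)
    also have "\<dots> = u s + u (-s) + v s + v (-s)"
      using V[of s] V[of "-s"] H[of s] H[of "-s"] s by (simp add: u_def v_def)
    finally show ?thesis using True by simp
  qed simp
  \<comment> \<open>Each of the four families of sides sweeps out at most the large square, so each
    contributes at most one area integral.\<close>
  have "ennreal (2 * pi * r * cmod (f 0) * r) = (\<integral>\<^sup>+s. ennreal (2 * pi * r * cmod (f 0)) * indicator {r..R} s \<partial>lborel)"
    using r by (simp add: nn_integral_cmult_indicator R_def ennreal_mult)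
  also have "\<dots> \<le> (\<integral>\<^sup>+s. u s + u (-s) + v s + v (-s) \<partial>lborel)"
    by (intro nn_integral_mono pw)
  also have "\<dots> = 4 * ?I"
    by (simp add: nn_integral_add refl ui) (metis (no_types, lifting) add.assoc mult_2 numeral_Bit0 distrib_right)
  finally have 1: "ennreal (2 * pi * r * cmod (f 0) * r) \<le> 4 * ?I" .
  \<comment> \<open>\<open>2 * pi\<close> is at least 4, which cancels the factor from the four
    sides.\<close>
  have "4 * (r\<^sup>2 * cmod (f 0)) \<le> 2 * pi * r * cmod (f 0) * r"
  proof -
    have "2 * (r\<^sup>2 * cmod (f 0)) \<le> pi * (r\<^sup>2 * cmod (f 0))"
      by (intro mult_right_mono pi_ge_two) auto
    then show ?thesis by (simp add: power2_eq_square algebra_simps)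
  qed
  then have "ennreal (4 * (r\<^sup>2 * cmod (f 0))) \<le> 4 * ?I"
    using 1 ennreal_leI order_trans by blast
  then have "4 * ennreal (r\<^sup>2 * cmod (f 0)) \<le> 4 * ?I" by (simp add: ennreal_mult)
  then show ?thesis unfolding g_def R_def
    by (subst (asm) ennreal_mult_le_mult_iff) auto
qed

text \<open>Translation reduces to the origin, and Cauchy--Schwarz against the indicator of a square
  of side \<open>4 * r\<close> replaces the L1 norm by the L2 norm; \<open>r\<^sup>2\<close> against
  \<open>4 * r\<close> leaves the factor \<open>4 / r\<close>.\<close>

lemma area_bound:
  assumes hol: "f holomorphic_on D" and D: "open D" "(\<lambda>w. z0 + w) ` sq (2 * r) \<subseteq> D" and r: "0 < r" and f: "f \<in> L2 (area D)"
  shows "cmod (f z0) \<le> 4 / r * L2_norm (area D) f"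
proof -
  define B where "B = (\<lambda>w. z0 + w) ` sq (2 * r)"
  have B: "compact B" unfolding B_def by (intro compact_continuous_image continuous_intros) (simp add: sq_def)
  have Bin: "z0 + w \<in> B \<longleftrightarrow> w \<in> sq (2 * r)" for w by (auto simp: B_def)
  have h: "(\<lambda>w. f (z0 + w)) holomorphic_on sq (2 * r)"
    using holomorphic_on_compose[of "\<lambda>w. z0 + w" "sq (2*r)" f] holomorphic_on_subset[OF hol D(2)]
    by (simp add: comp_def holomorphic_intros)
  have cont: "continuous_on B f" using holomorphic_on_imp_continuous_on[OF hol] D(2) continuous_on_subset B_def by blast
  define g where "g = (\<lambda>z. indicator B z *\<^sub>R cmod (f z))"
  have g [measurable]: "g \<in> borel_measurable borel" unfolding g_def
    by (intro borel_measurable_continuous_on_indicator continuous_intros cont) (simp add: B compact_imp_closed)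
  have "ennreal (r\<^sup>2 * cmod (f z0)) \<le> (\<integral>\<^sup>+w. ennreal (indicator (sq (2 * r)) w * cmod (f (z0 + w))) \<partial>lborel)"
    using area_bound_zero[OF h r] by simp
  also have "\<dots> = (\<integral>\<^sup>+w. ennreal (g (z0 + w)) \<partial>lborel)"
    by (simp add: g_def indicator_def Bin)
  also have "\<dots> = (\<integral>\<^sup>+z. ennreal (g z) \<partial>distr lborel borel ((+) z0))"
    by (subst nn_integral_distr) auto
  also have "\<dots> = (\<integral>\<^sup>+z. ennreal (g z) \<partial>lborel)" by (simp add: lborel_distr_plus)
  also have "\<dots> = (\<integral>\<^sup>+z. ennreal (g z) \<partial>lebesgue)" by (simp add: nn_integral_completion)
  also have "\<dots> = (\<integral>\<^sup>+z. ennreal (g z) * indicator D z \<partial>lebesgue)"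
    by (rule nn_integral_cong) (use D(2) in \<open>auto simp: g_def B_def indicator_def\<close>)
  also have "\<dots> = (\<integral>\<^sup>+z. ennreal (g z) \<partial>area D)"
    using D(1) by (subst nn_integral_restrict_space) auto
  finally have 1: "ennreal (r\<^sup>2 * cmod (f z0)) \<le> (\<integral>\<^sup>+z. ennreal (g z) \<partial>area D)" .
  have BD: "B \<in> sets lebesgue" "B \<subseteq> D" using B D(2) by (auto simp: B_def compact_imp_closed borel_closed)
  then have BM: "B \<in> sets (area D)" using D(1) by (simp add: sets_restrict_space_iff)
  have mB: "measure lebesgue B = (4 * r)\<^sup>2"
  proof -
    have "measure lebesgue B = measure lebesgue (sq (2 * r))" unfolding B_def by (rule measure_translation)
    also have "\<dots> = (4 * r)\<^sup>2" using r by (simp add: sq_def content_cbox' Basis_complex_def power2_eq_square box_ne_empty)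
    finally show ?thesis .
  qed
  have emB: "emeasure (area D) B = ennreal ((4 * r)\<^sup>2)" "measure (area D) B = (4 * r)\<^sup>2"
    using BD BM D(1) mB B by (auto simp: emeasure_restrict_space measure_restrict_space emeasure_eq_measure2 lmeasurable_compact)
  have eqB: "(\<lambda>z. (cmod (indicator B z))\<^sup>2) = indicator B" by (auto simp: fun_eq_iff indicator_def)
  have "integrable (area D) (indicator B :: complex \<Rightarrow> real)"
    using BM emB by (intro integrable_real_indicator) auto
  then have indL: "(indicator B :: complex \<Rightarrow> complex) \<in> L2 (area D)"
    using BM unfolding L2_def by (simp add: eqB borel_measurable_indicator)
  have indn: "L2_norm (area D) (indicator B) = 4 * r"
    unfolding L2_norm_def eqB using emB r BM BD(2) by (simp add: Int_absorb2 real_sqrt_mult)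
  have "(\<integral>\<^sup>+z. ennreal (g z) \<partial>area D) = (\<integral>\<^sup>+z. ennreal (cmod (f z) * cmod (indicator B z)) \<partial>area D)"
    by (rule nn_integral_cong) (simp add: g_def indicator_def)
  also have "\<dots> = ennreal (LINT z|area D. cmod (f z) * cmod (indicator B z))"
    by (intro nn_integral_eq_integral L2_inner_integrable_norm f indL) auto
  also have "\<dots> \<le> ennreal (L2_norm (area D) f * (4 * r))"
    using L2_Cauchy_Schwarz_abs[OF f indL] by (simp add: indn ennreal_leI)
  finally have "ennreal (r\<^sup>2 * cmod (f z0)) \<le> ennreal (L2_norm (area D) f * (4 * r))" using 1 by (rule order_trans[rotated])
  then have "r\<^sup>2 * cmod (f z0) \<le> L2_norm (area D) f * (4 * r)" using r by (simp add: ennreal_le_iff)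
  then show ?thesis using r by (simp add: field_simps power2_eq_square)
qed


section \<open>Bergman spaces, point evaluations and reproducing kernels\<close>

lemma L2_holomorphic_measurable:
  assumes "open D" "f holomorphic_on D" shows "f \<in> borel_measurable (area D)"
  using continuous_imp_measurable_on_sets_lebesgue[OF holomorphic_on_imp_continuous_on] assms by simp

lemma A2D: "f \<in> A2 D \<Longrightarrow> f \<in> L2 (area D)" "f \<in> A2 D \<Longrightarrow> f holomorphic_on D"
  by (auto simp: A2_def)

lemma A2_diff: "f \<in> A2 D \<Longrightarrow> g \<in> A2 D \<Longrightarrow> f - g \<in> A2 D"
  using L2_diff[of f "area D" g] holomorphic_on_diff[of f D g] by (simp add: A2_def fun_diff_def)

text \<open>A square of half-side \<open>2 * R / 5\<close> stays at distance at most
  \<open>4 * R / 5\<close> from its center and so fits into the ball; \<open>r = R / 5\<close> in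
  the estimate over squares gives the constant 20.\<close>

lemma A2_point_bound:
  assumes f: "f \<in> A2 D" and D: "open D" "ball z R \<subseteq> D" and R: "0 < R"
  shows "cmod (f z) \<le> 20 / R * L2_norm (area D) f"
proof -
  have "(\<lambda>w. z + w) ` sq (2 * (R/5)) \<subseteq> D"
  proof safe
    fix w assume "w \<in> sq (2 * (R/5))"
    then have "cmod w < R" using cmod_le[of w] R by (simp add: sq_iff)
    then have "z + w \<in> ball z R" by (simp add: dist_norm)
    then show "z + w \<in> D" using D by blast
  qed
  from area_bound[OF A2D(2)[OF f] D(1) this _ A2D(1)[OF f]] R show ?thesis by simp
qed

text \<open>Point evaluations are bounded uniformly near each point, so an L2 Cauchy sequence
  converges locally uniformly and its limit is analytic; Fatou shows that this is also the L2
  limit.\<close>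

lemma A2_closed_subspace:
  assumes D: "open D"
  shows "L2_closed_subspace (area D) (A2 D)"
proof
  show "A2 D \<subseteq> L2 (area D)" by (auto simp: A2_def)
  show "(\<lambda>x. 0) \<in> A2 D" by (auto simp: A2_def)
  show "(\<lambda>x. f x + g x) \<in> A2 D" if "f \<in> A2 D" "g \<in> A2 D" for f g
    using that by (auto simp: A2_def intro: holomorphic_intros)
  show "(\<lambda>x. c * f x) \<in> A2 D" if "f \<in> A2 D" for c f
    using that by (auto simp: A2_def intro: holomorphic_intros)
  fix f :: "nat \<Rightarrow> complex \<Rightarrow> complex"
  assume f: "\<And>n. f n \<in> A2 D" and C: "L2_Cauchy (area D) f"
  define g where "g = (\<lambda>z. lim (\<lambda>n. f n z))"
  have unif: "\<exists>d>0. cball x d \<subseteq> D \<and> uniform_limit (cball x d) f g sequentially" if x: "x \<in> D" for x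
  proof -
    obtain e where e: "e > 0" "ball x e \<subseteq> D" using D x openE by blast
    \<comment> \<open>At half the radius every point of the closed disc still has a ball of radius
      \<open>d\<close> inside \<open>D\<close>, so one constant serves the whole disc.\<close>
    define d where "d = e / 2"
    have d: "d > 0" using e by (simp add: d_def)
    have sub: "ball z d \<subseteq> D" if "z \<in> cball x d" for z
    proof -
      have "ball z d \<subseteq> ball x e"
        using that by (auto simp: d_def) (smt (verit) dist_triangle field_sum_of_halves)
      then show ?thesis using e by blast
    qed
    have bd: "cmod (f m z - f n z) \<le> 20 / d * L2_norm (area D) (f m - f n)" if "z \<in> cball x d" for m n z
      using A2_point_bound[OF A2_diff[OF f f] D sub[OF that] d, of m n] by simp
    have "uniformly_Cauchy_on (cball x d) f"
      unfolding uniformly_Cauchy_on_def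
    proof (intro allI impI)
      fix \<epsilon> :: real assume "\<epsilon> > 0"
      then have "\<epsilon> * d / 20 > 0" using d by simp
      then obtain N where N: "\<And>m n. m \<ge> N \<Longrightarrow> n \<ge> N \<Longrightarrow> L2_norm (area D) (f m - f n) < \<epsilon> * d / 20"
        using C unfolding L2_Cauchy_def by meson
      show "\<exists>M. \<forall>z\<in>cball x d. \<forall>m\<ge>M. \<forall>n\<ge>M. dist (f m z) (f n z) < \<epsilon>"
      proof (intro exI ballI allI impI)
        fix z m n assume z: "z \<in> cball x d" and mn: "N \<le> m" "N \<le> n"
        have "20 / d * L2_norm (area D) (f m - f n) < \<epsilon>" using N[OF mn] d by (simp add: field_simps)
        then show "dist (f m z) (f n z) < \<epsilon>" using bd[OF z, of m n] by (simp add: dist_norm)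
      qed
    qed
    then have "uniformly_convergent_on (cball x d) f" by (rule Cauchy_uniformly_convergent)
    then have "uniform_limit (cball x d) f (\<lambda>z. lim (\<lambda>n. f n z)) sequentially" by (rule uniformly_convergent_uniform_limit_iff[THEN iffD1])
    moreover have "cball x d \<subseteq> D" using sub d centre_in_ball by blast
    ultimately show ?thesis using d unfolding g_def by blast
  qed
  have hol: "g holomorphic_on D"
    by (rule holomorphic_uniform_sequence[OF D, of f]) (use A2D(2)[OF f] unif in auto)
  have lim: "(\<lambda>n. f n x) \<longlonglongrightarrow> g x" if x: "x \<in> D" for x
  proof -
    obtain d where "d > 0" "uniform_limit (cball x d) f g sequentially" using unif[OF x] by blast
    then show ?thesis by - (rule tendsto_uniform_limitI[where S = "cball x d"], assumption, simp)
  qed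
  have "AE x in area D. (\<lambda>n. f n x) \<longlonglongrightarrow> g x" by (intro AE_I2) (use lim in simp)
  from L2_Fatou_limit[OF A2D(1)[OF f] C L2_holomorphic_measurable[OF D hol] this] hol
  show "\<exists>g\<in>A2 D. (\<lambda>n. L2_norm (area D) (f n - g)) \<longlonglongrightarrow> 0" by (auto simp: A2_def)
qed

text \<open>A nonempty open set is never null. This is how values at single points are recovered
  from equalities almost everywhere.\<close>

lemma continuous_AE_eq:
  fixes f g :: "complex \<Rightarrow> complex"
  assumes D: "open D" and c: "continuous_on D f" "continuous_on D g" and ae: "AE x in area D. f x = g x" and x: "x \<in> D"
  shows "f x = g x"
proof (rule ccontr)
  assume "f x \<noteq> g x"
  define U where "U = {x \<in> D. f x - g x \<in> - {0}}"
  have "open U" unfolding U_def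
    by (rule continuous_open_preimage[OF _ D, unfolded vimage_def Int_def mem_Collect_eq]) (auto intro: continuous_intros c)
  moreover have "U \<noteq> {}" using x \<open>f x \<noteq> g x\<close> by (auto simp: U_def)
  moreover have "negligible U"
  proof -
    have "AE x in lebesgue. x \<in> D \<longrightarrow> f x = g x" using ae D by (simp add: AE_restrict_space_iff)
    then have "negligible {x. \<not> (x \<in> D \<longrightarrow> f x = g x)}"
      unfolding negligible_iff_null_sets completion.AE_iff_null_sets by simp
    then show ?thesis by (rule negligible_subset) (auto simp: U_def)
  qed
  ultimately show False using open_not_negligible by blast
qed

lemma A2_AE_eq:
  assumes "open D" "f \<in> A2 D" "g \<in> A2 D" "AE x in area D. f x = g x" "x \<in> D"
  shows "f x = g x"
  by (rule continuous_AE_eq[OF assms(1) holomorphic_on_imp_continuous_on[OF A2D(2)[OF assms(2)]]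
        holomorphic_on_imp_continuous_on[OF A2D(2)[OF assms(3)]] assms(4,5)])

text \<open>The functions vanishing at \<open>z\<close> form a closed subspace. The component
  \<open>e\<close> of the constant 1 orthogonal to it satisfies \<open>e z = 1\<close>, and
  \<open>f\<close> minus \<open>f z\<close> times \<open>e\<close> vanishes at \<open>z\<close>;
  hence \<open>e\<close> divided by its squared norm reproduces.\<close>

lemma A2_kernel_exists:
  assumes D: "open D" "(\<lambda>z. 1) \<in> L2 (area D)" and z: "z \<in> D"
  shows "\<exists>k\<in>A2 D. \<forall>f\<in>A2 D. f z = L2_inner (area D) f k"
proof -
  interpret A: L2_closed_subspace "area D" "A2 D" by (rule A2_closed_subspace[OF D(1)])
  obtain R where R: "R > 0" "ball z R \<subseteq> D" using D z openE by blast
  define W where "W = {f \<in> A2 D. f z = 0}"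
  interpret W: L2_closed_subspace "area D" W
  proof
    fix f assume f: "\<And>n. f n \<in> W" "L2_Cauchy (area D) f"
    then have fA: "\<And>n. f n \<in> A2 D" by (auto simp: W_def)
    then obtain g where g: "g \<in> A2 D" "(\<lambda>n. L2_norm (area D) (f n - g)) \<longlonglongrightarrow> 0" using A.complete f by blast
    \<comment> \<open>Point evaluation is continuous, so vanishing at \<open>z\<close> survives the
      limit.\<close>
    have "(\<lambda>n. 20 / R * L2_norm (area D) (f n - g)) \<longlonglongrightarrow> 20 / R * 0" by (intro tendsto_intros g)
    moreover have "cmod (g z) \<le> 20 / R * L2_norm (area D) (f n - g)" for n
      using A2_point_bound[OF A2_diff[OF fA g(1)] D(1) R(2,1), of n] f(1)[of n] by (simp add: W_def)
    ultimately have "cmod (g z) \<le> 0" using LIMSEQ_le_const[of _ "20 / R * 0" "cmod (g z)"] by simp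
    then show "\<exists>g\<in>W. (\<lambda>n. L2_norm (area D) (f n - g)) \<longlonglongrightarrow> 0" using g by (auto simp: W_def)
  qed (use A.sub A.zero A.add A.scale in \<open>auto simp: W_def\<close>)
  have one: "(\<lambda>z. 1) \<in> A2 D" using D by (simp add: A2_def)
  obtain p where p: "p \<in> W" "\<And>g. g \<in> W \<Longrightarrow> L2_inner (area D) ((\<lambda>z. 1) - p) g = 0"
    using W.projection_exists[OF D(2)] by blast
  define e where "e = (\<lambda>z. 1) - p"
  have e: "e \<in> A2 D" "e z = 1" using one p(1) A2_diff by (auto simp: e_def W_def)
  define c where "c = L2_inner (area D) e e"
  have c: "c \<noteq> 0"
  proof
    assume "c = 0"
    then have "L2_norm (area D) e = 0" by (simp add: c_def L2_inner_self)
    then have "AE x in area D. e x = (\<lambda>x. 0) x" using L2_norm_eq_0_AE A2D(1)[OF e(1)] by blast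
    from A2_AE_eq[OF D(1) e(1) A.zero this z] e(2) show False by simp
  qed
  have cr: "cnj c = c" by (simp add: c_def L2_inner_self)
  show ?thesis
  proof (intro bexI ballI)
    show "(\<lambda>x. (1 / c) * e x) \<in> A2 D" by (rule A.scale[OF e(1)])
    fix f assume f: "f \<in> A2 D"
    have "(\<lambda>x. f z * e x) \<in> A2 D" by (rule A.scale[OF e(1)])
    then have w: "f - (\<lambda>x. f z * e x) \<in> W" using f e A2_diff by (auto simp: W_def)
    have "L2_inner (area D) e (f - (\<lambda>x. f z * e x)) = 0" using p(2)[OF w] by (simp add: e_def)
    then have "L2_inner (area D) (f - (\<lambda>x. f z * e x)) e = 0" 
      by (metis L2_inner_commute complex_cnj_zero)
    then have "L2_inner (area D) f e = f z * c"
      using L2_inner_diff_left[OF A2D(1)[OF f] L2_cmult[OF A2D(1)[OF e(1)]] A2D(1)[OF e(1)], of "f z"]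
      by (simp add: L2_inner_cmult_left c_def)
    then show "f z = L2_inner (area D) f (\<lambda>x. (1 / c) * e x)"
      unfolding L2_inner_cmult_right using c cr by simp
  qed
qed


section \<open>Separability of the Bergman space\<close>

definition rat_comb :: "(nat \<Rightarrow> 'a \<Rightarrow> complex) \<Rightarrow> (nat \<times> rat \<times> rat) list \<Rightarrow> 'a \<Rightarrow> complex" where
  "rat_comb k xs x = (\<Sum>(n, a, b)\<leftarrow>xs. Complex (of_rat a) (of_rat b) * k n x)"

lemma rat_comb_append: "rat_comb k (xs @ ys) = (\<lambda>x. rat_comb k xs x + rat_comb k ys x)"
  by (simp add: rat_comb_def fun_eq_iff)

lemma rat_comb_scale:
  "\<exists>ys. rat_comb k ys = (\<lambda>x. Complex (of_rat a) (of_rat b) * rat_comb k xs x)"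
proof (induction xs)
  case Nil
  show ?case by (rule exI[of _ "[]"]) (simp add: rat_comb_def fun_eq_iff)
next
  case (Cons p xs)
  then obtain ys where ys: "rat_comb k ys = (\<lambda>x. Complex (of_rat a) (of_rat b) * rat_comb k xs x)" by blast
  obtain n c d where p: "p = (n, c, d)" by (cases p) auto
  have "Complex (of_rat (a * c - b * d)) (of_rat (a * d + b * c)) = Complex (of_rat a) (of_rat b) * Complex (of_rat c) (of_rat d)"
    by (simp add: complex_eq_iff of_rat_add of_rat_diff of_rat_mult)
  then have "rat_comb k ((n, a * c - b * d, a * d + b * c) # ys) = (\<lambda>x. Complex (of_rat a) (of_rat b) * rat_comb k (p # xs) x)"
    unfolding fun_eq_iff using ys[unfolded fun_eq_iff] by (simp add: rat_comb_def p distrib_left mult.assoc)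
  then show ?case by blast
qed

lemma rational_complex_approx:
  assumes "e > 0" shows "\<exists>a b. cmod (c - Complex (of_rat a) (of_rat b)) < e"
proof -
  obtain a where a: "Re c - e / 2 < of_rat a" "of_rat a < Re c + e / 2" 
    using of_rat_dense[of "Re c - e / 2" "Re c + e / 2"] assms by auto
  obtain b where b: "Im c - e / 2 < of_rat b" "of_rat b < Im c + e / 2" 
    using of_rat_dense[of "Im c - e / 2" "Im c + e / 2"] assms by auto
  have "cmod (c - Complex (of_rat a) (of_rat b)) \<le> \<bar>Re c - of_rat a\<bar> + \<bar>Im c - of_rat b\<bar>"
    using cmod_le[of "c - Complex (of_rat a) (of_rat b)"] by simp
  also have "\<dots> < e" using a b by (auto simp: abs_if field_simps)
  finally show ?thesis by blast
qed

text \<open>The closure \<open>V\<close> of the rational combinations is a closed subspace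
  containing every \<open>k n\<close>. An element of \<open>W\<close> differs from its projection to
  \<open>V\<close> by something orthogonal to all \<open>k n\<close>, hence by something of norm
  zero.\<close>

lemma (in L2_closed_subspace) separable_of_total:
  fixes k :: "nat \<Rightarrow> 'a \<Rightarrow> complex"
  assumes k: "\<And>n. k n \<in> W"
    and total: "\<And>f. f \<in> W \<Longrightarrow> (\<And>n. L2_inner M f (k n) = 0) \<Longrightarrow> L2_norm M f = 0"
  shows "\<exists>D. countable D \<and> D \<subseteq> W \<and> (\<forall>f\<in>W. \<forall>e>0. \<exists>d\<in>D. L2_norm M (f - d) < e)"
proof -
  \<comment> \<open>Lists of triples of an index and two rationals form a countable type, so this
    range is countable.\<close>
  define D where "D = range (rat_comb k)"
  have L: "f \<in> L2 M" if "f \<in> W" for f using that sub by blast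
  have DW: "d \<in> W" if d: "d \<in> D" for d
  proof -
    have "rat_comb k xs \<in> W" for xs
    proof (induction xs)
      case Nil
      have "rat_comb k [] = (\<lambda>x. 0)" by (simp add: rat_comb_def fun_eq_iff)
      then show ?case using zero by simp
    next
      case (Cons p xs)
      obtain n c d where p: "p = (n, c, d)" by (cases p) auto
      have "rat_comb k (p # xs) = (\<lambda>x. Complex (of_rat c) (of_rat d) * k n x + rat_comb k xs x)"
        by (simp add: rat_comb_def fun_eq_iff p)
      then show ?case using add[OF scale[OF k] Cons] by simp
    qed
    then show ?thesis using d by (auto simp: D_def)
  qed
  define V where "V = {f \<in> W. \<forall>e>0. \<exists>d\<in>D. L2_norm M (f - d) < e}"
  interpret V: L2_closed_subspace M V
  proof
    show "V \<subseteq> L2 M" using sub by (auto simp: V_def)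
    have "(\<lambda>x. 0) = rat_comb k []" by (simp add: rat_comb_def fun_eq_iff)
    then have "(\<lambda>x. 0) \<in> D" by (auto simp: D_def)
    then show "(\<lambda>x. 0) \<in> V" using zero L2_norm_diff_self[of M "\<lambda>x. 0"] by (force simp: V_def)
  next
    fix f g assume f: "f \<in> V" and g: "g \<in> V"
    show "(\<lambda>x. f x + g x) \<in> V" unfolding V_def
    proof (intro CollectI conjI allI impI)
      show "(\<lambda>x. f x + g x) \<in> W" using f g add by (auto simp: V_def)
      fix e :: real assume "e > 0"
      then have "e/2 > 0" by simp
      then obtain c d where c: "c \<in> D" "L2_norm M (f - c) < e/2" and d: "d \<in> D" "L2_norm M (g - d) < e/2"
        using f g unfolding V_def by blast
      have "(\<lambda>x. f x + g x) - (\<lambda>x. c x + d x) = (\<lambda>x. (f - c) x + (g - d) x)" by (simp add: fun_eq_iff)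
      then have "L2_norm M ((\<lambda>x. f x + g x) - (\<lambda>x. c x + d x)) < e"
        using L2_norm_triangle[of "f - c" M "g - d"] c d f g L DW by (auto simp: V_def L2_diff)
      moreover have "(\<lambda>x. c x + d x) \<in> D" using c(1) d(1) by (auto simp: D_def rat_comb_append[symmetric])
      ultimately show "\<exists>d\<in>D. L2_norm M ((\<lambda>x. f x + g x) - d) < e" by blast
    qed
  next
    fix f c assume f: "f \<in> V"
    show "(\<lambda>x. c * f x) \<in> V" unfolding V_def
    proof (intro CollectI conjI allI impI)
      show "(\<lambda>x. c * f x) \<in> W" using f scale by (auto simp: V_def)
      fix e :: real assume e: "e > 0"
      \<comment> \<open>Two tolerances: \<open>f\<close> is approximated first, then the scalar
        \<open>c\<close> by a rational one, to a precision that depends on the approximant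
        \<open>d\<close>. Adding 1 avoids division by zero.\<close>
      then have "e / (2 * (cmod c + 1)) > 0" by (simp add: add_nonneg_pos)
      then obtain d where d: "d \<in> D" "L2_norm M (f - d) < e / (2 * (cmod c + 1))" using f unfolding V_def by blast
      then obtain xs where xs: "d = rat_comb k xs" by (auto simp: D_def)
      have dL: "d \<in> L2 M" "f \<in> L2 M" using DW[OF d(1)] f L by (auto simp: V_def)
      have "e / (2 * (L2_norm M d + 1)) > 0" using e by (simp add: add_nonneg_pos)
      then obtain a b where ab: "cmod (c - Complex (of_rat a) (of_rat b)) < e / (2 * (L2_norm M d + 1))"
        using rational_complex_approx by blast
      define q where "q = Complex (of_rat a) (of_rat b)"
      obtain ys where ys: "rat_comb k ys = (\<lambda>x. q * d x)" using rat_comb_scale[of k a b xs] by (auto simp: q_def xs)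
      have aux: "u * x < e / 2" if "x < e / (2 * u)" "u > 0" for x u :: real
        using that by (simp add: field_simps)
      have eq: "(\<lambda>x. c * f x) - (\<lambda>x. q * d x) = (\<lambda>x. c * (f - d) x + (c - q) * d x)" by (simp add: fun_eq_iff algebra_simps)
      have "L2_norm M ((\<lambda>x. c * f x) - (\<lambda>x. q * d x)) \<le> L2_norm M (\<lambda>x. c * (f - d) x) + L2_norm M (\<lambda>x. (c - q) * d x)"
        unfolding eq by (rule L2_norm_triangle[OF L2_cmult[OF L2_diff[OF dL(2,1)]] L2_cmult[OF dL(1)]])
      also have "\<dots> = cmod c * L2_norm M (f - d) + cmod (c - q) * L2_norm M d"
        by (simp only: L2_norm_cmult)
      also have "cmod c * L2_norm M (f - d) \<le> (cmod c + 1) * L2_norm M (f - d)" by (intro mult_right_mono) auto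
      also have "(cmod c + 1) * L2_norm M (f - d) < e / 2" by (rule aux[OF d(2)]) (simp add: add_nonneg_pos)
      also have "cmod (c - q) * L2_norm M d \<le> cmod (c - q) * (L2_norm M d + 1)" by (intro mult_left_mono) auto
      also have "cmod (c - q) * (L2_norm M d + 1) < e / 2"
        unfolding q_def by (subst mult.commute, rule aux[OF ab]) (simp add: add_nonneg_pos)
      finally have "L2_norm M ((\<lambda>x. c * f x) - rat_comb k ys) < e" by (simp add: ys)
      then show "\<exists>d\<in>D. L2_norm M ((\<lambda>x. c * f x) - d) < e" by (auto simp: D_def)
    qed
  next
    fix f assume f: "\<And>n. f n \<in> V" and C: "L2_Cauchy M f"
    then obtain g where g: "g \<in> W" "(\<lambda>n. L2_norm M (f n - g)) \<longlonglongrightarrow> 0" using complete by (force simp: V_def)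
    have "\<exists>d\<in>D. L2_norm M (g - d) < e" if e: "e > 0" for e
    proof -
      obtain n where n: "L2_norm M (f n - g) < e/2" using LIMSEQ_D[OF g(2), of "e/2"] e by auto
      obtain d where d: "d \<in> D" "L2_norm M (f n - d) < e/2" using f[of n] half_gt_zero[OF e] unfolding V_def by blast
      have fn: "f n \<in> L2 M" using f[of n] L by (auto simp: V_def)
      have "L2_norm M (g - d) < e"
        using L2_norm_triangle_diff[OF L[OF g(1)] fn L[OF DW[OF d(1)]]] n d(2) L2_norm_minus_commute[of M g "f n"] by simp
      then show ?thesis using d by blast
    qed
    then show "\<exists>g\<in>V. (\<lambda>n. L2_norm M (f n - g)) \<longlonglongrightarrow> 0" using g by (auto simp: V_def)
  qed
  have kV: "k n \<in> V" for n
  proof -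
    have "k n = rat_comb k [(n, 1, 0)]" by (simp add: rat_comb_def fun_eq_iff one_complex.code[symmetric])
    then have "k n \<in> D" by (metis D_def rangeI)
    then show ?thesis using k L2_norm_diff_self[of M "k n"] by (force simp: V_def)
  qed
  have "\<exists>d\<in>D. L2_norm M (f - d) < e" if f: "f \<in> W" and e: "e > 0" for f e
  proof -
    obtain p where p: "p \<in> V" "\<And>g. g \<in> V \<Longrightarrow> L2_inner M (f - p) g = 0" using V.projection_exists[OF L[OF f]] by blast
    have pW: "p \<in> W" using p by (auto simp: V_def)
    have z: "L2_norm M (f - p) = 0" using total[OF diff[OF f pW]] p(2)[OF kV] by blast
    obtain d where d: "d \<in> D" "L2_norm M (p - d) < e" using p(1) e unfolding V_def by blast
    then show ?thesis using L2_norm_triangle_diff[OF L[OF f] L[OF pW] L[OF DW[OF d(1)]]] z by force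
  qed
  moreover have "countable D" by (simp add: D_def)
  ultimately show ?thesis using DW by blast
qed

text \<open>The kernels at a countable dense set of points are total: a function orthogonal to all
  of them vanishes at those points, hence everywhere by continuity.\<close>

lemma A2_separable:
  assumes D: "open D" "(\<lambda>z. 1) \<in> L2 (area D)"
  shows "\<exists>S. countable S \<and> S \<subseteq> A2 D \<and> (\<forall>f\<in>A2 D. \<forall>e>0. \<exists>d\<in>S. L2_norm (area D) (f - d) < e)"
proof (cases "D = {}")
  case True
  have "L2_norm (area D) f = 0" for f by (simp add: L2_norm_def True Bochner_Integration.integral_empty space_restrict_space)
  moreover have "(\<lambda>z. 0) \<in> A2 D" by (auto simp: A2_def)
  ultimately show ?thesis by (intro exI[of _ "{\<lambda>z. 0}"]) auto
next
  case False
  interpret A: L2_closed_subspace "area D" "A2 D" by (rule A2_closed_subspace[OF D(1)])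
  obtain k where k: "\<And>z. z \<in> D \<Longrightarrow> k z \<in> A2 D" "\<And>z f. z \<in> D \<Longrightarrow> f \<in> A2 D \<Longrightarrow> f z = L2_inner (area D) f (k z)"
    using A2_kernel_exists[OF D] by metis
  obtain C :: "complex set" where C: "countable C" "\<And>U. open U \<Longrightarrow> U \<noteq> {} \<Longrightarrow> \<exists>c\<in>C. c \<in> U"
    using countable_dense_exists by blast
  define S where "S = C \<inter> D"
  have S: "countable S" "S \<noteq> {}" using C(1) C(2)[OF D(1) False] by (auto simp: S_def)
  define q where "q = from_nat_into S"
  have q: "q n \<in> D" for n using from_nat_into[OF S(2), of n] by (auto simp: q_def S_def)
  show ?thesis
  proof (rule A.separable_of_total[of "\<lambda>n. k (q n)"])
    show "k (q n) \<in> A2 D" for n using k q by blast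
    fix f assume f: "f \<in> A2 D" "\<And>n. L2_inner (area D) f (k (q n)) = 0"
    have fS: "f z = 0" if z: "z \<in> S" for z
    proof -
      obtain n where "z = q n" using from_nat_into_surj[OF S(1) z] by (auto simp: q_def)
      then show ?thesis using k(2)[OF q f(1)] f(2) by simp
    qed
    have "f z = 0" if z: "z \<in> D" for z
    proof (rule ccontr)
      assume nz: "f z \<noteq> 0"
      have "open (D \<inter> f -` (- {0}))"
        by (rule continuous_open_preimage[OF holomorphic_on_imp_continuous_on[OF A2D(2)[OF f(1)]] D(1)]) auto
      then obtain c where "c \<in> C" "c \<in> D \<inter> f -` (- {0})" using C(2)[of "D \<inter> f -` (- {0})"] nz z by blast
      then show False using fS[of c] by (auto simp: S_def)
    qed
    then have "(LINT x|area D. (cmod (f x))\<^sup>2) = (LINT x|area D. 0)"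
      by (intro Bochner_Integration.integral_cong) auto
    then show "L2_norm (area D) f = 0" by (simp add: L2_norm_def)
  qed
qed

section \<open>Lattice translates\<close>

definition cell_index :: "complex \<Rightarrow> complex" where
  "cell_index z = of_int \<lfloor>Re z\<rfloor> + \<i> * of_int \<lfloor>Im z\<rfloor>"

lemma Re_cell_index [simp]: "Re (cell_index z) = of_int \<lfloor>Re z\<rfloor>"
  and Im_cell_index [simp]: "Im (cell_index z) = of_int \<lfloor>Im z\<rfloor>"
  by (simp_all add: cell_index_def)

lemma tr_eq: "tr z = z - cell_index z"
  by (simp add: tr_def cell_index_def)

lemma cell_index_in [simp]: "cell_index z \<in> period_lattice"
  by (simp add: period_lattice_def)

lemma period_lattice_simps [simp]:
  "0 \<in> period_lattice" "1 \<in> period_lattice" "\<i> \<in> period_lattice"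
  by (auto simp: period_lattice_def)

lemma period_lattice_add [intro]: "m \<in> period_lattice \<Longrightarrow> n \<in> period_lattice \<Longrightarrow> m + n \<in> period_lattice"
  and period_lattice_diff [intro]: "m \<in> period_lattice \<Longrightarrow> n \<in> period_lattice \<Longrightarrow> m - n \<in> period_lattice"
  and period_lattice_minus [intro]: "m \<in> period_lattice \<Longrightarrow> - m \<in> period_lattice"
  by (auto simp: period_lattice_def)

lemma period_lattice_eq_range: "period_lattice = range (\<lambda>(a::int, b::int). Complex (of_int a) (of_int b))"
proof
  show "period_lattice \<subseteq> range (\<lambda>(a::int, b::int). Complex (of_int a) (of_int b))"
  proof
    fix m assume "m \<in> period_lattice"
    then obtain a b :: int where "Re m = of_int a" "Im m = of_int b" by (auto simp: period_lattice_def elim!: Ints_cases)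
    then have "m = (\<lambda>(a::int, b::int). Complex (of_int a) (of_int b)) (a, b)" by (simp add: complex_eq_iff)
    then show "m \<in> range (\<lambda>(a::int, b::int). Complex (of_int a) (of_int b))" by (rule range_eqI)
  qed
qed (auto simp: period_lattice_def)

lemma countable_period_lattice [simp]: "countable period_lattice"
  unfolding period_lattice_eq_range by simp

lemma cell_index_add: "m \<in> period_lattice \<Longrightarrow> cell_index (z + m) = cell_index z + m"
  unfolding period_lattice_eq_range by (auto simp: complex_eq_iff)

lemma tr_add: "m \<in> period_lattice \<Longrightarrow> tr (z + m) = tr z"
  by (simp add: tr_eq cell_index_add)

lemma cell_index_unit: "0 \<le> Re z \<Longrightarrow> Re z < 1 \<Longrightarrow> 0 \<le> Im z \<Longrightarrow> Im z < 1 \<Longrightarrow> cell_index z = 0"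
  by (simp add: complex_eq_iff floor_unique[of 0])

lemma tr_bounds: "0 \<le> Re (tr z)" "Re (tr z) < 1" "0 \<le> Im (tr z)" "Im (tr z) < 1"
  by (simp_all add: tr_eq) linarith+

lemma tr_decomp: "z = tr z + cell_index z"
  by (simp add: tr_eq)

lemma cmod_tr_le: "cmod (tr z) \<le> 2"
  using cmod_le[of "tr z"] tr_bounds[of z] by simp

lemma unit_cell_box: "unit_cell = box 0 (Complex 1 1)"
  by (auto simp: unit_cell_def in_box_complex_iff)

lemma closure_unit_cell: "closure unit_cell = {z. 0 \<le> Re z \<and> Re z \<le> 1 \<and> 0 \<le> Im z \<and> Im z \<le> 1}"
proof -
  have "(1/2::complex) + \<i>/2 \<in> box 0 (Complex 1 1)" by (simp add: in_box_complex_iff)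
  then have "box 0 (Complex 1 1) \<noteq> {}" by blast
  then show ?thesis unfolding unit_cell_box by (auto simp: closure_box in_cbox_complex_iff)
qed

lemma open_unit_cell [simp]: "open unit_cell" by (simp add: unit_cell_box open_box)

lemma frontier_unit_cell: "frontier unit_cell = closure unit_cell - unit_cell"
  by (simp add: frontier_def interior_open)

lemma in_translate: "z \<in> translate S m \<longleftrightarrow> z - m \<in> S"
  by (auto simp: translate_def) (metis diff_add_cancel image_eqI)

lemma translate_eq_plus: "translate S m = (+) m ` S"
  by (simp add: translate_def add.commute cong: image_cong)

lemma closure_translate: "closure (translate S m) = translate (closure S) m"
  by (simp add: translate_eq_plus closure_translation)

section \<open>Periodicity of the domain and its cells\<close>

locale doubly_periodic =
  fixes \<omega> \<Omega> :: "complex set"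
  assumes cell: "periodic_cell \<omega>" and Omega: "\<Omega> = periodic_domain \<omega>"
begin

lemma omega: "open \<omega>" "\<omega> \<noteq> {}" "\<omega> \<subseteq> unit_cell"
  using cell by (auto simp: periodic_cell_def)

lemma frontier_sub: "frontier unit_cell \<subseteq> closure \<omega>"
  using cell by (auto simp: periodic_cell_def frontier_def)

lemma open_Omega: "open \<Omega>"
  by (simp add: Omega periodic_domain_def)

lemma shift_in_Omega: assumes "z \<in> \<omega>" "m \<in> period_lattice" shows "z + m \<in> \<Omega>"
proof -
  have "translate \<omega> m \<subseteq> \<Omega>" unfolding Omega periodic_domain_def
  proof (rule interior_maximal)
    show "translate \<omega> m \<subseteq> (\<Union>m\<in>period_lattice. closure (translate \<omega> m))" using assms(2) closure_subset by blast
    show "open (translate \<omega> m)" unfolding translate_eq_plus by (intro open_translation omega)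
  qed
  then show ?thesis using assms by (auto simp: in_translate)
qed

lemma omega_sub: "\<omega> \<subseteq> \<Omega>"
  using shift_in_Omega[of _ 0] by auto

lemma Omega_shift: assumes "m \<in> period_lattice" shows "z + m \<in> \<Omega> \<longleftrightarrow> z \<in> \<Omega>"
proof -
  define S where "S = (\<Union>m\<in>period_lattice. closure (translate \<omega> m))"
  have S: "x + m \<in> S" if xm: "x \<in> S" "m \<in> period_lattice" for x m
  proof -
    obtain k where k: "k \<in> period_lattice" "x - k \<in> closure \<omega>" using xm by (auto simp: S_def closure_translate in_translate)
    then have "k + m \<in> period_lattice" "x + m - (k + m) \<in> closure \<omega>" using xm by auto
    then show ?thesis unfolding S_def closure_translate in_translate UN_iff by blast
  qed
  have imp: "x + m \<in> interior S" if "x \<in> interior S" "m \<in> period_lattice" for x m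
  proof -
    have "(+) m ` S \<subseteq> S" using S[OF _ that(2)] by (auto simp: add.commute)
    then have "interior ((+) m ` S) \<subseteq> interior S" by (rule interior_mono)
    moreover have "m + x \<in> interior ((+) m ` S)" unfolding interior_translation using that by blast
    ultimately show ?thesis by (auto simp: add.commute[of x])
  qed
  show ?thesis
    unfolding Omega periodic_domain_def S_def[symmetric]
    using imp[of z m] imp[of "z + m" "- m"] assms by auto
qed

lemma tr_in_Omega: "tr z \<in> \<Omega> \<longleftrightarrow> z \<in> \<Omega>"
  using Omega_shift[of "cell_index z" "tr z"] tr_decomp[of z] by simp

text \<open>A closed translate with nonzero index does not reach into the open unit cell, and the
  frontier of the unit cell belongs to \<open>closure \<omega>\<close> by assumption. So a
  neighborhood of \<open>closure \<omega> \<inter> \<Omega>\<close> contains every point of \<Omega>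
  in the closed unit cell, edges and corners included.\<close>

lemma Omega_closure: assumes "z \<in> \<Omega>" "z \<in> closure unit_cell" shows "z \<in> closure \<omega>"
proof (cases "z \<in> unit_cell")
  case False
  then show ?thesis using assms frontier_sub by (auto simp: frontier_unit_cell)
next
  case True
  obtain m where m: "m \<in> period_lattice" "z - m \<in> closure \<omega>"
    using assms(1) interior_subset by (force simp: Omega periodic_domain_def closure_translate in_translate)
  have "closure \<omega> \<subseteq> closure unit_cell" by (rule closure_mono[OF omega(3)])
  then have "0 \<le> Re (z - m) \<and> Re (z - m) \<le> 1 \<and> 0 \<le> Im (z - m) \<and> Im (z - m) \<le> 1"
    using m by (auto simp: closure_unit_cell)
  moreover obtain a b :: int where "Re m = of_int a" "Im m = of_int b" using m(1) by (auto simp: period_lattice_def elim!: Ints_cases)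
  ultimately have "a = 0" "b = 0" using True by (auto simp: unit_cell_def)
  then have "m = 0" using \<open>Re m = of_int a\<close> \<open>Im m = of_int b\<close> by (simp add: complex_eq_iff)
  then show ?thesis using m by simp
qed

lemma omega_bounds: "z \<in> \<omega> \<Longrightarrow> 0 < Re z \<and> Re z < 1 \<and> 0 < Im z \<and> Im z < 1"
  using omega(3) by (auto simp: unit_cell_def)

lemma cell_index_omega: "z \<in> \<omega> \<Longrightarrow> m \<in> period_lattice \<Longrightarrow> cell_index (z + m) = m"
  using omega_bounds[of z] by (simp add: cell_index_add cell_index_unit)

lemma tr_omega: "z \<in> \<omega> \<Longrightarrow> m \<in> period_lattice \<Longrightarrow> tr (z + m) = z"
  by (simp add: tr_eq cell_index_omega)

lemma omega_lmeasurable: "\<omega> \<in> lmeasurable"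
proof -
  have "bounded \<omega>" using bounded_subset[OF bounded_box] omega(3) unfolding unit_cell_box by blast
  then show ?thesis using omega(1) lmeasurable_open by blast
qed

lemma omega_sets [simp]: "\<omega> \<in> sets lebesgue" "\<Omega> \<in> sets lebesgue"
  using omega open_Omega by auto

lemma finite_area: "finite_measure (area \<omega>)"
  by (rule finite_measure_lebesgue_on[OF omega_lmeasurable])

lemma shift_measurable: "m \<in> period_lattice \<Longrightarrow> (\<lambda>z. z + m) \<in> measurable (area \<omega>) (area \<Omega>)"
proof (rule measurable_restrict_space3)
  show "(\<lambda>z. z + m) \<in> lebesgue \<rightarrow>\<^sub>M lebesgue"
    using lebesgue_affine_measurable[of "\<lambda>_. 1" m] by (simp add: euclidean_representation add.commute)
  show "m \<in> period_lattice \<Longrightarrow> (\<lambda>z. z + m) \<in> \<omega> \<rightarrow> \<Omega>" using shift_in_Omega by auto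
qed

lemma shift_borel_measurable:
  "f \<in> borel_measurable (area \<Omega>) \<Longrightarrow> m \<in> period_lattice \<Longrightarrow> (\<lambda>z. f (z + m)) \<in> borel_measurable (area \<omega>)"
  using measurable_compose[OF shift_measurable] by blast

end

text \<open>\<Omega> also contains boundary points of the translated cells, and these could have
  positive area. When they are null, \<Omega> is the disjoint union of the translates up to a null
  set.\<close>

locale doubly_periodic_null = doubly_periodic +
  assumes null: "negligible (\<Omega> - (\<Union>m\<in>period_lattice. translate \<omega> m))"
begin

lemma pair_shift_measurable: "(\<lambda>(m, z). z + m) \<in> measurable (count_space period_lattice \<Otimes>\<^sub>M area \<omega>) (area \<Omega>)"
  by (rule measurable_pair_measure_countable1) (auto simp: shift_measurable)

text \<open>As the image of counting measure times area, the area of \<Omega> admits Tonelli for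
  nonnegative and Fubini for integrable functions; integrals over \<Omega> become lattice sums of
  integrals over one cell.\<close>

lemma area_decomp: "area \<Omega> = distr (count_space period_lattice \<Otimes>\<^sub>M area \<omega>) (area \<Omega>) (\<lambda>(m, z). z + m)"
proof (rule measure_eqI)
  fix A assume A: "A \<in> sets (area \<Omega>)"
  interpret finite_measure "area \<omega>" by (rule finite_area)
  have AL: "A \<in> sets lebesgue" "A \<subseteq> \<Omega>" using A by (auto simp: sets_restrict_space_iff)
  have tL: "translate \<omega> m \<in> sets lebesgue" for m
    unfolding translate_eq_plus using open_translation[OF omega(1)] by auto
  have emA: "emeasure (area \<Omega>) A = emeasure lebesgue A" using AL by (simp add: emeasure_restrict_space)
  define N where "N = \<Omega> - (\<Union>m\<in>period_lattice. translate \<omega> m)"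
  have N: "N \<in> null_sets lebesgue" using null by (simp add: N_def negligible_iff_null_sets)
  have "emeasure lebesgue A = emeasure lebesgue (A - N)" using emeasure_Diff_null_set[OF N] AL by simp
  also have "A - N = (\<Union>m\<in>period_lattice. A \<inter> translate \<omega> m)" using AL by (auto simp: N_def)
  also have "emeasure lebesgue \<dots> = (\<integral>\<^sup>+m. emeasure lebesgue (A \<inter> translate \<omega> m) \<partial>count_space period_lattice)"
  proof (rule emeasure_UN_countable)
    \<comment> \<open>The index of a translate is recovered from any of its points as
      \<open>cell_index\<close>.\<close>
    show "disjoint_family_on (\<lambda>m. A \<inter> translate \<omega> m) period_lattice"
      unfolding disjoint_family_on_def
    proof (intro ballI impI)
      fix m n assume mn: "m \<in> period_lattice" "n \<in> period_lattice" "m \<noteq> n"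
      have "m = n" if "z - m \<in> \<omega>" "z - n \<in> \<omega>" for z
        using cell_index_omega[OF that(1) mn(1)] cell_index_omega[OF that(2) mn(2)] by simp
      then show "A \<inter> translate \<omega> m \<inter> (A \<inter> translate \<omega> n) = {}" using mn by (auto simp: in_translate)
    qed
  qed (use AL tL in auto)
  also have "\<dots> = (\<integral>\<^sup>+m. emeasure (area \<omega>) (Pair m -` ((\<lambda>(m, z). z + m) -` A \<inter> space (count_space period_lattice \<Otimes>\<^sub>M area \<omega>))) \<partial>count_space period_lattice)"
  proof (rule nn_integral_cong)
    fix m assume "m \<in> space (count_space period_lattice)"
    then have m: "m \<in> period_lattice" by simp
    define B where "B = {z \<in> \<omega>. z + m \<in> A}"
    have B: "Pair m -` ((\<lambda>(m, z). z + m) -` A \<inter> space (count_space period_lattice \<Otimes>\<^sub>M area \<omega>)) = B"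
      using m by (auto simp: B_def space_pair_measure)
    have tr: "A \<inter> translate \<omega> m = (\<lambda>z. 1 *\<^sub>R z + m) ` B"
      by (force simp: B_def in_translate image_iff)
    have "B = (\<lambda>z. z + m) -` A \<inter> space (area \<omega>)" by (auto simp: B_def)
    then have "B \<in> sets (area \<omega>)" using measurable_sets[OF shift_measurable[OF m] A] by simp
    then have BL: "B \<in> sets lebesgue" by (simp add: sets_restrict_space_iff)
    have "emeasure lebesgue (A \<inter> translate \<omega> m) = emeasure lebesgue B"
      unfolding tr using emeasure_lebesgue_affine[of 1 m B] by simp
    also have "\<dots> = emeasure (area \<omega>) B" using BL by (subst emeasure_restrict_space) (auto simp: B_def)
    finally show "emeasure lebesgue (A \<inter> translate \<omega> m) = emeasure (area \<omega>) (Pair m -` ((\<lambda>(m, z). z + m) -` A \<inter> space (count_space period_lattice \<Otimes>\<^sub>M area \<omega>)))"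
      unfolding B .
  qed
  also have "\<dots> = emeasure (count_space period_lattice \<Otimes>\<^sub>M area \<omega>) ((\<lambda>(m, z). z + m) -` A \<inter> space (count_space period_lattice \<Otimes>\<^sub>M area \<omega>))"
    by (rule emeasure_pair_measure_alt[symmetric]) (rule measurable_sets[OF pair_shift_measurable A])
  also have "\<dots> = emeasure (distr (count_space period_lattice \<Otimes>\<^sub>M area \<omega>) (area \<Omega>) (\<lambda>(m, z). z + m)) A"
    by (rule emeasure_distr[OF pair_shift_measurable A, symmetric])
  finally show "emeasure (area \<Omega>) A = emeasure (distr (count_space period_lattice \<Otimes>\<^sub>M area \<omega>) (area \<Omega>) (\<lambda>(m, z). z + m)) A"
    using emA by simp
qed simp

lemma nn_integral_Omega:
  assumes u: "u \<in> borel_measurable (area \<Omega>)"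
  shows "(\<integral>\<^sup>+z. u z \<partial>area \<Omega>) = (\<integral>\<^sup>+m. \<integral>\<^sup>+z. u (z + m) \<partial>area \<omega> \<partial>count_space period_lattice)"
proof -
  interpret finite_measure "area \<omega>" by (rule finite_area)
  have "(\<integral>\<^sup>+z. u z \<partial>area \<Omega>) = (\<integral>\<^sup>+p. u (snd p + fst p) \<partial>(count_space period_lattice \<Otimes>\<^sub>M area \<omega>))"
    by (subst area_decomp, subst nn_integral_distr[OF pair_shift_measurable]) (simp_all add: case_prod_beta u)
  also have "\<dots> = (\<integral>\<^sup>+m. \<integral>\<^sup>+z. u (z + m) \<partial>area \<omega> \<partial>count_space period_lattice)"
    by (subst nn_integral_fst[symmetric]) (use measurable_compose[OF pair_shift_measurable u] in \<open>simp_all add: case_prod_beta\<close>)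
  finally show ?thesis .
qed

text \<open>Fubini gives absolute summability over the lattice, hence an unconditional sum.\<close>

lemma has_sum_integral_Omega:
  fixes u :: "complex \<Rightarrow> complex"
  assumes u: "integrable (area \<Omega>) u"
  shows "((\<lambda>m. LINT z|area \<omega>. u (z + m)) has_sum (LINT z|area \<Omega>. u z)) period_lattice"
proof -
  interpret A: finite_measure "area \<omega>" by (rule finite_area)
  interpret C: sigma_finite_measure "count_space period_lattice" by (rule sigma_finite_measure_count_space_countable) simp
  interpret P: pair_sigma_finite "count_space period_lattice" "area \<omega>" ..
  have um: "u \<in> borel_measurable (area \<Omega>)" using u by simp
  have "integrable (distr (count_space period_lattice \<Otimes>\<^sub>M area \<omega>) (area \<Omega>) (\<lambda>(m, z). z + m)) u"
    using u area_decomp by simp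
  then have i: "integrable (count_space period_lattice \<Otimes>\<^sub>M area \<omega>) (\<lambda>(m, z). u (z + m))"
    by (subst (asm) integrable_distr_eq[OF pair_shift_measurable um]) (simp add: case_prod_unfold)
  have "(LINT z|area \<Omega>. u z) = integral\<^sup>L (count_space period_lattice \<Otimes>\<^sub>M area \<omega>) (\<lambda>(m, z). u (z + m))"
    by (subst area_decomp, subst integral_distr[OF pair_shift_measurable um]) (simp add: case_prod_unfold)
  also have "\<dots> = (LINT m|count_space period_lattice. LINT z|area \<omega>. u (z + m))"
    using P.integral_fst'[OF i] by simp
  finally have eq: "(LINT z|area \<Omega>. u z) = infsetsum (\<lambda>m. LINT z|area \<omega>. u (z + m)) period_lattice"
    by (simp add: infsetsum_def)
  have "integrable (count_space period_lattice) (\<lambda>m. LINT z|area \<omega>. u (z + m))"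
    using P.integrable_fst'[OF i] by simp
  then have i': "Infinite_Set_Sum.abs_summable_on (\<lambda>m. LINT z|area \<omega>. u (z + m)) period_lattice"
    by (simp add: Infinite_Set_Sum.abs_summable_on_def)
  then have "(\<lambda>m. norm (LINT z|area \<omega>. u (z + m))) summable_on period_lattice"
    by (simp add: abs_summable_equivalent)
  then have "(\<lambda>m. LINT z|area \<omega>. u (z + m)) summable_on period_lattice" by (rule abs_summable_summable)
  then show ?thesis using infsetsum_infsum[OF i'] eq by (simp add: has_sum_infsum)
qed

lemma AE_Omega_omega: "AE z in area \<Omega>. tr z \<in> \<omega>"
proof -
  have "AE z in lebesgue. z \<notin> \<Omega> - (\<Union>m\<in>period_lattice. translate \<omega> m)"
    using null by (intro AE_not_in) (simp add: negligible_iff_null_sets)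
  then have "AE z in lebesgue. z \<in> \<Omega> \<longrightarrow> tr z \<in> \<omega>"
  proof eventually_elim
    case (elim z)
    show ?case
    proof
      assume "z \<in> \<Omega>"
      then obtain m where m: "m \<in> period_lattice" "z - m \<in> \<omega>" using elim by (auto simp: in_translate)
      then show "tr z \<in> \<omega>" using tr_omega[OF m(2,1)] by simp
    qed
  qed
  then show ?thesis by (simp add: AE_restrict_space_iff)
qed

end

section \<open>Holomorphic partition of unity\<close>

lemma summable_on_int_powr:
  fixes s :: real assumes s: "s > 1"
  shows "(\<lambda>n::int. (1 + \<bar>of_int n\<bar>) powr (- s)) summable_on UNIV"
proof -
  have "summable (\<lambda>n. of_nat n powr (- s) :: real)" using s by (simp add: summable_real_powr_iff)
  then have "summable (\<lambda>n. of_nat (Suc n) powr (- s) :: real)" by (subst summable_Suc_iff)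
  then have nat: "(\<lambda>n::nat. (1 + real n) powr (- s)) summable_on UNIV"
    by (subst summable_on_UNIV_nonneg_real_iff) (simp_all add: add.commute)
  have 1: "(\<lambda>n::int. (1 + \<bar>of_int n\<bar>) powr (- s)) summable_on range int"
    by (subst summable_on_reindex) (use nat in \<open>auto simp: comp_def\<close>)
  have 2: "(\<lambda>n::int. (1 + \<bar>of_int n\<bar>) powr (- s)) summable_on range (\<lambda>n. - int n)"
    by (subst summable_on_reindex) (use nat in \<open>auto simp: comp_def inj_def\<close>)
  have "range int \<union> range (\<lambda>n. - int n) = UNIV"
    by (auto simp: image_iff) (metis int_cases2)
  then show ?thesis using summable_on_union[OF 1 2] by simp
qed

definition weight :: "real \<Rightarrow> complex \<Rightarrow> real" where
  "weight b z = (1 + cmod z) powr (- b)"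

lemma weight_nonneg [simp]: "0 \<le> weight b z" and weight_pos [simp]: "0 < weight b z"
  by (simp_all add: weight_def add_pos_nonneg less_imp_neq[symmetric])

text \<open>The weight is at most a product of two one-dimensional weights with exponent
  \<open>b / 2\<close>, and each of these is summable since \<open>b / 2 > 1\<close>.\<close>

lemma summable_weight:
  assumes b: "b > 2" shows "weight b summable_on period_lattice"
proof -
  define g where "g = (\<lambda>n::int. (1 + \<bar>of_int n\<bar>) powr (- (b/2)))"
  have g: "g summable_on UNIV" unfolding g_def by (rule summable_on_int_powr) (use b in simp)
  have g0: "0 \<le> g n" for n by (simp add: g_def)
  have "(\<lambda>(x, y). g x * g y) summable_on Sigma UNIV (\<lambda>_. UNIV)"
  proof (rule summable_on_SigmaI)
    show "((\<lambda>y. case (x, y) of (x, y) \<Rightarrow> g x * g y) has_sum g x * infsum g UNIV) UNIV" for x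
      using has_sum_cmult_right[OF has_sum_infsum[OF g]] by simp
    show "(\<lambda>x. g x * infsum g UNIV) summable_on UNIV" by (rule summable_on_cmult_left[OF g])
  qed (auto simp: g0)
  then have "(\<lambda>(x, y). g x * g y) summable_on UNIV" by simp
  then have "(weight b \<circ> (\<lambda>(a::int, b::int). Complex (of_int a) (of_int b))) summable_on UNIV"
  proof (rule summable_on_comparison_test)
    fix p :: "int \<times> int"
    obtain x y where p: "p = (x, y)" by fastforce
    define X Y where "X = \<bar>real_of_int x\<bar>" and "Y = \<bar>real_of_int y\<bar>"
    have XY: "0 \<le> X" "0 \<le> Y" "X \<le> cmod (Complex x y)" "Y \<le> cmod (Complex x y)"
      using abs_Re_le_cmod[of "Complex x y"] abs_Im_le_cmod[of "Complex x y"] by (auto simp: X_def Y_def)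
    have "(1 + cmod (Complex x y)) powr (- b) = (1 + cmod (Complex x y)) powr (-(b/2)) * (1 + cmod (Complex x y)) powr (-(b/2))"
      by (simp add: powr_add[symmetric])
    also have "\<dots> \<le> (1 + X) powr (-(b/2)) * (1 + Y) powr (-(b/2))"
      using XY b by (intro mult_mono powr_mono2') auto
    finally show "(weight b \<circ> (\<lambda>(a, b). Complex (of_int a) (of_int b))) p \<le> (case p of (x, y) \<Rightarrow> g x * g y)"
      by (simp add: p g_def weight_def X_def Y_def)
  qed (auto simp: weight_def)
  moreover have "inj (\<lambda>(a::int, b::int). Complex (of_int a) (of_int b))" by (auto simp: inj_def)
  ultimately show ?thesis unfolding period_lattice_eq_range by (subst summable_on_reindex)
qed

text \<open>From \<open>1 + cmod m \<le> (1 + cmod (z + m)) * (1 + cmod z)\<close>: decay along the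
  lattice carries over to its translate by \<open>z\<close>, locally uniformly.\<close>

lemma weight_add:
  assumes "b \<ge> 0" shows "weight b (z + m) \<le> (1 + cmod z) powr b * weight b m"
proof -
  have "1 + cmod m \<le> 1 + (cmod (z + m) + cmod z)"
    using norm_triangle_ineq4[of "z + m" z] by simp
  also have "\<dots> \<le> (1 + cmod (z + m)) * (1 + cmod z)" by (simp add: algebra_simps)
  finally have "((1 + cmod (z + m)) * (1 + cmod z)) powr (- b) \<le> (1 + cmod m) powr (- b)"
    using assms by (intro powr_mono2') (auto simp: add_pos_nonneg)
  then have "(1 + cmod z) powr b * (weight b (z + m) * (1 + cmod z) powr (- b)) \<le> (1 + cmod z) powr b * weight b m"
    by (intro mult_left_mono) (auto simp: weight_def powr_mult)
  moreover have "(1 + cmod z) powr b * (1 + cmod z) powr (- b) = 1"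
  proof -
    have "0 < 1 + cmod z" by (simp add: add_pos_nonneg)
    then show ?thesis by (simp add: powr_minus)
  qed
  then have "(1 + cmod z) powr b * (weight b (z + m) * (1 + cmod z) powr (- b)) = weight b (z + m)"
    by (simp add: mult.assoc[symmetric] mult.commute[of _ "weight b (z + m)"])
  ultimately show ?thesis by simp
qed

text \<open>The majorants may depend on the disc: the M-test gives uniform convergence near each
  point, which suffices for analyticity.\<close>

lemma holomorphic_on_infsum:
  fixes f :: "'i \<Rightarrow> complex \<Rightarrow> complex"
  assumes S: "open S" and hol: "\<And>i. i \<in> I \<Longrightarrow> f i holomorphic_on S"
    and bd: "\<And>z. z \<in> S \<Longrightarrow> \<exists>d>0. \<exists>M. cball z d \<subseteq> S \<and> M summable_on I \<and> (\<forall>i\<in>I. \<forall>w\<in>cball z d. cmod (f i w) \<le> M i)"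
  shows "(\<lambda>z. \<Sum>\<^sub>\<infinity>i\<in>I. f i z) holomorphic_on S"
proof -
  have "(\<lambda>z. \<Sum>\<^sub>\<infinity>i\<in>I. f i z) field_differentiable at z" if z: "z \<in> S" for z
  proof -
    obtain d M where d: "d > 0" "cball z d \<subseteq> S" and M: "M summable_on I" "\<forall>i\<in>I. \<forall>w\<in>cball z d. cmod (f i w) \<le> M i"
      using bd[OF z] by blast
    have ul: "uniform_limit (cball z d) (\<lambda>X w. \<Sum>i\<in>X. f i w) (\<lambda>w. \<Sum>\<^sub>\<infinity>i\<in>I. f i w) (finite_subsets_at_top I)"
      by (rule Weierstrass_m_test_general[OF _ M(1)]) (use M(2) in auto)
    have ev: "\<forall>\<^sub>F X in finite_subsets_at_top I. continuous_on (cball z d) (\<lambda>w. \<Sum>i\<in>X. f i w) \<and> (\<lambda>w. \<Sum>i\<in>X. f i w) holomorphic_on ball z d"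
    proof (rule eventually_finite_subsets_at_top_weakI)
      fix X assume X: "finite X" "X \<subseteq> I"
      have "(\<lambda>w. \<Sum>i\<in>X. f i w) holomorphic_on S" using X hol by (intro holomorphic_on_sum) auto
      then show "continuous_on (cball z d) (\<lambda>w. \<Sum>i\<in>X. f i w) \<and> (\<lambda>w. \<Sum>i\<in>X. f i w) holomorphic_on ball z d"
        using d by (meson ball_subset_cball continuous_on_subset holomorphic_on_imp_continuous_on holomorphic_on_subset order_trans)
    qed
    have "(\<lambda>w. \<Sum>\<^sub>\<infinity>i\<in>I. f i w) holomorphic_on ball z d"
      using holomorphic_uniform_limit[OF ev ul] by auto
    then show ?thesis using d(1) holomorphic_on_imp_differentiable_at by (metis centre_in_ball open_ball)
  qed
  then show ?thesis using S by (simp add: holomorphic_on_open field_differentiable_def)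
qed

lemma has_sum_lattice_shift:
  assumes "k \<in> period_lattice"
  shows "((\<lambda>m. f (m + k)) has_sum s) period_lattice \<longleftrightarrow> (f has_sum s) period_lattice"
  by (rule has_sum_reindex_bij_witness[where i = "\<lambda>m. m - k" and j = "\<lambda>m. m + k"]) (use assms in auto)

lemma has_sum_lattice_uminus:
  shows "((\<lambda>m. f (- m)) has_sum s) period_lattice \<longleftrightarrow> (f has_sum s) period_lattice"
  by (rule has_sum_reindex_bij_witness[where i = "\<lambda>m. - m" and j = "\<lambda>m. - m"]) auto

lemma periodic_lattice:
  assumes "\<And>z. \<phi> (z + 1) = \<phi> z" "\<And>z. \<phi> (z + \<i>) = \<phi> z" "m \<in> period_lattice"
  shows "\<phi> (z + m) = (\<phi> z :: complex)"
proof -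
  have 1: "\<phi> (z + of_int a) = \<phi> z" for z and a :: int
  proof (induction a rule: int_induct[where k = 0])
    case (step1 i) then show ?case using assms(1)[of "z + of_int i"] by (simp add: add.assoc)
  next
    case (step2 i) then show ?case using assms(1)[of "z + of_int (i - 1)"] by simp
  qed simp
  have 2: "\<phi> (z + \<i> * of_int a) = \<phi> z" for z and a :: int
  proof (induction a rule: int_induct[where k = 0])
    case (step1 i) then show ?case using assms(2)[of "z + \<i> * of_int i"] by (simp add: algebra_simps)
  next
    case (step2 i) then show ?case using assms(2)[of "z + \<i> * of_int (i - 1)"] by (simp add: algebra_simps)
  qed simp
  obtain a b :: int where "m = Complex (of_int a) (of_int b)" using assms(3) unfolding period_lattice_eq_range by auto
  then have "z + m = (z + of_int a) + \<i> * of_int b" by (simp add: complex_eq_iff)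
  then show ?thesis using 1[of z a] 2[of "z + of_int a" b] by (simp add: add.assoc)
qed

lemma tr_tr: "tr (tr z) = tr z"
  using cell_index_unit[OF tr_bounds[of z]] tr_eq[of "tr z"] by simp

text \<open>Periodic and continuous, equal to 1 on the lines bounding the cells and smaller inside
  them. The sets \<open>grid z > c\<close> with \<open>c < 1\<close> are periodic neighborhoods of
  these lines; they separate the poles from the cell boundaries.\<close>

definition grid :: "complex \<Rightarrow> real" where
  "grid z = max (cos (2 * pi * Re z)) (cos (2 * pi * Im z))"

lemma continuous_on_grid [continuous_intros]: "continuous_on S grid"
  unfolding grid_def by (intro continuous_intros)

lemma cos_int_shift: "cos (2 * pi * (x + of_int a)) = cos (2 * pi * x)"
  using cos.periodic_simps sin_int_2pin cos_int_2pin by (simp add: distrib_left cos_add mult.assoc)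

lemma grid_shift: "m \<in> period_lattice \<Longrightarrow> grid (z + m) = grid z"
  unfolding period_lattice_eq_range by (auto simp: grid_def cos_int_shift)

lemma cos_less_one: assumes "0 < x" "x < 1" shows "cos (2 * pi * x) < 1"
proof -
  have "sin (pi * x) > 0" using assms by (intro sin_gt_zero) auto
  moreover have "cos (2 * (pi * x)) = 1 - 2 * (sin (pi * x))\<^sup>2" by (rule cos_double_sin)
  ultimately show ?thesis by (simp add: mult.assoc)
qed

lemma grid_unit_cell: "z \<in> unit_cell \<Longrightarrow> grid z < 1"
  by (simp add: grid_def unit_cell_def cos_less_one)

lemma grid_frontier:
  assumes "z \<in> closure unit_cell" "z \<notin> unit_cell"
  shows "grid z = 1"
proof -
  have "Re z = 0 \<or> Re z = 1 \<or> Im z = 0 \<or> Im z = 1"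
    using assms(1)[unfolded closure_unit_cell] assms(2) by (auto simp: unit_cell_def)
  then have "cos (2 * pi * Re z) = 1 \<or> cos (2 * pi * Im z) = 1" by auto
  then show ?thesis unfolding grid_def
    using cos_le_one[of "2 * pi * Re z"] cos_le_one[of "2 * pi * Im z"] by (auto simp: max_absorb1 max_absorb2)
qed

context doubly_periodic
begin

text \<open>The quotients of \<open>\<psi> (z + m)\<close> by \<open>\<phi> z\<close> sum to 1, but
  inside the unit cell both functions may have poles. There the quotient for \<open>m = 0\<close> is
  replaced by 1 minus the sum of the others, whose arguments avoid the unit cell and hence the
  poles. The sums over \<open>z - m\<close> and over \<open>z + m\<close> agree because the lattice
  is symmetric.\<close>

lemma partition_exists:
  assumes A: "assumption_A \<omega>"
  obtains R C b where "b > 2" "C \<ge> 0" "R holomorphic_on \<Omega>"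
    "\<And>z. z \<in> \<Omega> \<Longrightarrow> cmod (R z) \<le> C * weight b z"
    "\<And>z. z \<in> \<Omega> \<Longrightarrow> ((\<lambda>m. R (z + m)) has_sum 1) period_lattice"
proof -
  obtain \<phi> \<psi> b where \<phi>n: "\<phi> nicely_meromorphic_on UNIV" and per: "\<And>z. \<phi> (z + 1) = \<phi> z" "\<And>z. \<phi> (z + \<i>) = \<phi> z"
    and nz: "\<And>z. \<not> is_pole \<phi> z \<Longrightarrow> \<phi> z = 0 \<Longrightarrow> z \<notin> closure \<Omega>"
    and \<psi>n: "\<psi> nicely_meromorphic_on UNIV" and fin: "finite {z. is_pole \<psi> z}" and polQ: "{z. is_pole \<psi> z} \<subseteq> unit_cell"
    and sumd: "\<And>z. (\<And>m. m \<in> period_lattice \<Longrightarrow> \<not> is_pole \<psi> (z - m)) \<Longrightarrow> ((\<lambda>m. \<psi> (z - m)) has_sum \<phi> z) period_lattice"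
    and b: "b > 2" and bdd: "bdd_above ((\<lambda>z. (1 + cmod z) powr b * cmod (\<psi> z)) ` (\<Omega> - closure unit_cell))"
  proof -
    from A[unfolded assumption_A_def, folded Omega] obtain \<phi> \<psi> where
       H: "\<phi> nicely_meromorphic_on UNIV \<and> (\<forall>z. \<phi> (z + 1) = \<phi> z \<and> \<phi> (z + \<i>) = \<phi> z) \<and>
       (\<forall>z. \<not> is_pole \<phi> z \<and> \<phi> z = 0 \<longrightarrow> z \<notin> closure \<Omega>) \<and>
       \<psi> nicely_meromorphic_on UNIV \<and>
       finite {z. is_pole \<psi> z} \<and> {z. is_pole \<psi> z} \<subseteq> unit_cell \<and>
       (\<forall>z. (\<forall>m\<in>period_lattice. \<not> is_pole \<psi> (z - m)) \<longrightarrow> ((\<lambda>m. \<psi> (z - m)) has_sum \<phi> z) period_lattice) \<and>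
       (\<exists>b>2. bdd_above ((\<lambda>z. (1 + cmod z) powr b * cmod (\<psi> z)) ` (\<Omega> - closure unit_cell)))"
      by (elim exE)
    then obtain b where "b > 2" "bdd_above ((\<lambda>z. (1 + cmod z) powr b * cmod (\<psi> z)) ` (\<Omega> - closure unit_cell))"
      by (elim conjE exE)
    with H show ?thesis by (intro that[of \<phi> \<psi> b]) simp_all
  qed
  note perL = periodic_lattice[of \<phi>, OF per]
  \<comment> \<open>The poles are finitely many and interior to the unit cell, so
    \<open>grid\<close> stays below some \<open>c < 1\<close> on them. By periodicity no translate
    of \<open>\<psi>\<close> has a pole where \<open>grid\<close> is at least
    \<open>c\<close>.\<close>
  have "\<exists>c<1. \<forall>z. is_pole \<psi> z \<longrightarrow> grid z < c"
  proof (cases "{z. is_pole \<psi> z} = {}")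
    case True then show ?thesis by (intro exI[of _ 0]) auto
  next
    case False
    define c0 where "c0 = Max (grid ` {z. is_pole \<psi> z})"
    have "c0 \<in> grid ` {z. is_pole \<psi> z}" unfolding c0_def using fin False by (intro Max_in) auto
    then have "c0 < 1" using polQ grid_unit_cell by auto
    moreover have "grid z \<le> c0" if "is_pole \<psi> z" for z unfolding c0_def using fin that by (intro Max_ge) auto
    ultimately show ?thesis by (intro exI[of _ "(c0 + 1) / 2"]) (force simp: field_simps)
  qed
  then obtain c where c: "c < 1" "\<And>z. is_pole \<psi> z \<Longrightarrow> grid z < c" by blast
  have \<psi>an: "\<psi> analytic_on {z}" if "\<not> is_pole \<psi> z" for z
    using nicely_meromorphic_on_imp_analytic_at[OF \<psi>n _ that] by simp
  have \<phi>an: "\<phi> analytic_on {z}" if "\<not> is_pole \<phi> z" for z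
    using nicely_meromorphic_on_imp_analytic_at[OF \<phi>n _ that] by simp
  define U0 where "U0 = {z. grid z > c}"
  have oU0: "open U0" unfolding U0_def
    by (intro open_Collect_less continuous_intros)
  obtain B0 where B0: "\<And>z. z \<in> \<Omega> - closure unit_cell \<Longrightarrow> (1 + cmod z) powr b * cmod (\<psi> z) \<le> B0"
    using bdd unfolding bdd_above_def by blast
  have wconv: "cmod x \<le> B * weight b z \<longleftrightarrow> (1 + cmod z) powr b * cmod x \<le> B" for x z B
  proof -
    have "(1 + cmod z) powr b > 0" by (simp add: add_pos_nonneg less_imp_neq[symmetric])
    then show ?thesis by (simp add: weight_def powr_minus field_simps)
  qed
  \<comment> \<open>Assumption (A) bounds \<open>\<psi>\<close> only off the closed unit cell. Near
    the edges of that cell, where \<open>grid\<close> is at least \<open>c\<close>, continuity on a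
    compact set supplies the bound.\<close>
  obtain B1 where B1: "B1 \<ge> 0" "\<And>z. z \<in> closure unit_cell \<Longrightarrow> c \<le> grid z \<Longrightarrow> (1 + cmod z) powr b * cmod (\<psi> z) \<le> B1"
  proof -
    define K where "K = closure unit_cell \<inter> {z. c \<le> grid z}"
    have "closed {z. c \<le> grid z}" by (intro closed_Collect_le continuous_intros)
    moreover have "compact (closure unit_cell)" unfolding unit_cell_box by (simp add: compact_closure bounded_box)
    ultimately have K: "compact K" unfolding K_def by (rule compact_Int_closed[rotated])
    have "continuous_on K \<psi>"
    proof (rule continuous_at_imp_continuous_on, rule ballI)
      fix z assume "z \<in> K"
      then have "\<not> is_pole \<psi> z" using c(2)[of z] by (auto simp: K_def)
      then show "isCont \<psi> z" using \<psi>an analytic_at_imp_isCont by blast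
    qed
    then have "continuous_on K (\<lambda>z. (1 + cmod z) powr b * cmod (\<psi> z))"
      by (intro continuous_intros) (auto simp: add_nonneg_eq_0_iff)
    then have "bounded ((\<lambda>z. (1 + cmod z) powr b * cmod (\<psi> z)) ` K)"
      using K compact_continuous_image compact_imp_bounded by blast
    then obtain B where "B > 0" "\<And>z. z \<in> K \<Longrightarrow> norm ((1 + cmod z) powr b * cmod (\<psi> z)) \<le> B"
      unfolding bounded_pos by blast
    then show ?thesis using that[of B] by (auto simp: K_def)
  qed
  define C1 where "C1 = max B0 B1"
  have C1: "0 \<le> C1" using B1(1) by (simp add: C1_def)
  have \<psi>b: "cmod (\<psi> z) \<le> C1 * weight b z" if "z \<in> \<Omega>" "c \<le> grid z \<or> z \<notin> unit_cell" for z
    unfolding wconv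
  proof (cases "z \<in> closure unit_cell")
    case True
    then have "c \<le> grid z" using that(2) grid_frontier c by force
    then show "(1 + cmod z) powr b * cmod (\<psi> z) \<le> C1" using B1(2)[OF True] by (simp add: C1_def)
  next
    case False
    then show "(1 + cmod z) powr b * cmod (\<psi> z) \<le> C1" using B0[of z] that by (simp add: C1_def)
  qed
  define W where "W = infsum (weight b) period_lattice"
  have W: "(weight b has_sum W) period_lattice" unfolding W_def by (rule has_sum_infsum[OF summable_weight[OF b]])
  have W0: "0 \<le> W" unfolding W_def by (rule infsum_nonneg) simp
  have bnd_near: "cmod (\<psi> (z + m)) \<le> C1 * ((1 + cmod z) powr b * weight b m)"
    if "z + m \<in> \<Omega>" "c \<le> grid (z + m) \<or> z + m \<notin> unit_cell" for z m
    using order_trans[OF \<psi>b[OF that] mult_left_mono[OF weight_add[of b z m] C1]] b by simp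
  have sumU: "((\<lambda>m. \<psi> (z + m)) has_sum \<phi> z) period_lattice" if "z \<in> U0" for z
  proof -
    have "\<not> is_pole \<psi> (z - m)" if "m \<in> period_lattice" for m
      using c(2)[of "z - m"] grid_shift[OF period_lattice_minus[OF that], of z] \<open>z \<in> U0\<close> by (auto simp: U0_def)
    from sumd[OF this] show ?thesis using has_sum_lattice_uminus[of "\<lambda>m. \<psi> (z + m)"] by simp
  qed
  have \<phi>b: "cmod (\<phi> z) \<le> C1 * ((1 + cmod z) powr b * W)" if z: "z \<in> \<Omega>" "z \<in> U0" for z
  proof (rule norm_infsum_le)
    show "((\<lambda>m. \<psi> (z + m)) has_sum \<phi> z) period_lattice" by (rule sumU[OF z(2)])
    show "((\<lambda>m. C1 * ((1 + cmod z) powr b * weight b m)) has_sum C1 * ((1 + cmod z) powr b * W)) period_lattice"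
      by (intro has_sum_cmult_right W)
    fix m assume m: "m \<in> period_lattice"
    show "norm (\<psi> (z + m)) \<le> C1 * ((1 + cmod z) powr b * weight b m)"
      using z m by (intro bnd_near) (auto simp: Omega_shift grid_shift U0_def)
  qed
  \<comment> \<open>The lattice sum keeps \<open>\<phi>\<close> bounded near the point, which rules
    out a pole. The base \<open>2 + cmod z\<close> comes from \<open>cmod w \<le> 1 + cmod z\<close>
    in a ball of radius at most 1.\<close>
  have nopole: "\<not> is_pole \<phi> z" if z: "z \<in> \<Omega>" "z \<in> U0" for z
  proof
    assume "is_pole \<phi> z"
    then have inf: "filterlim \<phi> at_infinity (at z)" by (simp add: is_pole_def)
    obtain r where r: "r > 0" "ball z r \<subseteq> \<Omega> \<inter> U0" using z open_Omega oU0 openE[of "\<Omega> \<inter> U0" z] by blast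
    define B where "B = C1 * ((2 + cmod z) powr b * W)"
    have "eventually (\<lambda>w. norm (\<phi> w) \<ge> B + 1) (at z)" using inf by (rule filterlim_at_infinity_imp_norm_at_top[THEN filterlim_at_top[THEN iffD1], rule_format])
    moreover have "eventually (\<lambda>w. w \<in> ball z (min r 1)) (at z)" using r(1) by (intro eventually_at_in_open') auto
    ultimately have "eventually (\<lambda>w. False) (at z)"
    proof eventually_elim
      case (elim w)
      have "cmod w \<le> 1 + cmod z" using elim(2) norm_triangle_sub[of w z] by (auto simp: dist_norm norm_minus_commute)
      then have "C1 * ((1 + cmod w) powr b * W) \<le> B" unfolding B_def using C1 W0 b
        by (intro mult_left_mono mult_right_mono powr_mono2) auto
      then show False using elim \<phi>b[of w] r by (auto simp: subset_eq)
    qed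
    then show False by simp
  qed
  have \<phi>nz: "\<phi> z \<noteq> 0" if "z \<in> \<Omega>" "z \<in> U0" for z
    using nopole[OF that] nz[of z] that(1) closure_subset by blast
  define G where "G = (\<lambda>z. inverse (\<phi> z))"
  have Gn: "G nicely_meromorphic_on UNIV" unfolding G_def by (rule nicely_meromorphic_on_inverse[OF \<phi>n])
  \<comment> \<open>At a pole of \<open>\<phi>\<close> the reciprocal tends to 0, and elsewhere on
    \<open>closure \<Omega>\<close> the function \<open>\<phi>\<close> does not vanish. Analyticity
    up to the closure is what the compactness argument for the bound on \<open>G\<close>
    needs.\<close>
  have Gan: "G analytic_on {z}" if z: "z \<in> closure \<Omega>" for z
  proof (rule nicely_meromorphic_on_imp_analytic_at[OF Gn])
    show "\<not> is_pole G z"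
    proof
      assume p: "is_pole G z"
      have "\<exists>l. (G \<longlongrightarrow> l) (at z)"
      proof (cases "is_pole \<phi> z")
        case True
        then have "(G \<longlongrightarrow> 0) (at z)" unfolding G_def is_pole_def by (rule tendsto_inverse_0[THEN filterlim_compose])
        then show ?thesis by blast
      next
        case False
        then have "\<phi> z \<noteq> 0" using nz z by blast
        moreover have "isCont \<phi> z" using \<phi>an[OF False] analytic_at_imp_isCont by blast
        ultimately have "(G \<longlongrightarrow> inverse (\<phi> z)) (at z)" unfolding G_def by (intro tendsto_inverse) (auto simp: isCont_def)
        then show ?thesis by blast
      qed
      then show False using p not_tendsto_and_filterlim_at_infinity[of "at z" G] by (auto simp: is_pole_def)
    qed
  qed simp
  have Ghol: "G holomorphic_on \<Omega>" using Gan closure_subset[of \<Omega>] by (meson analytic_imp_holomorphic analytic_on_analytic_at subsetD)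
  have Gper: "G (z + m) = G z" if "m \<in> period_lattice" for z m using perL[OF that] by (simp add: G_def)
  obtain MG where MG: "MG \<ge> 0" "\<And>z. z \<in> \<Omega> \<Longrightarrow> cmod (G z) \<le> MG"
  proof -
    \<comment> \<open>One period of \<open>closure \<Omega>\<close> is compact; periodicity of
      \<open>G\<close> spreads the bound over \<Omega>.\<close>
    define K where "K = closure \<Omega> \<inter> closure unit_cell"
    have K: "compact K" unfolding K_def unit_cell_box by (simp add: compact_closure bounded_box closed_Int_compact)
    have "continuous_on K G"
      by (rule continuous_at_imp_continuous_on) (auto simp: K_def intro: analytic_at_imp_isCont Gan)
    then have "bounded (G ` K)" using K compact_continuous_image compact_imp_bounded by blast
    then obtain B where B: "B > 0" "\<And>z. z \<in> K \<Longrightarrow> cmod (G z) \<le> B" unfolding bounded_pos by blast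
    have "cmod (G z) \<le> B" if "z \<in> \<Omega>" for z
    proof -
      have "tr z \<in> K" using that tr_in_Omega[of z] closure_subset[of \<Omega>] tr_bounds[of z] by (auto simp: K_def closure_unit_cell less_imp_le)
      moreover have "G (tr z) = G z" using Gper[of "cell_index z" "tr z"] tr_decomp[of z] by simp
      ultimately show ?thesis using B(2)[of "tr z"] by simp
    qed
    then show ?thesis using that[of B] B(1) by simp
  qed
  \<comment> \<open>For \<open>z\<close> in the unit cell, omitting \<open>m = 0\<close> leaves only
    arguments outside that cell, where \<open>\<psi>\<close> has no poles.\<close>
  define S where "S = (\<lambda>z. \<Sum>\<^sub>\<infinity>m\<in>period_lattice - {0}. \<psi> (z + m))"
  have notQ: "z + m \<notin> unit_cell" if "m \<in> period_lattice - {0}" "tr z = z" for z m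
  proof
    assume "z + m \<in> unit_cell"
    then have "cell_index (z + m) = 0" by (intro cell_index_unit) (auto simp: unit_cell_def)
    moreover have "cell_index z = 0" using that(2) tr_eq[of z] by simp
    ultimately show False using that(1) by (simp add: cell_index_add)
  qed
  have trQ: "tr z = z" if "z \<in> unit_cell" for z
    using that cell_index_unit[of z] by (simp add: tr_eq unit_cell_def)
  \<comment> \<open>3 bounds \<open>1 + cmod z\<close> on the unit cell.\<close>
  define C3 where "C3 = C1 * 3 powr b"
  have C3: "0 \<le> C3" using C1 by (simp add: C3_def)
  have \<psi>off: "cmod (\<psi> (z + m)) \<le> C3 * weight b m" if "z \<in> \<Omega>" "z \<in> unit_cell" "m \<in> period_lattice - {0}" for z m
  proof -
    have "cmod z \<le> 2" using cmod_tr_le[of z] trQ[OF that(2)] by simp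
    then have "C1 * ((1 + cmod z) powr b * weight b m) \<le> C1 * (3 powr b * weight b m)"
      using C1 b by (intro mult_left_mono mult_right_mono powr_mono2) auto
    moreover have "cmod (\<psi> (z + m)) \<le> C1 * ((1 + cmod z) powr b * weight b m)"
      using that notQ[OF that(3) trQ[OF that(2)]] by (intro bnd_near) (auto simp: Omega_shift)
    ultimately show ?thesis by (simp add: C3_def mult.assoc)
  qed
  have wsum0: "weight b summable_on (period_lattice - {0})"
    using summable_on_subset_banach[OF summable_weight[OF b]] by blast
  have Msum: "(\<lambda>m. C3 * weight b m) summable_on (period_lattice - {0})"
    by (rule summable_on_cmult_right[OF wsum0])
  have Ssum: "((\<lambda>m. \<psi> (z + m)) has_sum S z) (period_lattice - {0})" if z: "z \<in> \<Omega>" "z \<in> unit_cell" for z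
    unfolding S_def
  proof (rule has_sum_infsum, rule abs_summable_summable, rule summable_on_comparison_test[OF Msum])
    show "norm (\<psi> (z + m)) \<le> C3 * weight b m" if "m \<in> period_lattice - {0}" for m by (rule \<psi>off[OF z that])
  qed simp
  have Sb: "cmod (S z) \<le> C3 * W" if z: "z \<in> \<Omega>" "z \<in> unit_cell" for z
  proof -
    have "norm (S z) \<le> infsum (\<lambda>m. C3 * weight b m) (period_lattice - {0})"
      by (rule norm_infsum_le[OF Ssum[OF z] has_sum_infsum[OF Msum]]) (rule \<psi>off[OF z])
    also have "\<dots> \<le> infsum (\<lambda>m. C3 * weight b m) period_lattice"
      by (rule infsum_mono2[OF Msum]) (use C3 in \<open>auto intro: summable_on_cmult_right summable_weight[OF b]\<close>)
    also have "\<dots> = C3 * W" unfolding W_def by (rule infsum_cmult_right) (use summable_weight[OF b] in auto)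
    finally show ?thesis .
  qed
  have Shol: "S holomorphic_on (\<Omega> \<inter> unit_cell)"
    unfolding S_def
  proof (rule holomorphic_on_infsum)
    show o: "open (\<Omega> \<inter> unit_cell)" using open_Omega by auto
    fix m assume m: "m \<in> period_lattice - {0}"
    show "(\<lambda>z. \<psi> (z + m)) holomorphic_on \<Omega> \<inter> unit_cell"
    proof -
      have "\<psi> analytic_on {z + m}" if "z \<in> \<Omega> \<inter> unit_cell" for z
        using notQ[OF m trQ[of z]] that polQ by (intro \<psi>an) auto
      then have "\<psi> holomorphic_on ((\<lambda>z. z + m) ` (\<Omega> \<inter> unit_cell))"
        by (intro analytic_imp_holomorphic, subst analytic_on_analytic_at) blast
      then have "(\<psi> \<circ> (\<lambda>z. z + m)) holomorphic_on \<Omega> \<inter> unit_cell"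
        by (intro holomorphic_on_compose holomorphic_intros)
      then show ?thesis by (simp add: comp_def)
    qed
  next
    fix z assume "z \<in> \<Omega> \<inter> unit_cell"
    moreover have "open (\<Omega> \<inter> unit_cell)" using open_Omega by auto
    ultimately obtain d where "d > 0" "cball z d \<subseteq> \<Omega> \<inter> unit_cell" unfolding open_contains_cball by blast
    then show "\<exists>d>0. \<exists>M. cball z d \<subseteq> \<Omega> \<inter> unit_cell \<and> M summable_on period_lattice - {0} \<and>
        (\<forall>i\<in>period_lattice - {0}. \<forall>w\<in>cball z d. cmod (\<psi> (w + i)) \<le> M i)"
      using Msum \<psi>off by (intro exI[of _ d] conjI exI[of _ "\<lambda>m. C3 * weight b m"]) auto
  qed
  \<comment> \<open>At a pole of \<open>\<psi>\<close> the product \<open>\<psi> z * G z\<close>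
    would take the conventional value 0; inside the cell the summand for \<open>m = 0\<close> is
    therefore expressed through the other ones.\<close>
  define R where "R = (\<lambda>z. if z \<in> unit_cell then 1 - G z * S z else \<psi> z * G z)"
  \<comment> \<open>Where the full series for \<open>\<phi>\<close> is available, \<open>S\<close>
    equals \<open>\<phi> - \<psi>\<close> and the two formulas agree; this glues them across the
    edges of the cell.\<close>
  have RU: "R z = \<psi> z * G z" if z: "z \<in> \<Omega>" "z \<in> U0" for z
  proof (cases "z \<in> unit_cell")
    case True
    have "((\<lambda>m. \<psi> (z + m)) has_sum (\<phi> z - \<psi> z)) (period_lattice - {0})"
      using has_sum_Diff[OF sumU[OF z(2)], of "{0}" "\<psi> z"] has_sum_finite[of "{0}" "\<lambda>m. \<psi> (z + m)"] by simp
    then have "S z = \<phi> z - \<psi> z" using Ssum[OF z(1) True] has_sum_unique by blast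
    then show ?thesis using \<phi>nz[OF z] True by (simp add: R_def G_def field_simps)
  qed (simp add: R_def)
  have Rhol: "R holomorphic_on \<Omega>"
  proof -
    have "R holomorphic_on (\<Omega> \<inter> unit_cell)"
      by (rule holomorphic_transform[of "\<lambda>z. 1 - G z * S z"])
        (auto simp: R_def intro!: holomorphic_intros Shol holomorphic_on_subset[OF Ghol])
    moreover have "R holomorphic_on (\<Omega> \<inter> (U0 \<union> - closure unit_cell))"
    proof (rule holomorphic_transform[of "\<lambda>z. \<psi> z * G z"])
      have "\<psi> analytic_on (\<Omega> \<inter> (U0 \<union> - closure unit_cell))"
      proof (subst analytic_on_analytic_at, rule ballI)
        fix z assume z: "z \<in> \<Omega> \<inter> (U0 \<union> - closure unit_cell)"
        have "\<not> is_pole \<psi> z" using z c(2)[of z] polQ closure_subset[of unit_cell] by (auto simp: U0_def)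
        then show "\<psi> analytic_on {z}" by (rule \<psi>an)
      qed
      then show "(\<lambda>z. \<psi> z * G z) holomorphic_on \<Omega> \<inter> (U0 \<union> - closure unit_cell)"
        by (intro holomorphic_intros analytic_imp_holomorphic holomorphic_on_subset[OF Ghol]) auto
      fix z assume z: "z \<in> \<Omega> \<inter> (U0 \<union> - closure unit_cell)"
      show "\<psi> z * G z = R z"
      proof (cases "z \<in> U0")
        case True then show ?thesis using RU[of z] z by simp
      next
        case False
        then have "z \<notin> unit_cell" using z closure_subset[of unit_cell] by auto
        then show ?thesis by (simp add: R_def)
      qed
    qed
    \<comment> \<open>A point of \<Omega> on the frontier of the unit cell has \<open>grid\<close>
      equal to 1 and so lies in \<open>U0\<close>; hence the two open pieces cover \<Omega>.\<close>
    moreover have "\<Omega> = (\<Omega> \<inter> unit_cell) \<union> (\<Omega> \<inter> (U0 \<union> - closure unit_cell))"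
      using grid_frontier c(1) by (force simp: U0_def)
    moreover have "open (\<Omega> \<inter> unit_cell)" "open (\<Omega> \<inter> (U0 \<union> - closure unit_cell))"
      using open_Omega oU0 by auto
    ultimately show ?thesis using holomorphic_on_Un by metis
  qed
  define C where "C = C1 * MG + (1 + MG * (C3 * W)) * 3 powr b"
  have pos: "0 \<le> C1 * MG" "0 \<le> (1 + MG * (C3 * W)) * 3 powr b" using C1 MG(1) C3 W0 by auto
  have Rb: "cmod (R z) \<le> C * weight b z" if z: "z \<in> \<Omega>" for z
  proof (cases "z \<in> unit_cell")
    case False
    have "cmod (R z) \<le> (C1 * weight b z) * MG"
      unfolding R_def using False z by (simp add: norm_mult) (intro mult_mono \<psi>b MG(2), auto simp: C1)
    also have "\<dots> = (C1 * MG) * weight b z" by simp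
    also have "\<dots> \<le> C * weight b z" unfolding C_def by (rule mult_right_mono) (use pos in auto)
    finally show ?thesis .
  next
    case True
    have "cmod (R z) \<le> 1 + cmod (G z * S z)"
      unfolding R_def using True norm_triangle_ineq4[of 1 "G z * S z"] by simp
    also have "\<dots> \<le> 1 + MG * (C3 * W)"
      unfolding norm_mult using MG Sb[OF z True] z by (intro add_left_mono mult_mono) auto
    also have "\<dots> \<le> (1 + MG * (C3 * W)) * (3 powr b * weight b z)"
    proof -
      have "1 + cmod z \<le> 3" using cmod_tr_le[of z] trQ[OF True] by simp
      then have "3 powr (- b) \<le> weight b z" unfolding weight_def using b by (intro powr_mono2') (auto simp: add_pos_nonneg)
      then have "3 powr b * 3 powr (- b) \<le> 3 powr b * weight b z" by (intro mult_left_mono) auto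
      then have "1 \<le> 3 powr b * weight b z" by (simp add: powr_minus)
      moreover have "0 \<le> 1 + MG * (C3 * W)" using MG(1) C3 W0 by auto
      ultimately show ?thesis using mult_left_mono[of 1 "3 powr b * weight b z" "1 + MG * (C3 * W)"] by simp
    qed
    also have "\<dots> = ((1 + MG * (C3 * W)) * 3 powr b) * weight b z" by simp
    also have "\<dots> \<le> C * weight b z" unfolding C_def by (rule mult_right_mono) (use pos in auto)
    finally show ?thesis .
  qed
  \<comment> \<open>In the open cell the terms with \<open>m \<noteq> 0\<close> add up to
    \<open>S z * G z\<close> and the remaining term complements them. On an edge all terms are
    quotients, and the series for \<open>\<phi>\<close> applies.\<close>
  have Rsum_tr: "((\<lambda>m. R (z + m)) has_sum 1) period_lattice" if z: "z \<in> \<Omega>" "tr z = z" for z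
  proof (cases "z \<in> unit_cell")
    case True
    have "((\<lambda>m. \<psi> (z + m) * G z) has_sum S z * G z) (period_lattice - {0})"
      by (intro has_sum_cmult_left Ssum z True)
    then have 1: "((\<lambda>m. R (z + m)) has_sum S z * G z) (period_lattice - {0})"
      by (subst has_sum_cong[where g = "\<lambda>m. \<psi> (z + m) * G z"]) (use notQ[OF _ z(2)] in \<open>auto simp: R_def Gper\<close>)
    have "((\<lambda>m. R (z + m)) has_sum (R z + S z * G z)) (insert 0 (period_lattice - {0}))"
      using has_sum_insert[OF _ 1, of 0] by simp
    moreover have "insert 0 (period_lattice - {0}) = period_lattice" by auto
    moreover have "R z + S z * G z = 1" using True by (simp add: R_def)
    ultimately show ?thesis by simp
  next
    case False
    then have zU: "z \<in> U0" using z tr_bounds[of z] c(1) grid_frontier[of z] by (auto simp: U0_def closure_unit_cell less_imp_le)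
    have "((\<lambda>m. \<psi> (z + m) * G z) has_sum \<phi> z * G z) period_lattice"
      by (intro has_sum_cmult_left sumU zU)
    then have "((\<lambda>m. R (z + m)) has_sum \<phi> z * G z) period_lattice"
      by (subst has_sum_cong[where g = "\<lambda>m. \<psi> (z + m) * G z"])
        (use z zU RU in \<open>auto simp: Gper U0_def grid_shift Omega_shift\<close>)
    then show ?thesis using \<phi>nz[OF z(1) zU] by (simp add: G_def)
  qed
  have Rsum: "((\<lambda>m. R (z + m)) has_sum 1) period_lattice" if z: "z \<in> \<Omega>" for z
  proof -
    have "((\<lambda>m. R (tr z + m)) has_sum 1) period_lattice"
      using z tr_in_Omega[of z] by (intro Rsum_tr) (auto simp: tr_tr)
    then have "((\<lambda>m. R (tr z + (m + cell_index z))) has_sum 1) period_lattice"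
      using has_sum_lattice_shift[of "cell_index z" "\<lambda>m. R (tr z + m)"] by simp
    moreover have "tr z + (m + cell_index z) = z + m" for m by (simp add: tr_eq)
    ultimately show ?thesis by simp
  qed
  show ?thesis using that[of b C R] b pos Rhol Rb Rsum by (simp add: C_def)
qed

end

section \<open>Strong measurability\<close>

lemma complete_measure_lebesgue_on: "S \<in> sets lebesgue \<Longrightarrow> complete_measure (lebesgue_on S)"
proof
  fix A B assume S: "S \<in> sets lebesgue" and B: "B \<subseteq> A" and A: "A \<in> null_sets (lebesgue_on S)"
  have "A \<in> null_sets lebesgue" using A S by (simp add: null_sets_restrict_space)
  then have "B \<in> null_sets lebesgue" using B completion.complete2 by blast
  moreover have "A \<subseteq> S" using A S by (simp add: null_sets_restrict_space)
  ultimately show "B \<in> sets (lebesgue_on S)" using B S by (auto simp: sets_restrict_space_iff)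
qed

lemma (in complete_measure) measurable_cong_AE:
  assumes f: "f \<in> measurable M K" and ae: "AE x in M. f x = g x" and g: "g \<in> space M \<rightarrow> space K"
  shows "g \<in> measurable M K"
proof (rule measurableI)
  fix A assume A: "A \<in> sets K"
  define N where "N = {x \<in> space M. f x \<noteq> g x}"
  have N: "N \<in> null_sets M" using ae by (simp add: AE_iff_null_sets N_def)
  have "g -` A \<inter> space M = (f -` A \<inter> space M - N) \<union> (g -` A \<inter> N)"
    by (auto simp: N_def)
  moreover have "g -` A \<inter> N \<in> sets M" by (rule complete[OF _ N]) auto
  moreover have "f -` A \<inter> space M - N \<in> sets M" using measurable_sets[OF f A] N by auto
  ultimately show "g -` A \<inter> space M \<in> sets M" by simp
qed (use g in auto)

text \<open>Completeness allows the limit to be prescribed only almost everywhere, which is all that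
  strong measurability provides.\<close>

lemma (in complete_measure) borel_measurable_AE_LIMSEQ:
  fixes u :: "nat \<Rightarrow> 'a \<Rightarrow> 'b::{banach, second_countable_topology}"
  assumes u: "\<And>n. u n \<in> borel_measurable M" and lim: "AE x in M. (\<lambda>n. u n x) \<longlonglongrightarrow> v x"
  shows "v \<in> borel_measurable M"
proof (rule measurable_cong_AE)
  show "(\<lambda>x. lim (\<lambda>n. u n x)) \<in> borel_measurable M" using u by measurable
  show "AE x in M. lim (\<lambda>n. u n x) = v x" using lim by eventually_elim (simp add: limI)
qed auto

text \<open>A simple function has finitely many values, so a map that also depends on the parameter
  directly, such as \<open>P_eta \<omega> \<eta>\<close> applied to \<open>s \<eta>\<close>, has to
  be measurable only for each fixed value.\<close>

lemma simple_function_compose_measurable: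
  assumes s: "simple_function N s" and h: "\<And>v. v \<in> s ` space N \<Longrightarrow> h v \<in> measurable N K"
  shows "(\<lambda>\<eta>. h (s \<eta>) \<eta>) \<in> measurable N K"
proof (rule measurable_compose_countable'[where I = "s ` space N"])
  have fin: "finite (s ` space N)" using s by (simp add: simple_function_def)
  show "s \<in> measurable N (count_space (s ` space N))"
    unfolding measurable_count_space_eq2[OF fin] using s by (auto simp: simple_function_def)
  show "countable (s ` space N)" using fin by (rule countable_finite)
qed (use h in auto)

text \<open>\<open>A\<close> may vary with the parameter, so that distances between partial Floquet
  sums and the transform are covered. Simple approximations of \<open>F\<close> reduce the claim to
  a fixed second argument.\<close>

lemma strongly_measurable_norm:
  assumes N: "complete_measure N" and S: "S \<subseteq> L2 M" and F: "\<And>\<eta>. \<eta> \<in> space N \<Longrightarrow> F \<eta> \<in> L2 M"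
    and sm: "strongly_measurable N M S F"
    and A: "\<And>\<eta>. \<eta> \<in> space N \<Longrightarrow> A \<eta> \<in> L2 M" "\<And>v. v \<in> S \<Longrightarrow> (\<lambda>\<eta>. L2_norm M (A \<eta> - v)) \<in> borel_measurable N"
  shows "(\<lambda>\<eta>. L2_norm M (A \<eta> - F \<eta>)) \<in> borel_measurable N"
proof -
  interpret complete_measure N by (rule N)
  obtain s where s: "\<And>n. simple_function N (s n)" "\<And>n \<eta>. \<eta> \<in> space N \<Longrightarrow> s n \<eta> \<in> S"
    and lim: "AE \<eta> in N. (\<lambda>n. L2_norm M (s n \<eta> - F \<eta>)) \<longlonglongrightarrow> 0"
    using sm unfolding strongly_measurable_def by blast
  show ?thesis
  proof (rule borel_measurable_AE_LIMSEQ)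
    show "(\<lambda>\<eta>. L2_norm M (A \<eta> - s n \<eta>)) \<in> borel_measurable N" for n
      by (rule simple_function_compose_measurable[OF s(1), where h = "\<lambda>v \<eta>. L2_norm M (A \<eta> - v)"]) (use s(2) A(2) in auto)
    show "AE \<eta> in N. (\<lambda>n. L2_norm M (A \<eta> - s n \<eta>)) \<longlonglongrightarrow> L2_norm M (A \<eta> - F \<eta>)"
      using lim AE_space
    proof eventually_elim
      case (elim \<eta>)
      have "s n \<eta> \<in> L2 M" for n using s(2)[OF elim(2)] S by blast
      from tendsto_L2_norm[OF this F[OF elim(2)] A(1)[OF elim(2)] elim(1)] show ?case
        by (simp add: L2_norm_minus_commute[of M "A \<eta>"])
    qed
  qed
qed

lemma strongly_measurable_norm_const:
  assumes "complete_measure N" "S \<subseteq> L2 M" "\<And>\<eta>. \<eta> \<in> space N \<Longrightarrow> F \<eta> \<in> L2 M"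
    "strongly_measurable N M S F" "v \<in> L2 M"
  shows "(\<lambda>\<eta>. L2_norm M (F \<eta> - v)) \<in> borel_measurable N"
  using strongly_measurable_norm[OF assms(1-4), of "\<lambda>_. v"] assms(5)
  by (simp add: L2_norm_minus_commute[of M v])

lemma strongly_measurable_inner:
  assumes N: "complete_measure N" and S: "S \<subseteq> L2 M" and F: "\<And>\<eta>. \<eta> \<in> space N \<Longrightarrow> F \<eta> \<in> L2 M"
    and sm: "strongly_measurable N M S F" and v: "v \<in> L2 M"
  shows "(\<lambda>\<eta>. L2_inner M (F \<eta>) v) \<in> borel_measurable N"
proof -
  interpret complete_measure N by (rule N)
  obtain s where s: "\<And>n. simple_function N (s n)" "\<And>n \<eta>. \<eta> \<in> space N \<Longrightarrow> s n \<eta> \<in> S"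
    and lim: "AE \<eta> in N. (\<lambda>n. L2_norm M (s n \<eta> - F \<eta>)) \<longlonglongrightarrow> 0"
    using sm unfolding strongly_measurable_def by blast
  show ?thesis
  proof (rule borel_measurable_AE_LIMSEQ)
    show "(\<lambda>\<eta>. L2_inner M (s n \<eta>) v) \<in> borel_measurable N" for n
      by (rule simple_function_compose_measurable[OF s(1), where h = "\<lambda>w \<eta>. L2_inner M w v"]) auto
    show "AE \<eta> in N. (\<lambda>n. L2_inner M (s n \<eta>) v) \<longlonglongrightarrow> L2_inner M (F \<eta>) v"
      using lim AE_space
    proof eventually_elim
      case (elim \<eta>)
      have "s n \<eta> \<in> L2 M" for n using s(2)[OF elim(2)] S by blast
      from tendsto_L2_inner[OF this F[OF elim(2)] v elim(1)] show ?case .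
    qed
  qed
qed

text \<open>Pettis: approximate by the nearest among the first \<open>n\<close> points of a countable dense set.\<close>

lemma strongly_measurable_of_separable:
  assumes S: "D \<subseteq> S" and D: "countable D"
    and dense: "\<And>\<eta> e. \<eta> \<in> space N \<Longrightarrow> 0 < e \<Longrightarrow> \<exists>d\<in>D. L2_norm M (F \<eta> - d) < e"
    and meas: "\<And>d. d \<in> D \<Longrightarrow> (\<lambda>\<eta>. L2_norm M (F \<eta> - d)) \<in> borel_measurable N"
  shows "strongly_measurable N M S F"
proof (cases "space N = {}")
  case True
  then show ?thesis unfolding strongly_measurable_def
    by (intro exI[of _ "\<lambda>n \<eta>. undefined"]) (auto simp: simple_function_def AE_I2)
next
  case False
  have Dne: "D \<noteq> {}" using False dense[of _ 1] by fastforce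
  define d where "d = from_nat_into D"
  have d: "d n \<in> D" for n using from_nat_into[OF Dne] by (simp add: d_def)
  define g where "g = (\<lambda>i \<eta>. L2_norm M (F \<eta> - d i))"
  have [measurable]: "g i \<in> borel_measurable N" for i unfolding g_def by (rule meas[OF d])
  \<comment> \<open>Several points may be nearest; \<open>LEAST\<close> breaks ties in a measurable
    way.\<close>
  define j where "j = (\<lambda>n \<eta>. LEAST j. j \<le> n \<and> (\<forall>i\<in>{..n}. g j \<eta> \<le> g i \<eta>))"
  have jm: "j n \<in> measurable N (count_space UNIV)" for n unfolding j_def by measurable
  have j: "j n \<eta> \<le> n \<and> (\<forall>i\<in>{..n}. g (j n \<eta>) \<eta> \<le> g i \<eta>)" for n \<eta>
    unfolding j_def
  proof (rule LeastI_ex)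
    have "Min ((\<lambda>i. g i \<eta>) ` {..n}) \<in> (\<lambda>i. g i \<eta>) ` {..n}" by (intro Min_in) auto
    then obtain k where k: "k \<in> {..n}" "Min ((\<lambda>i. g i \<eta>) ` {..n}) = g k \<eta>" by (rule imageE)
    have "g k \<eta> \<le> g i \<eta>" if "i \<in> {..n}" for i
      unfolding k(2)[symmetric] using that by (intro Min_le) auto
    with k(1) show "\<exists>j\<le>n. \<forall>i\<in>{..n}. g j \<eta> \<le> g i \<eta>" by (intro exI[of _ k]) auto
  qed
  have js: "simple_function N (j n)" for n
    unfolding simple_function_def
  proof (intro conjI ballI)
    have "j n ` space N \<subseteq> {..n}" using j by auto
    then show "finite (j n ` space N)" by (rule finite_subset) simp
    show "j n -` {x} \<inter> space N \<in> sets N" for x using measurable_sets[OF jm, of "{x}"] by simp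
  qed
  show ?thesis unfolding strongly_measurable_def
  proof (intro exI[of _ "\<lambda>n \<eta>. d (j n \<eta>)"] conjI allI ballI AE_I2)
    show "simple_function N (\<lambda>\<eta>. d (j n \<eta>))" for n by (rule simple_function_compose1[OF js])
    show "d (j n \<eta>) \<in> S" for n \<eta> using d S by blast
    fix \<eta> assume \<eta>: "\<eta> \<in> space N"
    show "(\<lambda>n. L2_norm M (d (j n \<eta>) - F \<eta>)) \<longlonglongrightarrow> 0"
    proof (rule LIMSEQ_I)
      fix e :: real assume "e > 0"
      from dense[OF \<eta> this] obtain x where "x \<in> D" "L2_norm M (F \<eta> - x) < e" by blast
      moreover obtain k where "d k = x" using from_nat_into_surj[OF D \<open>x \<in> D\<close>] by (auto simp: d_def)
      ultimately have k: "g k \<eta> < e" by (simp add: g_def)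
      have "norm (L2_norm M (d (j n \<eta>) - F \<eta>) - 0) < e" if "n \<ge> k" for n
      proof -
        have "g (j n \<eta>) \<eta> \<le> g k \<eta>" using j[of n \<eta>] that by auto
        then show ?thesis using k by (simp add: g_def L2_norm_minus_commute[of M _ "F \<eta>"])
      qed
      then show "\<exists>n0. \<forall>n\<ge>n0. norm (L2_norm M (d (j n \<eta>) - F \<eta>) - 0) < e" by blast
    qed
  qed
qed

section \<open>Closures of subspaces and metric properties of projections\<close>

context L2_closed_subspace
begin

lemma closure_subspace:
  assumes E: "E \<subseteq> W" "(\<lambda>x. 0) \<in> E"
    and Eadd: "\<And>f g. f \<in> E \<Longrightarrow> g \<in> E \<Longrightarrow> (\<lambda>x. f x + g x) \<in> E"
    and Escale: "\<And>c f. f \<in> E \<Longrightarrow> (\<lambda>x. c * f x) \<in> E"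
  shows "L2_closed_subspace M {f \<in> W. \<forall>\<epsilon>>0. \<exists>g\<in>E. L2_norm M (f - g) < \<epsilon>}"
proof -
  define V where "V = {f \<in> W. \<forall>\<epsilon>>0. \<exists>g\<in>E. L2_norm M (f - g) < \<epsilon>}"
  have L: "f \<in> L2 M" if "f \<in> W" for f using that sub by blast
  have EW: "f \<in> W" if "f \<in> E" for f using that E by blast
  have "L2_closed_subspace M V"
  proof
    show "V \<subseteq> L2 M" using sub by (auto simp: V_def)
    show "(\<lambda>x. 0) \<in> V" using zero E(2) L2_norm_diff_self[of M "\<lambda>x. 0"] by (force simp: V_def)
  next
    fix f g assume f: "f \<in> V" and g: "g \<in> V"
    show "(\<lambda>x. f x + g x) \<in> V" unfolding V_def
    proof (intro CollectI conjI allI impI)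
      show "(\<lambda>x. f x + g x) \<in> W" using f g add by (auto simp: V_def)
      fix e :: real assume "e > 0"
      then have "e/2 > 0" by simp
      then obtain c d where c: "c \<in> E" "L2_norm M (f - c) < e/2" and d: "d \<in> E" "L2_norm M (g - d) < e/2"
        using f g unfolding V_def by blast
      have "(\<lambda>x. f x + g x) - (\<lambda>x. c x + d x) = (\<lambda>x. (f - c) x + (g - d) x)" by (simp add: fun_eq_iff)
      then have "L2_norm M ((\<lambda>x. f x + g x) - (\<lambda>x. c x + d x)) < e"
        using L2_norm_triangle[of "f - c" M "g - d"] c d f g L EW by (auto simp: V_def L2_diff)
      then show "\<exists>d\<in>E. L2_norm M ((\<lambda>x. f x + g x) - d) < e" using Eadd[OF c(1) d(1)] by blast
    qed
  next
    fix f c assume f: "f \<in> V"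
    show "(\<lambda>x. c * f x) \<in> V" unfolding V_def
    proof (intro CollectI conjI allI impI)
      show "(\<lambda>x. c * f x) \<in> W" using f scale by (auto simp: V_def)
      fix e :: real assume e: "e > 0"
      then have "e / (cmod c + 1) > 0" by (simp add: add_nonneg_pos)
      then obtain d where d: "d \<in> E" "L2_norm M (f - d) < e / (cmod c + 1)" using f unfolding V_def by blast
      have "(\<lambda>x. c * f x) - (\<lambda>x. c * d x) = (\<lambda>x. c * (f - d) x)" by (simp add: fun_eq_iff algebra_simps)
      then have "L2_norm M ((\<lambda>x. c * f x) - (\<lambda>x. c * d x)) = cmod c * L2_norm M (f - d)" by (simp only: L2_norm_cmult)
      also have "\<dots> \<le> (cmod c + 1) * L2_norm M (f - d)" by (intro mult_right_mono) auto
      also have "\<dots> < (cmod c + 1) * (e / (cmod c + 1))" using d(2) by (intro mult_strict_left_mono) (auto simp: add_nonneg_pos)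
      also have "\<dots> = e" using norm_ge_zero[of c] by (simp add: add_nonneg_eq_0_iff)
      finally show "\<exists>d\<in>E. L2_norm M ((\<lambda>x. c * f x) - d) < e" using Escale[OF d(1)] by blast
    qed
  next
    fix f assume f: "\<And>n. f n \<in> V" and C: "L2_Cauchy M f"
    then obtain g where g: "g \<in> W" "(\<lambda>n. L2_norm M (f n - g)) \<longlonglongrightarrow> 0" using complete by (force simp: V_def)
    have "\<exists>d\<in>E. L2_norm M (g - d) < e" if e: "e > 0" for e
    proof -
      obtain n where n: "L2_norm M (f n - g) < e/2" using LIMSEQ_D[OF g(2), of "e/2"] e by auto
      obtain d where d: "d \<in> E" "L2_norm M (f n - d) < e/2" using f[of n] half_gt_zero[OF e] unfolding V_def by blast
      have fn: "f n \<in> L2 M" using f[of n] L by (auto simp: V_def)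
      have "L2_norm M (g - d) < e"
        using L2_norm_triangle_diff[OF L[OF g(1)] fn L[OF EW[OF d(1)]]] n d(2) L2_norm_minus_commute[of M g "f n"] by simp
      then show ?thesis using d by blast
    qed
    then show "\<exists>g\<in>V. (\<lambda>n. L2_norm M (f n - g)) \<longlonglongrightarrow> 0" using g by (auto simp: V_def)
  qed
  then show ?thesis by (simp add: V_def)
qed

text \<open>Orthogonality makes the inner product of \<open>f - g\<close> with
  \<open>P f - P g\<close> equal to the squared norm of \<open>P f - P g\<close>; Cauchy--Schwarz
  then gives the bound.\<close>

lemma orth_proj_Lipschitz:
  assumes P: "is_orth_proj (L2_inner M) (L2 M) W P" and f: "f \<in> L2 M" and g: "g \<in> L2 M"
  shows "L2_norm M (P f - P g) \<le> L2_norm M (f - g)"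
proof -
  note pf = orth_proj_props[OF P f] and pg = orth_proj_props[OF P g]
  define h where "h = P f - P g"
  have h: "h \<in> W" "h \<in> L2 M" using pf pg diff by (auto simp: h_def)
  have "L2_inner M (f - g) h = L2_inner M h h"
    using pf(2) pf(3)[OF h(1)] pg(2) pg(3)[OF h(1)] f g h by (simp add: L2_inner_diff_left h_def[symmetric]) (simp add: h_def L2_inner_diff_left)
  then have "(L2_norm M h)\<^sup>2 = cmod (L2_inner M (f - g) h)" by (simp add: L2_inner_self norm_power)
  also have "\<dots> \<le> L2_norm M (f - g) * L2_norm M h" using f g h by (intro L2_Cauchy_Schwarz) auto
  finally have "L2_norm M h * L2_norm M h \<le> L2_norm M (f - g) * L2_norm M h" by (simp add: power2_eq_square)
  then show ?thesis
    by (cases "L2_norm M h = 0") (auto simp: h_def mult_le_cancel_right less_le)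
qed

text \<open>The inner product of \<open>P h\<close> with \<open>h\<close> is the squared norm of
  \<open>P h\<close>. Polarization thus recovers inner products from norms of projections, the
  quantities that can be controlled as functions of the parameter.\<close>

lemma orth_proj_polarization:
  assumes P: "is_orth_proj (L2_inner M) (L2 M) W P" and f: "f \<in> L2 M" and d: "d \<in> L2 M"
  shows "4 * Re (L2_inner M (P f) d) = (L2_norm M (P (\<lambda>x. f x + d x)))\<^sup>2 - (L2_norm M (P (f - d)))\<^sup>2"
proof -
  have q: "(L2_norm M (P h))\<^sup>2 = Re (L2_inner M (P h) h)" if h: "h \<in> L2 M" for h
    using orth_proj_props(3,4)[OF P h] orth_proj_props(1,2)[OF P h] h by (metis L2_inner_self Re_complex_of_real)
  have add: "L2_inner M (P (\<lambda>x. f x + d x)) g = L2_inner M (P f) g + L2_inner M (P d) g" if g: "g \<in> L2 M" for g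
    using orth_proj_props(4)[OF P f g] orth_proj_props(4)[OF P d g] orth_proj_props(4)[OF P L2_add[OF f d] g] orth_proj_props(2)[OF P g] f d
    by (simp add: L2_inner_add_left)
  have dif: "L2_inner M (P (f - d)) g = L2_inner M (P f) g - L2_inner M (P d) g" if g: "g \<in> L2 M" for g
    using orth_proj_props(4)[OF P f g] orth_proj_props(4)[OF P d g] orth_proj_props(4)[OF P L2_diff[OF f d] g] orth_proj_props(2)[OF P g] f d
    by (simp add: L2_inner_diff_left)
  have "L2_inner M (P d) f = cnj (L2_inner M (P f) d)"
    using orth_proj_props(4)[OF P d f] by (simp add: L2_inner_commute[of M d "P f"])
  then show ?thesis
    using f d orth_proj_props(2)[OF P f] orth_proj_props(2)[OF P d]
    by (simp add: q L2_add L2_diff add dif L2_inner_add_right L2_inner_diff_right)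
qed

end

lemma L2_bounded_mult:
  assumes f: "f \<in> L2 M" and h: "h \<in> borel_measurable M" and B: "\<And>x. x \<in> space M \<Longrightarrow> cmod (h x) \<le> B" "0 \<le> B"
  shows "(\<lambda>x. f x * h x) \<in> L2 M" "L2_norm M (\<lambda>x. f x * h x) \<le> B * L2_norm M f"
proof -
  have fm [measurable]: "f \<in> borel_measurable M" using f by (rule L2D)
  note h [measurable]
  have bd: "(cmod (f x * h x))\<^sup>2 \<le> B\<^sup>2 * (cmod (f x))\<^sup>2" if "x \<in> space M" for x
    using mult_right_mono[OF power_mono[OF B(1)[OF that], of 2], of "(cmod (f x))\<^sup>2"] by (simp add: norm_mult power_mult_distrib mult.commute)
  have i: "integrable M (\<lambda>x. B\<^sup>2 * (cmod (f x))\<^sup>2)" using L2D(2)[OF f] by simp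
  show L: "(\<lambda>x. f x * h x) \<in> L2 M" unfolding L2_def
  proof (intro CollectI conjI)
    show "integrable M (\<lambda>x. (cmod (f x * h x))\<^sup>2)"
      by (rule Bochner_Integration.integrable_bound[OF i]) (use bd in \<open>auto intro!: AE_I2\<close>)
  qed measurable
  have "(L2_norm M (\<lambda>x. f x * h x))\<^sup>2 \<le> (LINT x|M. B\<^sup>2 * (cmod (f x))\<^sup>2)"
    unfolding L2_norm_sq by (rule integral_mono[OF L2D(2)[OF L] i bd])
  also have "\<dots> = (B * L2_norm M f)\<^sup>2" by (simp add: L2_norm_sq power_mult_distrib)
  finally show "L2_norm M (\<lambda>x. f x * h x) \<le> B * L2_norm M f"
    by (rule power2_le_imp_le) (simp add: B(2))
qed

section \<open>Dependence of the projections on the parameter\<close>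

definition chi :: "real \<times> real \<Rightarrow> complex \<Rightarrow> complex" where
  "chi \<eta> m = cis (fst \<eta> * Re m + snd \<eta> * Im m)"

lemma norm_chi [simp]: "cmod (chi \<eta> m) = 1" by (simp add: chi_def)
lemma chi_zero [simp]: "chi 0 m = 1" "chi \<eta> 0 = 1" by (simp_all add: chi_def)
lemma chi_add: "chi \<eta> (m + n) = chi \<eta> m * chi \<eta> n" by (simp add: chi_def cis_mult algebra_simps)
lemma chi_add_left: "chi (\<eta> + \<theta>) m = chi \<eta> m * chi \<theta> m" by (simp add: chi_def cis_mult algebra_simps)
lemma chi_minus: "chi \<eta> (- m) = cnj (chi \<eta> m)" by (simp add: chi_def cis_cnj)
lemma chi_minus_left: "chi (- \<eta>) m = cnj (chi \<eta> m)" by (simp add: chi_def cis_cnj)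
lemma chi_diff: "chi \<eta> (m - n) = chi \<eta> m * cnj (chi \<eta> n)" using chi_add[of \<eta> m "- n"] by (simp add: chi_minus)
lemma chi_diff_left: "chi (\<eta> - \<theta>) m = chi \<eta> m * cnj (chi \<theta> m)" using chi_add_left[of \<eta> "- \<theta>" m] by (simp add: chi_minus_left)
lemma chi_cnj [simp]: "chi \<eta> m * cnj (chi \<eta> m) = 1" "cnj (chi \<eta> m) * chi \<eta> m = 1"
  by (simp_all add: complex_norm_square[symmetric] mult.commute[of "cnj _"])
lemma chi_one [simp]: "chi \<eta> 1 = cis (fst \<eta>)" "chi \<eta> \<i> = cis (snd \<eta>)" by (simp_all add: chi_def)

lemma continuous_on_chi [continuous_intros]: "continuous_on S (\<lambda>\<eta>. chi \<eta> m)"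
  unfolding chi_def by (intro continuous_intros)

lemma dual_cell_cbox: "dual_cell = cbox (-pi, -pi) (pi, pi)"
  by (simp add: dual_cell_def cbox_Pair_eq)

lemma dual_cell_lmeasurable: "dual_cell \<in> lmeasurable" by (simp add: dual_cell_cbox)
lemma dual_cell_sets [simp]: "dual_cell \<in> sets lebesgue" by (simp add: dual_cell_cbox)

abbreviation "NN \<equiv> lebesgue_on dual_cell"

lemma finite_dual: "finite_measure NN"
  by (rule finite_measure_lebesgue_on[OF dual_cell_lmeasurable])

lemma complete_dual: "complete_measure NN"
  by (rule complete_measure_lebesgue_on) simp

lemma borel_measurable_dual: "f \<in> borel_measurable borel \<Longrightarrow> f \<in> borel_measurable NN"
  by (rule measurable_restrict_space1) (simp add: measurable_completion)

locale cell_partition = doubly_periodic +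
  fixes R :: "complex \<Rightarrow> complex" and C b :: real
  assumes b: "b > 2" and C: "0 \<le> C" and R_hol: "R holomorphic_on \<Omega>"
    and R_bound: "\<And>z. z \<in> \<Omega> \<Longrightarrow> cmod (R z) \<le> C * weight b z"
    and R_sum: "\<And>z. z \<in> \<Omega> \<Longrightarrow> ((\<lambda>m. R (z + m)) has_sum 1) period_lattice"
begin

lemma R_shift_bound:
  assumes z: "z \<in> \<Omega>" "m \<in> period_lattice"
  shows "cmod (R (z + m)) \<le> C * (1 + cmod z) powr b * weight b m"
proof -
  have "cmod (R (z + m)) \<le> C * weight b (z + m)" using z by (intro R_bound) (simp add: Omega_shift)
  also have "\<dots> \<le> C * ((1 + cmod z) powr b * weight b m)" using weight_add[of b z m] b C by (intro mult_left_mono) auto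
  finally show ?thesis by (simp add: mult.assoc)
qed

definition T :: "real \<times> real \<Rightarrow> complex \<Rightarrow> complex" where
  "T \<eta> z = (\<Sum>\<^sub>\<infinity>m\<in>period_lattice. chi \<eta> m * R (z + m))"

lemma T_has_sum:
  assumes z: "z \<in> \<Omega>" shows "((\<lambda>m. chi \<eta> m * R (z + m)) has_sum T \<eta> z) period_lattice"
  unfolding T_def
proof (rule has_sum_infsum, rule abs_summable_summable, rule summable_on_comparison_test)
  show "(\<lambda>m. C * (1 + cmod z) powr b * weight b m) summable_on period_lattice"
    by (rule summable_on_cmult_right[OF summable_weight[OF b]])
  show "norm (chi \<eta> m * R (z + m)) \<le> C * (1 + cmod z) powr b * weight b m" if "m \<in> period_lattice" for m
    using R_shift_bound[OF z that] by (simp add: norm_mult)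
qed simp

lemma T_hol: "T \<eta> holomorphic_on \<Omega>"
  unfolding T_def
proof (rule holomorphic_on_infsum[OF open_Omega])
  fix m assume m: "m \<in> period_lattice"
  have "(\<lambda>z. z + m) ` \<Omega> \<subseteq> \<Omega>" using Omega_shift[OF m] by auto
  then have "(R \<circ> (\<lambda>z. z + m)) holomorphic_on \<Omega>"
    by (intro holomorphic_on_compose holomorphic_intros holomorphic_on_subset[OF R_hol])
  then show "(\<lambda>z. chi \<eta> m * R (z + m)) holomorphic_on \<Omega>" by (auto simp: comp_def intro!: holomorphic_intros)
next
  fix z assume "z \<in> \<Omega>"
  then obtain d where d: "d > 0" "cball z d \<subseteq> \<Omega>" using open_Omega unfolding open_contains_cball by blast
  show "\<exists>d>0. \<exists>M. cball z d \<subseteq> \<Omega> \<and> M summable_on period_lattice \<and> (\<forall>m\<in>period_lattice. \<forall>w\<in>cball z d. cmod (chi \<eta> m * R (w + m)) \<le> M m)"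
  proof (intro exI[of _ d] conjI d exI[of _ "\<lambda>m. C * (1 + cmod z + d) powr b * weight b m"] ballI)
    show "(\<lambda>m. C * (1 + cmod z + d) powr b * weight b m) summable_on period_lattice"
      by (rule summable_on_cmult_right[OF summable_weight[OF b]])
    fix m w assume m: "m \<in> period_lattice" and w: "w \<in> cball z d"
    have "1 + cmod w \<le> 1 + cmod z + d" using w norm_triangle_sub[of w z] by (auto simp: dist_norm norm_minus_commute)
    then have "C * (1 + cmod w) powr b * weight b m \<le> C * (1 + cmod z + d) powr b * weight b m"
      using C b by (intro mult_right_mono mult_left_mono powr_mono2) auto
    then show "cmod (chi \<eta> m * R (w + m)) \<le> C * (1 + cmod z + d) powr b * weight b m"
      using R_shift_bound[of w m] m w d by (auto simp: norm_mult)
  qed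
qed

text \<open>Reindexing of the series. The multiplier is the conjugate one, so that a function with
  multipliers \<open>chi \<eta>0\<close> times \<open>T (\<eta>0 - \<eta>)\<close> has multipliers
  \<open>chi \<eta>\<close>.\<close>

lemma T_shift:
  assumes z: "z \<in> \<Omega>" and k: "k \<in> period_lattice"
  shows "T \<eta> (z + k) = cnj (chi \<eta> k) * T \<eta> z"
proof -
  have "((\<lambda>m. chi \<eta> m * R (z + m)) has_sum T \<eta> z) period_lattice" by (rule T_has_sum[OF z])
  then have "((\<lambda>m. chi \<eta> (m + k) * R (z + (m + k))) has_sum T \<eta> z) period_lattice"
    using has_sum_lattice_shift[OF k, of "\<lambda>m. chi \<eta> m * R (z + m)"] by blast
  then have "((\<lambda>m. cnj (chi \<eta> k) * (chi \<eta> (m + k) * R (z + (m + k)))) has_sum cnj (chi \<eta> k) * T \<eta> z) period_lattice"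
    by (rule has_sum_cmult_right)
  moreover have "cnj (chi \<eta> k) * (chi \<eta> (m + k) * R (z + (m + k))) = chi \<eta> m * R (z + k + m)" for m
  proof -
    have "cnj (chi \<eta> k) * (chi \<eta> (m + k) * R (z + (m + k))) = (cnj (chi \<eta> k) * chi \<eta> k) * (chi \<eta> m * R (z + k + m))"
      by (simp add: chi_add algebra_simps)
    then show ?thesis by simp
  qed
  ultimately have "((\<lambda>m. chi \<eta> m * R (z + k + m)) has_sum cnj (chi \<eta> k) * T \<eta> z) period_lattice" by simp
  then show ?thesis using T_has_sum[of "z + k" \<eta>] z k has_sum_unique by (metis Omega_shift)
qed

text \<open>A majorant for \<open>T \<eta> - 1\<close> on the cell, up to the factor
  \<open>K\<close>. It is independent of the point, continuous in the parameter, and zero at the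
  origin.\<close>

definition tau :: "real \<times> real \<Rightarrow> real" where
  "tau \<eta> = (\<Sum>\<^sub>\<infinity>m\<in>period_lattice. cmod (chi \<eta> m - 1) * weight b m)"

lemma summable_tau: "(\<lambda>m. cmod (chi \<eta> m - 1) * weight b m) summable_on period_lattice"
proof (rule summable_on_comparison_test[OF summable_on_cmult_right[OF summable_weight[OF b], of 2]])
  show "cmod (chi \<eta> m - 1) * weight b m \<le> 2 * weight b m" for m
    using norm_triangle_ineq4[of "chi \<eta> m" 1] by (intro mult_right_mono) auto
qed simp

lemma tau_nonneg: "0 \<le> tau \<eta>" unfolding tau_def by (rule infsum_nonneg) simp

lemma continuous_tau: "continuous_on UNIV tau"
proof -
  have "uniform_limit UNIV (\<lambda>X \<eta>. \<Sum>m\<in>X. cmod (chi \<eta> m - 1) * weight b m) (\<lambda>\<eta>. \<Sum>\<^sub>\<infinity>m\<in>period_lattice. cmod (chi \<eta> m - 1) * weight b m) (finite_subsets_at_top period_lattice)"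
  proof (rule Weierstrass_m_test_general[OF _ summable_on_cmult_right[OF summable_weight[OF b], of 2]])
    show "norm (cmod (chi \<eta> m - 1) * weight b m) \<le> 2 * weight b m" for \<eta> m
      using norm_triangle_ineq4[of "chi \<eta> m" 1] by (auto simp: abs_mult intro!: mult_right_mono)
  qed
  then show ?thesis unfolding tau_def
    by (rule uniform_limit_theorem[rotated]) (auto intro!: always_eventually continuous_intros)
qed

lemma tau_tendsto: "((\<lambda>\<eta>. tau (\<eta>0 - \<eta>)) \<longlongrightarrow> 0) (at \<eta>0)"
proof -
  have "continuous_on UNIV (\<lambda>\<eta>. tau (\<eta>0 - \<eta>))"
    by (rule continuous_on_compose2[OF continuous_tau]) (auto intro: continuous_intros)
  then have "((\<lambda>\<eta>. tau (\<eta>0 - \<eta>)) \<longlongrightarrow> tau (\<eta>0 - \<eta>0)) (at \<eta>0)"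
    unfolding continuous_on_eq_continuous_at[OF open_UNIV] isCont_def by blast
  moreover have "tau 0 = 0" by (simp add: tau_def)
  ultimately show ?thesis by simp
qed

text \<open>3 bounds \<open>1 + cmod z\<close> on the cell, where
  \<open>cmod z \<le> 2\<close>.\<close>

definition K :: real where "K = C * 3 powr b"

lemma K_nonneg: "0 \<le> K" using C by (simp add: K_def)

lemma R_omega_bound: "z \<in> \<Omega> \<Longrightarrow> cmod z \<le> 2 \<Longrightarrow> m \<in> period_lattice \<Longrightarrow> cmod (R (z + m)) \<le> K * weight b m"
proof -
  assume z: "z \<in> \<Omega>" "cmod z \<le> 2" "m \<in> period_lattice"
  have "C * (1 + cmod z) powr b * weight b m \<le> K * weight b m" unfolding K_def
    using C b z(2) by (intro mult_right_mono mult_left_mono powr_mono2) auto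
  then show ?thesis by (rule order_trans[OF R_shift_bound[OF z(1,3)]])
qed

text \<open>The translates of \<open>R\<close> sum to 1, so \<open>T \<eta> z - 1\<close> is the
  series of \<open>(chi \<eta> m - 1) * R (z + m)\<close>, which is estimated term by term.\<close>

lemma T_near_one:
  assumes z: "z \<in> \<Omega>" "cmod z \<le> 2"
  shows "cmod (T \<eta> z - 1) \<le> K * tau \<eta>"
proof (rule norm_infsum_le)
  show "((\<lambda>m. chi \<eta> m * R (z + m) - R (z + m)) has_sum (T \<eta> z - 1)) period_lattice"
    using has_sum_add[OF T_has_sum[OF z(1)] has_sum_uminusI[OF R_sum[OF z(1)]]] by simp
  show "((\<lambda>m. K * (cmod (chi \<eta> m - 1) * weight b m)) has_sum K * tau \<eta>) period_lattice"
    unfolding tau_def by (intro has_sum_cmult_right has_sum_infsum summable_tau)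
  fix m assume m: "m \<in> period_lattice"
  have "norm (chi \<eta> m * R (z + m) - R (z + m)) = cmod (chi \<eta> m - 1) * cmod (R (z + m))"
    by (simp add: norm_mult[symmetric] algebra_simps)
  also have "\<dots> \<le> cmod (chi \<eta> m - 1) * (K * weight b m)" by (intro mult_left_mono R_omega_bound z m) auto
  finally show "norm (chi \<eta> m * R (z + m) - R (z + m)) \<le> K * (cmod (chi \<eta> m - 1) * weight b m)" by (simp add: mult_ac)
qed

lemma omega_facts: assumes "z \<in> \<omega>" shows "z \<in> \<Omega>" "cmod z \<le> 2" "tr z = z"
proof -
  show "z \<in> \<Omega>" using assms omega_sub by blast
  show "cmod z \<le> 2" using cmod_le[of z] omega_bounds[OF assms] by simp
  show "tr z = z" using tr_omega[OF assms, of 0] by simp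
qed

definition sect :: "(complex \<Rightarrow> complex) \<Rightarrow> real \<times> real \<Rightarrow> complex \<Rightarrow> complex" where
  "sect f \<eta> z = f z * T \<eta> z"

lemma T_measurable: "T \<eta> \<in> borel_measurable (area \<omega>)"
  by (rule L2_holomorphic_measurable[OF omega(1) holomorphic_on_subset[OF T_hol omega_sub]])

lemma sect_L2: assumes f: "f \<in> L2 (area \<omega>)" shows "sect f \<eta> \<in> L2 (area \<omega>)"
  unfolding sect_def
proof (rule L2_bounded_mult(1)[OF f T_measurable])
  show "cmod (T \<eta> x) \<le> K * tau \<eta> + 1" if "x \<in> space (area \<omega>)" for x
    using T_near_one[of x \<eta>] omega_facts[of x] that norm_triangle_sub[of "T \<eta> x" 1] by auto
  show "0 \<le> K * tau \<eta> + 1" using K_nonneg tau_nonneg by auto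
qed

lemma sect_close:
  assumes f: "f \<in> L2 (area \<omega>)"
  shows "L2_norm (area \<omega>) (sect f \<eta> - f) \<le> K * tau \<eta> * L2_norm (area \<omega>) f"
proof -
  have "sect f \<eta> - f = (\<lambda>z. f z * (T \<eta> z - 1))" by (simp add: sect_def fun_eq_iff algebra_simps)
  moreover have "L2_norm (area \<omega>) (\<lambda>z. f z * (T \<eta> z - 1)) \<le> K * tau \<eta> * L2_norm (area \<omega>) f"
    using T_near_one omega_facts K_nonneg tau_nonneg T_measurable by (intro L2_bounded_mult(2)[OF f]) auto
  ultimately show ?thesis by simp
qed

text \<open>\<open>T\<close> is analytic on all of \<Omega>, so multiplying the extension by it
  keeps the neighborhood \<open>U\<close>. On opposite edges the multipliers of the two factors
  combine to those of \<open>\<eta>\<close>.\<close>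

lemma sect_ext:
  assumes f: "f \<in> A2_ext \<omega> \<eta>0"
  shows "sect f (\<eta>0 - \<eta>) \<in> A2_ext \<omega> \<eta>"
proof -
  have fA: "f \<in> A2 \<omega>" using f by (simp add: A2_ext_def)
  obtain U g where U: "open U" "closure \<omega> \<inter> \<Omega> \<subseteq> U" "U \<subseteq> \<Omega>" and g: "g holomorphic_on U" "\<And>z. z \<in> \<omega> \<Longrightarrow> g z = f z"
    and q: "\<And>y. y \<in> {0<..<1} \<Longrightarrow> g (1 + \<i> * of_real y) = cis (fst \<eta>0) * g (\<i> * of_real y)"
      "\<And>x. x \<in> {0<..<1} \<Longrightarrow> g (of_real x + \<i>) = cis (snd \<eta>0) * g (of_real x)"
    using f unfolding A2_ext_def Omega by blast
  \<comment> \<open>The edge conditions of \<open>A2_ext\<close> range over all of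
    \<open>(0, 1)\<close>, also where the edge leaves \<Omega>; the value 0 satisfies them
    there.\<close>
  define g' where "g' = (\<lambda>z. if z \<in> \<Omega> then g z * T (\<eta>0 - \<eta>) z else 0)"
  have g': "g' (z + m) = chi \<eta> m * g' z" if qq: "g (z + m) = chi \<eta>0 m * g z" and m: "m \<in> period_lattice" for z m
  proof (cases "z \<in> \<Omega>")
    case True
    have "chi \<eta>0 m * (cnj (chi (\<eta>0 - \<eta>) m)) = (chi \<eta>0 m * cnj (chi \<eta>0 m)) * chi \<eta> m"
      by (simp add: chi_diff_left algebra_simps del: chi_cnj)
    then have "chi \<eta>0 m * (cnj (chi (\<eta>0 - \<eta>) m)) = chi \<eta> m" by simp
    then have "g (z + m) * T (\<eta>0 - \<eta>) (z + m) = chi \<eta> m * (g z * T (\<eta>0 - \<eta>) z)"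
      unfolding qq T_shift[OF True m] by (metis (no_types, lifting) mult.assoc mult.left_commute)
    then show ?thesis using True m by (simp add: g'_def Omega_shift)
  qed (use m in \<open>simp add: g'_def Omega_shift\<close>)
  show ?thesis unfolding A2_ext_def Omega[symmetric]
  proof (intro CollectI conjI exI[of _ U] exI[of _ g'] U ballI)
    show "sect f (\<eta>0 - \<eta>) \<in> A2 \<omega>" unfolding A2_def
      using sect_L2[OF A2D(1)[OF fA], of "\<eta>0 - \<eta>"] A2D(2)[OF fA] holomorphic_on_subset[OF T_hol[of "\<eta>0 - \<eta>"] omega_sub]
      by (auto simp: sect_def[abs_def] intro!: holomorphic_intros)
    show "g' holomorphic_on U"
      by (rule holomorphic_transform[of "\<lambda>z. g z * T (\<eta>0 - \<eta>) z"])
        (use U in \<open>auto simp: g'_def intro!: holomorphic_intros g holomorphic_on_subset[OF T_hol]\<close>)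
    show "g' z = sect f (\<eta>0 - \<eta>) z" if "z \<in> \<omega>" for z
      using that omega_sub g(2) by (auto simp: g'_def sect_def)
    show "g' (1 + \<i> * of_real y) = cis (fst \<eta>) * g' (\<i> * of_real y)" if "y \<in> {0<..<1}" for y :: real
      using g'[of "\<i> * of_real y" 1] q(1)[OF that] by (simp add: add.commute)
    show "g' (of_real x + \<i>) = cis (snd \<eta>) * g' (of_real x)" if "x \<in> {0<..<1}" for x :: real
      using g'[of "of_real x" \<i>] q(2)[OF that] by simp
  qed
qed

end

section \<open>The fibers as closed subspaces\<close>

context doubly_periodic
begin

lemma one_L2: "(\<lambda>z. 1) \<in> L2 (area \<omega>)"
  by (rule L2_const[OF finite_area])

lemma A2_ext_add: assumes f1: "f1 \<in> A2_ext \<omega> \<eta>" and f2: "f2 \<in> A2_ext \<omega> \<eta>" shows "(\<lambda>z. f1 z + f2 z) \<in> A2_ext \<omega> \<eta>"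
proof -
  interpret A: L2_closed_subspace "area \<omega>" "A2 \<omega>" by (rule A2_closed_subspace[OF omega(1)])
  obtain U1 g1 where U1: "open U1" "closure \<omega> \<inter> \<Omega> \<subseteq> U1" "U1 \<subseteq> \<Omega>" and g1: "g1 holomorphic_on U1" "\<And>z. z \<in> \<omega> \<Longrightarrow> g1 z = f1 z"
    "\<And>y. y \<in> {0<..<1} \<Longrightarrow> g1 (1 + \<i> * of_real y) = cis (fst \<eta>) * g1 (\<i> * of_real y)"
    "\<And>x. x \<in> {0<..<1} \<Longrightarrow> g1 (of_real x + \<i>) = cis (snd \<eta>) * g1 (of_real x)"
    using f1 unfolding A2_ext_def Omega by blast
  obtain U2 g2 where U2: "open U2" "closure \<omega> \<inter> \<Omega> \<subseteq> U2" "U2 \<subseteq> \<Omega>" and g2: "g2 holomorphic_on U2" "\<And>z. z \<in> \<omega> \<Longrightarrow> g2 z = f2 z"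
    "\<And>y. y \<in> {0<..<1} \<Longrightarrow> g2 (1 + \<i> * of_real y) = cis (fst \<eta>) * g2 (\<i> * of_real y)"
    "\<And>x. x \<in> {0<..<1} \<Longrightarrow> g2 (of_real x + \<i>) = cis (snd \<eta>) * g2 (of_real x)"
    using f2 unfolding A2_ext_def Omega by blast
  show ?thesis unfolding A2_ext_def Omega[symmetric]
    by (intro CollectI conjI exI[of _ "U1 \<inter> U2"] exI[of _ "\<lambda>z. g1 z + g2 z"] ballI)
      (use f1 f2 U1 U2 g1 g2 A.add in \<open>auto simp: A2_ext_def distrib_left intro!: holomorphic_intros intro: holomorphic_on_subset\<close>)
qed

lemma A2_ext_scale: assumes f1: "f1 \<in> A2_ext \<omega> \<eta>" shows "(\<lambda>z. c * f1 z) \<in> A2_ext \<omega> \<eta>"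
proof -
  interpret A: L2_closed_subspace "area \<omega>" "A2 \<omega>" by (rule A2_closed_subspace[OF omega(1)])
  obtain U1 g1 where U1: "open U1" "closure \<omega> \<inter> \<Omega> \<subseteq> U1" "U1 \<subseteq> \<Omega>" and g1: "g1 holomorphic_on U1" "\<And>z. z \<in> \<omega> \<Longrightarrow> g1 z = f1 z"
    "\<And>y. y \<in> {0<..<1} \<Longrightarrow> g1 (1 + \<i> * of_real y) = cis (fst \<eta>) * g1 (\<i> * of_real y)"
    "\<And>x. x \<in> {0<..<1} \<Longrightarrow> g1 (of_real x + \<i>) = cis (snd \<eta>) * g1 (of_real x)"
    using f1 unfolding A2_ext_def Omega by blast
  show ?thesis unfolding A2_ext_def Omega[symmetric]
    by (intro CollectI conjI exI[of _ U1] exI[of _ "\<lambda>z. c * g1 z"] ballI)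
      (use f1 U1 g1 A.scale in \<open>auto simp: A2_ext_def intro!: holomorphic_intros intro: holomorphic_on_subset\<close>)
qed

lemma A2_ext_zero: "(\<lambda>z. 0) \<in> A2_ext \<omega> \<eta>"
  unfolding A2_ext_def Omega[symmetric]
  by (intro CollectI conjI exI[of _ \<Omega>] exI[of _ "\<lambda>z. 0"]) (auto simp: open_Omega A2_def)

lemma A2_ext_sub: "A2_ext \<omega> \<eta> \<subseteq> A2 \<omega>" by (auto simp: A2_ext_def)

lemma A2_eta_closed_subspace: "L2_closed_subspace (area \<omega>) (A2_eta \<omega> \<eta>)"
proof -
  interpret A: L2_closed_subspace "area \<omega>" "A2 \<omega>" by (rule A2_closed_subspace[OF omega(1)])
  show ?thesis unfolding A2_eta_def
    by (rule A.closure_subspace[OF A2_ext_sub A2_ext_zero A2_ext_add A2_ext_scale])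
qed

lemma A2_ext_eta: "A2_ext \<omega> \<eta> \<subseteq> A2_eta \<omega> \<eta>"
proof
  fix f assume f: "f \<in> A2_ext \<omega> \<eta>"
  then show "f \<in> A2_eta \<omega> \<eta>" unfolding A2_eta_def using subsetD[OF A2_ext_sub] by (auto intro!: bexI[of _ f])
qed

lemma A2_eta_sub: "A2_eta \<omega> \<eta> \<subseteq> A2 \<omega>" by (auto simp: A2_eta_def)

lemma P_eta_proj: "is_orth_proj (L2_inner (area \<omega>)) (L2 (area \<omega>)) (A2_eta \<omega> \<eta>) (P_eta \<omega> \<eta>)"
  using someI_ex[OF L2_closed_subspace.orth_proj_exists[OF A2_eta_closed_subspace[of \<eta>]]] by (simp add: P_eta_def)

lemmas P_eta_props = L2_closed_subspace.orth_proj_props[OF A2_eta_closed_subspace P_eta_proj]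

lemma P_eta_A2: "f \<in> L2 (area \<omega>) \<Longrightarrow> P_eta \<omega> \<eta> f \<in> A2 \<omega>"
  using P_eta_props(1) A2_eta_sub by blast

end

section \<open>Measurable dependence of the projections on the parameter\<close>

context cell_partition
begin

text \<open>The norm is the distance from \<open>f\<close> to the fiber at \<open>\<eta>\<close>. A
  nearly optimal \<open>g\<close> in \<open>A2_ext\<close> at \<open>\<eta>0\<close>, multiplied by
  \<open>T\<close>, is an almost equally good competitor at nearby parameters, so the distance is
  upper semicontinuous.\<close>

lemma P_eta_dist_open:
  assumes f: "f \<in> L2 (area \<omega>)"
  shows "open {\<eta>. L2_norm (area \<omega>) (f - P_eta \<omega> \<eta> f) < c}"
  unfolding open_contains_ball
proof (intro ballI)
  fix \<eta>0 assume "\<eta>0 \<in> {\<eta>. L2_norm (area \<omega>) (f - P_eta \<omega> \<eta> f) < c}"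
  then have lt: "L2_norm (area \<omega>) (f - P_eta \<omega> \<eta>0 f) < c" by simp
  define e where "e = c - L2_norm (area \<omega>) (f - P_eta \<omega> \<eta>0 f)"
  have e: "e/2 > 0" using lt by (simp add: e_def)
  obtain g where g: "g \<in> A2_ext \<omega> \<eta>0" "L2_norm (area \<omega>) (P_eta \<omega> \<eta>0 f - g) < e/2"
    using P_eta_props(1)[OF f, of \<eta>0] e unfolding A2_eta_def by blast
  have gL: "g \<in> L2 (area \<omega>)" using g(1) A2_ext_sub A2D(1) by blast
  have "((\<lambda>\<eta>. K * tau (\<eta>0 - \<eta>) * L2_norm (area \<omega>) g) \<longlongrightarrow> K * 0 * L2_norm (area \<omega>) g) (at \<eta>0)"
    by (intro tendsto_intros tau_tendsto)
  then have "eventually (\<lambda>\<eta>. K * tau (\<eta>0 - \<eta>) * L2_norm (area \<omega>) g < e/2) (at \<eta>0)"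
    using e by (intro order_tendstoD) auto
  then obtain d where d: "d > 0" "\<And>\<eta>. \<eta> \<noteq> \<eta>0 \<Longrightarrow> dist \<eta> \<eta>0 < d \<Longrightarrow> K * tau (\<eta>0 - \<eta>) * L2_norm (area \<omega>) g < e/2"
    unfolding eventually_at by auto
  show "\<exists>d>0. ball \<eta>0 d \<subseteq> {\<eta>. L2_norm (area \<omega>) (f - P_eta \<omega> \<eta> f) < c}"
  proof (intro exI[of _ d] conjI d subsetI CollectI)
    fix \<eta> assume \<eta>: "\<eta> \<in> ball \<eta>0 d"
    show "L2_norm (area \<omega>) (f - P_eta \<omega> \<eta> f) < c"
    proof (cases "\<eta> = \<eta>0")
      case False
      define h where "h = sect g (\<eta>0 - \<eta>)"
      have h: "h \<in> A2_eta \<omega> \<eta>" unfolding h_def by (rule subsetD[OF A2_ext_eta sect_ext[OF g(1)]])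
      have hL: "h \<in> L2 (area \<omega>)" using sect_L2[OF gL] by (simp add: h_def)
      have 1: "L2_norm (area \<omega>) (f - P_eta \<omega> \<eta> f) \<le> L2_norm (area \<omega>) (f - h)" by (rule P_eta_props(6)[OF f h])
      have 2: "L2_norm (area \<omega>) (f - h) \<le> L2_norm (area \<omega>) (f - g) + L2_norm (area \<omega>) (g - h)" by (rule L2_norm_triangle_diff[OF f gL hL])
      have 3: "L2_norm (area \<omega>) (f - g) \<le> L2_norm (area \<omega>) (f - P_eta \<omega> \<eta>0 f) + L2_norm (area \<omega>) (P_eta \<omega> \<eta>0 f - g)"
        by (rule L2_norm_triangle_diff[OF f P_eta_props(2)[OF f] gL])
      have "L2_norm (area \<omega>) (g - h) \<le> K * tau (\<eta>0 - \<eta>) * L2_norm (area \<omega>) g"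
        unfolding L2_norm_minus_commute[of _ g] h_def by (rule sect_close[OF gL])
      moreover have "K * tau (\<eta>0 - \<eta>) * L2_norm (area \<omega>) g < e/2" using d(2)[OF False] \<eta> by (simp add: dist_commute)
      ultimately have 4: "L2_norm (area \<omega>) (g - h) < e/2" by (rule order_le_less_trans)
      have arith: "x < c" if "x \<le> u" "u \<le> v + w" "v \<le> p + q" "q < e/2" "w < e/2" "e = c - p" for x u v w p q :: real
        using that by linarith
      show ?thesis by (rule arith[OF 1 2 3 g(2) 4 e_def])
    qed (use lt in simp)
  qed
qed

text \<open>By Pythagoras the norm of the projection is determined by the distance to the
  fiber.\<close>

lemma P_eta_norm_measurable:
  assumes f: "f \<in> L2 (area \<omega>)"
  shows "(\<lambda>\<eta>. (L2_norm (area \<omega>) (P_eta \<omega> \<eta> f))\<^sup>2) \<in> borel_measurable borel"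
proof -
  have [measurable]: "(\<lambda>\<eta>. L2_norm (area \<omega>) (f - P_eta \<omega> \<eta> f)) \<in> borel_measurable borel"
    unfolding borel_measurable_iff_less using P_eta_dist_open[OF f] by (auto simp: borel_open)
  have "(L2_norm (area \<omega>) (P_eta \<omega> \<eta> f))\<^sup>2 = (L2_norm (area \<omega>) f)\<^sup>2 - (L2_norm (area \<omega>) (f - P_eta \<omega> \<eta> f))\<^sup>2" for \<eta>
    using P_eta_props(5)[OF f, of \<eta>] by simp
  then show ?thesis by simp
qed

text \<open>Polarization gives the real part; replacing \<open>d\<close> by \<open>\<i> * d\<close>
  gives the imaginary part.\<close>

lemma P_eta_inner_measurable:
  assumes f: "f \<in> L2 (area \<omega>)" and d: "d \<in> L2 (area \<omega>)"
  shows "(\<lambda>\<eta>. L2_inner (area \<omega>) (P_eta \<omega> \<eta> f) d) \<in> borel_measurable borel"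
proof -
  have Re: "(\<lambda>\<eta>. Re (L2_inner (area \<omega>) (P_eta \<omega> \<eta> f) d)) \<in> borel_measurable borel" if d: "d \<in> L2 (area \<omega>)" for d
  proof -
    have eq: "Re (L2_inner (area \<omega>) (P_eta \<omega> \<eta> f) d) = ((L2_norm (area \<omega>) (P_eta \<omega> \<eta> (\<lambda>x. f x + d x)))\<^sup>2 - (L2_norm (area \<omega>) (P_eta \<omega> \<eta> (f - d)))\<^sup>2) / 4" for \<eta>
      using L2_closed_subspace.orth_proj_polarization[OF A2_eta_closed_subspace P_eta_proj f d, of \<eta>] by simp
    show ?thesis unfolding eq
      by (intro borel_measurable_divide borel_measurable_diff P_eta_norm_measurable L2_add[OF f d] L2_diff[OF f d] borel_measurable_const)
  qed
  have "Im (L2_inner (area \<omega>) (P_eta \<omega> \<eta> f) d) = Re (L2_inner (area \<omega>) (P_eta \<omega> \<eta> f) (\<lambda>x. \<i> * d x))" for \<eta>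
    by (simp add: L2_inner_cmult_right)
  then have "(\<lambda>\<eta>. Im (L2_inner (area \<omega>) (P_eta \<omega> \<eta> f) d)) \<in> borel_measurable borel"
    using Re[OF L2_cmult[OF d, of \<i>]] by simp
  then show ?thesis using Re[OF d] borel_measurable_complex_iff by blast
qed

lemma P_eta_distance_measurable:
  assumes f: "f \<in> L2 (area \<omega>)" and d: "d \<in> L2 (area \<omega>)"
  shows "(\<lambda>\<eta>. L2_norm (area \<omega>) (P_eta \<omega> \<eta> f - d)) \<in> borel_measurable borel"
proof -
  have "L2_norm (area \<omega>) (P_eta \<omega> \<eta> f - d) = sqrt ((L2_norm (area \<omega>) (P_eta \<omega> \<eta> f))\<^sup>2 + (L2_norm (area \<omega>) d)\<^sup>2 - 2 * Re (L2_inner (area \<omega>) (P_eta \<omega> \<eta> f) d))" for \<eta>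
    unfolding L2_norm_diff_sq[OF P_eta_props(2)[OF f] d, symmetric] by simp
  then show ?thesis using P_eta_norm_measurable[OF f] P_eta_inner_measurable[OF f d] by simp
qed

lemma floquet_space_iff: "F \<in> floquet_space \<omega> \<longleftrightarrow>
  (\<forall>\<eta>\<in>dual_cell. F \<eta> \<in> L2 (area \<omega>)) \<and> strongly_measurable NN (area \<omega>) (L2 (area \<omega>)) F \<and> integrable NN (\<lambda>\<eta>. (L2_norm (area \<omega>) (F \<eta>))\<^sup>2)"
  by (simp add: bochner_L2_def)

text \<open>\<open>A2 \<omega>\<close> is separable, so strong measurability reduces to distances
  from fixed functions. For simple approximations of \<open>F\<close> these are measurable, and
  since projections do not increase distances the general case is an almost everywhere
  limit.\<close>

lemma fiber_proj_in:
  assumes F: "F \<in> floquet_space \<omega>"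
  shows "fiber_proj \<omega> F \<in> floquet_A2_space \<omega>"
proof -
  interpret complete_measure NN by (rule complete_dual)
  have FL: "F \<eta> \<in> L2 (area \<omega>)" if "\<eta> \<in> dual_cell" for \<eta> using F that by (simp add: floquet_space_iff)
  have sm: "strongly_measurable NN (area \<omega>) (L2 (area \<omega>)) F" and int: "integrable NN (\<lambda>\<eta>. (L2_norm (area \<omega>) (F \<eta>))\<^sup>2)"
    using F by (auto simp: floquet_space_iff)
  obtain s where s: "\<And>n. simple_function NN (s n)" "\<And>n \<eta>. \<eta> \<in> dual_cell \<Longrightarrow> s n \<eta> \<in> L2 (area \<omega>)"
    and lim: "AE \<eta> in NN. (\<lambda>n. L2_norm (area \<omega>) (s n \<eta> - F \<eta>)) \<longlonglongrightarrow> 0"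
    using sm unfolding strongly_measurable_def by auto
  obtain D where D: "countable D" "D \<subseteq> A2 \<omega>" "\<And>f e. f \<in> A2 \<omega> \<Longrightarrow> e > 0 \<Longrightarrow> \<exists>d\<in>D. L2_norm (area \<omega>) (f - d) < e"
    using A2_separable[OF omega(1) one_L2] by blast
  have dist: "(\<lambda>\<eta>. L2_norm (area \<omega>) (P_eta \<omega> \<eta> (F \<eta>) - d)) \<in> borel_measurable NN" if d: "d \<in> L2 (area \<omega>)" for d
  proof (rule borel_measurable_AE_LIMSEQ)
    show "(\<lambda>\<eta>. L2_norm (area \<omega>) (P_eta \<omega> \<eta> (s n \<eta>) - d)) \<in> borel_measurable NN" for n
      by (rule simple_function_compose_measurable[OF s(1), where h = "\<lambda>v \<eta>. L2_norm (area \<omega>) (P_eta \<omega> \<eta> v - d)"])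
        (use s(2) d in \<open>auto intro!: borel_measurable_dual P_eta_distance_measurable\<close>)
    show "AE \<eta> in NN. (\<lambda>n. L2_norm (area \<omega>) (P_eta \<omega> \<eta> (s n \<eta>) - d)) \<longlonglongrightarrow> L2_norm (area \<omega>) (P_eta \<omega> \<eta> (F \<eta>) - d)"
      using lim AE_space
    proof eventually_elim
      case (elim \<eta>)
      then have \<eta>: "\<eta> \<in> dual_cell" by simp
      have "(\<lambda>n. L2_norm (area \<omega>) (P_eta \<omega> \<eta> (s n \<eta>) - P_eta \<omega> \<eta> (F \<eta>))) \<longlonglongrightarrow> 0"
        by (rule Lim_null_comparison[OF _ elim(1)], rule always_eventually)
          (use L2_closed_subspace.orth_proj_Lipschitz[OF A2_eta_closed_subspace P_eta_proj s(2)[OF \<eta>] FL[OF \<eta>]] in auto)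
      then show ?case by (intro tendsto_L2_norm P_eta_props(2) s(2) FL \<eta> d)
    qed
  qed
  have sm': "strongly_measurable NN (area \<omega>) (A2 \<omega>) (fiber_proj \<omega> F)"
    by (rule strongly_measurable_of_separable[OF D(2,1)])
      (use D P_eta_A2 FL dist A2D(1) in \<open>auto simp: fiber_proj_def\<close>)
  have "integrable NN (\<lambda>\<eta>. (L2_norm (area \<omega>) (P_eta \<omega> \<eta> (F \<eta>)))\<^sup>2)"
  proof (rule Bochner_Integration.integrable_bound[OF int])
    have "(\<lambda>\<eta>. L2_norm (area \<omega>) (P_eta \<omega> \<eta> (F \<eta>) - (\<lambda>x. 0))) \<in> borel_measurable NN" by (rule dist) simp
    then show "(\<lambda>\<eta>. (L2_norm (area \<omega>) (P_eta \<omega> \<eta> (F \<eta>)))\<^sup>2) \<in> borel_measurable NN" by (simp add: fun_diff_def)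
    show "AE \<eta> in NN. norm ((L2_norm (area \<omega>) (P_eta \<omega> \<eta> (F \<eta>)))\<^sup>2) \<le> norm ((L2_norm (area \<omega>) (F \<eta>))\<^sup>2)"
      by (rule AE_I2) (use P_eta_props(7) FL in \<open>auto intro!: power_mono\<close>)
  qed
  with sm' show ?thesis unfolding floquet_A2_space_def bochner_L2_def
    using P_eta_A2 P_eta_props(1) FL by (auto simp: fiber_proj_def intro!: AE_I2)
qed

text \<open>Orthogonality holds in almost every fiber, so its integral over the parameters
  vanishes.\<close>

lemma fiber_proj_is_orth_proj:
  "is_orth_proj (bochner_inner NN (area \<omega>)) (floquet_space \<omega>) (floquet_A2_space \<omega>) (fiber_proj \<omega>)"
  unfolding is_orth_proj_def
proof (intro conjI ballI)
  show "floquet_A2_space \<omega> \<subseteq> floquet_space \<omega>"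
    unfolding floquet_A2_space_def bochner_L2_def strongly_measurable_def by (auto simp: A2_def)
  fix F assume F: "F \<in> floquet_space \<omega>"
  show "fiber_proj \<omega> F \<in> floquet_A2_space \<omega>" by (rule fiber_proj_in[OF F])
  fix G assume G: "G \<in> floquet_A2_space \<omega>"
  have "AE \<eta> in NN. L2_inner (area \<omega>) ((F - fiber_proj \<omega> F) \<eta>) (G \<eta>) = 0"
  proof -
    have "AE \<eta> in NN. G \<eta> \<in> A2_eta \<omega> \<eta>" using G by (simp add: floquet_A2_space_def)
    then show ?thesis using AE_space
    proof eventually_elim
      case (elim \<eta>)
      then have "F \<eta> \<in> L2 (area \<omega>)" using F by (simp add: floquet_space_iff)
      then show ?case using P_eta_proj[of \<eta>] elim(1) by (simp add: is_orth_proj_def fiber_proj_def)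
    qed
  qed
  then show "bochner_inner NN (area \<omega>) (F - fiber_proj \<omega> F) G = 0"
    unfolding bochner_inner_def by (rule integral_eq_zero_AE)
qed

end

section \<open>The Floquet transform\<close>

lemma integrable_continuous_dual:
  fixes f :: "real \<times> real \<Rightarrow> 'a::euclidean_space"
  assumes "continuous_on UNIV f" shows "integrable NN f"
proof -
  have "f absolutely_integrable_on dual_cell"
    unfolding dual_cell_cbox by (rule absolutely_integrable_continuous) (rule continuous_on_subset[OF assms], simp)
  then show ?thesis by (rule absolutely_integrable_imp_integrable) simp
qed

lemma integral_cis_period:
  assumes "a \<in> \<int>"
  shows "integral {-pi..pi} (\<lambda>x. cis (a * x)) = (if a = 0 then 2 * pi else 0)"
proof (cases "a = 0")
  case False
  have "((\<lambda>x. cis (a * x)) has_integral (cis (a * pi) / (\<i> * a) - cis (a * (- pi)) / (\<i> * a))) {-pi..pi}"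
  proof (rule fundamental_theorem_of_calculus)
    fix x
    show "((\<lambda>x. cis (a * x) / (\<i> * of_real a)) has_vector_derivative cis (a * x)) (at x within {-pi..pi})"
    proof -
      have "((\<lambda>z. exp (\<i> * (of_real a * z)) / (\<i> * of_real a)) has_field_derivative exp (\<i> * (of_real a * of_real x))) (at (of_real x))"
        using False by (auto intro!: derivative_eq_intros simp: field_simps)
      from has_vector_derivative_real_field[OF this, of "{-pi..pi}"] show ?thesis by (simp add: cis_conv_exp)
    qed
  qed simp
  moreover have "cis (a * pi) = cis (a * (- pi))"
  proof -
    obtain n where n: "a = of_int n" using assms by (auto elim: Ints_cases)
    have "sin (of_int n * pi) = 0" by (simp add: sin_times_pi_eq_0)
    then show ?thesis unfolding n by (simp add: complex_eq_iff)
  qed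
  ultimately have "((\<lambda>x. cis (a * x)) has_integral 0) {-pi..pi}" by simp
  then show ?thesis using False by (simp add: integral_unique)
qed (simp add: scaleR_conv_of_real)

lemma integral_chi:
  assumes m: "m \<in> period_lattice"
  shows "(LINT \<eta>|NN. chi \<eta> m) = (if m = 0 then of_real (4 * pi\<^sup>2) else 0)"
proof -
  have c: "continuous_on UNIV (\<lambda>\<eta>. chi \<eta> m)" by (intro continuous_intros)
  have mi: "Re m \<in> \<int>" "Im m \<in> \<int>" using m by (auto simp: period_lattice_def)
  have "(LINT \<eta>|NN. chi \<eta> m) = integral dual_cell (\<lambda>\<eta>. chi \<eta> m)"
    by (rule lebesgue_integral_eq_integral[OF integrable_continuous_dual[OF c]]) simp
  also have "\<dots> = integral (cbox (-pi) pi) (\<lambda>x. integral (cbox (-pi) pi) (\<lambda>y. chi (x, y) m))"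
    unfolding dual_cell_cbox by (rule integral_prod_continuous) (rule continuous_on_subset[OF c], simp)
  also have "\<dots> = integral {-pi..pi} (\<lambda>x. integral {-pi..pi} (\<lambda>y. cis (Re m * x) * cis (Im m * y)))"
    by (simp add: chi_def cis_mult mult.commute)
  also have "\<dots> = integral {-pi..pi} (\<lambda>x. cis (Re m * x)) * integral {-pi..pi} (\<lambda>y. cis (Im m * y))"
    by simp
  also have "\<dots> = (if m = 0 then of_real (4 * pi\<^sup>2) else 0)"
    unfolding integral_cis_period[OF mi(1)] integral_cis_period[OF mi(2)]
    by (simp add: complex_eq_iff power2_eq_square)
  finally show ?thesis .
qed

section \<open>Cell norms and finite partial sums of the Floquet series\<close>

context doubly_periodic_null
begin

abbreviation "L \<equiv> period_lattice"

lemma shift_L2: assumes f: "f \<in> L2 (area \<Omega>)" and m: "m \<in> L" shows "(\<lambda>z. f (z + m)) \<in> L2 (area \<omega>)"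
proof -
  have fm: "f \<in> borel_measurable (area \<Omega>)" using f by (rule L2D)
  have m': "(\<lambda>z. f (z + m)) \<in> borel_measurable (area \<omega>)" by (rule shift_borel_measurable[OF fm m])
  have "(\<integral>\<^sup>+z. ennreal ((cmod (f (z + m)))\<^sup>2) \<partial>area \<omega>) \<le> (\<integral>\<^sup>+m. \<integral>\<^sup>+z. ennreal ((cmod (f (z + m)))\<^sup>2) \<partial>area \<omega> \<partial>count_space L)"
    by (rule nn_integral_ge_point[OF m])
  also have "\<dots> = (\<integral>\<^sup>+z. ennreal ((cmod (f z))\<^sup>2) \<partial>area \<Omega>)"
    by (rule nn_integral_Omega[symmetric]) (use fm in measurable)
  also have "\<dots> < \<infinity>" using nn_integral_L2[OF f] by simp
  finally have "(\<integral>\<^sup>+z. ennreal ((cmod (f (z + m)))\<^sup>2) \<partial>area \<omega>) < \<infinity>" .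
  then have "integrable (area \<omega>) (\<lambda>z. (cmod (f (z + m)))\<^sup>2)"
    using m' by (intro integrableI_bounded) auto
  then show ?thesis using m' by (simp add: L2_def)
qed

lemma L2_OmegaI:
  assumes f: "f \<in> borel_measurable (area \<Omega>)" and fm: "\<And>m. m \<in> L \<Longrightarrow> (\<lambda>z. f (z + m)) \<in> L2 (area \<omega>)"
    and c: "\<And>m. m \<in> L \<Longrightarrow> (L2_norm (area \<omega>) (\<lambda>z. f (z + m)))\<^sup>2 \<le> c m" "c summable_on L"
  shows "f \<in> L2 (area \<Omega>)"
proof -
  have c0: "0 \<le> c m" if "m \<in> L" for m using c(1)[OF that] zero_le_power2 order_trans by blast
  have "(\<integral>\<^sup>+z. ennreal ((cmod (f z))\<^sup>2) \<partial>area \<Omega>) = (\<integral>\<^sup>+m. \<integral>\<^sup>+z. ennreal ((cmod (f (z + m)))\<^sup>2) \<partial>area \<omega> \<partial>count_space L)"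
    by (rule nn_integral_Omega) (use f in measurable)
  also have "\<dots> \<le> (\<integral>\<^sup>+m. ennreal (c m) \<partial>count_space L)"
    by (rule nn_integral_mono) (simp add: nn_integral_L2[OF fm] ennreal_leI c(1))
  also have "\<dots> < \<infinity>"
  proof -
    have "(\<lambda>m. norm (c m)) summable_on L"
      using summable_on_cong[of L "\<lambda>m. norm (c m)" c] c(2) c0 by simp
    then have "Infinite_Set_Sum.abs_summable_on c L" by (rule abs_summable_equivalent[THEN iffD1])
    then have "integrable (count_space L) c" by (simp add: Infinite_Set_Sum.abs_summable_on_def)
    then have "(\<integral>\<^sup>+m. ennreal (norm (c m)) \<partial>count_space L) < \<infinity>" by (simp add: integrable_iff_bounded)
    moreover have "(\<integral>\<^sup>+m. ennreal (norm (c m)) \<partial>count_space L) = (\<integral>\<^sup>+m. ennreal (c m) \<partial>count_space L)"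
      by (rule nn_integral_cong) (simp add: c0)
    ultimately show ?thesis by simp
  qed
  finally have "integrable (area \<Omega>) (\<lambda>z. (cmod (f z))\<^sup>2)" using f by (intro integrableI_bounded) auto
  then show ?thesis using f by (simp add: L2_def)
qed

lemma L2_inner_Omega:
  assumes f: "f \<in> L2 (area \<Omega>)" and h: "h \<in> L2 (area \<Omega>)"
  shows "((\<lambda>m. L2_inner (area \<omega>) (\<lambda>z. f (z + m)) (\<lambda>z. h (z + m))) has_sum L2_inner (area \<Omega>) f h) L"
  unfolding L2_inner_def by (rule has_sum_integral_Omega) (rule L2_inner_integrable[OF f h])

lemma L2_norm_Omega:
  assumes f: "f \<in> L2 (area \<Omega>)"
  shows "((\<lambda>m. (L2_norm (area \<omega>) (\<lambda>z. f (z + m)))\<^sup>2) has_sum (L2_norm (area \<Omega>) f)\<^sup>2) L"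
  using L2_inner_Omega[OF f f] unfolding L2_inner_self by (simp only: has_sum_of_real_iff)

definition S :: "(complex \<Rightarrow> complex) \<Rightarrow> complex set \<Rightarrow> real \<times> real \<Rightarrow> complex \<Rightarrow> complex" where
  "S f B \<eta> z = (\<Sum>m\<in>B. (of_real (1 / (2 * pi)) * cnj (chi \<eta> m)) * f (z + m))"

lemma floquet_partial_sum_eq: "floquet_partial_sum f B = S f B"
proof -
  have "cis (- fst \<eta> * Re m - snd \<eta> * Im m) = cnj (chi \<eta> m)" for \<eta> m by (simp add: chi_def cis_cnj)
  then show ?thesis by (simp add: floquet_partial_sum_def S_def[abs_def] sum_distrib_left mult.assoc fun_eq_iff)
qed

abbreviation "M \<equiv> area \<omega>"

lemma S_L2: "f \<in> L2 (area \<Omega>) \<Longrightarrow> B \<subseteq> L \<Longrightarrow> S f B \<eta> \<in> L2 M"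
  unfolding S_def[abs_def] by (intro L2_sum L2_cmult shift_L2) auto

lemma S_inner:
  assumes f: "f \<in> L2 (area \<Omega>)" and B: "B \<subseteq> L" and v: "v \<in> L2 M"
  shows "L2_inner M (S f B \<eta>) v = (\<Sum>m\<in>B. (of_real (1 / (2 * pi)) * cnj (chi \<eta> m)) * L2_inner M (\<lambda>z. f (z + m)) v)"
proof -
  have "L2_inner M (S f B \<eta>) v = (\<Sum>m\<in>B. L2_inner M (\<lambda>z. (of_real (1 / (2 * pi)) * cnj (chi \<eta> m)) * f (z + m)) v)"
    unfolding S_def[abs_def] by (rule L2_inner_sum_left[OF L2_cmult[OF shift_L2[OF f subsetD[OF B]]] v])
  then show ?thesis by (simp only: L2_inner_cmult_left)
qed

lemma S_inner_continuous:
  assumes "f \<in> L2 (area \<Omega>)" "B \<subseteq> L" "v \<in> L2 M"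
  shows "continuous_on UNIV (\<lambda>\<eta>. L2_inner M (S f B \<eta>) v)"
  unfolding S_inner[OF assms] by (intro continuous_intros)

text \<open>As a function of the parameter the squared norm is a trigonometric polynomial. This
  gives continuity, hence measurability, and reduces Parseval to the orthogonality of
  characters.\<close>

lemma S_norm_sq:
  assumes f: "f \<in> L2 (area \<Omega>)" and B: "B \<subseteq> L"
  shows "of_real ((L2_norm M (S f B \<eta>))\<^sup>2) = (\<Sum>m\<in>B. \<Sum>k\<in>B. of_real (1 / (4 * pi\<^sup>2)) * chi \<eta> (k - m) * L2_inner M (\<lambda>z. f (z + m)) (\<lambda>z. f (z + k)))"
proof -
  have "of_real ((L2_norm M (S f B \<eta>))\<^sup>2) = L2_inner M (S f B \<eta>) (S f B \<eta>)" by (rule L2_inner_self[symmetric])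
  also have "\<dots> = (\<Sum>m\<in>B. (of_real (1 / (2 * pi)) * cnj (chi \<eta> m)) * L2_inner M (\<lambda>z. f (z + m)) (S f B \<eta>))"
    by (rule S_inner[OF f B S_L2[OF f B]])
  also have "\<dots> = (\<Sum>m\<in>B. \<Sum>k\<in>B. of_real (1 / (4 * pi\<^sup>2)) * chi \<eta> (k - m) * L2_inner M (\<lambda>z. f (z + m)) (\<lambda>z. f (z + k)))"
  proof (rule sum.cong[OF refl])
    fix m assume "m \<in> B"
    then have fm: "(\<lambda>z. f (z + m)) \<in> L2 M" using shift_L2[OF f] B by blast
    have "L2_inner M (\<lambda>z. f (z + m)) (S f B \<eta>) = cnj (L2_inner M (S f B \<eta>) (\<lambda>z. f (z + m)))" by (rule L2_inner_commute)
    also have "\<dots> = (\<Sum>k\<in>B. (of_real (1 / (2 * pi)) * chi \<eta> k) * L2_inner M (\<lambda>z. f (z + m)) (\<lambda>z. f (z + k)))"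
      unfolding S_inner[OF f B fm] by (simp add: L2_inner_commute[of M "\<lambda>z. f (z + m)"])
    finally show "(of_real (1 / (2 * pi)) * cnj (chi \<eta> m)) * L2_inner M (\<lambda>z. f (z + m)) (S f B \<eta>) =
        (\<Sum>k\<in>B. of_real (1 / (4 * pi\<^sup>2)) * chi \<eta> (k - m) * L2_inner M (\<lambda>z. f (z + m)) (\<lambda>z. f (z + k)))"
      by (simp add: sum_distrib_left chi_diff power2_eq_square mult_ac)
  qed
  finally show ?thesis .
qed

lemma S_norm_continuous:
  assumes f: "f \<in> L2 (area \<Omega>)" and B: "B \<subseteq> L"
  shows "continuous_on UNIV (\<lambda>\<eta>. L2_norm M (S f B \<eta>))"
proof -
  have "(L2_norm M (S f B \<eta>))\<^sup>2 = Re (\<Sum>m\<in>B. \<Sum>k\<in>B. of_real (1 / (4 * pi\<^sup>2)) * chi \<eta> (k - m) * L2_inner M (\<lambda>z. f (z + m)) (\<lambda>z. f (z + k)))" for \<eta>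
    unfolding S_norm_sq[OF f B, symmetric] by simp
  then have "L2_norm M (S f B \<eta>) = sqrt (Re (\<Sum>m\<in>B. \<Sum>k\<in>B. of_real (1 / (4 * pi\<^sup>2)) * chi \<eta> (k - m) * L2_inner M (\<lambda>z. f (z + m)) (\<lambda>z. f (z + k))))" for \<eta>
    by (metis L2_norm_nonneg real_sqrt_unique)
  then show ?thesis by (simp only:) (intro continuous_intros)
qed

lemma S_dist_continuous:
  assumes f: "f \<in> L2 (area \<Omega>)" and B: "B \<subseteq> L" and v: "v \<in> L2 M"
  shows "continuous_on UNIV (\<lambda>\<eta>. L2_norm M (S f B \<eta> - v))"
proof -
  have "L2_norm M (S f B \<eta> - v) = sqrt ((L2_norm M (S f B \<eta>))\<^sup>2 + (L2_norm M v)\<^sup>2 - 2 * Re (L2_inner M (S f B \<eta>) v))" for \<eta>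
    unfolding L2_norm_diff_sq[OF S_L2[OF f B] v, symmetric] by simp
  then show ?thesis by (simp only:) (intro continuous_intros S_norm_continuous S_inner_continuous f B v)
qed

lemma S_Parseval:
  assumes f: "f \<in> L2 (area \<Omega>)" and B: "finite B" "B \<subseteq> L"
  shows "(LINT \<eta>|NN. (L2_norm M (S f B \<eta>))\<^sup>2) = (\<Sum>m\<in>B. (L2_norm M (\<lambda>z. f (z + m)))\<^sup>2)"
proof -
  have i: "integrable NN (\<lambda>\<eta>. chi \<eta> m)" for m by (intro integrable_continuous_dual continuous_intros)
  have "complex_of_real (LINT \<eta>|NN. (L2_norm M (S f B \<eta>))\<^sup>2) = (LINT \<eta>|NN. of_real ((L2_norm M (S f B \<eta>))\<^sup>2))"
    by (rule integral_complex_of_real[symmetric])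
  also have "\<dots> = (LINT \<eta>|NN. (\<Sum>m\<in>B. \<Sum>k\<in>B. of_real (1 / (4 * pi\<^sup>2)) * chi \<eta> (k - m) * L2_inner M (\<lambda>z. f (z + m)) (\<lambda>z. f (z + k))))"
    by (simp only: S_norm_sq[OF f B(2)])
  also have "\<dots> = (\<Sum>m\<in>B. \<Sum>k\<in>B. of_real (1 / (4 * pi\<^sup>2)) * (LINT \<eta>|NN. chi \<eta> (k - m)) * L2_inner M (\<lambda>z. f (z + m)) (\<lambda>z. f (z + k)))"
    using i by (simp add: Bochner_Integration.integral_sum)
  also have "\<dots> = (\<Sum>m\<in>B. \<Sum>k\<in>B. if k = m then of_real ((L2_norm M (\<lambda>z. f (z + m)))\<^sup>2) else 0)"
  proof (intro sum.cong refl)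
    fix m k assume "m \<in> B" "k \<in> B"
    then have km: "k - m \<in> L" using B by blast
    show "of_real (1 / (4 * pi\<^sup>2)) * (LINT \<eta>|NN. chi \<eta> (k - m)) * L2_inner M (\<lambda>z. f (z + m)) (\<lambda>z. f (z + k)) =
        (if k = m then of_real ((L2_norm M (\<lambda>z. f (z + m)))\<^sup>2) else 0)"
      unfolding integral_chi[OF km] by (simp add: L2_inner_self)
  qed
  also have "\<dots> = of_real (\<Sum>m\<in>B. (L2_norm M (\<lambda>z. f (z + m)))\<^sup>2)"
    using B(1) by simp
  finally show ?thesis by (simp only: of_real_eq_iff)
qed

lemma S_diff_subset: "finite B \<Longrightarrow> A \<subseteq> B \<Longrightarrow> S f B \<eta> - S f A \<eta> = S f (B - A) \<eta>"
  by (simp add: S_def sum_diff fun_eq_iff)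

lemma S_fun_diff: "S (f - h) B \<eta> = S f B \<eta> - S h B \<eta>"
  unfolding fun_eq_iff S_def minus_apply sum_subtractf[symmetric] right_diff_distrib by simp

text \<open>Moving to another cell only shifts the index set, apart from a phase. Both index sets
  exhaust the lattice, so in the limit this becomes quasiperiodicity.\<close>

lemma S_shift:
  assumes "finite B"
  shows "S f B \<eta> (z + k) = chi \<eta> k * S f ((+) k ` B) \<eta> z"
proof -
  have "S f ((+) k ` B) \<eta> z = (\<Sum>m\<in>B. (of_real (1 / (2 * pi)) * cnj (chi \<eta> (k + m))) * f (z + (k + m)))"
    unfolding S_def by (subst sum.reindex) auto
  also have "chi \<eta> k * \<dots> = (\<Sum>m\<in>B. (chi \<eta> k * cnj (chi \<eta> k)) * ((of_real (1 / (2 * pi)) * cnj (chi \<eta> m)) * f (z + k + m)))"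
    unfolding sum_distrib_left by (intro sum.cong refl) (simp add: chi_add mult_ac add_ac del: chi_cnj)
  finally show ?thesis by (simp add: S_def)
qed

text \<open>The transform is fixed only almost everywhere, and \<open>floquet\<close> picks some
  representative. Working with the property admits explicit representatives, such as that of a
  function living on a single cell.\<close>

definition is_floquet :: "(complex \<Rightarrow> complex) \<Rightarrow> (real \<times> real \<Rightarrow> complex \<Rightarrow> complex) \<Rightarrow> bool" where
  "is_floquet f F \<longleftrightarrow> F \<in> floquet_space \<omega> \<and>
    ((\<lambda>B. bochner_norm NN M (floquet_partial_sum f B - F)) \<longlongrightarrow> 0) (finite_subsets_at_top L)"

lemma floquet_space_D:
  assumes "F \<in> floquet_space \<omega>"
  shows "\<And>\<eta>. \<eta> \<in> dual_cell \<Longrightarrow> F \<eta> \<in> L2 M" "strongly_measurable NN M (L2 M) F" "integrable NN (\<lambda>\<eta>. (L2_norm M (F \<eta>))\<^sup>2)"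
  using assms by (auto simp: bochner_L2_def)

lemma S_dist_measurable:
  assumes f: "f \<in> L2 (area \<Omega>)" and B: "B \<subseteq> L" and F: "F \<in> floquet_space \<omega>"
  shows "(\<lambda>\<eta>. L2_norm M (S f B \<eta> - F \<eta>)) \<in> borel_measurable NN"
proof (rule strongly_measurable_norm[OF complete_dual subset_refl _ floquet_space_D(2)[OF F]])
  show "(\<lambda>\<eta>. L2_norm M (S f B \<eta> - v)) \<in> borel_measurable NN" if "v \<in> L2 M" for v
    by (intro borel_measurable_dual borel_measurable_continuous_onI S_dist_continuous f B that)
qed (use floquet_space_D(1)[OF F] S_L2[OF f B] in auto)

lemma L2_norm_diff_sq_le:
  assumes "u \<in> L2 M" "v \<in> L2 M"
  shows "(L2_norm M (u - v))\<^sup>2 \<le> 2 * (L2_norm M u)\<^sup>2 + 2 * (L2_norm M v)\<^sup>2"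
proof -
  have "L2_norm M (u - v) \<le> L2_norm M u + L2_norm M v"
    using L2_norm_triangle_diff[OF assms(1) L2_zero assms(2)] L2_norm_minus_commute[of M "\<lambda>x. 0" v] by (simp add: fun_diff_def)
  then have "(L2_norm M (u - v))\<^sup>2 \<le> (L2_norm M u + L2_norm M v)\<^sup>2" by (intro power_mono) auto
  also have "\<dots> \<le> 2 * (L2_norm M u)\<^sup>2 + 2 * (L2_norm M v)\<^sup>2"
    using sum_squares_bound[of "L2_norm M u" "L2_norm M v"] by (simp add: power2_sum)
  finally show ?thesis .
qed

lemma S_dist_integrable:
  assumes f: "f \<in> L2 (area \<Omega>)" and B: "B \<subseteq> L" and F: "F \<in> floquet_space \<omega>"
  shows "integrable NN (\<lambda>\<eta>. (L2_norm M (S f B \<eta> - F \<eta>))\<^sup>2)"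
proof (rule Bochner_Integration.integrable_bound)
  show "integrable NN (\<lambda>\<eta>. 2 * (L2_norm M (S f B \<eta>))\<^sup>2 + 2 * (L2_norm M (F \<eta>))\<^sup>2)"
    using floquet_space_D(3)[OF F] integrable_continuous_dual[OF continuous_on_power[OF S_norm_continuous[OF f B]], of 2] by simp
  show "(\<lambda>\<eta>. (L2_norm M (S f B \<eta> - F \<eta>))\<^sup>2) \<in> borel_measurable NN"
    using S_dist_measurable[OF f B F] by simp
  show "AE \<eta> in NN. norm ((L2_norm M (S f B \<eta> - F \<eta>))\<^sup>2) \<le> norm (2 * (L2_norm M (S f B \<eta>))\<^sup>2 + 2 * (L2_norm M (F \<eta>))\<^sup>2)"
    by (rule AE_I2) (use L2_norm_diff_sq_le[OF S_L2[OF f B] floquet_space_D(1)[OF F]] in auto)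
qed

lemma is_floquet_sq_limit:
  assumes F: "is_floquet f F" and B: "filterlim B (finite_subsets_at_top L) sequentially"
  shows "(\<lambda>n. LINT \<eta>|NN. (L2_norm M (S f (B n) \<eta> - F \<eta>))\<^sup>2) \<longlonglongrightarrow> 0"
proof -
  have "((\<lambda>B. bochner_norm NN M (floquet_partial_sum f B - F)) \<longlongrightarrow> 0) (finite_subsets_at_top L)"
    using F by (simp add: is_floquet_def)
  then have "(\<lambda>n. bochner_norm NN M (S f (B n) - F)) \<longlonglongrightarrow> 0"
    unfolding floquet_partial_sum_eq by (rule filterlim_compose[OF _ B])
  then have "(\<lambda>n. (bochner_norm NN M (S f (B n) - F))\<^sup>2) \<longlonglongrightarrow> 0\<^sup>2" by (rule tendsto_power)
  then show ?thesis by (simp add: bochner_norm_def)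
qed

end

section \<open>Existence of the transform\<close>

lemma L2_Cauchy_of_summable:
  assumes f: "\<And>n. f n \<in> L2 M" and s: "summable (\<lambda>n. L2_norm M (f (Suc n) - f n))"
  shows "L2_Cauchy M f"
  unfolding L2_Cauchy_def
proof (intro allI impI)
  fix e :: real assume e: "e > 0"
  define a where "a = (\<lambda>n. L2_norm M (f (Suc n) - f n))"
  obtain N where N: "\<And>m n. m \<ge> N \<Longrightarrow> norm (sum a {m..<n}) < e"
    using s e unfolding summable_Cauchy a_def[symmetric] by blast
  have tel: "L2_norm M (f (m + k) - f m) \<le> sum a {m..<m + k}" for m k
  proof (induction k)
    case (Suc k)
    have "L2_norm M (f (m + Suc k) - f m) \<le> L2_norm M (f (m + Suc k) - f (m + k)) + L2_norm M (f (m + k) - f m)"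
      by (rule L2_norm_triangle_diff) (rule f)+
    also have "\<dots> \<le> a (m + k) + sum a {m..<m + k}" by (rule add_mono[OF _ Suc.IH]) (simp add: a_def)
    also have "\<dots> = sum a {m..<m + Suc k}" by simp
    finally show ?case .
  qed simp
  have "L2_norm M (f n - f m) < e" if "N \<le> m" "m \<le> n" for m n
    using tel[of m "n - m"] N[of m n] that by (simp add: abs_less_iff)
  then have "L2_norm M (f m - f n) < e" if "N \<le> m" "N \<le> n" for m n
    using that by (metis L2_norm_minus_commute linear)
  then show "\<exists>N. \<forall>m\<ge>N. \<forall>n\<ge>N. L2_norm M (f m - f n) < e" by blast
qed

text \<open>Cauchy--Schwarz against the constant 1, with the real function regarded as
  complex.\<close>

lemma integral_norm_le_sqrt:
  fixes g :: "'a \<Rightarrow> real"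
  assumes N: "finite_measure N" and g: "g \<in> borel_measurable N" "integrable N (\<lambda>x. (g x)\<^sup>2)"
  shows "integrable N g" "(LINT x|N. \<bar>g x\<bar>) \<le> sqrt (measure N (space N)) * sqrt (LINT x|N. (g x)\<^sup>2)"
proof -
  have L: "(\<lambda>x. complex_of_real (g x)) \<in> L2 N" using g by (simp add: L2_def)
  show "(LINT x|N. \<bar>g x\<bar>) \<le> sqrt (measure N (space N)) * sqrt (LINT x|N. (g x)\<^sup>2)"
    using L2_finite_integrable(2)[OF N L] by (simp add: L2_norm_def)
  have "integrable N (\<lambda>x. Re (complex_of_real (g x)))"
    using L2_finite_integrable(1)[OF N L] by (rule integrable_Re)
  then show "integrable N g" by simp
qed

text \<open>Fatou's lemma for real functions. The bound is demanded only from \<open>n0\<close> on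
  because a partial sum will be compared with later ones only.\<close>

lemma liminf_integral_bound:
  fixes u :: "nat \<Rightarrow> 'a \<Rightarrow> real"
  assumes u: "\<And>n. integrable N (u n)" "\<And>n x. x \<in> space N \<Longrightarrow> 0 \<le> u n x" and v: "v \<in> borel_measurable N"
    and lim: "AE x in N. (\<lambda>n. u n x) \<longlonglongrightarrow> v x" and B: "\<And>n. n \<ge> n0 \<Longrightarrow> (LINT x|N. u n x) \<le> B"
  shows "integrable N v" "(LINT x|N. v x) \<le> B"
proof -
  have v0: "AE x in N. 0 \<le> v x"
    using lim AE_space by eventually_elim (rule LIMSEQ_le_const, auto simp: u)
  have "(\<integral>\<^sup>+x. ennreal (v x) \<partial>N) \<le> (\<integral>\<^sup>+x. liminf (\<lambda>n. ennreal (u n x)) \<partial>N)"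
  proof (rule nn_integral_mono_AE)
    show "AE x in N. ennreal (v x) \<le> liminf (\<lambda>n. ennreal (u n x))"
      using lim
    proof eventually_elim
      case (elim x)
      then have "(\<lambda>n. ennreal (u n x)) \<longlonglongrightarrow> ennreal (v x)" by (intro tendsto_intros)
      then have "liminf (\<lambda>n. ennreal (u n x)) = ennreal (v x)" by (intro lim_imp_Liminf) auto
      then show ?case by simp
    qed
  qed
  also have "\<dots> \<le> liminf (\<lambda>n. \<integral>\<^sup>+x. ennreal (u n x) \<partial>N)"
    by (rule nn_integral_liminf) (use u(1) in auto)
  also have "\<dots> \<le> ennreal B"
  proof (rule Liminf_le)
    show "eventually (\<lambda>n. (\<integral>\<^sup>+x. ennreal (u n x) \<partial>N) \<le> ennreal B) sequentially"
      using eventually_ge_at_top[of n0]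
      by eventually_elim (use B in \<open>simp add: nn_integral_eq_integral[OF u(1)] u(2) AE_I2 ennreal_leI\<close>)
  qed simp
  finally have le: "(\<integral>\<^sup>+x. ennreal (v x) \<partial>N) \<le> ennreal B" .
  have "(\<integral>\<^sup>+x. ennreal (norm (v x)) \<partial>N) = (\<integral>\<^sup>+x. ennreal (v x) \<partial>N)"
    by (rule nn_integral_cong_AE) (use v0 in eventually_elim, simp)
  then show i: "integrable N v" using v le by (intro integrableI_bounded) (auto simp: order_le_less_trans[OF _ ennreal_less_top])
  have "0 \<le> B" using B[of n0] Bochner_Integration.integral_nonneg[of N "u n0"] u(2) by fastforce
  then show "(LINT x|N. v x) \<le> B"
    using le nn_integral_eq_integral[OF i v0] by (simp add: ennreal_le_iff)
qed

context doubly_periodic_null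
begin

text \<open>Partial sums along a fast exhaustion \<open>X\<close> of the lattice converge in \<open>L2\<close> for almost
  every \<open>\<eta>\<close>, since their consecutive distances are summable in the Bochner norm.\<close>

lemma is_floquet_exists:
  assumes f: "f \<in> L2 (area \<Omega>)"
  shows "\<exists>F. is_floquet f F"
proof -
  interpret complete_measure NN by (rule complete_dual)
  define a where "a = (\<lambda>m. (L2_norm M (\<lambda>z. f (z + m)))\<^sup>2)"
  define s where "s = (L2_norm (area \<Omega>) f)\<^sup>2"
  have as: "(a has_sum s) L" unfolding a_def s_def by (rule L2_norm_Omega[OF f])
  have a0: "0 \<le> a m" for m by (simp add: a_def)
  have le_s: "sum a B \<le> s" if "finite B" "B \<subseteq> L" for B
    by (rule finite_sum_le_has_sum[OF as]) (use that a0 in auto)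
  \<comment> \<open>Squared norms of the tails below \<open>(1/4)^k\<close> make consecutive
    distances of order \<open>(1/2)^k\<close>, a summable sequence.\<close>
  have "\<exists>Y. finite Y \<and> Y \<subseteq> L \<and> s - (1/4)^k < sum a Y" for k :: nat
  proof -
    have "eventually (\<lambda>Y. s - (1/4)^k < sum a Y) (finite_subsets_at_top L)"
      using as unfolding has_sum_def by (rule order_tendstoD) simp
    then show ?thesis unfolding eventually_finite_subsets_at_top by blast
  qed
  then obtain Y where Y: "\<And>k. finite (Y k)" "\<And>k. Y k \<subseteq> L" "\<And>k. s - (1/4)^k < sum a (Y k)" by metis
  \<comment> \<open>Unions make the index sets increase, so that consecutive partial sums differ by
    a partial sum.\<close>
  define X where "X = (\<lambda>k. \<Union>j\<le>k. Y j)"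
  have Xmono: "X k \<subseteq> X j" if "k \<le> j" for k j unfolding X_def using that by (intro UN_mono) auto
  have X: "finite (X k)" "X k \<subseteq> L" "X k \<subseteq> X (Suc k)" for k
    using Y Xmono[of k "Suc k"] by (auto simp: X_def)
  have tail: "sum a (B - X k) \<le> (1/4)^k" if B: "finite B" "B \<subseteq> L" for B k
  proof -
    have "sum a (Y k) \<le> sum a (X k)" by (rule sum_mono2) (use X a0 in \<open>auto simp: X_def\<close>)
    moreover have "sum a (B - X k) + sum a (X k) = sum a ((B - X k) \<union> X k)"
      by (rule sum.union_disjoint[symmetric]) (use B X in auto)
    moreover have "\<dots> \<le> s" by (rule le_s) (use B X in auto)
    ultimately show ?thesis using Y(3)[of k] by linarith
  qed
  define t where "t = (\<lambda>k. S f (X k))"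
  have tL: "t k \<eta> \<in> L2 M" for k \<eta> unfolding t_def by (rule S_L2[OF f X(2)])
  have Bint: "integrable NN (\<lambda>\<eta>. (L2_norm M (S f B \<eta>))\<^sup>2)" if "B \<subseteq> L" for B
    by (intro integrable_continuous_dual continuous_intros S_norm_continuous f that)
  define \<delta> where "\<delta> = (\<lambda>k \<eta>. L2_norm M (t (Suc k) \<eta> - t k \<eta>))"
  have \<delta>_eq: "\<delta> k \<eta> = L2_norm M (S f (X (Suc k) - X k) \<eta>)" for k \<eta>
    unfolding \<delta>_def t_def by (simp add: S_diff_subset[OF X(1) X(3)])
  have \<delta>sub: "X (Suc k) - X k \<subseteq> L" for k using X by blast
  have \<delta>m: "\<delta> k \<in> borel_measurable NN" for k
    unfolding \<delta>_eq[abs_def] by (intro borel_measurable_dual borel_measurable_continuous_onI S_norm_continuous f \<delta>sub)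
  have \<delta>2: "(LINT \<eta>|NN. (\<delta> k \<eta>)\<^sup>2) \<le> (1/4)^k" for k
    unfolding \<delta>_eq S_Parseval[OF f finite_Diff[OF X(1)] \<delta>sub] using tail[OF X(1,2), of "Suc k" k] by (simp add: a_def)
  define c where "c = sqrt (measure NN (space NN))"
  have \<delta>i: "integrable NN (\<delta> k)" "(LINT \<eta>|NN. \<bar>\<delta> k \<eta>\<bar>) \<le> c * (1/2)^k" for k
  proof -
    have sq: "integrable NN (\<lambda>\<eta>. (\<delta> k \<eta>)\<^sup>2)" unfolding \<delta>_eq by (rule Bint[OF \<delta>sub])
    show "integrable NN (\<delta> k)" by (rule integral_norm_le_sqrt(1)[OF finite_dual \<delta>m sq])
    have "(LINT \<eta>|NN. \<bar>\<delta> k \<eta>\<bar>) \<le> c * sqrt (LINT \<eta>|NN. (\<delta> k \<eta>)\<^sup>2)"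
      unfolding c_def by (rule integral_norm_le_sqrt(2)[OF finite_dual \<delta>m sq])
    also have "\<dots> \<le> c * sqrt ((1/4)^k)" unfolding c_def by (intro mult_left_mono real_sqrt_le_mono \<delta>2) auto
    also have "sqrt ((1/4)^k) = (1/2)^k" by (simp add: real_sqrt_power real_sqrt_divide)
    finally show "(LINT \<eta>|NN. \<bar>\<delta> k \<eta>\<bar>) \<le> c * (1/2)^k" .
  qed
  have c0: "0 \<le> c" by (simp add: c_def)
  have "AE \<eta> in NN. summable (\<lambda>k. \<delta> k \<eta>)"
  proof -
    have "(\<integral>\<^sup>+\<eta>. (\<Sum>k. ennreal (\<delta> k \<eta>)) \<partial>NN) = (\<Sum>k. \<integral>\<^sup>+\<eta>. ennreal (\<delta> k \<eta>) \<partial>NN)"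
      by (rule nn_integral_suminf) (use \<delta>m in auto)
    also have "\<dots> \<le> (\<Sum>k. ennreal (c * (1/2)^k))"
    proof (rule suminf_le)
      fix k
      have "(\<integral>\<^sup>+\<eta>. ennreal (\<delta> k \<eta>) \<partial>NN) = ennreal (LINT \<eta>|NN. \<delta> k \<eta>)"
        by (rule nn_integral_eq_integral[OF \<delta>i(1)]) (simp add: \<delta>_def)
      also have "\<dots> \<le> ennreal (c * (1/2)^k)" using \<delta>i(2)[of k] by (intro ennreal_leI) (simp add: \<delta>_def)
      finally show "(\<integral>\<^sup>+\<eta>. ennreal (\<delta> k \<eta>) \<partial>NN) \<le> ennreal (c * (1/2)^k)" .
    qed auto
    also have "\<dots> = ennreal (\<Sum>k. c * (1/2)^k)"
      by (rule suminf_ennreal2) (use c0 in \<open>auto intro!: summable_mult summable_geometric\<close>)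
    finally have "(\<integral>\<^sup>+\<eta>. (\<Sum>k. ennreal (\<delta> k \<eta>)) \<partial>NN) < \<infinity>" by (rule order_le_less_trans) simp
    then have "AE \<eta> in NN. (\<Sum>k. ennreal (\<delta> k \<eta>)) \<noteq> \<infinity>"
      by (intro nn_integral_noteq_infinite) (use \<delta>m in auto)
    then show ?thesis
      by eventually_elim (rule summable_suminf_not_top, auto simp: \<delta>_def)
  qed
  then have Cau: "AE \<eta> in NN. L2_Cauchy M (\<lambda>k. t k \<eta>)"
    by eventually_elim (rule L2_Cauchy_of_summable[OF tL], simp add: \<delta>_def)
  \<comment> \<open>Membership in the Bochner space is required at every parameter, so the
    exceptional ones receive the zero function.\<close>
  define F where "F = (\<lambda>\<eta>. if L2_Cauchy M (\<lambda>k. t k \<eta>) then (SOME g. g \<in> L2 M \<and> (\<lambda>k. L2_norm M (t k \<eta> - g)) \<longlonglongrightarrow> 0) else (\<lambda>z. 0))"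
  have Flim: "F \<eta> \<in> L2 M \<and> (\<lambda>k. L2_norm M (t k \<eta> - F \<eta>)) \<longlonglongrightarrow> 0" if "L2_Cauchy M (\<lambda>k. t k \<eta>)" for \<eta>
  proof -
    have "\<exists>g. g \<in> L2 M \<and> (\<lambda>k. L2_norm M (t k \<eta> - g)) \<longlonglongrightarrow> 0"
      using L2_Riesz_Fischer[OF finite_area tL that] by blast
    from someI_ex[OF this] show ?thesis using that by (simp add: F_def)
  qed
  have FL: "F \<eta> \<in> L2 M" for \<eta> using Flim[of \<eta>] by (cases "L2_Cauchy M (\<lambda>k. t k \<eta>)") (auto simp: F_def)
  have AElim: "AE \<eta> in NN. (\<lambda>k. L2_norm M (t k \<eta> - F \<eta>)) \<longlonglongrightarrow> 0"
    using Cau by eventually_elim (use Flim in blast)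
  have dist_m: "(\<lambda>\<eta>. L2_norm M (F \<eta> - v)) \<in> borel_measurable NN" if v: "v \<in> L2 M" for v
  proof (rule borel_measurable_AE_LIMSEQ)
    show "(\<lambda>\<eta>. L2_norm M (t k \<eta> - v)) \<in> borel_measurable NN" for k
      unfolding t_def by (intro borel_measurable_dual borel_measurable_continuous_onI S_dist_continuous f X(2) v)
    show "AE \<eta> in NN. (\<lambda>k. L2_norm M (t k \<eta> - v)) \<longlonglongrightarrow> L2_norm M (F \<eta> - v)"
      using AElim by eventually_elim (rule tendsto_L2_norm[OF tL FL v])
  qed
  obtain Q :: "(real \<times> real) set" where Q: "countable Q" "\<And>U. open U \<Longrightarrow> U \<noteq> {} \<Longrightarrow> \<exists>q\<in>Q. q \<in> U"
    using countable_dense_exists by blast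
  \<comment> \<open>Partial sums vary continuously with the parameter, so those taken at a countable
    dense set of parameters approximate all values of \<open>F\<close>; the zero function serves the
    exceptional parameters.\<close>
  define D where "D = insert (\<lambda>z. 0) ((\<lambda>(k, q). t k q) ` (UNIV \<times> Q))"
  have sm: "strongly_measurable NN M (L2 M) F"
  proof (rule strongly_measurable_of_separable[of D])
    show DL: "D \<subseteq> L2 M" using tL by (auto simp: D_def)
    show "countable D" unfolding D_def using Q(1) by auto
    show "(\<lambda>\<eta>. L2_norm M (F \<eta> - d)) \<in> borel_measurable NN" if "d \<in> D" for d using dist_m DL that by blast
    fix \<eta> and e :: real assume e: "e > 0"
    show "\<exists>d\<in>D. L2_norm M (F \<eta> - d) < e"
    proof (cases "L2_Cauchy M (\<lambda>k. t k \<eta>)")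
      case False
      then have "F \<eta> = (\<lambda>z. 0)" by (simp add: F_def)
      then show ?thesis using e L2_norm_diff_self[of M "\<lambda>z. 0"] by (intro bexI[of _ "\<lambda>z. 0"]) (simp_all add: D_def)
    next
      case True
      then obtain k where k: "L2_norm M (t k \<eta> - F \<eta>) < e/2"
        using LIMSEQ_D[of "\<lambda>k. L2_norm M (t k \<eta> - F \<eta>)" 0 "e/2"] Flim e by auto
      define U where "U = {q. L2_norm M (t k q - t k \<eta>) < e/2}"
      have "open U" unfolding U_def t_def
        by (intro open_Collect_less S_dist_continuous f X(2) S_L2 continuous_intros)
      moreover have "\<eta> \<in> U" using e by (simp add: U_def)
      ultimately obtain q where qU: "q \<in> Q" "q \<in> U" using Q(2)[of U] by blast
      then have q: "q \<in> Q" "L2_norm M (t k q - t k \<eta>) < e/2" by (simp_all add: U_def)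
      have "L2_norm M (F \<eta> - t k q) \<le> L2_norm M (F \<eta> - t k \<eta>) + L2_norm M (t k \<eta> - t k q)"
        by (rule L2_norm_triangle_diff[OF FL tL tL])
      then have "L2_norm M (F \<eta> - t k q) < e"
        unfolding L2_norm_minus_commute[of M "F \<eta>" "t k \<eta>"] L2_norm_minus_commute[of M "t k \<eta>" "t k q"] using k q(2) by simp
      moreover have "t k q \<in> D" using q(1) by (auto simp: D_def)
      ultimately show ?thesis by blast
    qed
  qed
  have Fn_m: "(\<lambda>\<eta>. L2_norm M (F \<eta>)) \<in> borel_measurable NN" using dist_m[of "\<lambda>z. 0"] by (simp add: fun_diff_def)
  have int: "integrable NN (\<lambda>\<eta>. (L2_norm M (F \<eta>))\<^sup>2)"
  proof (rule liminf_integral_bound(1)[of NN "\<lambda>k \<eta>. (L2_norm M (t k \<eta>))\<^sup>2" _ 0 s])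
    show "integrable NN (\<lambda>\<eta>. (L2_norm M (t k \<eta>))\<^sup>2)" for k unfolding t_def by (rule Bint[OF X(2)])
    show "(LINT \<eta>|NN. (L2_norm M (t k \<eta>))\<^sup>2) \<le> s" for k
      unfolding t_def S_Parseval[OF f X(1,2)] using le_s[OF X(1,2)] by (simp add: a_def)
    show "AE \<eta> in NN. (\<lambda>k. (L2_norm M (t k \<eta>))\<^sup>2) \<longlonglongrightarrow> (L2_norm M (F \<eta>))\<^sup>2"
      using AElim
    proof eventually_elim
      case (elim \<eta>)
      from tendsto_power[OF tendsto_L2_norm[OF tL FL L2_zero elim], of 2] show ?case by (simp add: fun_diff_def)
    qed
  qed (use Fn_m in auto)
  have Fin: "F \<in> floquet_space \<omega>" unfolding bochner_L2_def using FL sm int by auto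
  \<comment> \<open>A finite index set containing \<open>X k\<close> is compared with later partial
    sums \<open>t j\<close> through \<open>X k\<close>. The two tails contribute
    \<open>2 * (1/4)^k\<close> each, and Fatou lets \<open>j\<close> grow; convergence along
    \<open>X\<close> thereby becomes convergence along all finite sets.\<close>
  have dist_bd: "(LINT \<eta>|NN. (L2_norm M (S f B \<eta> - F \<eta>))\<^sup>2) \<le> 4 * (1/4)^k" if B: "finite B" "B \<subseteq> L" "X k \<subseteq> B" for B k
  proof (rule liminf_integral_bound(2)[of NN "\<lambda>j \<eta>. (L2_norm M (S f B \<eta> - t j \<eta>))\<^sup>2" _ k])
    fix j
    have cont: "continuous_on UNIV (\<lambda>\<eta>. L2_norm M (S f B \<eta> - t j \<eta>))"
    proof -
      have "(L2_norm M (S f B \<eta> - t j \<eta>))\<^sup>2 = (L2_norm M (S f B \<eta>))\<^sup>2 + (L2_norm M (t j \<eta>))\<^sup>2 - 2 * Re (L2_inner M (S f B \<eta>) (t j \<eta>))" for \<eta>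
        by (intro L2_norm_diff_sq S_L2 f B tL)
      then have "L2_norm M (S f B \<eta> - t j \<eta>) = sqrt ((L2_norm M (S f B \<eta>))\<^sup>2 + (L2_norm M (t j \<eta>))\<^sup>2 - 2 * Re (L2_inner M (S f B \<eta>) (t j \<eta>)))" for \<eta>
        by (metis L2_norm_nonneg real_sqrt_unique)
      moreover have "L2_inner M (S f B \<eta>) (t j \<eta>) = (\<Sum>m\<in>B. (of_real (1 / (2 * pi)) * cnj (chi \<eta> m)) * cnj (L2_inner M (t j \<eta>) (\<lambda>z. f (z + m))))" for \<eta>
        unfolding S_inner[OF f B(2) tL] by (simp add: L2_inner_commute[of M _ "t j \<eta>"])
      ultimately show ?thesis
        unfolding t_def by (simp only:) (intro continuous_intros S_norm_continuous S_inner_continuous f B X(2) shift_L2, use B in blast)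
    qed
    show "integrable NN (\<lambda>\<eta>. (L2_norm M (S f B \<eta> - t j \<eta>))\<^sup>2)"
      by (intro integrable_continuous_dual continuous_intros cont)
    assume j: "k \<le> j"
    have sub: "B - X k \<subseteq> L" "X j - X k \<subseteq> L" using B X(2)[of j] by auto
    have bd: "(L2_norm M (S f B \<eta> - t j \<eta>))\<^sup>2 \<le> 2 * (L2_norm M (S f (B - X k) \<eta>))\<^sup>2 + 2 * (L2_norm M (S f (X j - X k) \<eta>))\<^sup>2" for \<eta>
    proof -
      have "S f B \<eta> - t j \<eta> = (S f B \<eta> - S f (X k) \<eta>) - (S f (X j) \<eta> - S f (X k) \<eta>)" by (simp add: t_def fun_eq_iff)
      also have "\<dots> = S f (B - X k) \<eta> - S f (X j - X k) \<eta>"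
        by (simp only: S_diff_subset[OF B(1,3)] S_diff_subset[OF X(1) Xmono[OF j]])
      finally have eq: "S f B \<eta> - t j \<eta> = S f (B - X k) \<eta> - S f (X j - X k) \<eta>" .
      show ?thesis unfolding eq by (intro L2_norm_diff_sq_le S_L2 f sub)
    qed
    have "(LINT \<eta>|NN. (L2_norm M (S f B \<eta> - t j \<eta>))\<^sup>2) \<le> (LINT \<eta>|NN. 2 * (L2_norm M (S f (B - X k) \<eta>))\<^sup>2 + 2 * (L2_norm M (S f (X j - X k) \<eta>))\<^sup>2)"
      using Bint[OF sub(1)] Bint[OF sub(2)]
      by (intro integral_mono integrable_continuous_dual continuous_intros cont bd S_norm_continuous f sub)
    also have "\<dots> = 2 * sum a (B - X k) + 2 * sum a (X j - X k)"
      using Bint[OF sub(1)] Bint[OF sub(2)] S_Parseval[OF f _ sub(1)] S_Parseval[OF f _ sub(2)] B(1) X(1) by (simp add: a_def)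
    also have "\<dots> \<le> 4 * (1/4)^k" using tail[OF B(1,2), of k] tail[OF X(1,2), of j k] by simp
    finally show "(LINT \<eta>|NN. (L2_norm M (S f B \<eta> - t j \<eta>))\<^sup>2) \<le> 4 * (1/4)^k" .
  next
    show "AE \<eta> in NN. (\<lambda>j. (L2_norm M (S f B \<eta> - t j \<eta>))\<^sup>2) \<longlonglongrightarrow> (L2_norm M (S f B \<eta> - F \<eta>))\<^sup>2"
      using AElim
    proof eventually_elim
      case (elim \<eta>)
      from tendsto_power[OF tendsto_L2_norm[OF tL FL S_L2[OF f B(2), of \<eta>] elim], of 2] show ?case
        by (simp only: L2_norm_minus_commute[of M "S f B \<eta>"])
    qed
    show "(\<lambda>\<eta>. (L2_norm M (S f B \<eta> - F \<eta>))\<^sup>2) \<in> borel_measurable NN"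
      using S_dist_measurable[OF f B(2) Fin] by simp
  qed auto
  have "((\<lambda>B. bochner_norm NN M (S f B - F)) \<longlongrightarrow> 0) (finite_subsets_at_top L)"
  proof (rule tendstoI)
    fix e :: real assume e: "e > 0"
    have "(\<lambda>k. 2 * (1/2::real)^k) \<longlonglongrightarrow> 2 * 0" by (intro tendsto_intros) simp
    then have "eventually (\<lambda>k. 2 * (1/2::real)^k < e) sequentially" using e by (intro order_tendstoD) auto
    then obtain k where k: "2 * (1/2::real)^k < e" by (auto simp: eventually_sequentially)
    have "dist (bochner_norm NN M (S f B - F)) 0 < e" if B: "finite B" "X k \<subseteq> B" "B \<subseteq> L" for B
    proof -
      have "bochner_norm NN M (S f B - F) = sqrt (LINT \<eta>|NN. (L2_norm M (S f B \<eta> - F \<eta>))\<^sup>2)" by (simp add: bochner_norm_def)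
      also have "\<dots> \<le> sqrt (4 * (1/4)^k)" using dist_bd[OF B(1,3,2)] by (rule real_sqrt_le_mono)
      also have "\<dots> = 2 * (1/2)^k" by (simp add: real_sqrt_mult real_sqrt_power real_sqrt_divide)
      finally show ?thesis using k by (simp add: bochner_norm_def)
    qed
    then show "\<forall>\<^sub>F B in finite_subsets_at_top L. dist (bochner_norm NN M (S f B - F)) 0 < e"
      unfolding eventually_finite_subsets_at_top
      by (intro exI[of _ "X k"] conjI X(1,2) allI impI) (elim conjE)
  qed
  then have "is_floquet f F" unfolding is_floquet_def floquet_partial_sum_eq using Fin by blast
  then show ?thesis by blast
qed

lemma is_floquet_floquet: assumes "f \<in> L2 (area \<Omega>)" shows "is_floquet f (floquet \<omega> f)"
  using someI_ex[OF is_floquet_exists[OF assms, unfolded is_floquet_def]]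
  unfolding floquet_def is_floquet_def .

end

section \<open>Vanishing Fourier coefficients and approximate continuity\<close>

lemma chi_measurable [measurable]: "(\<lambda>\<eta>. chi \<eta> k) \<in> borel_measurable NN"
  by (intro borel_measurable_dual borel_measurable_continuous_onI continuous_intros)

definition zero_coeffs :: "(real \<times> real \<Rightarrow> complex) \<Rightarrow> bool" where
  "zero_coeffs c \<longleftrightarrow> integrable NN c \<and> (\<forall>k\<in>period_lattice. (LINT \<eta>|NN. chi \<eta> k * c \<eta>) = 0)"

lemma integrable_chi_mult:
  assumes "integrable NN c" shows "integrable NN (\<lambda>\<eta>. chi \<eta> k * c \<eta>)"
proof (rule Bochner_Integration.integrable_bound[OF assms])
  have [measurable]: "c \<in> borel_measurable NN" using assms by simp
  show "(\<lambda>\<eta>. chi \<eta> k * c \<eta>) \<in> borel_measurable NN" by measurable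
qed (auto simp: norm_mult)

lemma zero_coeffs_chi:
  assumes "zero_coeffs c" "j \<in> period_lattice" shows "zero_coeffs (\<lambda>\<eta>. chi \<eta> j * c \<eta>)"
  unfolding zero_coeffs_def
proof (intro conjI ballI)
  show "integrable NN (\<lambda>\<eta>. chi \<eta> j * c \<eta>)" using assms by (auto simp: zero_coeffs_def intro: integrable_chi_mult)
  fix k assume "k \<in> period_lattice"
  then have "k + j \<in> period_lattice" using assms by auto
  then have "(LINT \<eta>|NN. chi \<eta> (k + j) * c \<eta>) = 0" using assms(1) by (simp add: zero_coeffs_def)
  then show "(LINT \<eta>|NN. chi \<eta> k * (chi \<eta> j * c \<eta>)) = 0" by (simp only: chi_add mult.assoc)
qed

lemma zero_coeffs_add:
  assumes "zero_coeffs c" "zero_coeffs d" shows "zero_coeffs (\<lambda>\<eta>. c \<eta> + d \<eta>)"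
  using assms integrable_chi_mult by (simp add: zero_coeffs_def distrib_left)

lemma zero_coeffs_scale:
  assumes "zero_coeffs c" shows "zero_coeffs (\<lambda>\<eta>. a * c \<eta>)"
  using assms by (simp add: zero_coeffs_def mult.left_commute[of _ a])

text \<open>Characters do not separate opposite boundary points of the dual cell. The torus
  identifies such points, so Stone--Weierstrass is applied to the image there.\<close>

definition torus_map :: "real \<times> real \<Rightarrow> complex \<times> complex" where
  "torus_map \<eta> = (cis (fst \<eta>), cis (snd \<eta>))"

lemma continuous_torus_map [continuous_intros]: "continuous_on S torus_map"
  unfolding torus_map_def by (intro continuous_intros)

text \<open>With one of the two points in the interior, their coordinates differ by less than
  \<open>2 * pi\<close>, so equal phases force equality.\<close>

lemma torus_map_inj:
  assumes "\<kappa> \<in> box (-pi, -pi) (pi, pi)" "\<eta> \<in> dual_cell" "torus_map \<eta> = torus_map \<kappa>"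
  shows "\<eta> = \<kappa>"
proof -
  have one: "x = y" if c: "cis x = cis y" and y: "-pi < y" "y < pi" and x: "-pi \<le> x" "x \<le> pi" for x y
  proof -
    have "cis (x - y) = 1" using c by (simp add: cis_divide[symmetric])
    then obtain n :: int where n: "x - y = of_int n * (2 * pi)"
      by (auto simp: complex_eq_iff cos_one_2pi_int mult_ac)
    have "\<bar>of_int n * (2 * pi)\<bar> < 2 * pi" unfolding n[symmetric] using x y by auto
    then have "\<bar>real_of_int n\<bar> * (2 * pi) < 1 * (2 * pi)" by (simp add: abs_mult)
    then have "\<bar>real_of_int n\<bar> < 1" by (subst (asm) mult_less_cancel_right_pos) auto
    then have "n = 0" by linarith
    then show ?thesis using n by simp
  qed
  show ?thesis using assms one[of "fst \<eta>" "fst \<kappa>"] one[of "snd \<eta>" "snd \<kappa>"]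
    by (auto simp: torus_map_def dual_cell_def mem_box Basis_prod_def inner_prod_def prod_eq_iff mem_Times_iff)
qed

text \<open>Trigonometric polynomials integrate to zero against \<open>c\<close>, and on the torus
  they are uniformly dense among the continuous functions.\<close>

lemma zero_coeffs_continuous_test:
  fixes p :: "complex \<times> complex \<Rightarrow> real"
  assumes c: "zero_coeffs c" and p: "continuous_on (torus_map ` dual_cell) p"
  shows "(LINT \<eta>|NN. of_real (p (torus_map \<eta>)) * c \<eta>) = 0"
proof -
  define X where "X = torus_map ` dual_cell"
  have X: "compact X" unfolding X_def
    by (intro compact_continuous_image continuous_intros) (simp add: dual_cell_cbox)
  \<comment> \<open>Quantifying over all functions with vanishing coefficients makes the property
    stable under products: the two multiplications are carried out one after the other.\<close>
  define P where "P = (\<lambda>p :: complex \<times> complex \<Rightarrow> real. continuous_on X p \<and> (\<forall>c. zero_coeffs c \<longrightarrow> zero_coeffs (\<lambda>\<eta>. of_real (p (torus_map \<eta>)) * c \<eta>)))"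
  have trig: "zero_coeffs (\<lambda>\<eta>. of_real (q (torus_map \<eta>)) * c \<eta>)"
    if q: "\<And>\<eta>. of_real (q (torus_map \<eta>)) = a * chi \<eta> j + b * chi \<eta> (- j)" and j: "j \<in> period_lattice" and c: "zero_coeffs c" for q a b j c
  proof -
    have "zero_coeffs (\<lambda>\<eta>. a * (chi \<eta> j * c \<eta>) + b * (chi \<eta> (- j) * c \<eta>))"
      by (intro zero_coeffs_add zero_coeffs_scale zero_coeffs_chi c j period_lattice_minus)
    then show ?thesis by (simp add: q distrib_right mult.assoc)
  qed
  have P1: "P (\<lambda>w. Re (fst w))" unfolding P_def
    using trig[of "\<lambda>w. Re (fst w)" "1/2" 1 "1/2"]
    by (auto intro!: continuous_intros simp: torus_map_def chi_minus complex_eq_iff)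
  have P2: "P (\<lambda>w. Im (fst w))" unfolding P_def
    using trig[of "\<lambda>w. Im (fst w)" "-\<i>/2" 1 "\<i>/2"]
    by (auto intro!: continuous_intros simp: torus_map_def chi_minus complex_eq_iff)
  have P3: "P (\<lambda>w. Re (snd w))" unfolding P_def
    using trig[of "\<lambda>w. Re (snd w)" "1/2" \<i> "1/2"]
    by (auto intro!: continuous_intros simp: torus_map_def chi_minus complex_eq_iff)
  have P4: "P (\<lambda>w. Im (snd w))" unfolding P_def
    using trig[of "\<lambda>w. Im (snd w)" "-\<i>/2" \<i> "\<i>/2"]
    by (auto intro!: continuous_intros simp: torus_map_def chi_minus complex_eq_iff)
  have approx: "\<exists>g. P g \<and> (\<forall>x\<in>X. \<bar>p x - g x\<bar> < e)" if "0 < e" for e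
  proof (rule Stone_Weierstrass_HOL[OF X])
    show "P (\<lambda>x. a)" for a by (auto simp: P_def intro: zero_coeffs_scale)
    show "P (\<lambda>x. f x + g x)" if "P f \<and> P g" for f g
      using that by (auto simp: P_def distrib_right intro!: continuous_intros zero_coeffs_add)
    show "P (\<lambda>x. f x * g x)" if "P f \<and> P g" for f g
      using that by (auto simp: P_def mult.assoc intro!: continuous_intros)
    show "\<exists>f. P f \<and> f x \<noteq> f y" if "x \<in> X \<and> y \<in> X \<and> x \<noteq> y" for x y
      using that P1 P2 P3 P4 by (auto simp: prod_eq_iff complex_eq_iff)
  qed (use p that in \<open>auto simp: P_def X_def\<close>)
  have ci: "integrable NN c" using c by (simp add: zero_coeffs_def)
  have cm [measurable]: "c \<in> borel_measurable NN" using ci by simp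
  have pm: "(\<lambda>\<eta>. p (torus_map \<eta>)) \<in> borel_measurable NN"
    by (intro continuous_imp_measurable_on_sets_lebesgue continuous_on_compose2[OF p] continuous_intros) auto
  obtain B where B: "\<And>x. x \<in> X \<Longrightarrow> \<bar>p x\<bar> \<le> B"
    using compact_imp_bounded[OF compact_continuous_image[OF p[folded X_def] X]] by (auto simp: bounded_iff)
  have pi: "integrable NN (\<lambda>\<eta>. of_real (p (torus_map \<eta>)) * c \<eta>)"
  proof (rule Bochner_Integration.integrable_bound)
    show "integrable NN (\<lambda>\<eta>. of_real B * c \<eta>)" using ci by simp
    show "(\<lambda>\<eta>. of_real (p (torus_map \<eta>)) * c \<eta>) \<in> borel_measurable NN" using pm by measurable
    show "AE \<eta> in NN. norm (of_real (p (torus_map \<eta>)) * c \<eta>) \<le> norm (of_real B * c \<eta>)"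
      by (rule AE_I2) (use B in \<open>fastforce simp: norm_mult X_def intro!: mult_right_mono\<close>)
  qed
  define A where "A = (LINT \<eta>|NN. cmod (c \<eta>))"
  have "cmod (LINT \<eta>|NN. of_real (p (torus_map \<eta>)) * c \<eta>) \<le> e * A" if e: "0 < e" for e
  proof -
    obtain g where g: "P g" "\<And>x. x \<in> X \<Longrightarrow> \<bar>p x - g x\<bar> < e" using approx[OF e] by blast
    have zc: "zero_coeffs (\<lambda>\<eta>. of_real (g (torus_map \<eta>)) * c \<eta>)" using g(1) c by (simp add: P_def)
    then have gi: "integrable NN (\<lambda>\<eta>. of_real (g (torus_map \<eta>)) * c \<eta>)" and g0: "(LINT \<eta>|NN. of_real (g (torus_map \<eta>)) * c \<eta>) = 0"
      by (auto simp: zero_coeffs_def dest: bspec[of _ _ 0])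
    have "(LINT \<eta>|NN. of_real (p (torus_map \<eta>)) * c \<eta>) = (LINT \<eta>|NN. of_real (p (torus_map \<eta>)) * c \<eta> - of_real (g (torus_map \<eta>)) * c \<eta>)"
      using pi gi g0 by simp
    also have "cmod \<dots> \<le> (LINT \<eta>|NN. e * cmod (c \<eta>))"
    proof (rule order_trans[OF Bochner_Integration.integral_norm_bound Bochner_Integration.integral_mono])
      show "cmod (of_real (p (torus_map \<eta>)) * c \<eta> - of_real (g (torus_map \<eta>)) * c \<eta>) \<le> e * cmod (c \<eta>)" if "\<eta> \<in> space NN" for \<eta>
      proof -
        have "\<bar>p (torus_map \<eta>) - g (torus_map \<eta>)\<bar> \<le> e" using g(2)[of "torus_map \<eta>"] that by (auto simp: X_def)
        then have "cmod (of_real (p (torus_map \<eta>) - g (torus_map \<eta>)) * c \<eta>) \<le> e * cmod (c \<eta>)"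
          unfolding norm_mult norm_of_real by (intro mult_right_mono) auto
        then show ?thesis by (simp add: left_diff_distrib)
      qed
    qed (use pi gi ci in auto)
    finally show ?thesis by (simp add: A_def)
  qed note bd = this
  have "cmod (LINT \<eta>|NN. of_real (p (torus_map \<eta>)) * c \<eta>) \<le> 0"
  proof (rule tendsto_lowerbound)
    show "((\<lambda>e. e * A) \<longlongrightarrow> 0) (at_right 0)" by (auto intro!: tendsto_eq_intros)
    show "\<forall>\<^sub>F e in at_right 0. cmod (LINT \<eta>|NN. of_real (p (torus_map \<eta>)) * c \<eta>) \<le> e * A"
      using eventually_at_right_less[of "0::real"] by eventually_elim (rule bd)
  qed simp
  then show ?thesis by simp
qed

text \<open>The cutoffs \<open>p n\<close> decrease to the indicator of the image of
  \<open>K\<close> on the torus. Since \<open>K\<close> lies in the open box, only its own points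
  are mapped into that image, and dominated convergence applies.\<close>

lemma zero_coeffs_compact:
  assumes c: "zero_coeffs c" and K: "compact K" "K \<subseteq> box (-pi, -pi) (pi, pi)"
  shows "(LINT \<eta>|NN. indicator K \<eta> *\<^sub>R c \<eta>) = 0"
proof (cases "K = {}")
  case False
  have ci: "integrable NN c" using c by (simp add: zero_coeffs_def)
  have [measurable]: "c \<in> borel_measurable NN" using ci by simp
  have [measurable]: "K \<in> sets borel" using K(1) by (simp add: compact_imp_closed borel_closed)
  have sub: "box (-pi, -pi) (pi, pi) \<subseteq> dual_cell" unfolding dual_cell_cbox by (rule box_subset_cbox)
  define A where "A = torus_map ` K"
  have A: "compact A" "A \<noteq> {}" unfolding A_def using K False by (auto intro!: compact_continuous_image continuous_intros)
  define p where "p = (\<lambda>n::nat. \<lambda>x. max 0 (1 - real n * infdist x A))"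
  have pc: "continuous_on X (p n)" for n X unfolding p_def by (intro continuous_intros)
  have "(\<lambda>n. LINT \<eta>|NN. of_real (p n (torus_map \<eta>)) * c \<eta>) \<longlonglongrightarrow> (LINT \<eta>|NN. indicator K \<eta> *\<^sub>R c \<eta>)"
  proof (rule integral_dominated_convergence[where w = "\<lambda>\<eta>. cmod (c \<eta>)"])
    show "(\<lambda>\<eta>. indicator K \<eta> *\<^sub>R c \<eta>) \<in> borel_measurable NN"
      by (intro borel_measurable_scaleR borel_measurable_dual[of "indicator K"]) auto
    have "(\<lambda>\<eta>. p n (torus_map \<eta>)) \<in> borel_measurable NN" for n
      by (intro borel_measurable_dual borel_measurable_continuous_onI continuous_on_compose2[OF pc[of UNIV]] continuous_intros) auto
    then show "(\<lambda>\<eta>. of_real (p n (torus_map \<eta>)) * c \<eta>) \<in> borel_measurable NN" for n by measurable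
    have "\<bar>p n x\<bar> \<le> 1" for n x unfolding p_def by (auto simp: max_def infdist_nonneg)
    then show "AE \<eta> in NN. norm (of_real (p n (torus_map \<eta>)) * c \<eta>) \<le> cmod (c \<eta>)" for n
      by (intro AE_I2) (simp add: norm_mult mult_left_le_one_le)
    show "integrable NN (\<lambda>\<eta>. cmod (c \<eta>))" using ci by simp
    show "AE \<eta> in NN. (\<lambda>n. of_real (p n (torus_map \<eta>)) * c \<eta>) \<longlonglongrightarrow> indicator K \<eta> *\<^sub>R c \<eta>"
    proof (rule AE_I2)
      fix \<eta> assume "\<eta> \<in> space NN"
      then have \<eta>: "\<eta> \<in> dual_cell" by simp
      have mem: "torus_map \<eta> \<in> A \<longleftrightarrow> \<eta> \<in> K"
        unfolding A_def using torus_map_inj[OF _ \<eta>] K(2) by blast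
      have "(\<lambda>n. p n (torus_map \<eta>)) \<longlonglongrightarrow> indicator K \<eta>"
      proof (cases "\<eta> \<in> K")
        case True
        then have "infdist (torus_map \<eta>) A = 0" using mem by simp
        then show ?thesis using True by (simp add: p_def)
      next
        case False
        then have pos: "infdist (torus_map \<eta>) A > 0"
          using mem A compact_imp_closed in_closed_iff_infdist_zero infdist_nonneg by (metis less_eq_real_def)
        obtain n0 where n0: "1 < real n0 * infdist (torus_map \<eta>) A" using reals_Archimedean3[OF pos] by blast
        have "p n (torus_map \<eta>) = 0" if "n \<ge> n0" for n
        proof -
          have "real n0 * infdist (torus_map \<eta>) A \<le> real n * infdist (torus_map \<eta>) A" using that pos by (intro mult_right_mono) auto
          then show ?thesis using n0 by (simp add: p_def)
        qed
        then have "eventually (\<lambda>n. p n (torus_map \<eta>) = 0) sequentially" by (auto simp: eventually_sequentially)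
        then show ?thesis using False by (simp add: tendsto_eventually)
      qed
      then have "(\<lambda>n. of_real (p n (torus_map \<eta>)) * c \<eta>) \<longlonglongrightarrow> of_real (indicator K \<eta>) * c \<eta>"
        by (intro tendsto_intros)
      then show "(\<lambda>n. of_real (p n (torus_map \<eta>)) * c \<eta>) \<longlonglongrightarrow> indicator K \<eta> *\<^sub>R c \<eta>" by (simp add: scaleR_conv_of_real)
    qed
  qed
  moreover have "(LINT \<eta>|NN. of_real (p n (torus_map \<eta>)) * c \<eta>) = 0" for n
    by (rule zero_coeffs_continuous_test[OF c pc])
  ultimately show ?thesis by (simp add: LIMSEQ_const_iff)
qed simp

text \<open>Inner regularity exhausts the part of the open box where \<open>d\<close> is positive by
  compact sets, up to a null set. On each of them a positive function has integral zero, so each is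
  null; the boundary of the dual cell is null as well.\<close>

lemma AE_nonpos_of_compact:
  fixes d :: "real \<times> real \<Rightarrow> real"
  assumes d: "integrable NN d" and K: "\<And>K. compact K \<Longrightarrow> K \<subseteq> box (-pi, -pi) (pi, pi) \<Longrightarrow> (LINT \<eta>|NN. indicator K \<eta> * d \<eta>) = 0"
  shows "AE \<eta> in NN. d \<eta> \<le> 0"
proof -
  let ?I = "box (-pi, -pi) (pi, pi) :: (real \<times> real) set"
  have sub: "?I \<subseteq> dual_cell" unfolding dual_cell_cbox by (rule box_subset_cbox)
  have [measurable]: "d \<in> borel_measurable NN" using d by simp
  define A where "A = {\<eta> \<in> dual_cell. 0 < d \<eta>} \<inter> ?I"
  have "{\<eta> \<in> space NN. 0 < d \<eta>} \<in> sets NN" by measurable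
  then have "{\<eta> \<in> dual_cell. 0 < d \<eta>} \<in> sets lebesgue" by (simp add: sets_restrict_space_iff)
  then have "A \<in> sets lebesgue" unfolding A_def by (intro sets.Int) auto
  then obtain Z C where Z: "negligible Z" and C: "\<And>n::nat. compact (C n)" and AC: "A = (\<Union>n. C n) \<union> Z"
    using lebesgue_regular_inner by metis
  have "AE \<eta> in NN. \<eta> \<notin> C n" for n
  proof -
    have Cs: "C n \<subseteq> A" using AC by blast
    have [measurable]: "C n \<in> sets borel" using C by (simp add: compact_imp_closed borel_closed)
    have ind: "(indicator (C n) :: real \<times> real \<Rightarrow> real) \<in> borel_measurable NN" by (intro borel_measurable_dual) auto
    have i: "integrable NN (\<lambda>\<eta>. indicator (C n) \<eta> * d \<eta>)"
    proof (rule Bochner_Integration.integrable_bound[OF d])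
      show "(\<lambda>\<eta>. indicator (C n) \<eta> * d \<eta>) \<in> borel_measurable NN" using ind by measurable
    qed (auto simp: indicator_def)
    have "(LINT \<eta>|NN. indicator (C n) \<eta> * d \<eta>) = 0" using Cs by (intro K C) (auto simp: A_def)
    moreover have "AE \<eta> in NN. 0 \<le> indicator (C n) \<eta> * d \<eta>"
      using Cs by (intro AE_I2) (auto simp: A_def indicator_def)
    ultimately have "AE \<eta> in NN. indicator (C n) \<eta> * d \<eta> = 0"
      using integral_nonneg_eq_0_iff_AE[OF i] by simp
    then show ?thesis by eventually_elim (use Cs in \<open>auto simp: A_def indicator_def split: if_splits\<close>)
  qed
  then have "AE \<eta> in NN. \<forall>n. \<eta> \<notin> C n" by (simp add: AE_all_countable)
  moreover have "AE \<eta> in NN. \<eta> \<notin> Z"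
  proof -
    have "AE \<eta> in lebesgue. \<eta> \<notin> Z" using Z by (intro AE_not_in) (simp add: negligible_iff_null_sets)
    then have "AE \<eta> in lebesgue. \<eta> \<in> dual_cell \<longrightarrow> \<eta> \<notin> Z" by eventually_elim simp
    then show ?thesis by (simp add: AE_restrict_space_iff)
  qed
  moreover have "AE \<eta> in NN. \<eta> \<in> ?I"
  proof -
    have "negligible (cbox (-pi, -pi) (pi, pi) - ?I)" by (rule negligible_frontier_interval)
    then have "AE \<eta> in lebesgue. \<eta> \<notin> dual_cell - ?I" unfolding dual_cell_cbox
      by (intro AE_not_in) (simp add: negligible_iff_null_sets)
    then have "AE \<eta> in lebesgue. \<eta> \<in> dual_cell \<longrightarrow> \<eta> \<in> ?I" by eventually_elim simp
    then show ?thesis by (simp add: AE_restrict_space_iff)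
  qed
  ultimately show ?thesis using AE_space
  proof eventually_elim
    case (elim \<eta>)
    then have "\<eta> \<notin> A" using AC by blast
    then show ?case using elim by (auto simp: A_def)
  qed
qed

text \<open>By Stone--Weierstrass on the torus, such a function integrates to zero over every compact
  subset of the open cell; Lebesgue measure is inner regular.\<close>

lemma zero_coeffs_imp_zero:
  assumes c: "zero_coeffs c"
  shows "AE \<eta> in NN. c \<eta> = 0"
proof -
  have ci: "integrable NN c" using c by (simp add: zero_coeffs_def)
  have ind: "integrable NN (\<lambda>\<eta>. indicator K \<eta> *\<^sub>R c \<eta>)" if "compact K" for K
  proof (rule Bochner_Integration.integrable_bound[OF ci])
    have "K \<in> sets borel" using that by (simp add: compact_imp_closed borel_closed)
    then show "(\<lambda>\<eta>. indicator K \<eta> *\<^sub>R c \<eta>) \<in> borel_measurable NN"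
      using ci by (intro borel_measurable_scaleR borel_measurable_dual[of "indicator K"]) auto
  qed (auto simp: indicator_def)
  have R: "(LINT \<eta>|NN. indicator K \<eta> * Re (c \<eta>)) = 0" "(LINT \<eta>|NN. indicator K \<eta> * Im (c \<eta>)) = 0"
    if K: "compact K" "K \<subseteq> box (-pi, -pi) (pi, pi)" for K
    using integral_Re[OF ind[OF K(1)]] integral_Im[OF ind[OF K(1)]] zero_coeffs_compact[OF c K] by simp_all
  have "AE \<eta> in NN. Re (c \<eta>) \<le> 0" by (rule AE_nonpos_of_compact) (use ci R in auto)
  moreover have "AE \<eta> in NN. - Re (c \<eta>) \<le> 0" by (rule AE_nonpos_of_compact) (use ci R in auto)
  moreover have "AE \<eta> in NN. Im (c \<eta>) \<le> 0" by (rule AE_nonpos_of_compact) (use ci R in auto)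
  moreover have "AE \<eta> in NN. - Im (c \<eta>) \<le> 0" by (rule AE_nonpos_of_compact) (use ci R in auto)
  ultimately show ?thesis by eventually_elim (simp add: complex_eq_iff)
qed

text \<open>Almost every point is a point of approximate continuity: any measurable function into
  a separable space takes values near \<open>U \<eta>0\<close> on a non-null set near \<open>\<eta>0\<close>.\<close>

lemma strongly_measurable_approx_continuous:
  fixes U :: "real \<times> real \<Rightarrow> 'a \<Rightarrow> complex"
  assumes sm: "strongly_measurable N M S U" and S: "S \<subseteq> L2 M" and U: "\<And>\<eta>. \<eta> \<in> space N \<Longrightarrow> U \<eta> \<in> L2 M"
  shows "AE \<eta>0 in N. \<forall>\<epsilon>>0. \<forall>\<delta>>0. \<not> (AE \<eta> in N. \<not> (dist \<eta> \<eta>0 < \<delta> \<and> L2_norm M (U \<eta> - U \<eta>0) < \<epsilon>))"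
proof -
  obtain s where s: "\<And>n. simple_function N (s n)" "\<And>n \<eta>. \<eta> \<in> space N \<Longrightarrow> s n \<eta> \<in> S"
    and lim: "AE \<eta> in N. (\<lambda>n. L2_norm M (s n \<eta> - U \<eta>)) \<longlonglongrightarrow> 0"
    using sm unfolding strongly_measurable_def by blast
  define V where "V = (\<Union>n. s n ` space N)"
  have V: "countable V" unfolding V_def using s(1) by (intro countable_UN) (auto simp: simple_function_def intro: countable_finite)
  obtain Q :: "(real \<times> real) set" where Q: "countable Q" "\<And>U. open U \<Longrightarrow> U \<noteq> {} \<Longrightarrow> \<exists>q\<in>Q. q \<in> U"
    using countable_dense_exists by blast
  define P where "P = (\<lambda>(d, q, k::nat, j::nat) \<eta>. dist \<eta> q < 1 / (k + 1) \<and> L2_norm M (U \<eta> - d) < 1 / (j + 1))"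
  define I where "I = V \<times> Q \<times> (UNIV :: nat set) \<times> (UNIV :: nat set)"
  have "countable I" unfolding I_def using V Q(1) by auto
  \<comment> \<open>A condition \<open>P i\<close> that fails almost everywhere is discarded
    together with a null set of exceptional \<open>\<eta>0\<close>. Countably many conditions
    suffice, since the centers come from the countable sets \<open>V\<close> and
    \<open>Q\<close>.\<close>
  moreover have "AE \<eta>0 in N. (AE \<eta> in N. \<not> P i \<eta>) \<longrightarrow> \<not> P i \<eta>0" for i
    by (cases "AE \<eta> in N. \<not> P i \<eta>") auto
  ultimately have "AE \<eta>0 in N. \<forall>i\<in>I. (AE \<eta> in N. \<not> P i \<eta>) \<longrightarrow> \<not> P i \<eta>0"
    by (subst AE_ball_countable) auto
  then show ?thesis using lim AE_space
  proof eventually_elim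
    case (elim \<eta>0)
    show ?case
    proof (intro allI impI notI)
      fix \<epsilon> \<delta> :: real assume pos: "\<epsilon> > 0" "\<delta> > 0" and ae: "AE \<eta> in N. \<not> (dist \<eta> \<eta>0 < \<delta> \<and> L2_norm M (U \<eta> - U \<eta>0) < \<epsilon>)"
      \<comment> \<open>Half of each tolerance: the data at \<open>\<eta>0\<close> are replaced by
        nearby centers \<open>d\<close> and \<open>q\<close>, and the triangle inequality returns to
        them.\<close>
      obtain j :: nat where j: "1 / (real j + 1) < \<epsilon> / 2" using reals_Archimedean[of "\<epsilon>/2"] pos by (auto simp: inverse_eq_divide add.commute)
      obtain k :: nat where k: "1 / (real k + 1) < \<delta> / 2" using reals_Archimedean[of "\<delta>/2"] pos by (auto simp: inverse_eq_divide add.commute)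
      have "0 < 1 / (real j + 1)" by simp
      from LIMSEQ_D[OF elim(2) this] obtain n where n: "L2_norm M (s n \<eta>0 - U \<eta>0) < 1 / (real j + 1)" by auto
      define d where "d = s n \<eta>0"
      have d: "d \<in> V" "d \<in> L2 M" "L2_norm M (U \<eta>0 - d) < 1 / (real j + 1)"
        using elim(3) s(2)[OF elim(3)] S n unfolding L2_norm_minus_commute[of M "U \<eta>0"] by (auto simp: d_def V_def)
      obtain q where q: "q \<in> Q" "q \<in> ball \<eta>0 (1 / (real k + 1))" using Q(2)[of "ball \<eta>0 (1 / (real k + 1))"] by force
      have "P (d, q, k, j) \<eta>0" using d q by (simp add: P_def)
      then have "\<not> (AE \<eta> in N. \<not> P (d, q, k, j) \<eta>)" using elim(1) d q by (auto simp: I_def)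
      moreover have "AE \<eta> in N. \<not> P (d, q, k, j) \<eta>"
        using ae AE_space
      proof eventually_elim
        case (elim \<eta>)
        show ?case
        proof
          assume Pe: "P (d, q, k, j) \<eta>"
          have "dist \<eta> \<eta>0 \<le> dist \<eta> q + dist q \<eta>0" by (rule dist_triangle)
          then have 1: "dist \<eta> \<eta>0 < \<delta>" using Pe q k by (simp add: P_def dist_commute)
          have "L2_norm M (U \<eta> - U \<eta>0) \<le> L2_norm M (U \<eta> - d) + L2_norm M (d - U \<eta>0)"
            by (rule L2_norm_triangle_diff[OF U[OF elim(2)] d(2) U]) (rule \<open>\<eta>0 \<in> space N\<close>)
          then have 2: "L2_norm M (U \<eta> - U \<eta>0) < \<epsilon>" using Pe d(3) j unfolding L2_norm_minus_commute[of M d] by (simp add: P_def)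
          show False using elim(1) 1 2 by blast
        qed
      qed
      ultimately show False by blast
    qed
  qed
qed

section \<open>Floquet transforms of analytic functions\<close>

lemma tendsto_zero_bound:
  fixes x :: "nat \<Rightarrow> 'a::real_normed_vector"
  assumes "y \<longlonglongrightarrow> 0" "\<And>n. norm (x n) \<le> y n"
  shows "x \<longlonglongrightarrow> 0"
  by (rule Lim_null_comparison[OF always_eventually assms(1)]) (use assms(2) in blast)

section \<open>Exhaustions of the lattice and control across cell boundaries\<close>

context doubly_periodic_null
begin

text \<open>A single sequence cofinal among the finite subsets of the lattice, so that unconditional
  convergence can be combined with dominated convergence and subsequences.\<close>

definition exhaustion :: "nat \<Rightarrow> complex set" where
  "exhaustion n = from_nat_into L ` {..n}"

lemma exhaustion: "finite (exhaustion n)" "exhaustion n \<subseteq> L"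
proof -
  have ne: "L \<noteq> {}" using period_lattice_simps(1) by blast
  show "exhaustion n \<subseteq> L" using from_nat_into[OF ne] by (auto simp: exhaustion_def)
qed (simp add: exhaustion_def)

text \<open>A lattice shift of the exhaustion is again cofinal, so partial sums over shifted index
  sets have the same limit.\<close>

lemma exhaustion_filterlim:
  assumes k: "k \<in> L"
  shows "filterlim (\<lambda>n. (+) k ` exhaustion n) (finite_subsets_at_top L) sequentially"
  unfolding filterlim_finite_subsets_at_top
proof (intro allI impI)
  fix X assume X: "finite X \<and> X \<subseteq> L"
  have "\<exists>n. from_nat_into L n = x - k" if "x \<in> X" for x
    using from_nat_into_surj[OF countable_period_lattice, of "x - k"] X k that by auto
  then obtain i where i: "\<And>x. x \<in> X \<Longrightarrow> from_nat_into L (i x) = x - k" by metis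
  define n0 where "n0 = Max (insert 0 (i ` X))"
  have n0: "i x \<le> n0" if "x \<in> X" for x unfolding n0_def using X that by (intro Max_ge) auto
  have "finite ((+) k ` exhaustion n) \<and> X \<subseteq> (+) k ` exhaustion n \<and> (+) k ` exhaustion n \<subseteq> L" if "n \<ge> n0" for n
  proof (intro conjI)
    show "X \<subseteq> (+) k ` exhaustion n"
    proof
      fix x assume x: "x \<in> X"
      have "x - k \<in> exhaustion n" unfolding exhaustion_def i[OF x, symmetric] using n0[OF x] that by auto
      then show "x \<in> (+) k ` exhaustion n" by (force simp: image_iff)
    qed
  qed (use exhaustion k in auto)
  then show "\<forall>\<^sub>F n in sequentially. finite ((+) k ` exhaustion n) \<and> X \<subseteq> (+) k ` exhaustion n \<and> (+) k ` exhaustion n \<subseteq> L"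
    by (auto simp: eventually_sequentially)
qed

text \<open>Convergence almost everywhere needs a subsequence, and one must serve all shifts in
  \<open>E\<close> at once; it is drawn for the sum of the squared distances.\<close>

lemma floquet_subseq:
  assumes f: "f \<in> L2 (area \<Omega>)" and F: "is_floquet f F" and E: "finite E" "E \<subseteq> L"
  obtains B :: "nat \<Rightarrow> complex set" where "\<And>n. finite (B n)" "\<And>n. B n \<subseteq> L"
    "AE \<eta> in NN. \<forall>e\<in>E. (\<lambda>n. L2_norm M (S f ((+) e ` B n) \<eta> - F \<eta>)) \<longlonglongrightarrow> 0"
proof -
  have Fs: "F \<in> floquet_space \<omega>" using F by (simp add: is_floquet_def)
  define u where "u = (\<lambda>n \<eta>. \<Sum>e\<in>E. (L2_norm M (S f ((+) e ` exhaustion n) \<eta> - F \<eta>))\<^sup>2)"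
  have sub: "(+) e ` exhaustion n \<subseteq> L" if "e \<in> E" for e n using exhaustion(2)[of n] E that by auto
  have i: "integrable NN (\<lambda>\<eta>. (L2_norm M (S f ((+) e ` exhaustion n) \<eta> - F \<eta>))\<^sup>2)" if "e \<in> E" for e n
    by (rule S_dist_integrable[OF f sub[OF that] Fs])
  have ui: "integrable NN (u n)" for n unfolding u_def by (rule Bochner_Integration.integrable_sum[OF i])
  have eq: "(LINT \<eta>|NN. u n \<eta>) = (\<Sum>e\<in>E. LINT \<eta>|NN. (L2_norm M (S f ((+) e ` exhaustion n) \<eta> - F \<eta>))\<^sup>2)" for n
    unfolding u_def by (rule Bochner_Integration.integral_sum[OF i])
  have "(\<lambda>n. LINT \<eta>|NN. u n \<eta>) \<longlonglongrightarrow> (\<Sum>e\<in>E. 0)"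
    unfolding eq using E by (intro tendsto_sum is_floquet_sq_limit[OF F] exhaustion_filterlim) auto
  moreover have "norm (u n \<eta>) = u n \<eta>" for n \<eta> unfolding u_def by (simp add: sum_nonneg)
  ultimately have "(\<lambda>n. LINT \<eta>|NN. norm (u n \<eta>)) \<longlonglongrightarrow> 0" by simp
  from tendsto_L1_AE_subseq[OF ui this] obtain r :: "nat \<Rightarrow> nat" where r: "AE \<eta> in NN. (\<lambda>n. u (r n) \<eta>) \<longlonglongrightarrow> 0" by blast
  show ?thesis
  proof (rule that[of "\<lambda>n. exhaustion (r n)"])
    show "AE \<eta> in NN. \<forall>e\<in>E. (\<lambda>n. L2_norm M (S f ((+) e ` exhaustion (r n)) \<eta> - F \<eta>)) \<longlonglongrightarrow> 0"
      using r
    proof eventually_elim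
      case (elim \<eta>)
      show ?case
      proof
        fix e assume e: "e \<in> E"
        have "(\<lambda>n. (L2_norm M (S f ((+) e ` exhaustion (r n)) \<eta> - F \<eta>))\<^sup>2) \<longlonglongrightarrow> 0"
        proof (rule tendsto_zero_bound[OF elim])
          fix n
          show "norm ((L2_norm M (S f ((+) e ` exhaustion (r n)) \<eta> - F \<eta>))\<^sup>2) \<le> u (r n) \<eta>"
            unfolding u_def using member_le_sum[OF e _ E(1), of "\<lambda>e. (L2_norm M (S f ((+) e ` exhaustion (r n)) \<eta> - F \<eta>))\<^sup>2"] by simp
        qed
        from tendsto_real_sqrt[OF this] show "(\<lambda>n. L2_norm M (S f ((+) e ` exhaustion (r n)) \<eta> - F \<eta>)) \<longlonglongrightarrow> 0" by simp
      qed
    qed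
  qed (use exhaustion in auto)
qed

text \<open>\<open>X\<close> meets only the cells with index in \<open>E\<close>, and \<Omega> is
  the union of the cells up to a null set. Norms over finitely many cells thus control an open set
  that crosses cell boundaries.\<close>

lemma box_L2:
  assumes X: "open X" and E: "finite E" "E \<subseteq> L" "\<And>z m. z \<in> \<omega> \<Longrightarrow> m \<in> L \<Longrightarrow> z + m \<in> X \<Longrightarrow> m \<in> E"
    and w: "w holomorphic_on \<Omega>" "\<And>e. e \<in> E \<Longrightarrow> (\<lambda>z. w (z + e)) \<in> L2 M"
  shows "w \<in> A2 (\<Omega> \<inter> X)" "(L2_norm (area (\<Omega> \<inter> X)) w)\<^sup>2 \<le> (\<Sum>e\<in>E. (L2_norm M (\<lambda>z. w (z + e)))\<^sup>2)"
proof -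
  have o: "open (\<Omega> \<inter> X)" using X open_Omega by auto
  have hol: "w holomorphic_on \<Omega> \<inter> X" by (rule holomorphic_on_subset[OF w(1)]) auto
  have wm: "w \<in> borel_measurable (area \<Omega>)" by (rule L2_holomorphic_measurable[OF open_Omega w(1)])
  have wm': "w \<in> borel_measurable (area (\<Omega> \<inter> X))" by (rule L2_holomorphic_measurable[OF o hol])
  have "X \<in> sets borel" using X by simp
  then have ind: "(indicator X :: complex \<Rightarrow> ennreal) \<in> borel_measurable (area \<Omega>)"
    by (intro measurable_restrict_space1 measurable_completion) auto
  have "(\<integral>\<^sup>+z. ennreal ((cmod (w z))\<^sup>2) \<partial>area (\<Omega> \<inter> X)) = (\<integral>\<^sup>+z. ennreal ((cmod (w z))\<^sup>2) * indicator (\<Omega> \<inter> X) z \<partial>lebesgue)"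
    using o by (intro nn_integral_restrict_space) auto
  also have "\<dots> = (\<integral>\<^sup>+z. (ennreal ((cmod (w z))\<^sup>2) * indicator X z) * indicator \<Omega> z \<partial>lebesgue)"
    by (rule nn_integral_cong) (simp add: indicator_def)
  also have "\<dots> = (\<integral>\<^sup>+z. ennreal ((cmod (w z))\<^sup>2) * indicator X z \<partial>area \<Omega>)"
    using open_Omega by (intro nn_integral_restrict_space[symmetric]) auto
  also have "\<dots> = (\<integral>\<^sup>+m. \<integral>\<^sup>+z. ennreal ((cmod (w (z + m)))\<^sup>2) * indicator X (z + m) \<partial>M \<partial>count_space L)"
    by (rule nn_integral_Omega) (use wm ind in measurable)
  also have "\<dots> \<le> (\<integral>\<^sup>+m. (\<integral>\<^sup>+z. ennreal ((cmod (w (z + m)))\<^sup>2) \<partial>M) * indicator E m \<partial>count_space L)"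
  proof (rule nn_integral_mono)
    fix m assume "m \<in> space (count_space L)"
    then have m: "m \<in> L" by simp
    show "(\<integral>\<^sup>+z. ennreal ((cmod (w (z + m)))\<^sup>2) * indicator X (z + m) \<partial>M) \<le> (\<integral>\<^sup>+z. ennreal ((cmod (w (z + m)))\<^sup>2) \<partial>M) * indicator E m"
    proof (cases "m \<in> E")
      case True
      then show ?thesis by (auto intro!: nn_integral_mono simp: indicator_def)
    next
      case False
      then have "(\<integral>\<^sup>+z. ennreal ((cmod (w (z + m)))\<^sup>2) * indicator X (z + m) \<partial>M) = (\<integral>\<^sup>+z. 0 \<partial>M)"
        using E(3)[OF _ m] by (intro nn_integral_cong) (auto simp: indicator_def)
      then show ?thesis by simp
    qed
  qed
  also have "\<dots> = (\<Sum>e\<in>E. (\<integral>\<^sup>+z. ennreal ((cmod (w (z + e)))\<^sup>2) \<partial>M) * indicator E e)"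
    by (rule nn_integral_count_space') (use E in \<open>auto simp: indicator_def\<close>)
  also have "\<dots> = (\<Sum>e\<in>E. ennreal ((L2_norm M (\<lambda>z. w (z + e)))\<^sup>2))"
    by (rule sum.cong) (auto simp: nn_integral_L2[OF w(2)])
  also have "\<dots> = ennreal (\<Sum>e\<in>E. (L2_norm M (\<lambda>z. w (z + e)))\<^sup>2)" by (simp add: sum_ennreal)
  finally have le: "(\<integral>\<^sup>+z. ennreal ((cmod (w z))\<^sup>2) \<partial>area (\<Omega> \<inter> X)) \<le> ennreal (\<Sum>e\<in>E. (L2_norm M (\<lambda>z. w (z + e)))\<^sup>2)" .
  then have "integrable (area (\<Omega> \<inter> X)) (\<lambda>z. (cmod (w z))\<^sup>2)"
    using wm' by (intro integrableI_bounded) (auto simp: order_le_less_trans[OF _ ennreal_less_top])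
  then have wL: "w \<in> L2 (area (\<Omega> \<inter> X))" using wm' by (simp add: L2_def)
  then show "w \<in> A2 (\<Omega> \<inter> X)" using hol by (simp add: A2_def)
  have "ennreal ((L2_norm (area (\<Omega> \<inter> X)) w)\<^sup>2) \<le> ennreal (\<Sum>e\<in>E. (L2_norm M (\<lambda>z. w (z + e)))\<^sup>2)"
    using le nn_integral_L2[OF wL] by simp
  then show "(L2_norm (area (\<Omega> \<inter> X)) w)\<^sup>2 \<le> (\<Sum>e\<in>E. (L2_norm M (\<lambda>z. w (z + e)))\<^sup>2)"
    by (simp add: ennreal_le_iff sum_nonneg)
qed

text \<open>Norm convergence on the open set \<open>\<Omega> \<inter> X\<close> is combined with the
  point estimate. It reaches points on the edges between cells, where quasiperiodicity has to be
  verified.\<close>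

lemma box_limit_zero:
  assumes X: "open X" and E: "finite E" "E \<subseteq> L" "\<And>z m. z \<in> \<omega> \<Longrightarrow> m \<in> L \<Longrightarrow> z + m \<in> X \<Longrightarrow> m \<in> E"
    and w: "\<And>n. w n holomorphic_on \<Omega>" "\<And>n e. e \<in> E \<Longrightarrow> (\<lambda>z. w n (z + e)) \<in> L2 M"
      "\<And>e. e \<in> E \<Longrightarrow> (\<lambda>n. L2_norm M (\<lambda>z. w n (z + e))) \<longlonglongrightarrow> 0"
    and z: "z \<in> \<Omega> \<inter> X"
  shows "(\<lambda>n. w n z) \<longlonglongrightarrow> 0"
proof -
  have o: "open (\<Omega> \<inter> X)" using X open_Omega by auto
  note b = box_L2[OF X E w(1,2)]
  have "(\<lambda>n. \<Sum>e\<in>E. (L2_norm M (\<lambda>z. w n (z + e)))\<^sup>2) \<longlonglongrightarrow> (\<Sum>e\<in>E. 0\<^sup>2)"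
    by (intro tendsto_sum tendsto_power w(3))
  then have "(\<lambda>n. (L2_norm (area (\<Omega> \<inter> X)) (w n))\<^sup>2) \<longlonglongrightarrow> 0"
    by - (rule tendsto_zero_bound[of "\<lambda>n. \<Sum>e\<in>E. (L2_norm M (\<lambda>z. w n (z + e)))\<^sup>2"], use b(2) in auto)
  from tendsto_real_sqrt[OF this] have lim: "(\<lambda>n. L2_norm (area (\<Omega> \<inter> X)) (w n)) \<longlonglongrightarrow> 0" by simp
  obtain r where r: "r > 0" "ball z r \<subseteq> \<Omega> \<inter> X" using z o openE by blast
  have "(\<lambda>n. 20 / r * L2_norm (area (\<Omega> \<inter> X)) (w n)) \<longlonglongrightarrow> 20 / r * 0" by (intro tendsto_intros lim)
  then show ?thesis
    by - (rule tendsto_zero_bound[of "\<lambda>n. 20 / r * L2_norm (area (\<Omega> \<inter> X)) (w n)"], use A2_point_bound[OF b(1) o r(2,1)] in simp_all)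
qed

lemma lattice_cases:
  assumes "z \<in> \<omega>" "m \<in> L"
  obtains a b :: int where "m = Complex a b" "of_int a < Re (z + m)" "Re (z + m) < of_int a + 1" "of_int b < Im (z + m)" "Im (z + m) < of_int b + 1"
proof -
  obtain a b :: int where "m = Complex a b" using assms(2) unfolding period_lattice_eq_range by auto
  then show ?thesis using that[of a b] omega_bounds[OF assms(1)] by simp
qed

text \<open>The partial sums converge on all nine cells around \<open>\<omega>\<close>, hence locally uniformly on a
  neighbourhood of the closed cell; the quasi-periodicity holds in the limit because shifted
  partial sums have the same limit.\<close>

lemma floquet_in_A2_ext:
  assumes h: "h \<in> A2 \<Omega>" and H: "is_floquet h H"
  shows "AE \<eta> in NN. \<exists>g\<in>A2_ext \<omega> \<eta>. AE z in M. H \<eta> z = g z"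
proof -
  have hL: "h \<in> L2 (area \<Omega>)" and hh: "h holomorphic_on \<Omega>" using h by (auto dest: A2D)
  define E where "E = (\<lambda>(a::int, b::int). Complex a b) ` ({-1..1} \<times> {-1..1})"
  have E: "finite E" "E \<subseteq> L" by (auto simp: E_def period_lattice_def)
  have E0: "0 \<in> E" unfolding E_def by (rule image_eqI[of _ _ "(0, 0)"]) (auto simp: complex_eq_iff)
  have EI: "Complex (of_int a) (of_int b) \<in> E" if "-1 \<le> a" "a \<le> 1" "-1 \<le> b" "b \<le> 1" for a b :: int
    unfolding E_def using that by (intro image_eqI[of _ _ "(a, b)"]) auto
  define X where "X = {z. -1 < Re z \<and> Re z < 2 \<and> -1 < Im z \<and> Im z < 2}"
  have "X = box (Complex (-1) (-1)) (Complex 2 2)" by (auto simp: X_def in_box_complex_iff)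
  then have oX: "open X" by (simp add: open_box)
  have EX: "m \<in> E" if zm: "z \<in> \<omega>" "m \<in> L" "z + m \<in> X" for z m
  proof -
    obtain a b :: int where m: "m = Complex a b" "of_int a < Re (z + m)" "Re (z + m) < of_int a + 1" "of_int b < Im (z + m)" "Im (z + m) < of_int b + 1"
      by (rule lattice_cases[OF zm(1,2)]) (rule that)
    have "of_int a < (2::real)" "-2 < real_of_int a" "of_int b < (2::real)" "-2 < real_of_int b" using m zm(3) by (auto simp: X_def)
    then show ?thesis unfolding m(1) by (intro EI) linarith+
  qed
  obtain B where B: "\<And>n. finite (B n)" "\<And>n. B n \<subseteq> L"
    and lim: "AE \<eta> in NN. \<forall>e\<in>E. (\<lambda>n. L2_norm M (S h ((+) e ` B n) \<eta> - H \<eta>)) \<longlonglongrightarrow> 0"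
    by (rule floquet_subseq[OF hL H E]) (rule that)
  have Bs: "(+) e ` B n \<subseteq> L" if "e \<in> L" for e n using B(2)[of n] that by auto
  have HL: "H \<eta> \<in> L2 M" if "\<eta> \<in> dual_cell" for \<eta>
    using H that by (auto simp: is_floquet_def intro: floquet_space_D)
  show ?thesis using lim AE_space
  proof eventually_elim
    case (elim \<eta>)
    then have \<eta>: "\<eta> \<in> dual_cell" by simp
    have lim: "(\<lambda>n. L2_norm M (S h ((+) e ` B n) \<eta> - H \<eta>)) \<longlonglongrightarrow> 0" if "e \<in> E" for e using elim(1) that by blast
    define v where "v = (\<lambda>n. S h (B n) \<eta>)"
    have shift_hol: "(\<lambda>z. f (z + m)) holomorphic_on \<Omega>" if f: "f holomorphic_on \<Omega>" and m: "m \<in> L" for f m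
    proof -
      have "(\<lambda>z. z + m) ` \<Omega> \<subseteq> \<Omega>" using Omega_shift[OF m] by auto
      then have "(f \<circ> (\<lambda>z. z + m)) holomorphic_on \<Omega>" by (intro holomorphic_on_compose holomorphic_intros holomorphic_on_subset[OF f])
      then show ?thesis by (simp add: comp_def)
    qed
    have vhol: "v n holomorphic_on \<Omega>" for n
      unfolding v_def S_def[abs_def] using B(2)[of n] by (intro holomorphic_intros shift_hol hh) auto
    have vsh: "v n (z + e) = chi \<eta> e * S h ((+) e ` B n) \<eta> z" for n z e
      unfolding v_def by (rule S_shift[OF B(1)])
    have SL: "S h ((+) e ` B n) \<eta> \<in> L2 M" if "e \<in> L" for e n by (rule S_L2[OF hL Bs[OF that]])
    have vL: "(\<lambda>z. v n (z + e)) \<in> L2 M" if "e \<in> E" for n e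
      unfolding vsh using SL[of e n] E that by (intro L2_cmult) auto
    define W where "W = \<Omega> \<inter> X"
    have vA: "v n \<in> A2 W" for n unfolding W_def by (rule box_L2(1)[OF oX E EX vhol vL])
    have oW: "open W" using open_Omega oX by (auto simp: W_def)
    have diff_bd: "(L2_norm (area W) (v m - v n))\<^sup>2 \<le> (\<Sum>e\<in>E. (L2_norm M (S h ((+) e ` B m) \<eta> - S h ((+) e ` B n) \<eta>))\<^sup>2)" for m n
    proof -
      have eq: "(\<lambda>z. (v m - v n) (z + e)) = (\<lambda>z. chi \<eta> e * (S h ((+) e ` B m) \<eta> - S h ((+) e ` B n) \<eta>) z)" for e
        by (simp add: fun_eq_iff vsh right_diff_distrib)
      have "(L2_norm (area W) (v m - v n))\<^sup>2 \<le> (\<Sum>e\<in>E. (L2_norm M (\<lambda>z. (v m - v n) (z + e)))\<^sup>2)"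
        unfolding W_def
      proof (rule box_L2(2)[OF oX E EX])
        show "v m - v n holomorphic_on \<Omega>" unfolding fun_diff_def by (intro holomorphic_intros vhol)
        show "(\<lambda>z. (v m - v n) (z + e)) \<in> L2 M" if "e \<in> E" for e
          unfolding eq using SL[of e] E that by (intro L2_cmult L2_diff) auto
      qed
      then show ?thesis unfolding eq L2_norm_cmult norm_chi mult_1 .
    qed
    have Cau: "L2_Cauchy (area W) v"
      unfolding L2_Cauchy_def
    proof (intro allI impI)
      fix e :: real assume e: "e > 0"
      \<comment> \<open>With the factor 2 inside the squares, the squared distance of two partial
        sums is at most the mean of two such expressions, hence below
        \<open>e\<^sup>2\<close>.\<close>
      have "(\<lambda>n. \<Sum>e\<in>E. (2 * L2_norm M (S h ((+) e ` B n) \<eta> - H \<eta>))\<^sup>2) \<longlonglongrightarrow> (\<Sum>e\<in>E. (2 * 0)\<^sup>2)"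
        by (intro tendsto_sum tendsto_power tendsto_intros lim)
      then have "eventually (\<lambda>n. (\<Sum>e\<in>E. (2 * L2_norm M (S h ((+) e ` B n) \<eta> - H \<eta>))\<^sup>2) < e\<^sup>2) sequentially"
        using e by (intro order_tendstoD) auto
      then obtain N where N: "\<And>n. n \<ge> N \<Longrightarrow> (\<Sum>e\<in>E. (2 * L2_norm M (S h ((+) e ` B n) \<eta> - H \<eta>))\<^sup>2) < e\<^sup>2"
        by (auto simp: eventually_sequentially)
      show "\<exists>N. \<forall>m\<ge>N. \<forall>n\<ge>N. L2_norm (area W) (v m - v n) < e"
      proof (intro exI allI impI)
        fix m n assume mn: "N \<le> m" "N \<le> n"
        have "(L2_norm M (S h ((+) k ` B m) \<eta> - S h ((+) k ` B n) \<eta>))\<^sup>2 \<le>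
            2 * (L2_norm M (S h ((+) k ` B m) \<eta> - H \<eta>))\<^sup>2 + 2 * (L2_norm M (S h ((+) k ` B n) \<eta> - H \<eta>))\<^sup>2" if "k \<in> E" for k
        proof -
          have k: "k \<in> L" using E that by blast
          have "S h ((+) k ` B m) \<eta> - S h ((+) k ` B n) \<eta> = (S h ((+) k ` B m) \<eta> - H \<eta>) - (S h ((+) k ` B n) \<eta> - H \<eta>)" by (simp add: fun_eq_iff)
          then show ?thesis using L2_norm_diff_sq_le[OF L2_diff[OF SL[OF k] HL[OF \<eta>]] L2_diff[OF SL[OF k] HL[OF \<eta>]], of m n] by (simp only:)
        qed
        then have "(L2_norm (area W) (v m - v n))\<^sup>2 \<le> (\<Sum>k\<in>E. 2 * (L2_norm M (S h ((+) k ` B m) \<eta> - H \<eta>))\<^sup>2 + 2 * (L2_norm M (S h ((+) k ` B n) \<eta> - H \<eta>))\<^sup>2)"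
          by (intro order_trans[OF diff_bd] sum_mono)
        also have "\<dots> = ((\<Sum>k\<in>E. (2 * L2_norm M (S h ((+) k ` B m) \<eta> - H \<eta>))\<^sup>2) + (\<Sum>k\<in>E. (2 * L2_norm M (S h ((+) k ` B n) \<eta> - H \<eta>))\<^sup>2)) / 2"
          unfolding sum.distrib sum_distrib_left[symmetric] power_mult_distrib by simp
        also have "\<dots> < e\<^sup>2" using N[OF mn(1)] N[OF mn(2)] by simp
        finally show "L2_norm (area W) (v m - v n) < e" using e by - (rule power2_less_imp_less, auto)
      qed
    qed
    obtain g where g: "g \<in> A2 W" and gl: "(\<lambda>n. L2_norm (area W) (v n - g)) \<longlonglongrightarrow> 0"
      using L2_closed_subspace.complete[OF A2_closed_subspace[OF oW] vA Cau] by blast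
    have pt: "(\<lambda>n. v n z) \<longlonglongrightarrow> g z" if z: "z \<in> W" for z
    proof -
      obtain r where r: "r > 0" "ball z r \<subseteq> W" using z oW openE by blast
      have "(\<lambda>n. 20 / r * L2_norm (area W) (v n - g)) \<longlonglongrightarrow> 20 / r * 0" by (intro tendsto_intros gl)
      then have "(\<lambda>n. v n z - g z) \<longlonglongrightarrow> 0"
        by - (rule tendsto_zero_bound[of "\<lambda>n. 20 / r * L2_norm (area W) (v n - g)"], use A2_point_bound[OF A2_diff[OF vA g] oW r(2,1)] in simp_all)
      then show ?thesis by (rule LIM_zero_cancel)
    qed
    have \<omega>W: "\<omega> \<subseteq> W" using omega_sub omega_bounds by (fastforce simp: W_def X_def)
    have vM: "v n \<in> L2 M" for n using vL[OF E0, of n] by simp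
    have vH: "(\<lambda>n. L2_norm M (v n - H \<eta>)) \<longlonglongrightarrow> 0" using lim[OF E0] by (simp add: v_def)
    have CM: "L2_Cauchy M v"
      unfolding L2_Cauchy_def
    proof (intro allI impI)
      fix e :: real assume "e > 0"
      then have "e/2 > 0" by simp
      from LIMSEQ_D[OF vH this] obtain N where N: "\<And>n. n \<ge> N \<Longrightarrow> L2_norm M (v n - H \<eta>) < e/2" by auto
      have "L2_norm M (v m - v n) < e" if "N \<le> m" "N \<le> n" for m n
      proof -
        have "L2_norm M (v m - v n) \<le> L2_norm M (v m - H \<eta>) + L2_norm M (H \<eta> - v n)"
          by (rule L2_norm_triangle_diff[OF vM HL[OF \<eta>] vM])
        then show ?thesis using N[OF that(1)] N[OF that(2)] unfolding L2_norm_minus_commute[of M "H \<eta>" "v n"] by simp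
      qed
      then show "\<exists>N. \<forall>m\<ge>N. \<forall>n\<ge>N. L2_norm M (v m - v n) < e" by blast
    qed
    have ghol: "g holomorphic_on \<omega>" using A2D(2)[OF g] \<omega>W holomorphic_on_subset by blast
    have aepw: "AE x in M. (\<lambda>n. v n x) \<longlonglongrightarrow> g x" using pt \<omega>W by (intro AE_I2) auto
    note FL = L2_Fatou_limit[OF vM CM L2_holomorphic_measurable[OF omega(1) ghol] aepw]
    have gA: "g \<in> A2 \<omega>" using FL(1) ghol by (simp add: A2_def)
    \<comment> \<open>On \<omega> the partial sums converge in norm both to \<open>H \<eta>\<close>
      and to \<open>g\<close>.\<close>
    have "L2_norm M (H \<eta> - g) \<le> 0"
    proof (rule LIMSEQ_le_const)
      have "(\<lambda>n. L2_norm M (v n - H \<eta>) + L2_norm M (v n - g)) \<longlonglongrightarrow> 0 + 0" by (intro tendsto_add vH FL(2))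
      then show "(\<lambda>n. L2_norm M (v n - H \<eta>) + L2_norm M (v n - g)) \<longlonglongrightarrow> 0" by simp
      show "\<exists>N. \<forall>n\<ge>N. L2_norm M (H \<eta> - g) \<le> L2_norm M (v n - H \<eta>) + L2_norm M (v n - g)"
        using L2_norm_triangle_diff[OF HL[OF \<eta>] vM FL(1)] unfolding L2_norm_minus_commute[of M "H \<eta>" "v _"] by blast
    qed
    then have "L2_norm M (H \<eta> - g) = 0" using L2_norm_nonneg[of M "H \<eta> - g"] by (rule antisym)
    from L2_norm_eq_0_AE[OF L2_diff[OF HL[OF \<eta>] FL(1)] this] have ae: "AE z in M. H \<eta> z = g z" by simp
    \<comment> \<open>\<open>Y\<close> is an open set containing the point on the edge and meeting
      only the cells in \<open>E'\<close>. On these cells \<open>w n\<close> is, up to a phase, the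
      difference of partial sums over two shifted index sets; both converge to
      \<open>H \<eta>\<close>, so \<open>w n\<close> tends to 0 at the edge.\<close>
    have quasi: "g (z + k) = chi \<eta> k * g z"
      if k: "k \<in> L" and Y: "open Y" "finite E'" "E' \<subseteq> E" "\<And>x m. x \<in> \<omega> \<Longrightarrow> m \<in> L \<Longrightarrow> x + m \<in> Y \<Longrightarrow> m \<in> E'"
        "\<And>e. e \<in> E' \<Longrightarrow> e + k \<in> E" and z: "z \<in> \<Omega> \<inter> Y" "z \<in> W" "z + k \<in> W" for k Y E' z
    proof -
      define w where "w = (\<lambda>n x. v n (x + k) - chi \<eta> k * v n x)"
      have eq: "(\<lambda>x. w n (x + e)) = (\<lambda>x. chi \<eta> (e + k) * (S h ((+) (e + k) ` B n) \<eta> - S h ((+) e ` B n) \<eta>) x)" for n e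
      proof
        fix x
        have "w n (x + e) = v n (x + (e + k)) - chi \<eta> k * v n (x + e)" by (simp add: w_def add.assoc)
        also have "\<dots> = chi \<eta> (e + k) * S h ((+) (e + k) ` B n) \<eta> x - chi \<eta> k * (chi \<eta> e * S h ((+) e ` B n) \<eta> x)"
          by (simp only: vsh)
        also have "\<dots> = chi \<eta> (e + k) * (S h ((+) (e + k) ` B n) \<eta> - S h ((+) e ` B n) \<eta>) x"
          by (simp add: chi_add right_diff_distrib mult_ac)
        finally show "w n (x + e) = chi \<eta> (e + k) * (S h ((+) (e + k) ` B n) \<eta> - S h ((+) e ` B n) \<eta>) x" .
      qed
      have "(\<lambda>n. w n z) \<longlonglongrightarrow> 0"
      proof (rule box_limit_zero[OF Y(1,2)])
        show "m \<in> E'" if "x \<in> \<omega>" "m \<in> L" "x + m \<in> Y" for x m by (rule Y(4)[OF that])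
        show "z \<in> \<Omega> \<inter> Y" by (rule z(1))
        show "E' \<subseteq> L" using Y E by blast
        show "w n holomorphic_on \<Omega>" for n unfolding w_def by (intro holomorphic_intros shift_hol[OF vhol k] vhol)
        have eL: "e \<in> L" "e + k \<in> L" "e \<in> E" "e + k \<in> E" if "e \<in> E'" for e using that Y E k by auto
        show "(\<lambda>x. w n (x + e)) \<in> L2 M" if "e \<in> E'" for n e unfolding eq by (intro L2_cmult L2_diff SL eL that)
        show "(\<lambda>n. L2_norm M (\<lambda>x. w n (x + e))) \<longlonglongrightarrow> 0" if e: "e \<in> E'" for e
          unfolding eq L2_norm_cmult norm_chi mult_1
        proof (rule tendsto_zero_bound)
          have "(\<lambda>n. L2_norm M (S h ((+) (e + k) ` B n) \<eta> - H \<eta>) + L2_norm M (S h ((+) e ` B n) \<eta> - H \<eta>)) \<longlonglongrightarrow> 0 + 0"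
            by (intro tendsto_add lim eL e)
          then show "(\<lambda>n. L2_norm M (S h ((+) (e + k) ` B n) \<eta> - H \<eta>) + L2_norm M (S h ((+) e ` B n) \<eta> - H \<eta>)) \<longlonglongrightarrow> 0" by simp
          have "L2_norm M (S h ((+) (e + k) ` B n) \<eta> - S h ((+) e ` B n) \<eta>) \<le> L2_norm M (S h ((+) (e + k) ` B n) \<eta> - H \<eta>) + L2_norm M (S h ((+) e ` B n) \<eta> - H \<eta>)" for n
            using L2_norm_triangle_diff[OF SL[OF eL(2)[OF e]] HL[OF \<eta>] SL[OF eL(1)[OF e]], of n n]
            unfolding L2_norm_minus_commute[of M "H \<eta>"] .
          then show "norm (L2_norm M (S h ((+) (e + k) ` B n) \<eta> - S h ((+) e ` B n) \<eta>)) \<le>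
              L2_norm M (S h ((+) (e + k) ` B n) \<eta> - H \<eta>) + L2_norm M (S h ((+) e ` B n) \<eta> - H \<eta>)" for n by simp
        qed
      qed
      moreover have "(\<lambda>n. w n z) \<longlonglongrightarrow> g (z + k) - chi \<eta> k * g z"
        unfolding w_def by (intro tendsto_intros pt z)
      ultimately have "g (z + k) - chi \<eta> k * g z = 0" using LIMSEQ_unique by blast
      then show ?thesis by simp
    qed
    \<comment> \<open>The edge conditions also concern points outside \<Omega>, where the value 0
      satisfies them.\<close>
    define g' where "g' = (\<lambda>z. if z \<in> W then g z else 0)"
    have "g \<in> A2_ext \<omega> \<eta>" unfolding A2_ext_def Omega[symmetric]
    proof (intro CollectI conjI exI[of _ W] exI[of _ g'] gA oW ballI)
      have "closure \<omega> \<subseteq> closure unit_cell" by (rule closure_mono[OF omega(3)])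
      then show "closure \<omega> \<inter> \<Omega> \<subseteq> W" by (fastforce simp: W_def X_def closure_unit_cell)
      show "W \<subseteq> \<Omega>" by (auto simp: W_def)
      show "g' holomorphic_on W" by (rule holomorphic_transform[OF A2D(2)[OF g]]) (simp add: g'_def)
      show "g' z = g z" if "z \<in> \<omega>" for z using that \<omega>W by (auto simp: g'_def)
    next
      fix y :: real assume y: "y \<in> {0<..<1}"
      let ?z = "\<i> * of_real y :: complex"
      have W1: "?z \<in> W \<longleftrightarrow> ?z \<in> \<Omega>" "?z + 1 \<in> W \<longleftrightarrow> ?z \<in> \<Omega>" using y Omega_shift[of 1 ?z] by (auto simp: W_def X_def)
      show "g' (1 + ?z) = cis (fst \<eta>) * g' ?z"
      proof (cases "?z \<in> \<Omega>")
        case True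
        \<comment> \<open>A box around the left edge that meets only the two cells on either side of
          it; after a shift by 1 their indices are still among the nine.\<close>
        define Y where "Y = {z. -1 < Re z \<and> Re z < 1 \<and> 0 < Im z \<and> Im z < 1}"
        have "Y = box (Complex (-1) 0) (Complex 1 1)" by (auto simp: Y_def in_box_complex_iff)
        then have oY: "open Y" by (simp add: open_box)
        define E' where "E' = {Complex (of_int (-1)) (of_int 0), Complex (of_int 0) (of_int 0)}"
        have "g (?z + 1) = chi \<eta> 1 * g ?z"
        proof (rule quasi[of 1 Y E'])
          show "open Y" by (rule oY)
          show "E' \<subseteq> E" unfolding E'_def using EI[of "-1" 0] EI[of 0 0] by simp
          show "e + 1 \<in> E" if "e \<in> E'" for e
          proof -
            have "e + 1 = Complex (of_int 0) (of_int 0) \<or> e + 1 = Complex (of_int 1) (of_int 0)" using that by (auto simp: E'_def complex_eq_iff)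
            then show ?thesis using EI[of 0 0] EI[of 1 0] by auto
          qed
          fix x m assume xm: "x \<in> \<omega>" "m \<in> L" "x + m \<in> Y"
          obtain a b :: int where m: "m = Complex a b" "of_int a < Re (x + m)" "Re (x + m) < of_int a + 1" "of_int b < Im (x + m)" "Im (x + m) < of_int b + 1"
            by (rule lattice_cases[OF xm(1,2)]) (rule that)
          have "of_int a < (1::real)" "-2 < real_of_int a" "of_int b < (1::real)" "-1 < real_of_int b" using m xm(3) by (auto simp: Y_def)
          then have "b = 0" "a = -1 \<or> a = 0" by linarith+
          then show "m \<in> E'" using m(1) by (auto simp: E'_def)
        qed (use True W1 y in \<open>auto simp: E'_def Y_def\<close>)
        then show ?thesis using True W1 by (simp add: g'_def add.commute)
      qed (use W1 in \<open>simp add: g'_def add.commute\<close>)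
    next
      fix x :: real assume x: "x \<in> {0<..<1}"
      let ?z = "of_real x :: complex"
      have W1: "?z \<in> W \<longleftrightarrow> ?z \<in> \<Omega>" "?z + \<i> \<in> W \<longleftrightarrow> ?z \<in> \<Omega>" using x Omega_shift[of \<i> ?z] by (auto simp: W_def X_def)
      show "g' (?z + \<i>) = cis (snd \<eta>) * g' ?z"
      proof (cases "?z \<in> \<Omega>")
        case True
        define Y where "Y = {z. 0 < Re z \<and> Re z < 1 \<and> -1 < Im z \<and> Im z < 1}"
        have "Y = box (Complex 0 (-1)) (Complex 1 1)" by (auto simp: Y_def in_box_complex_iff)
        then have oY: "open Y" by (simp add: open_box)
        define E' where "E' = {Complex (of_int 0) (of_int (-1)), Complex (of_int 0) (of_int 0)}"
        have "g (?z + \<i>) = chi \<eta> \<i> * g ?z"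
        proof (rule quasi[of \<i> Y E'])
          show "open Y" by (rule oY)
          show "E' \<subseteq> E" unfolding E'_def using EI[of 0 "-1"] EI[of 0 0] by simp
          show "e + \<i> \<in> E" if "e \<in> E'" for e
          proof -
            have "e + \<i> = Complex (of_int 0) (of_int 0) \<or> e + \<i> = Complex (of_int 0) (of_int 1)" using that by (auto simp: E'_def complex_eq_iff)
            then show ?thesis using EI[of 0 0] EI[of 0 1] by auto
          qed
          fix y m assume xm: "y \<in> \<omega>" "m \<in> L" "y + m \<in> Y"
          obtain a b :: int where m: "m = Complex a b" "of_int a < Re (y + m)" "Re (y + m) < of_int a + 1" "of_int b < Im (y + m)" "Im (y + m) < of_int b + 1"
            by (rule lattice_cases[OF xm(1,2)]) (rule that)
          have "of_int b < (1::real)" "-2 < real_of_int b" "of_int a < (1::real)" "-1 < real_of_int a" using m xm(3) by (auto simp: Y_def)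
          then have "a = 0" "b = -1 \<or> b = 0" by linarith+
          then show "m \<in> E'" using m(1) by (auto simp: E'_def)
        qed (use True W1 x in \<open>auto simp: E'_def Y_def\<close>)
        then show ?thesis using True W1 by (simp add: g'_def)
      qed (use W1 in \<open>simp add: g'_def\<close>)
    qed
    then show ?case using ae by blast
  qed
qed

end

section \<open>Orthogonality in the fibers\<close>

text \<open>Identity theorem: a relation known at points of an edge accumulating at \<open>p\<close>
  holds in a whole ball.\<close>

lemma quasiperiodic_near:
  assumes U: "open U" "p \<in> U" "p + k \<in> U" and g: "g holomorphic_on U"
    and Y: "p islimpt Y" "\<And>y. y \<in> Y \<Longrightarrow> g (y + k) = c * g y"
  shows "\<exists>r>0. \<forall>w\<in>ball p r. w \<in> U \<and> g (w + k) = c * g w"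
proof -
  obtain r1 where r1: "r1 > 0" "ball p r1 \<subseteq> U" using U openE by blast
  obtain r2 where r2: "r2 > 0" "ball (p + k) r2 \<subseteq> U" using U openE by blast
  define r where "r = min r1 r2"
  have r: "r > 0" "ball p r \<subseteq> U" using r1 r2 by (auto simp: r_def)
  have rk: "w + k \<in> U" if "w \<in> ball p r" for w
  proof -
    have "w + k \<in> ball (p + k) r2" using that by (simp add: r_def dist_norm)
    then show ?thesis using r2 by blast
  qed
  have "(g \<circ> (\<lambda>w. w + k)) holomorphic_on ball p r"
    by (intro holomorphic_on_compose holomorphic_intros holomorphic_on_subset[OF g]) (use rk in auto)
  then have hol: "(\<lambda>w. g (w + k) - c * g w) holomorphic_on ball p r"
    by (auto simp: comp_def intro!: holomorphic_intros holomorphic_on_subset[OF g] dest: subsetD[OF r(2)])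
  have "g (w + k) - c * g w = 0" if "w \<in> ball p r" for w
  proof (rule analytic_continuation[OF hol])
    show "p islimpt (Y \<inter> ball p r)" 
    proof (rule islimpt_Int_eventually[OF Y(1)])
      show "eventually (\<lambda>y. y \<in> ball p r) (at p)" using r(1) by (intro eventually_at_in_open') auto
    qed
    show "g (z + k) - c * g z = 0" if "z \<in> Y \<inter> ball p r" for z using Y(2) that by simp
  qed (use r that in auto)
  then show ?thesis using r by (intro exI[of _ r]) auto
qed

text \<open>The endpoints are included, so that corners of the cell are limits of edge points
  too.\<close>

lemma islimpt_vertical:
  assumes "Re p = 0" "0 \<le> Im p" "Im p \<le> 1"
  shows "p islimpt (\<lambda>y. \<i> * complex_of_real y) ` {0<..<1}"
  unfolding islimpt_approachable
proof (intro allI impI)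
  fix e :: real assume e: "e > 0"
  define y where "y = (if Im p < 1/2 then Im p + min (e/2) (1/4) else Im p - min (e/2) (1/4))"
  have y: "0 < y" "y < 1" "y \<noteq> Im p" "\<bar>y - Im p\<bar> < e" using assms e by (auto simp: y_def min_def)
  have "\<i> * of_real y - p = \<i> * of_real (y - Im p)" using assms(1) by (simp add: complex_eq_iff)
  then have "dist (\<i> * complex_of_real y) p < e" using y(4) by (simp add: dist_norm norm_mult del: of_real_diff)
  moreover have "\<i> * complex_of_real y \<noteq> p" using y(3) by (auto simp: complex_eq_iff)
  ultimately show "\<exists>x'\<in>(\<lambda>y. \<i> * complex_of_real y) ` {0<..<1}. x' \<noteq> p \<and> dist x' p < e" using y by auto
qed

lemma islimpt_horizontal:
  assumes "Im p = 0" "0 \<le> Re p" "Re p \<le> 1"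
  shows "p islimpt complex_of_real ` {0<..<1}"
  unfolding islimpt_approachable
proof (intro allI impI)
  fix e :: real assume e: "e > 0"
  define y where "y = (if Re p < 1/2 then Re p + min (e/2) (1/4) else Re p - min (e/2) (1/4))"
  have y: "0 < y" "y < 1" "y \<noteq> Re p" "\<bar>y - Re p\<bar> < e" using assms e by (auto simp: y_def min_def)
  have "of_real y - p = of_real (y - Re p)" using assms(1) by (simp add: complex_eq_iff)
  then have "dist (complex_of_real y) p < e" using y(4) by (simp add: dist_norm del: of_real_diff)
  moreover have "complex_of_real y \<noteq> p" using y(3) by (auto simp: complex_eq_iff)
  ultimately show "\<exists>x'\<in>complex_of_real ` {0<..<1}. x' \<noteq> p \<and> dist x' p < e" using y by auto
qed

text \<open>The cells are half-open: near a point of the cell the floor can drop to -1 only at the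
  left endpoint.\<close>

lemma floor_near:
  fixes x :: real assumes "0 \<le> x" "x < 1"
  obtains r where "r > 0" "\<And>y. \<bar>y - x\<bar> < r \<Longrightarrow> \<lfloor>y\<rfloor> = 0 \<or> \<lfloor>y\<rfloor> = -1 \<and> x = 0"
proof (cases "x = 0")
  case True
  then show ?thesis by (intro that[of 1]) (auto simp: floor_eq_iff)
next
  case False
  then show ?thesis using assms by (intro that[of "min x (1 - x)"]) (auto simp: floor_eq_iff)
qed

section \<open>Quasiperiodic extension to the whole domain\<close>

context doubly_periodic
begin

text \<open>The identity theorem extends the edge relations to neighborhoods of the edges, corners
  included. Hence the function obtained by copying \<open>g\<close> from cell to cell with the
  appropriate phase agrees near every point with an analytic function.\<close>

lemma quasiperiodic_extension:
  assumes f: "f \<in> A2_ext \<omega> \<eta>"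
  obtains F where "F holomorphic_on \<Omega>" "\<And>z. z \<in> \<omega> \<Longrightarrow> F z = f z"
    "\<And>z m. m \<in> period_lattice \<Longrightarrow> F (z + m) = chi \<eta> m * F z"
proof -
  obtain U g where U: "open U" "closure \<omega> \<inter> \<Omega> \<subseteq> U" "U \<subseteq> \<Omega>" and g: "g holomorphic_on U" "\<And>z. z \<in> \<omega> \<Longrightarrow> g z = f z"
    and q: "\<And>y. y \<in> {0<..<1} \<Longrightarrow> g (1 + \<i> * of_real y) = cis (fst \<eta>) * g (\<i> * of_real y)"
      "\<And>x. x \<in> {0<..<1} \<Longrightarrow> g (of_real x + \<i>) = cis (snd \<eta>) * g (of_real x)"
    using f unfolding A2_ext_def Omega by blast
  define F where "F = (\<lambda>z. chi \<eta> (cell_index z) * g (tr z))"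
  have F_shift: "F (z + m) = chi \<eta> m * F z" if "m \<in> period_lattice" for z m
    using that by (simp add: F_def cell_index_add tr_add chi_add mult_ac)
  have inU: "z \<in> U" if "z \<in> \<Omega>" "0 \<le> Re z" "Re z \<le> 1" "0 \<le> Im z" "Im z \<le> 1" for z
    using that Omega_closure[of z] U(2) by (auto simp: closure_unit_cell)
  have vert: "\<exists>r>0. \<forall>w\<in>ball p r. w \<in> U \<and> g (w + 1) = chi \<eta> 1 * g w" if p: "p \<in> \<Omega>" "Re p = 0" "0 \<le> Im p" "Im p \<le> 1" for p
  proof (rule quasiperiodic_near[OF U(1) _ _ g(1) islimpt_vertical[OF p(2-4)]])
    show "p \<in> U" "p + 1 \<in> U" using p by (auto intro!: inU simp: Omega_shift)
    fix y assume "y \<in> (\<lambda>y. \<i> * complex_of_real y) ` {0<..<1}"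
    then show "g (y + 1) = chi \<eta> 1 * g y" using q(1) by (auto simp: add.commute)
  qed
  have horiz: "\<exists>r>0. \<forall>w\<in>ball p r. w \<in> U \<and> g (w + \<i>) = chi \<eta> \<i> * g w" if p: "p \<in> \<Omega>" "Im p = 0" "0 \<le> Re p" "Re p \<le> 1" for p
  proof (rule quasiperiodic_near[OF U(1) _ _ g(1) islimpt_horizontal[OF p(2-4)]])
    show "p \<in> U" "p + \<i> \<in> U" using p by (auto intro!: inU simp: Omega_shift)
    fix y assume "y \<in> complex_of_real ` {0<..<1}"
    then show "g (y + \<i>) = chi \<eta> \<i> * g y" using q(2) by auto
  qed
  \<comment> \<open>A small ball around a point of the half-open cell meets at most four cells,
    those with index 0, -1, \<open>- \<i>\<close> and \<open>- (1 + \<i>)\<close>; in each of them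
    the edge relations turn the copy of \<open>g\<close> back into \<open>g\<close>.\<close>
  have local: "\<exists>r>0. \<forall>w\<in>ball p r. w \<in> U \<and> F w = g w" if p: "p \<in> \<Omega>" "0 \<le> Re p" "Re p < 1" "0 \<le> Im p" "Im p < 1" for p
  proof -
    obtain r0 where r0: "r0 > 0" "ball p r0 \<subseteq> U" using inU[of p] p U(1) openE[of U p] by auto
    obtain ra where ra: "ra > 0" "\<And>y. \<bar>y - Re p\<bar> < ra \<Longrightarrow> \<lfloor>y\<rfloor> = 0 \<or> \<lfloor>y\<rfloor> = -1 \<and> Re p = 0"
      by (rule floor_near[OF p(2,3)]) (rule that)
    obtain rb where rb: "rb > 0" "\<And>y. \<bar>y - Im p\<bar> < rb \<Longrightarrow> \<lfloor>y\<rfloor> = 0 \<or> \<lfloor>y\<rfloor> = -1 \<and> Im p = 0"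
      by (rule floor_near[OF p(4,5)]) (rule that)
    have "\<exists>r>0. Re p = 0 \<longrightarrow> (\<forall>w\<in>ball p r. g (w + 1) = chi \<eta> 1 * g w)"
    proof (cases "Re p = 0")
      case True
      then show ?thesis using vert[OF p(1) True] p by force
    qed (auto intro: exI[of _ 1])
    then obtain r1 where r1: "r1 > 0" "\<And>w. Re p = 0 \<Longrightarrow> w \<in> ball p r1 \<Longrightarrow> g (w + 1) = chi \<eta> 1 * g w" by blast
    have "\<exists>r>0. Im p = 0 \<longrightarrow> (\<forall>w\<in>ball p r. g (w + \<i>) = chi \<eta> \<i> * g w)"
    proof (cases "Im p = 0")
      case True
      then show ?thesis using horiz[OF p(1) True] p by force
    qed (auto intro: exI[of _ 1])
    then obtain r2 where r2: "r2 > 0" "\<And>w. Im p = 0 \<Longrightarrow> w \<in> ball p r2 \<Longrightarrow> g (w + \<i>) = chi \<eta> \<i> * g w" by blast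
    \<comment> \<open>In the diagonal neighbor of a corner the shift by \<open>1 + \<i>\<close> is
      made in two moves, so the relation for horizontal edges is needed near
      \<open>p + 1\<close>.\<close>
    have "\<exists>r>0. Re p = 0 \<and> Im p = 0 \<longrightarrow> (\<forall>w\<in>ball (p + 1) r. g (w + \<i>) = chi \<eta> \<i> * g w)"
    proof (cases "Re p = 0 \<and> Im p = 0")
      case True
      then show ?thesis using horiz[of "p + 1"] p by (force simp: Omega_shift)
    qed (auto intro: exI[of _ 1])
    then obtain r3 where r3: "r3 > 0" "\<And>w. Re p = 0 \<Longrightarrow> Im p = 0 \<Longrightarrow> w \<in> ball (p + 1) r3 \<Longrightarrow> g (w + \<i>) = chi \<eta> \<i> * g w" by blast
    define r where "r = min r0 (min (min ra rb) (min r1 (min r2 r3)))"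
    have rpos: "r > 0" using r0 ra rb r1 r2 r3 by (simp add: r_def)
    have "F w = g w" if w: "w \<in> ball p r" for w
    proof -
      have dr: "cmod (w - p) < r" using w by (simp add: dist_norm norm_minus_commute)
      then have "\<bar>Re w - Re p\<bar> < ra" "\<bar>Im w - Im p\<bar> < rb"
        using abs_Re_le_cmod[of "w - p"] abs_Im_le_cmod[of "w - p"] by (auto simp: r_def)
      from ra(2)[OF this(1)] rb(2)[OF this(2)]
      consider "\<lfloor>Re w\<rfloor> = 0" "\<lfloor>Im w\<rfloor> = 0" | "\<lfloor>Re w\<rfloor> = -1" "Re p = 0" "\<lfloor>Im w\<rfloor> = 0"
        | "\<lfloor>Re w\<rfloor> = 0" "\<lfloor>Im w\<rfloor> = -1" "Im p = 0" | "\<lfloor>Re w\<rfloor> = -1" "Re p = 0" "\<lfloor>Im w\<rfloor> = -1" "Im p = 0" by blast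
      then show ?thesis
      proof cases
        case 1
        then have "cell_index w = 0" by (simp add: complex_eq_iff)
        then show ?thesis by (simp add: F_def tr_eq)
      next
        case 2
        then have ci: "cell_index w = - 1" by (simp add: complex_eq_iff)
        have "g (w + 1) = chi \<eta> 1 * g w" using 2 w by (intro r1) (auto simp: r_def)
        then have "F w = (cnj (chi \<eta> 1) * chi \<eta> 1) * g w" by (simp add: F_def tr_eq ci chi_minus del: chi_cnj chi_one)
        then show ?thesis by (simp only: chi_cnj mult_1)
      next
        case 3
        then have ci: "cell_index w = - \<i>" by (simp add: complex_eq_iff)
        have "g (w + \<i>) = chi \<eta> \<i> * g w" using 3 w by (intro r2) (auto simp: r_def)
        then have "F w = (cnj (chi \<eta> \<i>) * chi \<eta> \<i>) * g w" by (simp add: F_def tr_eq ci chi_minus del: chi_cnj chi_one)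
        then show ?thesis by (simp only: chi_cnj mult_1)
      next
        case 4
        then have ci: "cell_index w = - (1 + \<i>)" by (simp add: complex_eq_iff)
        have "g (w + 1) = chi \<eta> 1 * g w" using 4 w by (intro r1) (auto simp: r_def)
        moreover have "g (w + 1 + \<i>) = chi \<eta> \<i> * g (w + 1)" using 4 w by (intro r3) (auto simp: r_def dist_norm)
        ultimately have "g (w + (1 + \<i>)) = chi \<eta> (1 + \<i>) * g w" by (simp add: add.assoc chi_add mult_ac del: chi_one)
        then have "F w = (cnj (chi \<eta> (1 + \<i>)) * chi \<eta> (1 + \<i>)) * g w" by (simp add: F_def tr_eq ci chi_minus[of \<eta> "1 + \<i>", simplified] del: chi_cnj chi_one minus_add_distrib) (metis (no_types) chi_minus mult.assoc diff_minus_eq_add)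
        then show ?thesis by simp
      qed
    qed
    moreover have "ball p r \<subseteq> U" using r0(2) by (auto simp: r_def)
    ultimately show ?thesis using rpos by (intro exI[of _ r]) blast
  qed
  \<comment> \<open>Quasiperiodicity carries analyticity from the half-open unit cell to the cell of
    \<open>z\<close>.\<close>
  have "F field_differentiable at z" if z: "z \<in> \<Omega>" for z
  proof -
    define k where "k = cell_index z"
    have zk: "z - k = tr z" by (simp add: k_def tr_eq)
    obtain r where r: "r > 0" "\<forall>w\<in>ball (z - k) r. w \<in> U \<and> F w = g w"
      using local[of "tr z"] z tr_in_Omega[of z] tr_bounds[of z] unfolding zk by blast
    have "(g \<circ> (\<lambda>w. w - k)) holomorphic_on ball z r"
      by (intro holomorphic_on_compose holomorphic_intros holomorphic_on_subset[OF g(1)]) (use r in \<open>auto simp: dist_norm\<close>)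
    then have "(\<lambda>w. chi \<eta> k * g (w - k)) holomorphic_on ball z r" by (auto simp: comp_def intro!: holomorphic_intros)
    then have "F holomorphic_on ball z r"
    proof (rule holomorphic_transform)
      fix w assume "w \<in> ball z r"
      then have "F (w - k) = g (w - k)" using r(2) by (auto simp: dist_norm)
      then show "chi \<eta> k * g (w - k) = F w" using F_shift[of k "w - k"] by (simp add: k_def)
    qed
    then show ?thesis using r(1) holomorphic_on_imp_differentiable_at by (metis centre_in_ball open_ball)
  qed
  then have "F holomorphic_on \<Omega>" using open_Omega by (simp add: holomorphic_on_open field_differentiable_def)
  moreover have "F z = f z" if "z \<in> \<omega>" for z
    using that cell_index_omega[OF that, of 0] tr_omega[OF that, of 0] g(2) by (simp add: F_def)
  ultimately show ?thesis using that[of F] F_shift by blast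
qed

end

section \<open>From quasiperiodic functions to the Bergman space of the domain\<close>

locale cell_partition_null = cell_partition + doubly_periodic_null
begin

lemma Omega_shift_measurable: "m \<in> L \<Longrightarrow> (\<lambda>z. z + m) \<in> measurable (area \<Omega>) (area \<Omega>)"
proof (rule measurable_restrict_space3)
  show "(\<lambda>z. z + m) \<in> lebesgue \<rightarrow>\<^sub>M lebesgue"
    using lebesgue_affine_measurable[of "\<lambda>_. 1" m] by (simp add: euclidean_representation add.commute)
  show "m \<in> L \<Longrightarrow> (\<lambda>z. z + m) \<in> \<Omega> \<rightarrow> \<Omega>" using Omega_shift by auto
qed

lemma shift_A2:
  assumes h: "h \<in> A2 \<Omega>" and k: "k \<in> L"
  shows "(\<lambda>z. h (z + k)) \<in> A2 \<Omega>"
  unfolding A2_def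
proof (intro CollectI conjI L2_OmegaI)
  have hL: "h \<in> L2 (area \<Omega>)" using h by (rule A2D)
  show "(\<lambda>z. h (z + k)) \<in> borel_measurable (area \<Omega>)"
    by (rule measurable_compose[OF Omega_shift_measurable[OF k] L2D(1)[OF hL]])
  show "(\<lambda>z. h (z + m + k)) \<in> L2 M" if "m \<in> L" for m
    using shift_L2[OF hL, of "m + k"] that k by (auto simp: add.assoc)
  show "(L2_norm M (\<lambda>z. h (z + m + k)))\<^sup>2 \<le> (L2_norm M (\<lambda>z. h (z + (m + k))))\<^sup>2" if "m \<in> L" for m
    by (simp add: add.assoc)
  show "(\<lambda>m. (L2_norm M (\<lambda>z. h (z + (m + k))))\<^sup>2) summable_on L"
    using has_sum_lattice_shift[OF k, of "\<lambda>m. (L2_norm M (\<lambda>z. h (z + m)))\<^sup>2"] L2_norm_Omega[OF hL] by (auto simp: summable_on_def)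
  have "(\<lambda>z. z + k) ` \<Omega> \<subseteq> \<Omega>" using Omega_shift[OF k] by auto
  then have "(h \<circ> (\<lambda>z. z + k)) holomorphic_on \<Omega>"
    by (intro holomorphic_on_compose holomorphic_intros holomorphic_on_subset[OF A2D(2)[OF h]])
  then show "(\<lambda>z. h (z + k)) holomorphic_on \<Omega>" by (simp add: comp_def)
qed

lemma R_mult_L2:
  assumes f: "f \<in> L2 M" and m: "m \<in> L"
  shows "(\<lambda>z. f z * R (z + m)) \<in> L2 M" "L2_norm M (\<lambda>z. f z * R (z + m)) \<le> K * weight b m * L2_norm M f"
proof -
  have "(\<lambda>z. z + m) ` \<Omega> \<subseteq> \<Omega>" using Omega_shift[OF m] by auto
  then have "(R \<circ> (\<lambda>z. z + m)) holomorphic_on \<Omega>"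
    by (intro holomorphic_on_compose holomorphic_intros holomorphic_on_subset[OF R_hol])
  then have Rm: "(\<lambda>z. R (z + m)) \<in> borel_measurable M"
    using L2_holomorphic_measurable[OF omega(1) holomorphic_on_subset[OF _ omega_sub]] by (simp add: comp_def)
  have bd: "cmod (R (z + m)) \<le> K * weight b m" if "z \<in> space M" for z
    using R_omega_bound[OF omega_facts(1,2) m, of z] that by simp
  have K0: "0 \<le> K * weight b m" using K_nonneg by simp
  show "(\<lambda>z. f z * R (z + m)) \<in> L2 M" "L2_norm M (\<lambda>z. f z * R (z + m)) \<le> K * weight b m * L2_norm M f"
    using L2_bounded_mult[OF f Rm bd K0] by auto
qed

text \<open>A quasiperiodic function has the same norm on every cell, so it is square integrable
  over \<Omega> only if it vanishes; the factor \<open>R\<close> supplies the decay. The resulting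
  cell norms are bounded by multiples of \<open>weight b m\<close>, and the weights are at most 1,
  so their squares are summable as well.\<close>

lemma A2_of_ext:
  assumes f: "f \<in> A2_ext \<omega> \<eta>"
  obtains h where "h \<in> A2 \<Omega>" "\<And>z m. z \<in> \<omega> \<Longrightarrow> m \<in> L \<Longrightarrow> h (z + m) = chi \<eta> m * (f z * R (z + m))"
proof -
  obtain F where F: "F holomorphic_on \<Omega>" "\<And>z. z \<in> \<omega> \<Longrightarrow> F z = f z" "\<And>z m. m \<in> L \<Longrightarrow> F (z + m) = chi \<eta> m * F z"
    by (rule quasiperiodic_extension[OF f]) (rule that)
  have fL: "f \<in> L2 M" using f A2_ext_sub A2D(1) by blast
  define h where "h = (\<lambda>z. F z * R z)"
  have hol: "h holomorphic_on \<Omega>" unfolding h_def by (intro holomorphic_intros F R_hol)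
  have hm: "h (z + m) = chi \<eta> m * (f z * R (z + m))" if "z \<in> \<omega>" "m \<in> L" for z m
    using that F by (simp add: h_def)
  have eqL: "(\<lambda>z. h (z + m)) \<in> L2 M \<and> L2_norm M (\<lambda>z. h (z + m)) = L2_norm M (\<lambda>z. f z * R (z + m))" if m: "m \<in> L" for m
  proof -
    have m1: "(\<lambda>z. h (z + m)) \<in> borel_measurable M"
      by (rule shift_borel_measurable[OF L2_holomorphic_measurable[OF open_Omega hol] m])
    have L1: "(\<lambda>z. chi \<eta> m * (f z * R (z + m))) \<in> L2 M" by (rule L2_cmult[OF R_mult_L2(1)[OF fL m]])
    have "integrable M (\<lambda>z. (cmod (h (z + m)))\<^sup>2) \<longleftrightarrow> integrable M (\<lambda>z. (cmod (chi \<eta> m * (f z * R (z + m))))\<^sup>2)"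
      by (rule Bochner_Integration.integrable_cong) (use hm[OF _ m] in auto)
    then have L2: "(\<lambda>z. h (z + m)) \<in> L2 M" using L1 m1 by (simp add: L2_def)
    have "L2_norm M (\<lambda>z. h (z + m)) = L2_norm M (\<lambda>z. chi \<eta> m * (f z * R (z + m)))"
      using hm[OF _ m] by (intro L2_norm_cong_AE AE_I2 m1 L2D(1)[OF L1]) auto
    then show ?thesis using L2 by (simp add: L2_norm_cmult)
  qed
  have "h \<in> L2 (area \<Omega>)"
  proof (rule L2_OmegaI)
    show "h \<in> borel_measurable (area \<Omega>)" by (rule L2_holomorphic_measurable[OF open_Omega hol])
    show "(\<lambda>z. h (z + m)) \<in> L2 M" if "m \<in> L" for m using eqL[OF that] by blast
    fix m assume m: "m \<in> L"
    have "L2_norm M (\<lambda>z. h (z + m)) \<le> K * weight b m * L2_norm M f" using eqL[OF m] R_mult_L2(2)[OF fL m] by simp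
    then have "(L2_norm M (\<lambda>z. h (z + m)))\<^sup>2 \<le> (K * weight b m * L2_norm M f)\<^sup>2" by (intro power_mono) auto
    also have "\<dots> = (K * L2_norm M f)\<^sup>2 * (weight b m * weight b m)" by (simp add: power2_eq_square mult_ac)
    also have "\<dots> \<le> (K * L2_norm M f)\<^sup>2 * (1 * weight b m)"
    proof (intro mult_left_mono mult_right_mono)
      show "weight b m \<le> 1" unfolding weight_def using b powr_mono[of "- b" 0 "1 + cmod m"] by (simp split: if_splits)
    qed auto
    finally show "(L2_norm M (\<lambda>z. h (z + m)))\<^sup>2 \<le> (K * L2_norm M f)\<^sup>2 * weight b m" by simp
  next
    show "(\<lambda>m. (K * L2_norm M f)\<^sup>2 * weight b m) summable_on L"
      by (rule summable_on_cmult_right[OF summable_weight[OF b]])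
  qed
  then show ?thesis using that[of h] hol hm by (simp add: A2_def)
qed

end

section \<open>Fourier coefficients of pairings with sections\<close>

context cell_partition_null
begin

text \<open>A truncation of \<open>sect\<close>: its pairing with a fixed function is a
  trigonometric polynomial, which gives measurability and Fourier coefficients in the limit.\<close>

definition sectX :: "(complex \<Rightarrow> complex) \<Rightarrow> complex set \<Rightarrow> real \<times> real \<Rightarrow> complex \<Rightarrow> complex" where
  "sectX f X \<eta> z = (\<Sum>n\<in>X. chi \<eta> n * (f z * R (z + n)))"

definition W :: real where "W = infsum (weight b) L"

lemma W_has_sum: "(weight b has_sum W) L"
  unfolding W_def by (rule has_sum_infsum[OF summable_weight[OF b]])

lemma W_nonneg: "0 \<le> W" unfolding W_def by (rule infsum_nonneg) simp

lemma exhaustion_limit: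
  assumes "(f has_sum s) L" shows "(\<lambda>n. sum f (exhaustion n)) \<longlonglongrightarrow> (s :: 'a :: {comm_monoid_add, topological_space})"
  using filterlim_compose[OF assms[unfolded has_sum_def] exhaustion_filterlim[of 0]] by simp

lemma sectX_L2: assumes f: "f \<in> L2 M" and X: "X \<subseteq> L" shows "sectX f X \<eta> \<in> L2 M"
  unfolding sectX_def[abs_def] by (intro L2_sum L2_cmult R_mult_L2(1) f subsetD[OF X])

lemma sectX_norm:
  assumes f: "f \<in> L2 M" and X: "finite X" "X \<subseteq> L"
  shows "L2_norm M (sectX f X \<eta>) \<le> K * W * L2_norm M f"
proof -
  have "L2_norm M (sectX f X \<eta>) \<le> (\<Sum>n\<in>X. L2_norm M (\<lambda>z. chi \<eta> n * (f z * R (z + n))))"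
    unfolding sectX_def[abs_def] by (intro L2_norm_sum X L2_cmult R_mult_L2(1) f subsetD[OF X(2)])
  also have "\<dots> \<le> (\<Sum>n\<in>X. K * weight b n * L2_norm M f)"
    unfolding L2_norm_cmult norm_chi mult_1 by (intro sum_mono R_mult_L2(2) f subsetD[OF X(2)])
  also have "\<dots> = K * L2_norm M f * sum (weight b) X"
    unfolding sum_distrib_left by (intro sum.cong refl) (simp add: mult_ac)
  also have "\<dots> \<le> K * L2_norm M f * W"
    using finite_sum_le_has_sum[OF W_has_sum X] K_nonneg by (intro mult_left_mono) auto
  finally show ?thesis by (simp add: mult_ac)
qed

text \<open>The tail of the series for \<open>T\<close> is bounded on the cell by the tail of the
  weights, uniformly in the parameter.\<close>

lemma sectX_tail:
  assumes f: "f \<in> L2 M" and X: "finite X" "X \<subseteq> L"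
  shows "L2_norm M (sectX f X \<eta> - sect f \<eta>) \<le> K * (W - sum (weight b) X) * L2_norm M f"
proof -
  have "sectX f X \<eta> - sect f \<eta> = (\<lambda>z. f z * ((\<Sum>n\<in>X. chi \<eta> n * R (z + n)) - T \<eta> z))"
    by (simp add: sectX_def sect_def fun_eq_iff sum_distrib_left right_diff_distrib mult_ac)
  moreover have "L2_norm M (\<lambda>z. f z * ((\<Sum>n\<in>X. chi \<eta> n * R (z + n)) - T \<eta> z)) \<le> K * (W - sum (weight b) X) * L2_norm M f"
  proof (rule L2_bounded_mult(2)[OF f])
    have "(\<lambda>z. R (z + n)) \<in> borel_measurable M" if "n \<in> X" for n
      using R_mult_L2(1)[OF one_L2, of n] X that by (auto dest: L2D)
    then show "(\<lambda>z. (\<Sum>n\<in>X. chi \<eta> n * R (z + n)) - T \<eta> z) \<in> borel_measurable M" using T_measurable by simp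
    show "0 \<le> K * (W - sum (weight b) X)" using K_nonneg finite_sum_le_has_sum[OF W_has_sum X] by simp
    fix z assume "z \<in> space M"
    then have z: "z \<in> \<Omega>" "cmod z \<le> 2" using omega_facts[of z] by auto
    have "norm (T \<eta> z - (\<Sum>n\<in>X. chi \<eta> n * R (z + n))) \<le> K * (W - sum (weight b) X)"
    proof (rule norm_infsum_le)
      show "((\<lambda>n. chi \<eta> n * R (z + n)) has_sum (T \<eta> z - (\<Sum>n\<in>X. chi \<eta> n * R (z + n)))) (L - X)"
        by (rule has_sum_Diff[OF T_has_sum[OF z(1)] has_sum_finite[OF X(1)] X(2)])
      show "((\<lambda>n. K * weight b n) has_sum K * (W - sum (weight b) X)) (L - X)"
        by (intro has_sum_cmult_right has_sum_Diff[OF W_has_sum has_sum_finite[OF X(1)] X(2)])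
      show "norm (chi \<eta> n * R (z + n)) \<le> K * weight b n" if "n \<in> L - X" for n
        using R_omega_bound[OF z, of n] that by (simp add: norm_mult)
    qed
    then show "cmod ((\<Sum>n\<in>X. chi \<eta> n * R (z + n)) - T \<eta> z) \<le> K * (W - sum (weight b) X)" by (simp add: norm_minus_commute)
  qed
  ultimately show ?thesis by simp
qed

lemma sectX_limit:
  assumes f: "f \<in> L2 M"
  shows "(\<lambda>n. L2_norm M (sectX f (exhaustion n) \<eta> - sect f \<eta>)) \<longlonglongrightarrow> 0"
proof (rule tendsto_zero_bound)
  have "(\<lambda>n. K * (W - sum (weight b) (exhaustion n)) * L2_norm M f) \<longlonglongrightarrow> K * (W - W) * L2_norm M f"
    by (intro tendsto_intros exhaustion_limit W_has_sum)
  then show "(\<lambda>n. K * (W - sum (weight b) (exhaustion n)) * L2_norm M f) \<longlonglongrightarrow> 0" by simp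
qed (use sectX_tail[OF f exhaustion] in simp)

lemma sect_norm:
  assumes f: "f \<in> L2 M" shows "L2_norm M (sect f \<eta>) \<le> K * W * L2_norm M f"
proof (rule LIMSEQ_le_const2)
  show "(\<lambda>n. L2_norm M (sectX f (exhaustion n) \<eta> - (\<lambda>z. 0))) \<longlonglongrightarrow> L2_norm M (sect f \<eta>)"
    using tendsto_L2_norm[OF sectX_L2[OF f exhaustion(2)] sect_L2[OF f] L2_zero sectX_limit[OF f], of \<eta>] by (simp add: fun_diff_def)
  show "\<exists>N. \<forall>n\<ge>N. L2_norm M (sectX f (exhaustion n) \<eta> - (\<lambda>z. 0)) \<le> K * W * L2_norm M f"
    using sectX_norm[OF f exhaustion] by (simp add: fun_diff_def)
qed

lemma sect_inner_limit:
  assumes f: "f \<in> L2 M" and u: "u \<in> L2 M"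
  shows "(\<lambda>n. L2_inner M u (sectX f (exhaustion n) \<eta>)) \<longlonglongrightarrow> L2_inner M u (sect f \<eta>)"
  unfolding L2_inner_commute[of M u]
  by (rule tendsto_cnj[OF tendsto_L2_inner[OF sectX_L2[OF f exhaustion(2)] sect_L2[OF f] u sectX_limit[OF f]]])

lemma sectX_inner:
  assumes f: "f \<in> L2 M" and u: "u \<in> L2 M" and X: "X \<subseteq> L"
  shows "L2_inner M u (sectX f X (\<eta>0 - \<eta>)) = (\<Sum>n\<in>X. cnj (chi \<eta>0 n) * chi \<eta> n * L2_inner M u (\<lambda>z. f z * R (z + n)))"
proof -
  have "L2_inner M u (sectX f X (\<eta>0 - \<eta>)) = cnj (L2_inner M (sectX f X (\<eta>0 - \<eta>)) u)" by (rule L2_inner_commute)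
  also have "L2_inner M (sectX f X (\<eta>0 - \<eta>)) u = (\<Sum>n\<in>X. L2_inner M (\<lambda>z. chi (\<eta>0 - \<eta>) n * (f z * R (z + n))) u)"
    unfolding sectX_def[abs_def] by (rule L2_inner_sum_left[OF L2_cmult[OF R_mult_L2(1)[OF f subsetD[OF X]]] u])
  also have "cnj \<dots> = (\<Sum>n\<in>X. cnj (chi (\<eta>0 - \<eta>) n) * L2_inner M u (\<lambda>z. f z * R (z + n)))"
    by (simp only: L2_inner_cmult_left cnj_sum complex_cnj_mult L2_inner_commute[of M u, symmetric])
  finally show ?thesis by (simp add: chi_diff_left)
qed

lemma sect_inner_measurable:
  assumes f: "f \<in> L2 M" and u: "u \<in> L2 M"
  shows "(\<lambda>\<eta>. L2_inner M u (sect f (\<eta>0 - \<eta>))) \<in> borel_measurable NN"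
proof (rule borel_measurable_LIMSEQ_metric)
  show "(\<lambda>\<eta>. L2_inner M u (sectX f (exhaustion n) (\<eta>0 - \<eta>))) \<in> borel_measurable NN" for n
    unfolding sectX_inner[OF f u exhaustion(2)] by measurable
  show "(\<lambda>n. L2_inner M u (sectX f (exhaustion n) (\<eta>0 - \<eta>))) \<longlonglongrightarrow> L2_inner M u (sect f (\<eta>0 - \<eta>))" for \<eta>
    by (rule sect_inner_limit[OF f u])
qed

text \<open>The series of \<open>T (\<eta>0 - \<eta>)\<close> is a Fourier series in
  \<open>\<eta>\<close>. The truncated pairings are uniformly bounded, so coefficients pass to the
  limit, and once \<open>j\<close> is among the indices the coefficient of a truncation no longer
  changes.\<close>

lemma sect_fourier_coeff:
  assumes f: "f \<in> L2 M" and u: "u \<in> L2 M" and j: "j \<in> L"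
  shows "(LINT \<eta>|NN. cnj (chi \<eta> j) * L2_inner M u (sect f (\<eta>0 - \<eta>))) =
    of_real (4 * pi\<^sup>2) * (cnj (chi \<eta>0 j) * L2_inner M u (\<lambda>z. f z * R (z + j)))"
proof -
  define V where "V = of_real (4 * pi\<^sup>2) * (cnj (chi \<eta>0 j) * L2_inner M u (\<lambda>z. f z * R (z + j)))"
  have ichi: "integrable NN (\<lambda>\<eta>. chi \<eta> m)" for m by (intro integrable_continuous_dual continuous_intros)
  have "(\<lambda>n. LINT \<eta>|NN. cnj (chi \<eta> j) * L2_inner M u (sectX f (exhaustion n) (\<eta>0 - \<eta>))) \<longlonglongrightarrow>
      (LINT \<eta>|NN. cnj (chi \<eta> j) * L2_inner M u (sect f (\<eta>0 - \<eta>)))"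
  proof (rule integral_dominated_convergence[where w = "\<lambda>_. L2_norm M u * (K * W * L2_norm M f)"])
    show "(\<lambda>\<eta>. cnj (chi \<eta> j) * L2_inner M u (sect f (\<eta>0 - \<eta>))) \<in> borel_measurable NN"
      using sect_inner_measurable[OF f u] by measurable
    show "(\<lambda>\<eta>. cnj (chi \<eta> j) * L2_inner M u (sectX f (exhaustion n) (\<eta>0 - \<eta>))) \<in> borel_measurable NN" for n
      unfolding sectX_inner[OF f u exhaustion(2)] by measurable
    show "integrable NN (\<lambda>_. L2_norm M u * (K * W * L2_norm M f))"
      using finite_dual by (simp add: finite_measure.integrable_const)
    show "AE \<eta> in NN. (\<lambda>n. cnj (chi \<eta> j) * L2_inner M u (sectX f (exhaustion n) (\<eta>0 - \<eta>))) \<longlonglongrightarrow> cnj (chi \<eta> j) * L2_inner M u (sect f (\<eta>0 - \<eta>))"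
      by (intro AE_I2 tendsto_intros sect_inner_limit f u)
    show "AE \<eta> in NN. norm (cnj (chi \<eta> j) * L2_inner M u (sectX f (exhaustion n) (\<eta>0 - \<eta>))) \<le> L2_norm M u * (K * W * L2_norm M f)" for n
    proof (rule AE_I2)
      fix \<eta>
      have "cmod (L2_inner M u (sectX f (exhaustion n) (\<eta>0 - \<eta>))) \<le> L2_norm M u * L2_norm M (sectX f (exhaustion n) (\<eta>0 - \<eta>))"
        by (rule L2_Cauchy_Schwarz[OF u sectX_L2[OF f exhaustion(2)]])
      also have "\<dots> \<le> L2_norm M u * (K * W * L2_norm M f)" by (intro mult_left_mono sectX_norm f exhaustion) auto
      finally show "norm (cnj (chi \<eta> j) * L2_inner M u (sectX f (exhaustion n) (\<eta>0 - \<eta>))) \<le> L2_norm M u * (K * W * L2_norm M f)"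
        by (simp add: norm_mult)
    qed
  qed
  moreover have "(\<lambda>n. LINT \<eta>|NN. cnj (chi \<eta> j) * L2_inner M u (sectX f (exhaustion n) (\<eta>0 - \<eta>))) \<longlonglongrightarrow> V"
  proof (rule tendsto_eventually)
    have "eventually (\<lambda>n. j \<in> exhaustion n) sequentially"
    proof -
      have "\<forall>X. finite X \<and> X \<subseteq> L \<longrightarrow> (\<forall>\<^sub>F n in sequentially. finite ((+) 0 ` exhaustion n) \<and> X \<subseteq> (+) 0 ` exhaustion n \<and> (+) 0 ` exhaustion n \<subseteq> L)"
        using exhaustion_filterlim[of 0] unfolding filterlim_finite_subsets_at_top by simp
      from this[rule_format, of "{j}"] j show ?thesis by (simp add: eventually_conj_iff)
    qed
    then show "eventually (\<lambda>n. (LINT \<eta>|NN. cnj (chi \<eta> j) * L2_inner M u (sectX f (exhaustion n) (\<eta>0 - \<eta>))) = V) sequentially"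
    proof eventually_elim
      case (elim n)
      have "(LINT \<eta>|NN. cnj (chi \<eta> j) * L2_inner M u (sectX f (exhaustion n) (\<eta>0 - \<eta>))) =
        (LINT \<eta>|NN. (\<Sum>m\<in>exhaustion n. (cnj (chi \<eta>0 m) * L2_inner M u (\<lambda>z. f z * R (z + m))) * chi \<eta> (m - j)))"
        unfolding sectX_inner[OF f u exhaustion(2)] sum_distrib_left by (simp add: chi_diff mult_ac)
      also have "\<dots> = (\<Sum>m\<in>exhaustion n. (cnj (chi \<eta>0 m) * L2_inner M u (\<lambda>z. f z * R (z + m))) * (LINT \<eta>|NN. chi \<eta> (m - j)))"
        by (subst Bochner_Integration.integral_sum) (use ichi in auto)
      also have "\<dots> = (\<Sum>m\<in>exhaustion n. if m = j then V else 0)"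
      proof (rule sum.cong[OF refl])
        fix m assume "m \<in> exhaustion n"
        then have mj: "m - j \<in> L" using exhaustion(2)[of n] j by auto
        show "(cnj (chi \<eta>0 m) * L2_inner M u (\<lambda>z. f z * R (z + m))) * (LINT \<eta>|NN. chi \<eta> (m - j)) = (if m = j then V else 0)"
          unfolding integral_chi[OF mj] by (simp add: V_def)
      qed
      also have "\<dots> = V" using elim exhaustion(1)[of n] by simp
      finally show ?case .
    qed
  qed
  ultimately show ?thesis unfolding V_def using LIMSEQ_unique by blast
qed

text \<open>The pairing is expanded twice, in the Floquet series of \<open>u\<close> and in the
  series of \<open>T\<close>. Its coefficient \<open>k\<close> is then a multiple of the inner
  product of \<open>u\<close> with the function \<open>h\<close> shifted by \<open>- k\<close>,
  again a member of the Bergman space.\<close>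

lemma section_orthogonal_AE:
  assumes u: "u \<in> L2 (area \<Omega>)" and orth: "\<And>h. h \<in> A2 \<Omega> \<Longrightarrow> L2_inner (area \<Omega>) u h = 0"
    and U: "is_floquet u U" and f: "f \<in> A2_ext \<omega> \<eta>0"
  shows "AE \<eta> in NN. L2_inner M (U \<eta>) (sect f (\<eta>0 - \<eta>)) = 0"
proof (rule zero_coeffs_imp_zero)
  interpret complete_measure NN by (rule complete_dual)
  have fL: "f \<in> L2 M" using f A2_ext_sub A2D(1) by blast
  have Us: "U \<in> floquet_space \<omega>" using U by (simp add: is_floquet_def)
  note UL = floquet_space_D(1)[OF Us]
  define c where "c = (\<lambda>\<eta>. L2_inner M (U \<eta>) (sect f (\<eta>0 - \<eta>)))"
  define Cf where "Cf = K * W * L2_norm M f"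
  have Cf: "0 \<le> Cf" using K_nonneg W_nonneg by (simp add: Cf_def)
  define cS where "cS = (\<lambda>A \<eta>. L2_inner M (S u A \<eta>) (sect f (\<eta>0 - \<eta>)))"
  have cS_eq: "cS A \<eta> = (\<Sum>m\<in>A. (of_real (1 / (2 * pi)) * cnj (chi \<eta> m)) * L2_inner M (\<lambda>z. u (z + m)) (sect f (\<eta>0 - \<eta>)))" if "A \<subseteq> L" for A \<eta>
    unfolding cS_def by (rule S_inner[OF u that sect_L2[OF fL]])
  have umL: "(\<lambda>z. u (z + m)) \<in> L2 M" if "m \<in> L" for m by (rule shift_L2[OF u that])
  have cS_meas: "cS A \<in> borel_measurable NN" if A: "A \<subseteq> L" for A
  proof -
    have "(\<lambda>\<eta>. L2_inner M (\<lambda>z. u (z + m)) (sect f (\<eta>0 - \<eta>))) \<in> borel_measurable NN" if "m \<in> A" for m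
      by (rule sect_inner_measurable[OF fL umL]) (use that A in blast)
    then show ?thesis unfolding cS_eq[OF A, abs_def] by (intro borel_measurable_sum borel_measurable_times) auto
  qed
  have diff_bd: "cmod (cS A \<eta> - c \<eta>) \<le> Cf * L2_norm M (S u A \<eta> - U \<eta>)" if A: "A \<subseteq> L" and \<eta>: "\<eta> \<in> dual_cell" for A \<eta>
  proof -
    have "cS A \<eta> - c \<eta> = L2_inner M (S u A \<eta> - U \<eta>) (sect f (\<eta>0 - \<eta>))"
      unfolding cS_def c_def by (rule L2_inner_diff_left[symmetric, OF S_L2[OF u A] UL[OF \<eta>] sect_L2[OF fL]])
    also have "cmod \<dots> \<le> L2_norm M (S u A \<eta> - U \<eta>) * L2_norm M (sect f (\<eta>0 - \<eta>))"
      by (rule L2_Cauchy_Schwarz[OF L2_diff[OF S_L2[OF u A] UL[OF \<eta>]] sect_L2[OF fL]])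
    also have "\<dots> \<le> L2_norm M (S u A \<eta> - U \<eta>) * Cf" unfolding Cf_def by (intro mult_left_mono sect_norm fL) auto
    finally show ?thesis by (simp add: mult.commute)
  qed
  \<comment> \<open>Both factors of the pairing vary with the parameter; a subsequence of partial
    sums converging almost everywhere gives measurability.\<close>
  have cm: "c \<in> borel_measurable NN"
  proof -
    obtain B where B: "\<And>n. finite (B n)" "\<And>n. B n \<subseteq> L" "AE \<eta> in NN. \<forall>e\<in>{0}. (\<lambda>n. L2_norm M (S u ((+) e ` B n) \<eta> - U \<eta>)) \<longlonglongrightarrow> 0"
      by (rule floquet_subseq[OF u U, of "{0}"]) (auto intro: that)
    show ?thesis
    proof (rule borel_measurable_AE_LIMSEQ[of "\<lambda>n. cS (B n)"])
      show "cS (B n) \<in> borel_measurable NN" for n by (rule cS_meas[OF B(2)])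
      show "AE \<eta> in NN. (\<lambda>n. cS (B n) \<eta>) \<longlonglongrightarrow> c \<eta>"
        using B(3) AE_space
      proof eventually_elim
        case (elim \<eta>)
        then have \<eta>: "\<eta> \<in> dual_cell" and l: "(\<lambda>n. L2_norm M (S u (B n) \<eta> - U \<eta>)) \<longlonglongrightarrow> 0" by auto
        have "(\<lambda>n. Cf * L2_norm M (S u (B n) \<eta> - U \<eta>)) \<longlonglongrightarrow> Cf * 0" by (intro tendsto_intros l)
        then have "(\<lambda>n. cS (B n) \<eta> - c \<eta>) \<longlonglongrightarrow> 0"
          by - (rule tendsto_zero_bound[of "\<lambda>n. Cf * L2_norm M (S u (B n) \<eta> - U \<eta>)"], use diff_bd[OF B(2) \<eta>] in simp_all)
        then show ?case by (rule LIM_zero_cancel)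
      qed
    qed
  qed
  have Un: "(\<lambda>\<eta>. L2_norm M (U \<eta>)) \<in> borel_measurable NN"
    using strongly_measurable_norm_const[OF complete_dual subset_refl _ floquet_space_D(2)[OF Us] L2_zero] UL by (simp add: fun_diff_def)
  have Ui: "integrable NN (\<lambda>\<eta>. L2_norm M (U \<eta>))"
    by (rule integral_norm_le_sqrt(1)[OF finite_dual Un floquet_space_D(3)[OF Us]])
  have ci: "integrable NN c"
  proof (rule Bochner_Integration.integrable_bound[OF integrable_mult_right[OF Ui, of Cf] cm], rule AE_I2)
    fix \<eta> assume "\<eta> \<in> space NN"
    then have \<eta>: "\<eta> \<in> dual_cell" by simp
    have "cmod (c \<eta>) \<le> L2_norm M (U \<eta>) * L2_norm M (sect f (\<eta>0 - \<eta>))" unfolding c_def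
      by (rule L2_Cauchy_Schwarz[OF UL[OF \<eta>] sect_L2[OF fL]])
    also have "\<dots> \<le> L2_norm M (U \<eta>) * Cf" unfolding Cf_def by (intro mult_left_mono sect_norm fL) auto
    finally show "norm (c \<eta>) \<le> norm (Cf * L2_norm M (U \<eta>))" using Cf by (simp add: mult.commute)
  qed
  obtain h where h: "h \<in> A2 \<Omega>" "\<And>z m. z \<in> \<omega> \<Longrightarrow> m \<in> L \<Longrightarrow> h (z + m) = chi \<eta>0 m * (f z * R (z + m))"
    by (rule A2_of_ext[OF f]) (rule that)
  have coef: "(LINT \<eta>|NN. chi \<eta> k * c \<eta>) = 0" if k: "k \<in> L" for k
  proof -
    have hk: "(\<lambda>z. h (z + - k)) \<in> A2 \<Omega>" by (rule shift_A2[OF h(1)]) (use k in auto)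
    \<comment> \<open>The factor \<open>1 / (2 * pi)\<close> of the transform and
      \<open>4 * pi\<^sup>2\<close> from the character integral combine to \<open>2 * pi\<close>;
      coefficient \<open>m - k\<close> of the section is the restriction of \<open>h\<close> to the
      cell with that index, up to its phase.\<close>
    have val: "(LINT \<eta>|NN. chi \<eta> k * cS A \<eta>) = of_real (2 * pi) * (\<Sum>m\<in>A. L2_inner M (\<lambda>z. u (z + m)) (\<lambda>z. h (z + m + - k)))"
      if A: "finite A" "A \<subseteq> L" for A
    proof -
      have int: "integrable NN (\<lambda>\<eta>. cnj (chi \<eta> (m - k)) * L2_inner M (\<lambda>z. u (z + m)) (sect f (\<eta>0 - \<eta>)))" if m: "m \<in> A" for m
      proof (rule finite_measure.integrable_const_bound[OF finite_dual, of _ "L2_norm M (\<lambda>z. u (z + m)) * Cf"])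
        have uL: "(\<lambda>z. u (z + m)) \<in> L2 M" using umL m A by blast
        show "(\<lambda>\<eta>. cnj (chi \<eta> (m - k)) * L2_inner M (\<lambda>z. u (z + m)) (sect f (\<eta>0 - \<eta>))) \<in> borel_measurable NN"
          using sect_inner_measurable[OF fL uL] by measurable
        show "AE \<eta> in NN. norm (cnj (chi \<eta> (m - k)) * L2_inner M (\<lambda>z. u (z + m)) (sect f (\<eta>0 - \<eta>))) \<le> L2_norm M (\<lambda>z. u (z + m)) * Cf"
        proof (rule AE_I2)
          fix \<eta>
          have "cmod (L2_inner M (\<lambda>z. u (z + m)) (sect f (\<eta>0 - \<eta>))) \<le> L2_norm M (\<lambda>z. u (z + m)) * L2_norm M (sect f (\<eta>0 - \<eta>))"
            by (rule L2_Cauchy_Schwarz[OF uL sect_L2[OF fL]])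
          also have "\<dots> \<le> L2_norm M (\<lambda>z. u (z + m)) * Cf" unfolding Cf_def by (intro mult_left_mono sect_norm fL) auto
          finally show "norm (cnj (chi \<eta> (m - k)) * L2_inner M (\<lambda>z. u (z + m)) (sect f (\<eta>0 - \<eta>))) \<le> L2_norm M (\<lambda>z. u (z + m)) * Cf"
            by (simp add: norm_mult)
        qed
      qed
      have "(LINT \<eta>|NN. chi \<eta> k * cS A \<eta>) =
        (LINT \<eta>|NN. (\<Sum>m\<in>A. of_real (1 / (2 * pi)) * (cnj (chi \<eta> (m - k)) * L2_inner M (\<lambda>z. u (z + m)) (sect f (\<eta>0 - \<eta>)))))"
        unfolding cS_eq[OF A(2)] sum_distrib_left by (simp add: chi_diff mult_ac)
      also have "\<dots> = (\<Sum>m\<in>A. LINT \<eta>|NN. of_real (1 / (2 * pi)) * (cnj (chi \<eta> (m - k)) * L2_inner M (\<lambda>z. u (z + m)) (sect f (\<eta>0 - \<eta>))))"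
        by (rule Bochner_Integration.integral_sum) (rule integrable_mult_right[OF int])
      also have "\<dots> = (\<Sum>m\<in>A. of_real (2 * pi) * L2_inner M (\<lambda>z. u (z + m)) (\<lambda>z. h (z + m + - k)))"
      proof (rule sum.cong[OF refl])
        fix m assume "m \<in> A"
        then have m: "m \<in> L" "m - k \<in> L" using A k by auto
        have "L2_inner M (\<lambda>z. u (z + m)) (\<lambda>z. h (z + m + - k)) = L2_inner M (\<lambda>z. u (z + m)) (\<lambda>z. chi \<eta>0 (m - k) * (f z * R (z + (m - k))))"
          unfolding L2_inner_def using h(2)[OF _ m(2)] by (intro Bochner_Integration.integral_cong) (auto simp: add_diff_eq)
        then have e1: "L2_inner M (\<lambda>z. u (z + m)) (\<lambda>z. h (z + m + - k)) = cnj (chi \<eta>0 (m - k)) * L2_inner M (\<lambda>z. u (z + m)) (\<lambda>z. f z * R (z + (m - k)))"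
          by (simp only: L2_inner_cmult_right)
        show "(LINT \<eta>|NN. of_real (1 / (2 * pi)) * (cnj (chi \<eta> (m - k)) * L2_inner M (\<lambda>z. u (z + m)) (sect f (\<eta>0 - \<eta>)))) =
            of_real (2 * pi) * L2_inner M (\<lambda>z. u (z + m)) (\<lambda>z. h (z + m + - k))"
          unfolding e1 integral_mult_right_zero sect_fourier_coeff[OF fL umL[OF m(1)] m(2)]
          by (simp add: power2_eq_square)
      qed
      finally show ?thesis by (simp add: sum_distrib_left)
    qed
    have "((\<lambda>m. L2_inner M (\<lambda>z. u (z + m)) (\<lambda>z. h (z + m + - k))) has_sum L2_inner (area \<Omega>) u (\<lambda>z. h (z + - k))) L"
      using L2_inner_Omega[OF u A2D(1)[OF hk]] .
    then have hs: "((\<lambda>m. L2_inner M (\<lambda>z. u (z + m)) (\<lambda>z. h (z + m + - k))) has_sum 0) L"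
      unfolding orth[OF hk] .
    have "(\<lambda>n. of_real (2 * pi) * (\<Sum>m\<in>exhaustion n. L2_inner M (\<lambda>z. u (z + m)) (\<lambda>z. h (z + m + - k)))) \<longlonglongrightarrow> of_real (2 * pi) * 0"
      by (intro tendsto_mult tendsto_const exhaustion_limit[OF hs])
    then have lim1: "(\<lambda>n. LINT \<eta>|NN. chi \<eta> k * cS (exhaustion n) \<eta>) \<longlonglongrightarrow> 0" by (simp only: val[OF exhaustion] mult_zero_right)
    \<comment> \<open>The sections are bounded uniformly in the parameter, so mean square
      convergence of the partial sums gives convergence of every coefficient.\<close>
    have lim2: "(\<lambda>n. (LINT \<eta>|NN. chi \<eta> k * cS (exhaustion n) \<eta>) - (LINT \<eta>|NN. chi \<eta> k * c \<eta>)) \<longlonglongrightarrow> 0"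
    proof (rule tendsto_zero_bound)
      define I where "I = (\<lambda>n. LINT \<eta>|NN. (L2_norm M (S u (exhaustion n) \<eta> - U \<eta>))\<^sup>2)"
      have "I \<longlonglongrightarrow> 0" unfolding I_def using is_floquet_sq_limit[OF U exhaustion_filterlim[of 0]] by simp
      then have "(\<lambda>n. Cf * (sqrt (measure NN (space NN)) * sqrt (I n))) \<longlonglongrightarrow> Cf * (sqrt (measure NN (space NN)) * sqrt 0)"
        by (intro tendsto_intros)
      then show "(\<lambda>n. Cf * (sqrt (measure NN (space NN)) * sqrt (I n))) \<longlonglongrightarrow> 0" by simp
      fix n
      define \<delta> where "\<delta> = (\<lambda>\<eta>. L2_norm M (S u (exhaustion n) \<eta> - U \<eta>))"
      have \<delta>m: "\<delta> \<in> borel_measurable NN" unfolding \<delta>_def by (rule S_dist_measurable[OF u exhaustion(2) Us])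
      have \<delta>2: "integrable NN (\<lambda>\<eta>. (\<delta> \<eta>)\<^sup>2)" unfolding \<delta>_def by (rule S_dist_integrable[OF u exhaustion(2) Us])
      have \<delta>i: "integrable NN \<delta>" by (rule integral_norm_le_sqrt(1)[OF finite_dual \<delta>m \<delta>2])
      have di: "integrable NN (\<lambda>\<eta>. cS (exhaustion n) \<eta> - c \<eta>)"
      proof (rule Bochner_Integration.integrable_bound[OF integrable_mult_right[OF \<delta>i, of Cf]])
        show "(\<lambda>\<eta>. cS (exhaustion n) \<eta> - c \<eta>) \<in> borel_measurable NN" using cS_meas[OF exhaustion(2)] cm by simp
        show "AE \<eta> in NN. norm (cS (exhaustion n) \<eta> - c \<eta>) \<le> norm (Cf * \<delta> \<eta>)"
          by (rule AE_I2) (use diff_bd[OF exhaustion(2)] Cf in \<open>auto simp: \<delta>_def abs_mult\<close>)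
      qed
      then have "integrable NN (\<lambda>\<eta>. (cS (exhaustion n) \<eta> - c \<eta>) + c \<eta>)" using ci by (rule Bochner_Integration.integrable_add)
      then have si: "integrable NN (cS (exhaustion n))" by simp
      have "(LINT \<eta>|NN. chi \<eta> k * cS (exhaustion n) \<eta>) - (LINT \<eta>|NN. chi \<eta> k * c \<eta>) = (LINT \<eta>|NN. chi \<eta> k * (cS (exhaustion n) \<eta> - c \<eta>))"
        using integrable_chi_mult[OF si] integrable_chi_mult[OF ci] by (simp add: right_diff_distrib)
      also have "cmod \<dots> \<le> (LINT \<eta>|NN. cmod (chi \<eta> k * (cS (exhaustion n) \<eta> - c \<eta>)))" by (rule Bochner_Integration.integral_norm_bound)
      also have "\<dots> \<le> (LINT \<eta>|NN. Cf * \<bar>\<delta> \<eta>\<bar>)"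
        by (rule Bochner_Integration.integral_mono)
          (use integrable_norm[OF integrable_chi_mult[OF di]] \<delta>i diff_bd[OF exhaustion(2)] in \<open>auto simp: norm_mult \<delta>_def\<close>)
      also have "\<dots> = Cf * (LINT \<eta>|NN. \<bar>\<delta> \<eta>\<bar>)" by simp
      also have "\<dots> \<le> Cf * (sqrt (measure NN (space NN)) * sqrt (I n))"
        unfolding I_def by (intro mult_left_mono Cf) (use integral_norm_le_sqrt(2)[OF finite_dual \<delta>m \<delta>2] in \<open>simp add: \<delta>_def\<close>)
      finally show "norm ((LINT \<eta>|NN. chi \<eta> k * cS (exhaustion n) \<eta>) - (LINT \<eta>|NN. chi \<eta> k * c \<eta>)) \<le> Cf * (sqrt (measure NN (space NN)) * sqrt (I n))" .
    qed
    from tendsto_diff[OF lim1 lim2] have "(\<lambda>n::nat. LINT \<eta>|NN. chi \<eta> k * c \<eta>) \<longlonglongrightarrow> 0" by simp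
    then show ?thesis by (simp add: LIMSEQ_const_iff)
  qed
  show "zero_coeffs (\<lambda>\<eta>. L2_inner M (U \<eta>) (sect f (\<eta>0 - \<eta>)))"
    unfolding zero_coeffs_def c_def[symmetric] using ci coef by blast
qed

lemma floquet_orthogonal_ext:
  assumes u: "u \<in> L2 (area \<Omega>)" and orth: "\<And>h. h \<in> A2 \<Omega> \<Longrightarrow> L2_inner (area \<Omega>) u h = 0"
    and U: "is_floquet u U"
  shows "AE \<eta>0 in NN. \<forall>f\<in>A2_ext \<omega> \<eta>0. L2_inner M (U \<eta>0) f = 0"
proof -
  have Us: "U \<in> floquet_space \<omega>" using U by (simp add: is_floquet_def)
  note UL = floquet_space_D(1)[OF Us]
  have "AE \<eta>0 in NN. \<forall>\<epsilon>>0. \<forall>\<delta>>0. \<not> (AE \<eta> in NN. \<not> (dist \<eta> \<eta>0 < \<delta> \<and> L2_norm M (U \<eta> - U \<eta>0) < \<epsilon>))"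
    by (rule strongly_measurable_approx_continuous[OF floquet_space_D(2)[OF Us]]) (use UL in auto)
  then show ?thesis using AE_space
  proof eventually_elim
    case (elim \<eta>0)
    then have \<eta>0: "\<eta>0 \<in> dual_cell" by simp
    show ?case
    proof
      fix f assume f: "f \<in> A2_ext \<omega> \<eta>0"
      have fL: "f \<in> L2 M" using f A2_ext_sub A2D(1) by blast
      define A where "A = L2_norm M (U \<eta>0)"
      define Cf where "Cf = K * W * L2_norm M f"
      have Cf: "0 \<le> Cf" using K_nonneg W_nonneg by (simp add: Cf_def)
      have bound: "cmod (L2_inner M (U \<eta>0) f) \<le> (A + Cf) * \<epsilon>" if \<epsilon>: "\<epsilon> > 0" for \<epsilon>
      proof -
        have "((\<lambda>\<eta>. K * tau (\<eta>0 - \<eta>) * L2_norm M f) \<longlongrightarrow> K * 0 * L2_norm M f) (at \<eta>0)"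
          by (intro tendsto_intros tau_tendsto)
        then have "eventually (\<lambda>\<eta>. K * tau (\<eta>0 - \<eta>) * L2_norm M f < \<epsilon>) (at \<eta>0)"
          using \<epsilon> by (intro order_tendstoD) auto
        then obtain d where d: "d > 0" "\<And>\<eta>. \<eta> \<noteq> \<eta>0 \<Longrightarrow> dist \<eta> \<eta>0 < d \<Longrightarrow> K * tau (\<eta>0 - \<eta>) * L2_norm M f < \<epsilon>"
          unfolding eventually_at by auto
        have tau0: "tau 0 = 0" by (simp add: tau_def)
        have d': "K * tau (\<eta>0 - \<eta>) * L2_norm M f < \<epsilon>" if "dist \<eta> \<eta>0 < d" for \<eta>
          using d(2)[OF _ that] \<epsilon> tau0 by (cases "\<eta> = \<eta>0") auto
        have nae: "\<not> (AE \<eta> in NN. \<not> (dist \<eta> \<eta>0 < d \<and> L2_norm M (U \<eta> - U \<eta>0) < \<epsilon>))" using elim(1) \<epsilon> d(1) by blast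
        have "AE \<eta> in NN. L2_inner M (U \<eta>) (sect f (\<eta>0 - \<eta>)) = 0"
          by (rule section_orthogonal_AE[OF u _ U f]) (rule orth)
        then have ae: "AE \<eta> in NN. L2_inner M (U \<eta>) (sect f (\<eta>0 - \<eta>)) = 0 \<and> \<eta> \<in> dual_cell"
          using AE_space by eventually_elim simp
        \<comment> \<open>A non-null set of parameters near \<open>\<eta>0\<close> meets the set of
          full measure that belongs to this particular \<open>f\<close>.\<close>
        have "\<exists>\<eta>\<in>dual_cell. dist \<eta> \<eta>0 < d \<and> L2_norm M (U \<eta> - U \<eta>0) < \<epsilon> \<and> L2_inner M (U \<eta>) (sect f (\<eta>0 - \<eta>)) = 0"
        proof (rule ccontr)
          assume no: "\<not> ?thesis"
          have "AE \<eta> in NN. \<not> (dist \<eta> \<eta>0 < d \<and> L2_norm M (U \<eta> - U \<eta>0) < \<epsilon>)"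
            using ae by eventually_elim (use no in blast)
          then show False using nae by blast
        qed
        then obtain \<eta> where \<eta>: "\<eta> \<in> dual_cell" "dist \<eta> \<eta>0 < d" "L2_norm M (U \<eta> - U \<eta>0) < \<epsilon>" "L2_inner M (U \<eta>) (sect f (\<eta>0 - \<eta>)) = 0" by blast
        define G where "G = sect f (\<eta>0 - \<eta>)"
        have GL: "G \<in> L2 M" unfolding G_def by (rule sect_L2[OF fL])
        \<comment> \<open>Both \<open>U\<close> and the section are moved from \<open>\<eta>\<close>
          to \<open>\<eta>0\<close>; each error is at most a constant times
          \<open>\<epsilon>\<close>.\<close>
        have eq: "L2_inner M (U \<eta>0) f = L2_inner M (U \<eta>0) (f - G) - L2_inner M (U \<eta> - U \<eta>0) G"
          unfolding L2_inner_diff_left[OF UL[OF \<eta>(1)] UL[OF \<eta>0] GL] L2_inner_diff_right[OF fL GL UL[OF \<eta>0]]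
          using \<eta>(4) unfolding G_def[symmetric] by simp
        have "cmod (L2_inner M (U \<eta>0) f) \<le> cmod (L2_inner M (U \<eta>0) (f - G)) + cmod (L2_inner M (U \<eta> - U \<eta>0) G)"
          by (subst eq) (rule norm_triangle_ineq4)
        also have "\<dots> \<le> A * L2_norm M (f - G) + L2_norm M (U \<eta> - U \<eta>0) * L2_norm M G"
          unfolding A_def by (rule add_mono[OF L2_Cauchy_Schwarz[OF UL[OF \<eta>0] L2_diff[OF fL GL]] L2_Cauchy_Schwarz[OF L2_diff[OF UL[OF \<eta>(1)] UL[OF \<eta>0]] GL]])
        also have "\<dots> \<le> A * \<epsilon> + \<epsilon> * Cf"
        proof (rule add_mono[OF mult_left_mono mult_mono])
          have "L2_norm M (G - f) \<le> K * tau (\<eta>0 - \<eta>) * L2_norm M f" unfolding G_def by (rule sect_close[OF fL])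
          then have "L2_norm M (G - f) \<le> \<epsilon>" using d'[OF \<eta>(2)] by (rule order_trans[OF _ less_imp_le])
          then show "L2_norm M (f - G) \<le> \<epsilon>" by (simp only: L2_norm_minus_commute[of M f G])
          show "L2_norm M G \<le> Cf" unfolding G_def Cf_def by (rule sect_norm[OF fL])
        qed (use \<eta>(3) \<epsilon> in \<open>auto simp: A_def\<close>)
        finally show ?thesis by (simp add: algebra_simps)
      qed
      have "cmod (L2_inner M (U \<eta>0) f) \<le> 0"
      proof (rule tendsto_lowerbound)
        show "((\<lambda>e. (A + Cf) * e) \<longlongrightarrow> 0) (at_right 0)" by (auto intro!: tendsto_eq_intros)
        show "\<forall>\<^sub>F e in at_right 0. cmod (L2_inner M (U \<eta>0) f) \<le> (A + Cf) * e"
          using eventually_at_right_less[of "0::real"] by eventually_elim (rule bound)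
      qed simp
      then show "L2_inner M (U \<eta>0) f = 0" by simp
    qed
  qed
qed

end

section \<open>The Bergman projection\<close>

lemma L2_norm_diff_le:
  assumes a: "a \<in> L2 M" and b: "b \<in> L2 M" shows "L2_norm M (a - b) \<le> L2_norm M a + L2_norm M b"
  using L2_norm_triangle_diff[OF a L2_zero b] L2_norm_minus_commute[of M "\<lambda>x. 0" b] by (simp add: fun_diff_def)

lemma strongly_measurable_diff:
  assumes F: "strongly_measurable N M (L2 M) F" "\<And>\<eta>. \<eta> \<in> space N \<Longrightarrow> F \<eta> \<in> L2 M"
    and G: "strongly_measurable N M (L2 M) G" "\<And>\<eta>. \<eta> \<in> space N \<Longrightarrow> G \<eta> \<in> L2 M"
  shows "strongly_measurable N M (L2 M) (\<lambda>\<eta>. F \<eta> - G \<eta>)"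
proof -
  obtain s where s: "\<And>n. simple_function N (s n)" "\<And>n \<eta>. \<eta> \<in> space N \<Longrightarrow> s n \<eta> \<in> L2 M"
    and sl: "AE \<eta> in N. (\<lambda>n::nat. L2_norm M (s n \<eta> - F \<eta>)) \<longlonglongrightarrow> 0"
    using F(1) unfolding strongly_measurable_def by blast
  obtain t where t: "\<And>n. simple_function N (t n)" "\<And>n \<eta>. \<eta> \<in> space N \<Longrightarrow> t n \<eta> \<in> L2 M"
    and tl: "AE \<eta> in N. (\<lambda>n::nat. L2_norm M (t n \<eta> - G \<eta>)) \<longlonglongrightarrow> 0"
    using G(1) unfolding strongly_measurable_def by blast
  show ?thesis unfolding strongly_measurable_def
  proof (intro exI[of _ "\<lambda>n \<eta>. s n \<eta> - t n \<eta>"] conjI allI ballI)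
    show "simple_function N (\<lambda>\<eta>. s n \<eta> - t n \<eta>)" for n by (rule simple_function_compose2[OF s(1) t(1)])
    show "s n \<eta> - t n \<eta> \<in> L2 M" if "\<eta> \<in> space N" for n \<eta> by (rule L2_diff[OF s(2)[OF that] t(2)[OF that]])
    show "AE \<eta> in N. (\<lambda>n::nat. L2_norm M (s n \<eta> - t n \<eta> - (F \<eta> - G \<eta>))) \<longlonglongrightarrow> 0"
      using sl tl AE_space
    proof eventually_elim
      case (elim \<eta>)
      have "L2_norm M (s n \<eta> - t n \<eta> - (F \<eta> - G \<eta>)) \<le> L2_norm M (s n \<eta> - F \<eta>) + L2_norm M (t n \<eta> - G \<eta>)" for n
      proof -
        have eq: "s n \<eta> - t n \<eta> - (F \<eta> - G \<eta>) = (s n \<eta> - F \<eta>) - (t n \<eta> - G \<eta>)" by (rule ext) simp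
        show ?thesis unfolding eq by (rule L2_norm_diff_le[OF L2_diff[OF s(2) F(2)] L2_diff[OF t(2) G(2)]]) (rule elim)+
      qed
      then show ?case using tendsto_add[OF elim(1,2)]
        by - (rule tendsto_zero_bound[of "\<lambda>n. L2_norm M (s n \<eta> - F \<eta>) + L2_norm M (t n \<eta> - G \<eta>)"], simp_all)
    qed
  qed
qed

context cell_partition_null
begin

lemma bochner_norm_S_sq:
  "(bochner_norm NN M (floquet_partial_sum f B - F))\<^sup>2 = (LINT \<eta>|NN. (L2_norm M (S f B \<eta> - F \<eta>))\<^sup>2)"
  unfolding bochner_norm_def floquet_partial_sum_eq minus_apply by (rule real_sqrt_pow2) (rule Bochner_Integration.integral_nonneg, simp)

text \<open>Linearity has to come from the partial sums, since representatives are arbitrary up to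
  null sets; their distances to \<open>F\<close> and \<open>H\<close> bound the distance to the
  difference.\<close>

lemma is_floquet_diff:
  assumes f: "f \<in> L2 (area \<Omega>)" and h: "h \<in> L2 (area \<Omega>)" and F: "is_floquet f F" and H: "is_floquet h H"
  shows "is_floquet (f - h) (\<lambda>\<eta>. F \<eta> - H \<eta>)"
proof -
  define D where "D = (\<lambda>\<eta>. F \<eta> - H \<eta>)"
  have Fs: "F \<in> floquet_space \<omega>" and Hs: "H \<in> floquet_space \<omega>" using F H by (simp_all add: is_floquet_def)
  note FL = floquet_space_D(1)[OF Fs] and HL = floquet_space_D(1)[OF Hs]
  have DL: "D \<eta> \<in> L2 M" if "\<eta> \<in> dual_cell" for \<eta> unfolding D_def by (rule L2_diff[OF FL[OF that] HL[OF that]])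
  have Dm: "strongly_measurable NN M (L2 M) D"
    unfolding D_def by (rule strongly_measurable_diff[OF floquet_space_D(2)[OF Fs] _ floquet_space_D(2)[OF Hs]]) (simp_all only: space_lebesgue_on FL HL)
  have Dn: "(\<lambda>\<eta>. L2_norm M (D \<eta>)) \<in> borel_measurable NN"
    using strongly_measurable_norm_const[OF complete_dual subset_refl _ Dm L2_zero] DL by (simp add: fun_diff_def)
  have Di: "integrable NN (\<lambda>\<eta>. (L2_norm M (D \<eta>))\<^sup>2)"
  proof (rule Bochner_Integration.integrable_bound)
    show "integrable NN (\<lambda>\<eta>. 2 * (L2_norm M (F \<eta>))\<^sup>2 + 2 * (L2_norm M (H \<eta>))\<^sup>2)"
      using floquet_space_D(3)[OF Fs] floquet_space_D(3)[OF Hs] by simp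
    show "(\<lambda>\<eta>. (L2_norm M (D \<eta>))\<^sup>2) \<in> borel_measurable NN" using Dn by simp
    show "AE \<eta> in NN. norm ((L2_norm M (D \<eta>))\<^sup>2) \<le> norm (2 * (L2_norm M (F \<eta>))\<^sup>2 + 2 * (L2_norm M (H \<eta>))\<^sup>2)"
    proof (rule AE_I2)
      fix \<eta> assume "\<eta> \<in> space NN"
      then have \<eta>: "\<eta> \<in> dual_cell" by simp
      show "norm ((L2_norm M (D \<eta>))\<^sup>2) \<le> norm (2 * (L2_norm M (F \<eta>))\<^sup>2 + 2 * (L2_norm M (H \<eta>))\<^sup>2)"
        unfolding D_def real_norm_def abs_power2 by (rule order_trans[OF L2_norm_diff_sq_le[OF FL[OF \<eta>] HL[OF \<eta>]] abs_ge_self])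
    qed
  qed
  have Ds: "D \<in> floquet_space \<omega>" unfolding floquet_space_iff by (intro conjI ballI DL Dm Di)
  define a where "a = (\<lambda>B. bochner_norm NN M (floquet_partial_sum f B - F))"
  define c where "c = (\<lambda>B. bochner_norm NN M (floquet_partial_sum h B - H))"
  have al: "(a \<longlongrightarrow> 0) (finite_subsets_at_top L)" and cl: "(c \<longlongrightarrow> 0) (finite_subsets_at_top L)"
    using F H by (simp_all add: is_floquet_def a_def c_def)
  have bound: "bochner_norm NN M (floquet_partial_sum (f - h) B - D) \<le> sqrt (2 * (a B)\<^sup>2 + 2 * (c B)\<^sup>2)" if B: "B \<subseteq> L" for B
  proof (rule real_le_rsqrt)
    note intf = S_dist_integrable[OF f B Fs] and inth = S_dist_integrable[OF h B Hs]
    have "(bochner_norm NN M (floquet_partial_sum (f - h) B - D))\<^sup>2 = (LINT \<eta>|NN. (L2_norm M (S (f - h) B \<eta> - D \<eta>))\<^sup>2)"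
      by (rule bochner_norm_S_sq)
    also have "\<dots> \<le> (LINT \<eta>|NN. 2 * (L2_norm M (S f B \<eta> - F \<eta>))\<^sup>2 + 2 * (L2_norm M (S h B \<eta> - H \<eta>))\<^sup>2)"
    proof (rule Bochner_Integration.integral_mono)
      show "integrable NN (\<lambda>\<eta>. (L2_norm M (S (f - h) B \<eta> - D \<eta>))\<^sup>2)" by (rule S_dist_integrable[OF L2_diff[OF f h] B Ds])
      show "integrable NN (\<lambda>\<eta>. 2 * (L2_norm M (S f B \<eta> - F \<eta>))\<^sup>2 + 2 * (L2_norm M (S h B \<eta> - H \<eta>))\<^sup>2)"
        using intf inth by simp
      fix \<eta> assume "\<eta> \<in> space NN"
      then have \<eta>: "\<eta> \<in> dual_cell" by simp
      have eq: "S (f - h) B \<eta> - D \<eta> = (S f B \<eta> - F \<eta>) - (S h B \<eta> - H \<eta>)" unfolding S_fun_diff D_def by (rule ext) simp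
      show "(L2_norm M (S (f - h) B \<eta> - D \<eta>))\<^sup>2 \<le> 2 * (L2_norm M (S f B \<eta> - F \<eta>))\<^sup>2 + 2 * (L2_norm M (S h B \<eta> - H \<eta>))\<^sup>2"
        unfolding eq by (rule L2_norm_diff_sq_le[OF L2_diff[OF S_L2[OF f B] FL[OF \<eta>]] L2_diff[OF S_L2[OF h B] HL[OF \<eta>]]])
    qed
    also have "\<dots> = 2 * (a B)\<^sup>2 + 2 * (c B)\<^sup>2"
      unfolding a_def c_def bochner_norm_S_sq using intf inth by simp
    finally show "(bochner_norm NN M (floquet_partial_sum (f - h) B - D))\<^sup>2 \<le> 2 * (a B)\<^sup>2 + 2 * (c B)\<^sup>2" .
  qed
  have "((\<lambda>B. bochner_norm NN M (floquet_partial_sum (f - h) B - D)) \<longlongrightarrow> 0) (finite_subsets_at_top L)"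
  proof (rule tendsto_sandwich[of "\<lambda>_. 0"])
    show "\<forall>\<^sub>F B in finite_subsets_at_top L. 0 \<le> bochner_norm NN M (floquet_partial_sum (f - h) B - D)"
      by (simp add: bochner_norm_def)
    show "\<forall>\<^sub>F B in finite_subsets_at_top L. bochner_norm NN M (floquet_partial_sum (f - h) B - D) \<le> sqrt (2 * (a B)\<^sup>2 + 2 * (c B)\<^sup>2)"
      by (rule eventually_finite_subsets_at_top_weakI) (rule bound)
    have "((\<lambda>B. sqrt (2 * (a B)\<^sup>2 + 2 * (c B)\<^sup>2)) \<longlongrightarrow> sqrt (2 * 0\<^sup>2 + 2 * 0\<^sup>2)) (finite_subsets_at_top L)"
      by (intro tendsto_intros al cl)
    then show "((\<lambda>B. sqrt (2 * (a B)\<^sup>2 + 2 * (c B)\<^sup>2)) \<longlongrightarrow> 0) (finite_subsets_at_top L)" by simp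
  qed simp
  then show ?thesis unfolding is_floquet_def D_def[symmetric] using Ds by blast
qed

text \<open>The transform of the difference is null, so the norms of the partial sums tend to 0; by
  Parseval they also tend to the norm of \<open>f - h\<close>.\<close>

lemma is_floquet_injective:
  assumes f: "f \<in> L2 (area \<Omega>)" and h: "h \<in> L2 (area \<Omega>)" and F: "is_floquet f F" and H: "is_floquet h H"
    and eq: "AE \<eta> in NN. AE z in M. F \<eta> z = H \<eta> z"
  shows "AE z in area \<Omega>. f z = h z"
proof -
  define d where "d = f - h"
  define D where "D = (\<lambda>\<eta>. F \<eta> - H \<eta>)"
  have d: "d \<in> L2 (area \<Omega>)" unfolding d_def by (rule L2_diff[OF f h])
  have fl: "is_floquet d D" unfolding d_def D_def by (rule is_floquet_diff[OF f h F H])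
  have Ds: "D \<in> floquet_space \<omega>" using fl by (simp add: is_floquet_def)
  have e: "(LINT \<eta>|NN. (L2_norm M (S d (exhaustion n) \<eta> - D \<eta>))\<^sup>2) = (\<Sum>m\<in>exhaustion n. (L2_norm M (\<lambda>z. d (z + m)))\<^sup>2)" for n
  proof -
    have "(LINT \<eta>|NN. (L2_norm M (S d (exhaustion n) \<eta> - D \<eta>))\<^sup>2) = (LINT \<eta>|NN. (L2_norm M (S d (exhaustion n) \<eta>))\<^sup>2)"
    proof (rule integral_cong_AE)
      show "(\<lambda>\<eta>. (L2_norm M (S d (exhaustion n) \<eta> - D \<eta>))\<^sup>2) \<in> borel_measurable NN"
        using S_dist_measurable[OF d exhaustion(2) Ds] by simp
      show "(\<lambda>\<eta>. (L2_norm M (S d (exhaustion n) \<eta>))\<^sup>2) \<in> borel_measurable NN"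
        using borel_measurable_dual[OF borel_measurable_continuous_onI[OF S_norm_continuous[OF d exhaustion(2)]]] by simp
      show "AE \<eta> in NN. (L2_norm M (S d (exhaustion n) \<eta> - D \<eta>))\<^sup>2 = (L2_norm M (S d (exhaustion n) \<eta>))\<^sup>2"
        using eq AE_space
      proof eventually_elim
        case (elim \<eta>)
        then have \<eta>: "\<eta> \<in> dual_cell" by simp
        have "L2_norm M (S d (exhaustion n) \<eta> - D \<eta>) = L2_norm M (S d (exhaustion n) \<eta>)"
        proof (rule L2_norm_cong_AE)
          show "AE x in M. (S d (exhaustion n) \<eta> - D \<eta>) x = S d (exhaustion n) \<eta> x"
            using elim(1) by eventually_elim (simp add: D_def)
          show "S d (exhaustion n) \<eta> - D \<eta> \<in> borel_measurable M"
            by (rule L2D(1)[OF L2_diff[OF S_L2[OF d exhaustion(2)] floquet_space_D(1)[OF Ds \<eta>]]])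
          show "S d (exhaustion n) \<eta> \<in> borel_measurable M" by (rule L2D(1)[OF S_L2[OF d exhaustion(2)]])
        qed
        then show ?case by (rule arg_cong)
      qed
    qed
    also have "\<dots> = (\<Sum>m\<in>exhaustion n. (L2_norm M (\<lambda>z. d (z + m)))\<^sup>2)" by (rule S_Parseval[OF d exhaustion])
    finally show ?thesis .
  qed
  have "filterlim exhaustion (finite_subsets_at_top L) sequentially" using exhaustion_filterlim[of 0] by simp
  from is_floquet_sq_limit[OF fl this] have "(\<lambda>n. \<Sum>m\<in>exhaustion n. (L2_norm M (\<lambda>z. d (z + m)))\<^sup>2) \<longlonglongrightarrow> 0"
    unfolding e .
  then have "(L2_norm (area \<Omega>) d)\<^sup>2 = 0"
    using exhaustion_limit[OF L2_norm_Omega[OF d]] LIMSEQ_unique by blast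
  then have "AE z in area \<Omega>. d z = 0" by (intro L2_norm_eq_0_AE d) simp
  then show ?thesis by eventually_elim (simp add: d_def)
qed

lemma bergman_proj: "is_orth_proj (L2_inner (area \<Omega>)) (L2 (area \<Omega>)) (A2 \<Omega>) (bergman_proj \<Omega>)"
  using someI_ex[OF L2_closed_subspace.orth_proj_exists[OF A2_closed_subspace[OF open_Omega]]] unfolding bergman_proj_def .

lemmas bergman_props = L2_closed_subspace.orth_proj_props[OF A2_closed_subspace[OF open_Omega] bergman_proj]

text \<open>Orthogonality passes from a dense subspace to its closure by continuity of the inner
  product.\<close>

lemma orthogonal_ext_imp_eta:
  assumes w: "w \<in> L2 M" and orth: "\<And>g. g \<in> A2_ext \<omega> \<eta> \<Longrightarrow> L2_inner M w g = 0" and v: "v \<in> A2_eta \<omega> \<eta>"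
  shows "L2_inner M w v = 0"
proof -
  have vL: "v \<in> L2 M" using v A2_eta_sub A2D(1) by blast
  have "cmod (L2_inner M w v) \<le> 0"
  proof (rule field_le_epsilon)
    fix e :: real assume e: "0 < e"
    define n where "n = L2_norm M w + 1"
    have n: "0 < n" "L2_norm M w \<le> n" using add_nonneg_pos[OF L2_norm_nonneg[of M w] zero_less_one] by (simp_all add: n_def)
    obtain q where q: "q \<in> A2_ext \<omega> \<eta>" "L2_norm M (v - q) < e / n" using v e n(1) unfolding A2_eta_def by (auto dest!: spec[of _ "e / n"])
    have qL: "q \<in> L2 M" using q(1) A2_ext_sub A2D(1) by blast
    have "L2_inner M w v = L2_inner M w (v - q)" unfolding L2_inner_diff_right[OF vL qL w] orth[OF q(1)] by simp
    then have "cmod (L2_inner M w v) \<le> L2_norm M w * L2_norm M (v - q)" using L2_Cauchy_Schwarz[OF w L2_diff[OF vL qL]] by simp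
    also have "\<dots> \<le> n * (e / n)" using n q(2) by (intro mult_mono) auto
    finally show "cmod (L2_inner M w v) \<le> 0 + e" using n(1) by simp
  qed
  then show ?thesis by simp
qed

text \<open>The two properties characterizing a projection hold in almost every fiber: the transform
  of an analytic function lies in the fiber space, and the transform of the remainder is orthogonal
  to it.\<close>

lemma floquet_bergman_proj:
  assumes f: "f \<in> L2 (area \<Omega>)" and F: "is_floquet f F" and H: "is_floquet (bergman_proj \<Omega> f) H"
  shows "AE \<eta> in NN. AE z in M. H \<eta> z = P_eta \<omega> \<eta> (F \<eta>) z"
proof -
  define h where "h = bergman_proj \<Omega> f"
  have hA: "h \<in> A2 \<Omega>" and hL: "h \<in> L2 (area \<Omega>)" unfolding h_def by (rule bergman_props(1,2)[OF f])+
  have Hh: "is_floquet h H" using H by (simp add: h_def)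
  have orth: "L2_inner (area \<Omega>) (f - h) g = 0" if g: "g \<in> A2 \<Omega>" for g
    unfolding L2_inner_diff_left[OF f hL A2D(1)[OF g]] using bergman_props(3)[OF f g] by (simp add: h_def)
  have e1: "AE \<eta> in NN. \<forall>g\<in>A2_ext \<omega> \<eta>. L2_inner M (F \<eta> - H \<eta>) g = 0"
    by (rule floquet_orthogonal_ext[OF L2_diff[OF f hL] _ is_floquet_diff[OF f hL F Hh]]) (rule orth)
  have e2: "AE \<eta> in NN. \<exists>g\<in>A2_ext \<omega> \<eta>. AE z in M. H \<eta> z = g z" by (rule floquet_in_A2_ext[OF hA Hh])
  have FL: "F \<eta> \<in> L2 M" and HL: "H \<eta> \<in> L2 M" if "\<eta> \<in> dual_cell" for \<eta>
    using F H that by (simp_all add: is_floquet_def floquet_space_D)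
  from e1 e2 AE_space show ?thesis
  proof eventually_elim
    case (elim \<eta>)
    then have \<eta>: "\<eta> \<in> dual_cell" by simp
    obtain g where g: "g \<in> A2_ext \<omega> \<eta>" "AE z in M. H \<eta> z = g z" using elim(2) by blast
    have gE: "g \<in> A2_eta \<omega> \<eta>" using g(1) A2_ext_eta by blast
    have gL: "g \<in> L2 M" using gE A2_eta_sub A2D(1) by blast
    have "AE z in M. P_eta \<omega> \<eta> (F \<eta>) z = g z"
    proof (rule L2_closed_subspace.orth_proj_unique[OF A2_eta_closed_subspace P_eta_proj FL[OF \<eta>] gE])
      fix v assume v: "v \<in> A2_eta \<omega> \<eta>"
      have vL: "v \<in> L2 M" using v A2_eta_sub A2D(1) by blast
      have "L2_inner M (F \<eta> - g) v = L2_inner M (F \<eta> - H \<eta>) v"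
      proof (rule L2_inner_cong_AE)
        show "AE x in M. (F \<eta> - g) x = (F \<eta> - H \<eta>) x" using g(2) by eventually_elim simp
      qed (intro L2D(1) L2_diff FL[OF \<eta>] HL[OF \<eta>] gL vL)+
      also have "\<dots> = 0"
        by (rule orthogonal_ext_imp_eta[OF L2_diff[OF FL[OF \<eta>] HL[OF \<eta>]] _ v]) (use elim(1) in blast)
      finally show "L2_inner M (F \<eta> - g) v = 0" .
    qed
    then show ?case using g(2) by eventually_elim simp
  qed
qed

lemma S_A2:
  assumes h: "h \<in> A2 \<Omega>" and B: "B \<subseteq> L" shows "S h B \<eta> \<in> A2 \<omega>"
proof -
  have "(\<lambda>z. h (z + m)) holomorphic_on \<omega>" if "m \<in> B" for m
    by (rule holomorphic_on_subset[OF A2D(2)[OF shift_A2[OF h subsetD[OF B that]]] omega_sub])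
  then have "S h B \<eta> holomorphic_on \<omega>" unfolding S_def[abs_def] by (intro holomorphic_intros)
  then show ?thesis using S_L2[OF A2D(1)[OF h] B] by (simp add: A2_def)
qed

end

section \<open>Reproducing kernels of the fibers\<close>

lemma L2_cnj: "f \<in> L2 M \<Longrightarrow> (\<lambda>x. cnj (f x)) \<in> L2 M"
  by (simp add: L2_def borel_measurable_cnj)

lemma L2_cong: "(\<And>x. x \<in> space M \<Longrightarrow> f x = g x) \<Longrightarrow> g \<in> L2 M \<Longrightarrow> f \<in> L2 M"
  unfolding L2_def by (simp cong: measurable_cong Bochner_Integration.integrable_cong)

lemma L2_norm_cong: "(\<And>x. x \<in> space M \<Longrightarrow> f x = g x) \<Longrightarrow> L2_norm M f = L2_norm M g"
  unfolding L2_norm_def by (simp cong: Bochner_Integration.integral_cong)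

lemma L2_inner_cong_right: "(\<And>x. x \<in> space M \<Longrightarrow> f x = g x) \<Longrightarrow> L2_inner M h f = L2_inner M h g"
  unfolding L2_inner_def by (simp cong: Bochner_Integration.integral_cong)

lemma strongly_measurable_scaled:
  assumes c: "c \<in> borel_measurable N" and v: "v \<in> L2 M"
  shows "strongly_measurable N M (L2 M) (\<lambda>\<eta> x. c \<eta> * v x)"
proof -
  obtain s where s: "\<And>i. simple_function N (s i)" "\<And>\<eta>. \<eta> \<in> space N \<Longrightarrow> (\<lambda>i. s i \<eta>) \<longlonglongrightarrow> c \<eta>"
    using borel_measurable_implies_sequence_metric[OF c, of 0] by blast
  show ?thesis unfolding strongly_measurable_def
  proof (intro exI[of _ "\<lambda>n \<eta> x. s n \<eta> * v x"] conjI allI ballI AE_I2)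
    show "simple_function N (\<lambda>\<eta> x. s n \<eta> * v x)" for n
      using simple_function_compose[OF s(1), of "\<lambda>a x. a * v x"] by (simp add: comp_def)
    show "(\<lambda>x. s n \<eta> * v x) \<in> L2 M" for n \<eta> by (rule L2_cmult[OF v])
    fix \<eta> assume \<eta>: "\<eta> \<in> space N"
    have "L2_norm M ((\<lambda>x. s n \<eta> * v x) - (\<lambda>x. c \<eta> * v x)) = cmod (s n \<eta> - c \<eta>) * L2_norm M v" for n
      unfolding L2_norm_cmult[symmetric] by (rule arg_cong[of _ _ "L2_norm M"]) (simp add: fun_eq_iff left_diff_distrib)
    moreover have "(\<lambda>n. cmod (s n \<eta> - c \<eta>) * L2_norm M v) \<longlonglongrightarrow> cmod (c \<eta> - c \<eta>) * L2_norm M v"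
      by (intro tendsto_intros s(2) \<eta>)
    ultimately show "(\<lambda>n. L2_norm M ((\<lambda>x. s n \<eta> * v x) - (\<lambda>x. c \<eta> * v x))) \<longlonglongrightarrow> 0" by simp
  qed
qed

definition reproducing :: "complex set \<Rightarrow> complex \<Rightarrow> (complex \<Rightarrow> complex) \<Rightarrow> bool" where
  "reproducing D x k \<longleftrightarrow> k \<in> A2 D \<and> (\<forall>f\<in>A2 D. f x = L2_inner (area D) f k)"

context doubly_periodic
begin

lemma reproducing_exists: "x \<in> \<omega> \<Longrightarrow> \<exists>k. reproducing \<omega> x k"
  unfolding reproducing_def using A2_kernel_exists[OF omega(1) one_L2] by blast

text \<open>Self-adjointness moves the projection onto the kernel, so the projected Bergman kernel
  of \<omega> represents \<open>P_eta \<omega> \<eta>\<close> at the point.\<close>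

lemma P_eta_reproducing:
  assumes k: "reproducing \<omega> x k" and f: "f \<in> L2 (area \<omega>)"
  shows "P_eta \<omega> \<eta> f x = L2_inner (area \<omega>) f (P_eta \<omega> \<eta> k)"
proof -
  have kL: "k \<in> L2 (area \<omega>)" using k A2D(1) by (auto simp: reproducing_def)
  have "P_eta \<omega> \<eta> f x = L2_inner (area \<omega>) (P_eta \<omega> \<eta> f) k"
    using k P_eta_A2[OF f] by (simp add: reproducing_def)
  also have "\<dots> = L2_inner (area \<omega>) f (P_eta \<omega> \<eta> k)" by (rule P_eta_props(4)[OF f kL])
  finally show ?thesis .
qed

text \<open>The projected kernels show that a continuous integral kernel exists, so
  \<open>SOME\<close> yields one. Two representing functions agree almost everywhere and, being
  continuous, everywhere.\<close>

lemma K_eta_reproducing: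
  assumes x: "x \<in> \<omega>" and w: "w \<in> \<omega>" and k: "reproducing \<omega> x k"
  shows "K_eta \<omega> \<eta> x w = cnj (P_eta \<omega> \<eta> k w)"
proof -
  let ?M = "area \<omega>"
  define Q where "Q K \<longleftrightarrow> (\<forall>z\<in>\<omega>. K z \<in> L2 ?M \<and> continuous_on \<omega> (K z) \<and>
    (\<forall>f\<in>L2 ?M. P_eta \<omega> \<eta> f z = (LINT w|?M. K z w * f w)))" for K
  have "\<forall>z\<in>\<omega>. \<exists>k. reproducing \<omega> z k" using reproducing_exists by blast
  then obtain \<kappa> where \<kappa>: "\<And>z. z \<in> \<omega> \<Longrightarrow> reproducing \<omega> z (\<kappa> z)" by metis
  have kL: "k' \<in> L2 ?M" if "reproducing \<omega> z k'" for z k' using that A2D(1) by (auto simp: reproducing_def)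
  have "Q (\<lambda>z w. cnj (P_eta \<omega> \<eta> (\<kappa> z) w))" unfolding Q_def
  proof (intro ballI conjI)
    fix z assume z: "z \<in> \<omega>"
    show "(\<lambda>w. cnj (P_eta \<omega> \<eta> (\<kappa> z) w)) \<in> L2 ?M" by (rule L2_cnj[OF P_eta_props(2)[OF kL[OF \<kappa>[OF z]]]])
    show "continuous_on \<omega> (\<lambda>w. cnj (P_eta \<omega> \<eta> (\<kappa> z) w))"
      by (intro continuous_intros holomorphic_on_imp_continuous_on A2D(2) P_eta_A2 kL[OF \<kappa>[OF z]])
    fix f assume f: "f \<in> L2 ?M"
    show "P_eta \<omega> \<eta> f z = (LINT w|?M. cnj (P_eta \<omega> \<eta> (\<kappa> z) w) * f w)"
      unfolding P_eta_reproducing[OF \<kappa>[OF z] f] L2_inner_def by (simp add: mult.commute)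
  qed
  then have "\<exists>K. Q K" by blast
  then have "Q (K_eta \<omega> \<eta>)" unfolding K_eta_def Q_def by (rule someI_ex)
  then have KL: "K_eta \<omega> \<eta> x \<in> L2 ?M" and Kc: "continuous_on \<omega> (K_eta \<omega> \<eta> x)"
    and K: "\<And>f. f \<in> L2 ?M \<Longrightarrow> P_eta \<omega> \<eta> f x = (LINT w|?M. K_eta \<omega> \<eta> x w * f w)"
    using x by (auto simp: Q_def)
  define q where "q = (\<lambda>w. cnj (K_eta \<omega> \<eta> x w))"
  define p where "p = P_eta \<omega> \<eta> k"
  have qL: "q \<in> L2 ?M" unfolding q_def by (rule L2_cnj[OF KL])
  have pL: "p \<in> L2 ?M" unfolding p_def by (rule P_eta_props(2)[OF kL[OF k]])
  have same: "L2_inner ?M f q = L2_inner ?M f p" if f: "f \<in> L2 ?M" for f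
    unfolding p_def P_eta_reproducing[OF k f, symmetric] K[OF f] by (simp add: L2_inner_def q_def mult.commute)
  have dL: "q - p \<in> L2 ?M" by (rule L2_diff[OF qL pL])
  have "L2_inner ?M (q - p) (q - p) = 0"
    unfolding L2_inner_diff_right[OF qL pL dL] same[OF dL] by simp
  then have "L2_norm ?M (q - p) = 0" unfolding L2_inner_self by simp
  then have "AE w in ?M. (q - p) w = 0" by (rule L2_norm_eq_0_AE[OF dL])
  then have ae: "AE w in ?M. q w = p w" by eventually_elim simp
  have qc: "continuous_on \<omega> q" unfolding q_def by (intro continuous_intros Kc)
  have pc: "continuous_on \<omega> p" unfolding p_def by (intro holomorphic_on_imp_continuous_on A2D(2) P_eta_A2 kL[OF k])
  have "q w = p w" by (rule continuous_AE_eq[OF omega(1) qc pc ae w])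
  then show ?thesis unfolding q_def p_def by (metis complex_cnj_cnj)
qed

end

section \<open>The single integral\<close>

context cell_partition_null
begin

lemma bergman_proj_fiber:
  assumes f: "f \<in> L2 (area \<Omega>)" and F: "is_floquet f F" and z: "tr z \<in> \<omega>"
  shows "integrable NN (\<lambda>\<eta>. chi \<eta> (cell_index z) * P_eta \<omega> \<eta> (F \<eta>) (tr z))"
    "bergman_proj \<Omega> f z = of_real (1 / (2 * pi)) * (LINT \<eta>|NN. chi \<eta> (cell_index z) * P_eta \<omega> \<eta> (F \<eta>) (tr z))"
proof -
  define z0 where "z0 = tr z"
  define m where "m = cell_index z"
  have zm: "z = z0 + m" unfolding z0_def m_def by (rule tr_decomp)
  have mL: "m \<in> L" by (simp add: m_def)
  have z0: "z0 \<in> \<omega>" using z by (simp add: z0_def)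
  have Fs: "F \<in> floquet_space \<omega>" using F by (simp add: is_floquet_def)
  note FL = floquet_space_D(1)[OF Fs]
  define p where "p = fiber_proj \<omega> F"
  have p_eq: "p \<eta> = P_eta \<omega> \<eta> (F \<eta>)" for \<eta> by (simp add: p_def fiber_proj_def)
  have pA: "p \<eta> \<in> A2 \<omega>" if "\<eta> \<in> dual_cell" for \<eta> unfolding p_eq by (rule P_eta_A2[OF FL[OF that]])
  have pL: "p \<eta> \<in> L2 M" if "\<eta> \<in> dual_cell" for \<eta> using A2D(1) pA[OF that] by blast
  have "p \<in> bochner_L2 NN M (A2 \<omega>)" using fiber_proj_in[OF Fs] by (simp add: p_def floquet_A2_space_def)
  then have pm: "strongly_measurable NN M (A2 \<omega>) p" and p2: "integrable NN (\<lambda>\<eta>. (L2_norm M (p \<eta>))\<^sup>2)"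
    by (simp_all add: bochner_L2_def)
  have AL: "A2 \<omega> \<subseteq> L2 M" using A2D(1) by blast
  obtain k where k: "reproducing \<omega> z0 k" using reproducing_exists[OF z0] by blast
  then have kL: "k \<in> L2 M" and kr: "\<And>v. v \<in> A2 \<omega> \<Longrightarrow> v z0 = L2_inner M v k"
    using A2D(1) by (auto simp: reproducing_def)
  have kb: "cmod (v z0) \<le> L2_norm M k * L2_norm M v" if "v \<in> A2 \<omega>" for v
    unfolding kr[OF that] using L2_Cauchy_Schwarz[OF A2D(1)[OF that] kL] by (simp add: mult.commute)
  have pn: "(\<lambda>\<eta>. L2_norm M (p \<eta>)) \<in> borel_measurable NN"
    using strongly_measurable_norm_const[OF complete_dual AL _ pm L2_zero] pL by (simp add: fun_diff_def)
  \<comment> \<open>Evaluation is an inner product with the kernel, hence measurable by strong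
    measurability.\<close>
  have pzm: "(\<lambda>\<eta>. p \<eta> z0) \<in> borel_measurable NN"
  proof (rule measurable_cong[THEN iffD1])
    show "(\<lambda>\<eta>. L2_inner M (p \<eta>) k) \<in> borel_measurable NN"
      by (rule strongly_measurable_inner[OF complete_dual AL _ pm kL]) (simp only: space_lebesgue_on pL)
    show "L2_inner M (p \<eta>) k = p \<eta> z0" if "\<eta> \<in> space NN" for \<eta> using kr[OF pA] that by simp
  qed
  have pz: "integrable NN (\<lambda>\<eta>. p \<eta> z0)"
  proof (rule Bochner_Integration.integrable_bound[OF integrable_mult_right[OF integral_norm_le_sqrt(1)[OF finite_dual pn p2], of "L2_norm M k"] pzm])
    show "AE \<eta> in NN. norm (p \<eta> z0) \<le> norm (L2_norm M k * L2_norm M (p \<eta>))"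
    proof (rule AE_I2)
      fix \<eta> assume "\<eta> \<in> space NN"
      then show "norm (p \<eta> z0) \<le> norm (L2_norm M k * L2_norm M (p \<eta>))" using kb[OF pA, of \<eta>] by simp
    qed
  qed
  show i1: "integrable NN (\<lambda>\<eta>. chi \<eta> (cell_index z) * P_eta \<omega> \<eta> (F \<eta>) (tr z))"
    using integrable_chi_mult[OF pz, of m] unfolding p_eq m_def z0_def .
  define h where "h = bergman_proj \<Omega> f"
  have hA: "h \<in> A2 \<Omega>" and hL: "h \<in> L2 (area \<Omega>)" unfolding h_def by (rule bergman_props(1,2)[OF f])+
  define H where "H = floquet \<omega> h"
  have Hh: "is_floquet h H" unfolding H_def by (rule is_floquet_floquet[OF hL])
  then have Hs: "H \<in> floquet_space \<omega>" by (simp add: is_floquet_def)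
  note HL = floquet_space_D(1)[OF Hs]
  have Hp: "AE \<eta> in NN. AE z in M. H \<eta> z = p \<eta> z"
    unfolding p_eq by (rule floquet_bergman_proj[OF f F Hh[unfolded h_def]])
  have fl: "filterlim exhaustion (finite_subsets_at_top L) sequentially" using exhaustion_filterlim[of 0] by simp
  define I where "I = (\<lambda>n. LINT \<eta>|NN. (L2_norm M (S h (exhaustion n) \<eta> - H \<eta>))\<^sup>2)"
  have I: "I \<longlonglongrightarrow> 0" unfolding I_def by (rule is_floquet_sq_limit[OF Hh fl])
  have ichi: "integrable NN (\<lambda>\<eta>. chi \<eta> j)" for j by (intro integrable_continuous_dual continuous_intros)
  define V where "V = (LINT \<eta>|NN. chi \<eta> m * p \<eta> z0)"
  have S_eq: "chi \<eta> m * S h B \<eta> z0 = (\<Sum>n\<in>B. (of_real (1 / (2 * pi)) * h (z0 + n)) * chi \<eta> (m - n))" for B \<eta>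
    by (simp add: S_def sum_distrib_left chi_diff mult_ac)
  have Si: "integrable NN (\<lambda>\<eta>. chi \<eta> m * S h B \<eta> z0)" for B
    unfolding S_eq using ichi by (intro Bochner_Integration.integrable_sum integrable_mult_right)
  have "(\<lambda>n. (LINT \<eta>|NN. chi \<eta> m * S h (exhaustion n) \<eta> z0) - V) \<longlonglongrightarrow> 0"
  proof (rule tendsto_zero_bound)
    have "(\<lambda>n. L2_norm M k * (sqrt (measure NN (space NN)) * sqrt (I n))) \<longlonglongrightarrow> L2_norm M k * (sqrt (measure NN (space NN)) * sqrt 0)"
      by (intro tendsto_intros I)
    then show "(\<lambda>n. L2_norm M k * (sqrt (measure NN (space NN)) * sqrt (I n))) \<longlonglongrightarrow> 0" by simp
    fix n
    define \<delta> where "\<delta> = (\<lambda>\<eta>. L2_norm M (S h (exhaustion n) \<eta> - H \<eta>))"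
    have \<delta>m: "\<delta> \<in> borel_measurable NN" unfolding \<delta>_def by (rule S_dist_measurable[OF hL exhaustion(2) Hs])
    have \<delta>2: "integrable NN (\<lambda>\<eta>. (\<delta> \<eta>)\<^sup>2)" unfolding \<delta>_def by (rule S_dist_integrable[OF hL exhaustion(2) Hs])
    have \<delta>i: "integrable NN \<delta>" by (rule integral_norm_le_sqrt(1)[OF finite_dual \<delta>m \<delta>2])
    \<comment> \<open>\<open>H \<eta>\<close> is determined only almost everywhere, so it is
      evaluated through the analytic \<open>p \<eta>\<close>, which has the same distance to the
      partial sum.\<close>
    have dist: "AE \<eta> in NN. cmod (S h (exhaustion n) \<eta> z0 - p \<eta> z0) \<le> L2_norm M k * \<bar>\<delta> \<eta>\<bar>"
      using Hp AE_space
    proof eventually_elim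
      case (elim \<eta>)
      then have \<eta>: "\<eta> \<in> dual_cell" by simp
      have SA: "S h (exhaustion n) \<eta> \<in> A2 \<omega>" by (rule S_A2[OF hA exhaustion(2)])
      have "cmod ((S h (exhaustion n) \<eta> - p \<eta>) z0) \<le> L2_norm M k * L2_norm M (S h (exhaustion n) \<eta> - p \<eta>)"
        by (rule kb[OF A2_diff[OF SA pA[OF \<eta>]]])
      also have "L2_norm M (S h (exhaustion n) \<eta> - p \<eta>) = \<delta> \<eta>" unfolding \<delta>_def
      proof (rule L2_norm_cong_AE)
        show "AE x in M. (S h (exhaustion n) \<eta> - p \<eta>) x = (S h (exhaustion n) \<eta> - H \<eta>) x"
          using elim(1) by eventually_elim simp
      qed (intro L2D(1) L2_diff A2D(1)[OF SA] pL[OF \<eta>] HL[OF \<eta>])+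
      finally show ?case by (simp add: \<delta>_def)
    qed
    have di: "integrable NN (\<lambda>\<eta>. chi \<eta> m * S h (exhaustion n) \<eta> z0 - chi \<eta> m * p \<eta> z0)"
      by (rule Bochner_Integration.integrable_diff[OF Si integrable_chi_mult[OF pz]])
    have "(LINT \<eta>|NN. chi \<eta> m * S h (exhaustion n) \<eta> z0) - V = (LINT \<eta>|NN. chi \<eta> m * S h (exhaustion n) \<eta> z0 - chi \<eta> m * p \<eta> z0)"
      unfolding V_def by (rule Bochner_Integration.integral_diff[symmetric, OF Si integrable_chi_mult[OF pz]])
    also have "cmod \<dots> \<le> (LINT \<eta>|NN. cmod (chi \<eta> m * S h (exhaustion n) \<eta> z0 - chi \<eta> m * p \<eta> z0))"
      by (rule Bochner_Integration.integral_norm_bound)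
    also have "\<dots> \<le> (LINT \<eta>|NN. L2_norm M k * \<bar>\<delta> \<eta>\<bar>)"
    proof (rule integral_mono_AE)
      show "integrable NN (\<lambda>\<eta>. cmod (chi \<eta> m * S h (exhaustion n) \<eta> z0 - chi \<eta> m * p \<eta> z0))" by (rule integrable_norm[OF di])
      show "integrable NN (\<lambda>\<eta>. L2_norm M k * \<bar>\<delta> \<eta>\<bar>)" using \<delta>i by simp
      show "AE \<eta> in NN. cmod (chi \<eta> m * S h (exhaustion n) \<eta> z0 - chi \<eta> m * p \<eta> z0) \<le> L2_norm M k * \<bar>\<delta> \<eta>\<bar>"
        using dist by eventually_elim (simp add: right_diff_distrib[symmetric] norm_mult)
    qed
    also have "\<dots> = L2_norm M k * (LINT \<eta>|NN. \<bar>\<delta> \<eta>\<bar>)" by simp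
    also have "\<dots> \<le> L2_norm M k * (sqrt (measure NN (space NN)) * sqrt (LINT \<eta>|NN. (\<delta> \<eta>)\<^sup>2))"
      by (rule mult_left_mono[OF integral_norm_le_sqrt(2)[OF finite_dual \<delta>m \<delta>2] L2_norm_nonneg])
    finally show "norm ((LINT \<eta>|NN. chi \<eta> m * S h (exhaustion n) \<eta> z0) - V) \<le> L2_norm M k * (sqrt (measure NN (space NN)) * sqrt (I n))"
      unfolding I_def \<delta>_def .
  qed
  then have l1: "(\<lambda>n. LINT \<eta>|NN. chi \<eta> m * S h (exhaustion n) \<eta> z0) \<longlonglongrightarrow> V" by (rule LIM_zero_cancel)
  \<comment> \<open>As soon as \<open>m\<close> is among the indices, the coefficient is exactly
    \<open>2 * pi\<close> times \<open>h z\<close>.\<close>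
  have l2: "(\<lambda>n. LINT \<eta>|NN. chi \<eta> m * S h (exhaustion n) \<eta> z0) \<longlonglongrightarrow> of_real (2 * pi) * h z"
  proof (rule tendsto_eventually)
    have "eventually (\<lambda>n. m \<in> exhaustion n) sequentially"
      using fl[unfolded filterlim_finite_subsets_at_top, rule_format, of "{m}"] mL by (simp add: eventually_conj_iff)
    then show "eventually (\<lambda>n. (LINT \<eta>|NN. chi \<eta> m * S h (exhaustion n) \<eta> z0) = of_real (2 * pi) * h z) sequentially"
    proof eventually_elim
      case (elim n)
      have "(LINT \<eta>|NN. chi \<eta> m * S h (exhaustion n) \<eta> z0) = (\<Sum>j\<in>exhaustion n. (of_real (1 / (2 * pi)) * h (z0 + j)) * (LINT \<eta>|NN. chi \<eta> (m - j)))"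
        unfolding S_eq by (subst Bochner_Integration.integral_sum) (use ichi in auto)
      also have "\<dots> = (\<Sum>j\<in>exhaustion n. if j = m then of_real (2 * pi) * h z else 0)"
      proof (rule sum.cong[OF refl])
        fix j assume "j \<in> exhaustion n"
        then have mj: "m - j \<in> L" using exhaustion(2)[of n] mL by auto
        show "(of_real (1 / (2 * pi)) * h (z0 + j)) * (LINT \<eta>|NN. chi \<eta> (m - j)) = (if j = m then of_real (2 * pi) * h z else 0)"
          unfolding integral_chi[OF mj] by (simp add: zm power2_eq_square)
      qed
      also have "\<dots> = of_real (2 * pi) * h z" using elim exhaustion(1)[of n] by simp
      finally show ?case .
    qed
  qed
  have "V = of_real (2 * pi) * h z" by (rule LIMSEQ_unique[OF l1 l2])
  then have "h z = of_real (1 / (2 * pi)) * V" by simp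
  then show "bergman_proj \<Omega> f z = of_real (1 / (2 * pi)) * (LINT \<eta>|NN. chi \<eta> (cell_index z) * P_eta \<omega> \<eta> (F \<eta>) (tr z))"
    unfolding V_def h_def p_eq m_def z0_def .
qed

end

section \<open>The double integral\<close>

context cell_partition_null
begin

text \<open>\<open>K_eta\<close> is the conjugate of the projected kernel at \<open>tr w\<close>.
  Absorbing the phase of \<open>z\<close> produces the integrand of the single integral at the point
  \<open>w\<close>, for a function with transform
  \<open>cnj (chi \<eta> (cell_index z)) * k\<close>.\<close>

lemma double_integrand_eq:
  assumes k: "reproducing \<omega> (tr z) k" and z: "tr z \<in> \<omega>" and w: "tr w \<in> \<omega>"
  shows "double_integrand \<omega> f z w \<eta> = f w * cnj (chi \<eta> (cell_index w) *
    P_eta \<omega> \<eta> (\<lambda>x. cnj (chi \<eta> (cell_index z)) * k x) (tr w))"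
proof -
  \<comment> \<open>The kernel at \<open>tr w\<close> turns homogeneity of \<open>P_eta\<close> into
    an equality of values at this very point.\<close>
  obtain k' where k': "reproducing \<omega> (tr w) k'" using reproducing_exists[OF w] by blast
  have kL: "k \<in> L2 M" using k A2D(1) by (auto simp: reproducing_def)
  have "P_eta \<omega> \<eta> (\<lambda>x. cnj (chi \<eta> (cell_index z)) * k x) (tr w) = cnj (chi \<eta> (cell_index z)) * P_eta \<omega> \<eta> k (tr w)"
    unfolding P_eta_reproducing[OF k' L2_cmult[OF kL]] P_eta_reproducing[OF k' kL] by (rule L2_inner_cmult_left)
  moreover have "cis (fst \<eta> * of_int (\<lfloor>Re z\<rfloor> - \<lfloor>Re w\<rfloor>) + snd \<eta> * of_int (\<lfloor>Im z\<rfloor> - \<lfloor>Im w\<rfloor>)) = chi \<eta> (cell_index z) * cnj (chi \<eta> (cell_index w))"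
    unfolding chi_diff[symmetric] by (simp add: chi_def)
  ultimately show ?thesis
    unfolding double_integrand_def K_eta_reproducing[OF z w k] by (simp add: mult_ac)
qed

text \<open>The function \<open>f\<close> below has the Floquet transform \<open>cnj (chi \<eta> m) * k\<close>; with \<open>k\<close> the
  reproducing kernel at \<open>tr z\<close> its Bergman projection is, up to a factor, the Bergman kernel of
  \<open>\<Omega>\<close> at \<open>z\<close>, so the double integral is an inner product.\<close>

lemma one_cell_function:
  assumes k: "k \<in> A2 \<omega>" and m: "m \<in> L"
  obtains f where "f \<in> L2 (area \<Omega>)" "is_floquet f (\<lambda>\<eta> x. cnj (chi \<eta> m) * k x)"
    "\<And>w n. w \<in> \<omega> \<Longrightarrow> n \<in> L \<Longrightarrow> f (w + n) = (if n = m then of_real (2 * pi) * k w else 0)"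
proof -
  \<comment> \<open>The factor \<open>2 * pi\<close> cancels the normalization of the
    transform.\<close>
  define f where "f = (\<lambda>w. if w \<in> translate \<omega> m then of_real (2 * pi) * k (w - m) else 0)"
  have f_shift: "f (w + n) = (if n = m then of_real (2 * pi) * k w else 0)" if w: "w \<in> \<omega>" and n: "n \<in> L" for w n
  proof (cases "n = m")
    case False
    have "w + (n - m) \<notin> \<omega>"
    proof
      assume c: "w + (n - m) \<in> \<omega>"
      have "cell_index (w + (n - m)) = n - m" by (rule cell_index_omega[OF w period_lattice_diff[OF n m]])
      moreover have "cell_index (w + (n - m)) = 0" using cell_index_omega[OF c, of 0] by simp
      ultimately show False using False by simp
    qed
    then show ?thesis using False by (simp add: f_def in_translate add_diff_eq)
  qed (use w in \<open>simp add: f_def in_translate\<close>)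
  have kL: "k \<in> L2 M" by (rule A2D(1)[OF k])
  have fnL: "(\<lambda>z. f (z + n)) \<in> L2 M" if n: "n \<in> L" for n
  proof (rule L2_cong)
    show "f (x + n) = (if n = m then of_real (2 * pi) else 0) * k x" if "x \<in> space M" for x
      using f_shift[of x n] n that by simp
    show "(\<lambda>x. (if n = m then of_real (2 * pi) else 0) * k x) \<in> L2 M" by (rule L2_cmult[OF kL])
  qed
  have fL: "f \<in> L2 (area \<Omega>)"
  proof (rule L2_OmegaI)
    have ot: "open (translate \<omega> m)" unfolding translate_eq_plus by (rule open_translation[OF omega(1)])
    have "(\<lambda>w. of_real (2 * pi) * k (w - m)) holomorphic_on translate \<omega> m"
    proof -
      have "(\<lambda>w. k (w - m)) holomorphic_on translate \<omega> m"
      proof (rule holomorphic_on_compose_gen[OF _ A2D(2)[OF k], of "\<lambda>w. w - m" "translate \<omega> m", unfolded comp_def])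
        show "(\<lambda>w. w - m) holomorphic_on translate \<omega> m" by (intro holomorphic_intros)
        show "(\<lambda>w. w - m) ` translate \<omega> m \<subseteq> \<omega>" by (auto simp: in_translate)
      qed
      then show ?thesis by (intro holomorphic_intros)
    qed
    then have "(\<lambda>w. of_real (2 * pi) * k (w - m)) \<in> borel_measurable (area (translate \<omega> m))"
      by (rule L2_holomorphic_measurable[OF ot])
    then have "f \<in> borel_measurable lebesgue" unfolding f_def by (rule borel_measurable_if_I) (use ot in simp)
    then show "f \<in> borel_measurable (area \<Omega>)" by (rule measurable_restrict_space1)
    show "(\<lambda>z. f (z + n)) \<in> L2 M" if "n \<in> L" for n by (rule fnL[OF that])
    show "(L2_norm M (\<lambda>z. f (z + n)))\<^sup>2 \<le> (if n = m then (L2_norm M (\<lambda>z. f (z + n)))\<^sup>2 else 0)" if n: "n \<in> L" for n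
    proof (cases "n = m")
      case False
      have "L2_norm M (\<lambda>z. f (z + n)) = L2_norm M (\<lambda>z. 0)" by (rule L2_norm_cong) (use f_shift n False in simp)
      then show ?thesis by simp
    qed simp
    show "(\<lambda>n. if n = m then (L2_norm M (\<lambda>z. f (z + n)))\<^sup>2 else 0) summable_on L"
      by (rule finite_nonzero_values_imp_summable_on) (rule finite_subset[of _ "{m}"], auto)
  qed
  define G where "G = (\<lambda>\<eta> x. cnj (chi \<eta> m) * k x)"
  have chim: "(\<lambda>\<eta>. cnj (chi \<eta> m)) \<in> borel_measurable NN" by measurable
  have GL: "G \<eta> \<in> L2 M" for \<eta> unfolding G_def by (rule L2_cmult[OF kL])
  have Gn: "L2_norm M (G \<eta>) = L2_norm M k" for \<eta> unfolding G_def L2_norm_cmult by simp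
  have Gm: "strongly_measurable NN M (L2 M) G" unfolding G_def by (rule strongly_measurable_scaled[OF chim kL])
  have Gi: "integrable NN (\<lambda>\<eta>. (L2_norm M (G \<eta>))\<^sup>2)" unfolding Gn using finite_dual by (rule finite_measure.integrable_const)
  have Gs: "G \<in> floquet_space \<omega>" unfolding floquet_space_iff by (intro conjI ballI GL Gm Gi)
  have "bochner_norm NN M (floquet_partial_sum f B - G) = 0" if B: "finite B" "B \<subseteq> L" "m \<in> B" for B
  proof -
    have "L2_norm M (S f B \<eta> - G \<eta>) = L2_norm M (\<lambda>x. 0)" for \<eta>
    proof (rule L2_norm_cong)
      fix x assume "x \<in> space M"
      then have x: "x \<in> \<omega>" by simp
      have "S f B \<eta> x = (\<Sum>n\<in>B. if n = m then cnj (chi \<eta> m) * k x else 0)"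
        unfolding S_def
      proof (rule sum.cong[OF refl])
        fix n assume "n \<in> B"
        then have "n \<in> L" using B(2) by blast
        then show "of_real (1 / (2 * pi)) * cnj (chi \<eta> n) * f (x + n) = (if n = m then cnj (chi \<eta> m) * k x else 0)"
          unfolding f_shift[OF x \<open>n \<in> L\<close>] by simp
      qed
      also have "\<dots> = G \<eta> x" using B by (simp add: G_def)
      finally show "(S f B \<eta> - G \<eta>) x = 0" by simp
    qed
    then have "(bochner_norm NN M (floquet_partial_sum f B - G))\<^sup>2 = 0" unfolding bochner_norm_S_sq by simp
    then show ?thesis by simp
  qed
  then have "\<forall>\<^sub>F B in finite_subsets_at_top L. bochner_norm NN M (floquet_partial_sum f B - G) = 0"
    unfolding eventually_finite_subsets_at_top using m by (intro exI[of _ "{m}"]) auto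
  then have "is_floquet f G" unfolding is_floquet_def using Gs by (auto intro: tendsto_eventually)
  then show ?thesis using that[OF fL] f_shift unfolding G_def by blast
qed

text \<open>With \<open>q\<close> the projection of the one-cell function \<open>g\<close>, the
  integral over the parameters is \<open>2 * pi\<close> times \<open>f w * cnj (q w)\<close>.
  Self-adjointness moves the projection to \<open>f\<close>, and pairing with \<open>g\<close>
  evaluates the result at \<open>z\<close> with another factor \<open>2 * pi\<close>; hence
  \<open>4 * pi\<^sup>2\<close>.\<close>

lemma bergman_proj_double:
  assumes f: "f \<in> L2 (area \<Omega>)" and z: "tr z \<in> \<omega>"
  shows "AE w in area \<Omega>. integrable NN (double_integrand \<omega> f z w)"
    "integrable (area \<Omega>) (\<lambda>w. LINT \<eta>|NN. double_integrand \<omega> f z w \<eta>)"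
    "bergman_proj \<Omega> f z = of_real (1 / (4 * pi\<^sup>2)) * (LINT w|area \<Omega>. LINT \<eta>|NN. double_integrand \<omega> f z w \<eta>)"
proof -
  define m where "m = cell_index z"
  have m: "m \<in> L" by (simp add: m_def)
  obtain k where k: "reproducing \<omega> (tr z) k" using reproducing_exists[OF z] by blast
  then have kA: "k \<in> A2 \<omega>" and kr: "\<And>v. v \<in> A2 \<omega> \<Longrightarrow> v (tr z) = L2_inner M v k"
    by (auto simp: reproducing_def)
  obtain g where g: "g \<in> L2 (area \<Omega>)" and G: "is_floquet g (\<lambda>\<eta> x. cnj (chi \<eta> m) * k x)"
    and g_shift: "\<And>w n. w \<in> \<omega> \<Longrightarrow> n \<in> L \<Longrightarrow> g (w + n) = (if n = m then of_real (2 * pi) * k w else 0)"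
    by (rule one_cell_function[OF kA m]) (rule that)
  define q where "q = bergman_proj \<Omega> g"
  define h where "h = bergman_proj \<Omega> f"
  have qL: "q \<in> L2 (area \<Omega>)" unfolding q_def by (rule bergman_props(2)[OF g])
  have hA: "h \<in> A2 \<Omega>" and hL: "h \<in> L2 (area \<Omega>)" unfolding h_def by (rule bergman_props(1,2)[OF f])+
  note dq = double_integrand_eq[OF k z, folded m_def]
  have int: "integrable NN (double_integrand \<omega> f z w)" if w: "tr w \<in> \<omega>" for w
    unfolding dq[OF w, abs_def] by (intro integrable_mult_right integrable_cnj bergman_proj_fiber(1)[OF g G w])
  have val: "(LINT \<eta>|NN. double_integrand \<omega> f z w \<eta>) = of_real (2 * pi) * (f w * cnj (q w))" if w: "tr w \<in> \<omega>" for w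
  proof -
    have "(LINT \<eta>|NN. double_integrand \<omega> f z w \<eta>) = f w * cnj (LINT \<eta>|NN. chi \<eta> (cell_index w) * P_eta \<omega> \<eta> (\<lambda>x. cnj (chi \<eta> m) * k x) (tr w))"
      unfolding dq[OF w] Bochner_Integration.integral_cnj[symmetric] by (rule integral_mult_right_zero)
    also have "(LINT \<eta>|NN. chi \<eta> (cell_index w) * P_eta \<omega> \<eta> (\<lambda>x. cnj (chi \<eta> m) * k x) (tr w)) = of_real (2 * pi) * q w"
      unfolding q_def bergman_proj_fiber(2)[OF g G w] by simp
    finally show ?thesis by simp
  qed
  show "AE w in area \<Omega>. integrable NN (double_integrand \<omega> f z w)"
    using AE_Omega_omega by eventually_elim (rule int)
  define J where "J = (\<lambda>w. LINT \<eta>|NN. double_integrand \<omega> f z w \<eta>)"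
  define J' where "J' = (\<lambda>w. of_real (2 * pi) * (f w * cnj (q w)))"
  have J'i: "integrable (area \<Omega>) J'" unfolding J'_def by (intro integrable_mult_right L2_inner_integrable f qL)
  have ae: "AE w in area \<Omega>. J' w = J w" using AE_Omega_omega by eventually_elim (simp add: J_def J'_def val)
  interpret complete_measure "area \<Omega>" by (rule complete_measure_lebesgue_on) simp
  \<comment> \<open>The inner integral is known only for almost every \<open>w\<close>; completeness
    of the measure makes it measurable.\<close>
  have Jm: "J \<in> borel_measurable (area \<Omega>)"
  proof (rule borel_measurable_AE_LIMSEQ)
    show "J' \<in> borel_measurable (area \<Omega>)" for n :: nat using J'i by simp
    show "AE w in area \<Omega>. (\<lambda>n. J' w) \<longlonglongrightarrow> J w" using ae by eventually_elim simp
  qed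
  have "integrable (area \<Omega>) J"
    by (rule integrable_cong_AE_imp[OF J'i Jm]) (use ae in \<open>eventually_elim, simp\<close>)
  then show "integrable (area \<Omega>) (\<lambda>w. LINT \<eta>|NN. double_integrand \<omega> f z w \<eta>)" unfolding J_def .
  have "(LINT w|area \<Omega>. J w) = (LINT w|area \<Omega>. J' w)"
    by (rule integral_cong_AE[OF Jm borel_measurable_integrable[OF J'i]]) (use ae in \<open>eventually_elim, simp\<close>)
  also have "\<dots> = of_real (2 * pi) * L2_inner (area \<Omega>) f q" by (simp add: J'_def L2_inner_def)
  also have "L2_inner (area \<Omega>) f q = L2_inner (area \<Omega>) h g"
    unfolding h_def q_def by (rule bergman_props(4)[OF f g, symmetric])
  \<comment> \<open>Only the cell with index \<open>m\<close> carries \<open>g\<close>, and there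
    \<open>g\<close> is \<open>2 * pi\<close> times the reproducing kernel at
    \<open>tr z\<close>.\<close>
  also have "\<dots> = of_real (2 * pi) * h z"
  proof (rule has_sum_unique[OF L2_inner_Omega[OF hL g]])
    have hm: "(\<lambda>x. h (x + m)) \<in> A2 \<omega>"
      using A2D[OF shift_A2[OF hA m]] shift_L2[OF hL m] holomorphic_on_subset[OF _ omega_sub] unfolding A2_def by simp
    have "L2_inner M (\<lambda>x. h (x + n)) (\<lambda>x. g (x + n)) = (if n = m then of_real (2 * pi) * h z else 0)" if n: "n \<in> L" for n
    proof (cases "n = m")
      case True
      have "L2_inner M (\<lambda>x. h (x + n)) (\<lambda>x. g (x + n)) = L2_inner M (\<lambda>x. h (x + m)) (\<lambda>x. of_real (2 * pi) * k x)"
        unfolding True by (rule L2_inner_cong_right) (simp add: g_shift m)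
      also have "\<dots> = of_real (2 * pi) * h (tr z + m)" unfolding L2_inner_cmult_right kr[OF hm, symmetric] by simp
      also have "tr z + m = z" unfolding m_def by (rule tr_decomp[symmetric])
      finally show ?thesis using True by simp
    next
      case False
      have "L2_inner M (\<lambda>x. h (x + n)) (\<lambda>x. g (x + n)) = L2_inner M (\<lambda>x. h (x + n)) (\<lambda>x. 0)"
        by (rule L2_inner_cong_right) (simp add: g_shift n False)
      then show ?thesis using False by (simp add: L2_inner_def)
    qed
    then show "((\<lambda>n. L2_inner M (\<lambda>x. h (x + n)) (\<lambda>x. g (x + n))) has_sum of_real (2 * pi) * h z) L"
      using m by (intro has_sum_finite_neutralI[of "{m}"]) auto
  qed
  finally have "(LINT w|area \<Omega>. J w) = of_real (4 * pi\<^sup>2) * h z" by (simp add: power2_eq_square)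
  then show "bergman_proj \<Omega> f z = of_real (1 / (4 * pi\<^sup>2)) * (LINT w|area \<Omega>. LINT \<eta>|NN. double_integrand \<omega> f z w \<eta>)"
    unfolding J_def h_def by simp
qed

text \<open>The Bergman projection has the projected transform and so is a candidate in the choice
  behind \<open>floquet_inv\<close>; injectivity identifies whatever is chosen.\<close>

lemma bergman_proj_floquet_inv:
  assumes f: "f \<in> L2 (area \<Omega>)"
  shows "AE z in area \<Omega>. bergman_proj \<Omega> f z = floquet_inv \<omega> (fiber_proj \<omega> (floquet \<omega> f)) z"
proof -
  define h where "h = bergman_proj \<Omega> f"
  define G where "G = fiber_proj \<omega> (floquet \<omega> f)"
  have hL: "h \<in> L2 (area \<Omega>)" unfolding h_def by (rule bergman_props(2)[OF f])
  note hF = is_floquet_floquet[OF hL]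
  have hG: "AE \<eta> in NN. AE z in M. floquet \<omega> h \<eta> z = G \<eta> z"
    unfolding G_def fiber_proj_def using floquet_bergman_proj[OF f is_floquet_floquet[OF f] hF[unfolded h_def]] by (simp add: h_def)
  define g where "g = floquet_inv \<omega> G"
  have "g \<in> L2 (area \<Omega>) \<and> (AE \<eta> in NN. AE z in M. floquet \<omega> g \<eta> z = G \<eta> z)"
    unfolding g_def floquet_inv_def Omega[symmetric] by (rule someI[of _ h]) (intro conjI hL hG)
  then have g: "g \<in> L2 (area \<Omega>)" and gG: "AE \<eta> in NN. AE z in M. floquet \<omega> g \<eta> z = G \<eta> z" by auto
  have "AE \<eta> in NN. AE z in M. floquet \<omega> h \<eta> z = floquet \<omega> g \<eta> z"
    using hG gG
  proof eventually_elim
    case (elim \<eta>)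
    then show ?case by eventually_elim simp
  qed
  then have "AE z in area \<Omega>. h z = g z" by (rule is_floquet_injective[OF hL g hF is_floquet_floquet[OF g]])
  then show ?thesis unfolding h_def g_def G_def .
qed

lemma single_integrand_eq:
  "single_integrand \<omega> f z = (\<lambda>\<eta>. chi \<eta> (cell_index z) * P_eta \<omega> \<eta> (floquet \<omega> f \<eta>) (tr z))"
  by (simp add: single_integrand_def chi_def fun_eq_iff mult.commute)

end

text \<open>The integral of a non-integrable function is 0 by convention, so integrability is
  asserted along with each formula. The integral formulas hold at every \<open>z\<close> with
  \<open>tr z\<close> in \<omega>; a further null set comes from the equality with
  \<open>floquet_inv\<close>, whose value is a function chosen up to null sets.\<close>

theorem theorem4p1:
  fixes \<omega> \<Omega> :: "complex set"
  assumes cell: "periodic_cell \<omega>"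
    and Omega: "\<Omega> = periodic_domain \<omega>"
    and A: "assumption_A \<omega>"
  shows "is_orth_proj (bochner_inner (lebesgue_on dual_cell) (area \<omega>))
           (floquet_space \<omega>) (floquet_A2_space \<omega>) (fiber_proj \<omega>) \<and>
         (negligible (\<Omega> - (\<Union>m\<in>period_lattice. translate \<omega> m)) \<longrightarrow>
          (\<forall>f\<in>L2 (area \<Omega>). AE z in area \<Omega>.
             bergman_proj \<Omega> f z = floquet_inv \<omega> (fiber_proj \<omega> (floquet \<omega> f)) z \<and>
             integrable (lebesgue_on dual_cell) (single_integrand \<omega> f z) \<and>
             bergman_proj \<Omega> f z =
               of_real (1 / (2 * pi)) * (LINT \<eta>|lebesgue_on dual_cell. single_integrand \<omega> f z \<eta>) \<and>
             (AE w in area \<Omega>. integrable (lebesgue_on dual_cell) (double_integrand \<omega> f z w)) \<and>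
             integrable (area \<Omega>) (\<lambda>w. LINT \<eta>|lebesgue_on dual_cell. double_integrand \<omega> f z w \<eta>) \<and>
             bergman_proj \<Omega> f z =
               of_real (1 / (4 * pi\<^sup>2)) *
               (LINT w|area \<Omega>. LINT \<eta>|lebesgue_on dual_cell. double_integrand \<omega> f z w \<eta>)))"
proof -
  interpret D: doubly_periodic \<omega> \<Omega> by (unfold_locales) (rule cell Omega)+
  obtain R C b where R: "b > 2" "C \<ge> 0" "R holomorphic_on \<Omega>"
    "\<And>z. z \<in> \<Omega> \<Longrightarrow> cmod (R z) \<le> C * weight b z" "\<And>z. z \<in> \<Omega> \<Longrightarrow> ((\<lambda>m. R (z + m)) has_sum 1) period_lattice"
    by (rule D.partition_exists[OF A]) (rule that)
  interpret C: cell_partition \<omega> \<Omega> R C b by unfold_locales (use R in auto)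
  show ?thesis
  proof (intro conjI impI ballI)
    show "is_orth_proj (bochner_inner NN (area \<omega>)) (floquet_space \<omega>) (floquet_A2_space \<omega>) (fiber_proj \<omega>)"
      by (rule C.fiber_proj_is_orth_proj)
    assume null: "negligible (\<Omega> - (\<Union>m\<in>period_lattice. translate \<omega> m))"
    interpret P: cell_partition_null \<omega> \<Omega> R C b by unfold_locales (rule null)
    fix f assume f: "f \<in> L2 (area \<Omega>)"
    show "AE z in area \<Omega>.
        bergman_proj \<Omega> f z = floquet_inv \<omega> (fiber_proj \<omega> (floquet \<omega> f)) z \<and>
        integrable NN (single_integrand \<omega> f z) \<and>
        bergman_proj \<Omega> f z = of_real (1 / (2 * pi)) * (LINT \<eta>|NN. single_integrand \<omega> f z \<eta>) \<and>
        (AE w in area \<Omega>. integrable NN (double_integrand \<omega> f z w)) \<and>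
        integrable (area \<Omega>) (\<lambda>w. LINT \<eta>|NN. double_integrand \<omega> f z w \<eta>) \<and>
        bergman_proj \<Omega> f z = of_real (1 / (4 * pi\<^sup>2)) * (LINT w|area \<Omega>. LINT \<eta>|NN. double_integrand \<omega> f z w \<eta>)"
      using P.bergman_proj_floquet_inv[OF f] P.AE_Omega_omega
    proof eventually_elim
      case (elim z)
      show ?case unfolding P.single_integrand_eq
        by (intro conjI elim(1) P.bergman_proj_fiber[OF f P.is_floquet_floquet[OF f] elim(2)] P.bergman_proj_double[OF f elim(2)])
    qed
  qed
qed

end
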